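(* Let $X_0,\ldots,X_n$ be a sample from a stationary FAR(1) process $X_{t+1}=\Psi(X_t)+\epsilon_{t+1}$, $-\infty<t<\infty$, in $\mathcal{H}$ with $\mathrm{E}X_t=0$, satisfying (i) $\{\epsilon_t\}$ are i.i.d. with $\mathrm{E}\epsilon_t=0$ and $\mathrm{E}\Vert\epsilon_t\Vert^4<\infty$; (ii) $\Psi$ is a Hilbert-Schmidt operator with $\Vert\Psi\Vert_{\mathcal{L}}<1$; (iii) the eigenvalues $\lambda_1>\lambda_2>\ldots$ of $\Gamma$ are all positive and have multiplicity 1. Put $a_1=\lambda_1-\lambda_2$ and $a_j=\min(\lambda_{j-1}-\lambda_j,\ \lambda_j-\lambda_{j+1})$ for $j\ge 2$. Suppose that $k_n\to\infty$, that $$\frac{k_n}{n}\sum_{j=1}^{k_n}\frac{1}{a_j^2}\to 0 \ (n\to\infty), \qquad \frac{1}{\lambda_{k_n}}=O\left(\frac{n^{1/4}}{(\log n)^{\beta}}\right)\ \text{ for some } \beta>\frac12,$$ and that $$\frac{1}{\lambda_{k_n}}\sum_{j=1}^{k_n}\frac{1}{a_j}=O\left(\frac{n^{1/4}}{(\log n)^{\beta}}\right)\ \text{ for some } \beta>1 .$$ Then $$n\, d_2^2\left(\hat\Gamma_n-\Gamma,\ \hat\Gamma_n^*-\hat\Gamma_n\right)\to 0\quad\text{in probability as } n\to\infty .$$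
   Context: $\mathcal{H}$ is a separable Hilbert space with scalar product $\langle\cdot,\cdot\rangle$ and norm $\Vert\cdot\Vert$. For $y,z\in\mathcal{H}$, $y\otimes z$ is the linear operator $(y\otimes z)(x)=\langle y,x\rangle z$. $\Vert A\Vert_{\mathcal{L}}$ is the operator norm of a bounded linear operator $A$ on $\mathcal{H}$. A FAR(1) process is a sequence of $\mathcal{H}$-valued random variables with $X_{t+1}=\Psi(X_t)+\epsilon_{t+1}$, where $\Psi:\mathcal{H}\to\mathcal{H}$ is a linear operator and the innovations $\epsilon_t$ are i.i.d. $\mathcal{H}$-valued random variables. $\Gamma=\mathrm{E}\,X_t\otimes X_t$ is the covariance operator, with eigenvalues $\lambda_1\ge\lambda_2\ge\ldots$. Estimates: $$\hat\Gamma_n=\frac1n\sum_{j=0}^{n-1}X_j\otimes X_j,\qquad \hat C_n=\frac1n\sum_{j=0}^{n-1}X_j\otimes X_{j+1}.$$ $\hat\lambda_1\ge\hat\lambda_2\ge\ldots$ and $\hat v_1,\hat v_2,\ldots$ are the eigenvalues and corresponding orthonormal eigenvectors of $\hat\Gamma_n$. $(k_n)$ is a sequence of positive integers, $\hat\Gamma_n^\dagger=\sum_{j=1}^{k_n}\frac{1}{\hat\lambda_j}\hat v_j\otimes\hat v_j$, and $\hat\Psi_n=\hat C_n\hat\Gamma_n^\dagger$. Residual-based bootstrap: $\hat\epsilon_j=X_j-\hat\Psi_n(X_{j-1})$, $\tilde\epsilon_j=\hat\epsilon_j-\frac1n\sum_{k=1}^n\hat\epsilon_k$, $j=1,\ldots,n$,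 and $\hat F_n$ is the empirical distribution of $\tilde\epsilon_1,\ldots,\tilde\epsilon_n$. Conditionally on $X_0,\ldots,X_n$, the bootstrap innovations $\epsilon_1^*,\ldots,\epsilon_n^*$ are i.i.d. with distribution $\hat F_n$, and the bootstrap data are generated recursively by $X_t^*=\hat\Psi_n(X_{t-1}^* )+\epsilon_t^*$, $t=1,\ldots,n$, for some suitable initial value $X_0^*$ (popular choices are $X_0^*=X_0$ or $X_0^*=\mathrm{E}X_0=0$). The bootstrap covariance operator estimate is $\hat\Gamma_n^*=\frac1n\sum_{t=0}^{n-1}X_t^*\otimes X_t^*$. Mallows metric for random bounded linear operators $A,B$ on $\mathcal{H}$: $d_2^2(A,B)=\inf\mathrm{E}\Vert A'-B'\Vert_{\mathcal{L}}^2$, the infimum being over all pairs of random operators $A',B'$ with the same marginal distributions as $A$ and $B$ respectively. In $d_2(\hat\Gamma_n-\Gamma,\hat\Gamma_n^*-\hat\Gamma_n)$ the first distribution is that of $\hat\Gamma_n-\Gamma$ and the second is the conditional distribution of $\hat\Gamma_n^*-\hat\Gamma_n$ given $X_0,\ldots,X_n$; so this is a random quantity depending on $X_0,\ldots,X_n$. *)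

theory Defs
  imports "HOL-Probability.Probability" "HOL-Probability.Product_PMF" "HOL-Library.Landau_Symbols"
begin

text \<open>
  A separable (real) Hilbert space is a type of sort
  \<open>{real_inner, banach, second_countable_topology}\<close>; bounded operators on it are elements of
  \<open>'h \<Rightarrow>\<^sub>L 'h\<close>, whose \<open>norm\<close> is the operator norm.
\<close>

section \<open>Operators\<close>

lift_definition tensor :: "'h::real_inner \<Rightarrow> 'h \<Rightarrow> 'h \<Rightarrow>\<^sub>L 'h" (infixr \<open>\<otimes>\<^sub>H\<close> 75)
  is "\<lambda>y z x. inner y x *\<^sub>R z"
  by (intro bounded_linear_scaleR_const bounded_linear_inner_right)

definition orthonormal_basis :: "'h::real_inner set \<Rightarrow> bool" where
  "orthonormal_basis E \<longleftrightarrow>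
     pairwise orthogonal E \<and> (\<forall>e\<in>E. norm e = 1) \<and> closure (span E) = UNIV"

definition hilbert_schmidt :: "('h::real_inner \<Rightarrow>\<^sub>L 'h) \<Rightarrow> bool" where
  "hilbert_schmidt A \<longleftrightarrow> (\<exists>E. orthonormal_basis E \<and> (\<lambda>e. (norm (A e))\<^sup>2) summable_on E)"

definition eigenspace :: "('h::real_inner \<Rightarrow>\<^sub>L 'h) \<Rightarrow> real \<Rightarrow> 'h set" where
  "eigenspace A \<mu> = {x. A x = \<mu> *\<^sub>R x}"

definition eigenvalues :: "('h::real_inner \<Rightarrow>\<^sub>L 'h) \<Rightarrow> real set" where
  "eigenvalues A = {\<mu>. \<exists>x. x \<noteq> 0 \<and> x \<in> eigenspace A \<mu>}"

text \<open>
  Eigenvalues in decreasing order with corresponding orthonormal eigenvectors, indexed from \<open>1\<close>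
  (the values at index \<open>0\<close> are irrelevant).  The last conjunct says that no nonzero eigenvalue is
  missed and that each is repeated according to its multiplicity.  It is not imposed at \<open>0\<close>: for an
  operator of finite rank the sequence ends in zeros, whose eigenvectors need not exhaust the kernel.
\<close>
definition eigensystem ::
  "('h::real_inner \<Rightarrow>\<^sub>L 'h) \<Rightarrow> (nat \<Rightarrow> real) \<Rightarrow> (nat \<Rightarrow> 'h) \<Rightarrow> bool" where
  "eigensystem A lam v \<longleftrightarrow>
     (\<forall>i\<ge>1. \<forall>j\<ge>i. lam j \<le> lam i) \<and>
     (\<forall>i\<ge>1. \<forall>j\<ge>1. inner (v i) (v j) = (if i = j then 1 else 0)) \<and>
     (\<forall>j\<ge>1. A (v j) = lam j *\<^sub>R v j) \<and>
     (\<forall>\<mu>. \<mu> \<noteq> 0 \<longrightarrow> eigenspace A \<mu> = span (v ` {j. 1 \<le> j \<and> lam j = \<mu>}))"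

definition eigen_gap :: "(nat \<Rightarrow> real) \<Rightarrow> nat \<Rightarrow> real" where
  "eigen_gap lam j =
     (if j = 1 then lam 1 - lam 2 else min (lam (j - 1) - lam j) (lam j - lam (j + 1)))"


section \<open>Stationarity and the covariance operator\<close>

definition stationary_process :: "'w measure \<Rightarrow> (int \<Rightarrow> 'w \<Rightarrow> 'h::topological_space) \<Rightarrow> bool" where
  "stationary_process M X \<longleftrightarrow>
     (\<forall>t. X t \<in> borel_measurable M) \<and>
     (\<forall>h. distr M (PiM UNIV (\<lambda>_. borel)) (\<lambda>\<omega> t. X (t + h) \<omega>)
        = distr M (PiM UNIV (\<lambda>_. borel)) (\<lambda>\<omega> t. X t \<omega>))"

text \<open>
  The expectation of \<open>Y \<otimes>\<^sub>H Y\<close> is taken pointwise (in the strong sense), because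
  \<open>'h \<Rightarrow>\<^sub>L 'h\<close> is not separable in infinite dimension and so has no Bochner integral.
\<close>
definition cov_operator ::
  "'w measure \<Rightarrow> ('w \<Rightarrow> 'h::{real_inner, banach, second_countable_topology}) \<Rightarrow> 'h \<Rightarrow>\<^sub>L 'h" where
  "cov_operator M Y = Blinfun (\<lambda>x. \<integral>\<omega>. (Y \<omega> \<otimes>\<^sub>H Y \<omega>) x \<partial>M)"

lemma cov_operator_apply:
  fixes Y :: "'w \<Rightarrow> 'h::{real_inner, banach, second_countable_topology}"
  assumes [measurable]: "Y \<in> borel_measurable M" and "integrable M (\<lambda>\<omega>. (norm (Y \<omega>))\<^sup>2)"
  shows "cov_operator M Y x = (\<integral>\<omega>. inner (Y \<omega>) x *\<^sub>R Y \<omega> \<partial>M)"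
proof -
  have bound: "norm (inner (Y \<omega>) x *\<^sub>R Y \<omega>) \<le> (norm (Y \<omega>))\<^sup>2 * norm x" for \<omega> x
    using mult_right_mono[OF Cauchy_Schwarz_ineq2[of "Y \<omega>" x] norm_ge_zero[of "Y \<omega>"]]
    by (simp add: power2_eq_square ac_simps)
  have int: "integrable M (\<lambda>\<omega>. inner (Y \<omega>) x *\<^sub>R Y \<omega>)" for x
    by (rule Bochner_Integration.integrable_bound[where f = "\<lambda>\<omega>. (norm (Y \<omega>))\<^sup>2 * norm x"])
       (use assms bound in \<open>auto simp: abs_mult\<close>)
  have "bounded_linear (\<lambda>x. \<integral>\<omega>. inner (Y \<omega>) x *\<^sub>R Y \<omega> \<partial>M)"
  proof (rule bounded_linear_intro[where K = "\<integral>\<omega>. (norm (Y \<omega>))\<^sup>2 \<partial>M"])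
    fix x :: 'h
    have "norm (\<integral>\<omega>. inner (Y \<omega>) x *\<^sub>R Y \<omega> \<partial>M) \<le> (\<integral>\<omega>. (norm (Y \<omega>))\<^sup>2 * norm x \<partial>M)"
      by (rule order_trans[OF integral_norm_bound integral_mono])
         (use assms integrable_norm[OF int] bound in auto)
    then show "norm (\<integral>\<omega>. inner (Y \<omega>) x *\<^sub>R Y \<omega> \<partial>M) \<le> norm x * (\<integral>\<omega>. (norm (Y \<omega>))\<^sup>2 \<partial>M)"
      by (simp add: mult.commute)
  qed (use int in \<open>simp_all add: inner_add_right scaleR_add_left flip: scaleR_scaleR\<close>)
  then show ?thesis
    by (simp add: cov_operator_def tensor.rep_eq bounded_linear_Blinfun_apply)
qed


section \<open>Estimators\<close>

text \<open>
  Estimators are functions of a sample \<open>x 0, \<dots>, x n\<close>; outside \<open>{..n}\<close> the sample is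
  \<open>undefined\<close>, so that they can depend on nothing but \<open>X\<^sub>0, \<dots>, X\<^sub>n\<close>.
\<close>

definition sample :: "(int \<Rightarrow> 'w \<Rightarrow> 'h) \<Rightarrow> nat \<Rightarrow> 'w \<Rightarrow> nat \<Rightarrow> 'h" where
  "sample X n \<omega> = restrict (\<lambda>j. X (int j) \<omega>) {..n}"

definition gamma_hat :: "nat \<Rightarrow> (nat \<Rightarrow> 'h::real_inner) \<Rightarrow> 'h \<Rightarrow>\<^sub>L 'h" where
  "gamma_hat n x = (1 / real n) *\<^sub>R (\<Sum>j<n. x j \<otimes>\<^sub>H x j)"

definition c_hat :: "nat \<Rightarrow> (nat \<Rightarrow> 'h::real_inner) \<Rightarrow> 'h \<Rightarrow>\<^sub>L 'h" where
  "c_hat n x = (1 / real n) *\<^sub>R (\<Sum>j<n. x j \<otimes>\<^sub>H x (j + 1))"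

definition spectral_cutoff_inverse ::
  "nat \<Rightarrow> (nat \<Rightarrow> real) \<Rightarrow> (nat \<Rightarrow> 'h::real_inner) \<Rightarrow> 'h \<Rightarrow>\<^sub>L 'h" where
  "spectral_cutoff_inverse k lam v = (\<Sum>j=1..k. (1 / lam j) *\<^sub>R (v j \<otimes>\<^sub>H v j))"

definition psi_hat ::
  "nat \<Rightarrow> nat \<Rightarrow> (nat \<Rightarrow> real) \<Rightarrow> (nat \<Rightarrow> 'h::real_inner) \<Rightarrow> (nat \<Rightarrow> 'h) \<Rightarrow> 'h \<Rightarrow>\<^sub>L 'h" where
  "psi_hat n k lam v x = c_hat n x o\<^sub>L spectral_cutoff_inverse k lam v"


section \<open>Residual-based bootstrap\<close>

definition residual :: "('h::real_inner \<Rightarrow>\<^sub>L 'h) \<Rightarrow> (nat \<Rightarrow> 'h) \<Rightarrow> nat \<Rightarrow> 'h" where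
  "residual P x j = x j - P (x (j - 1))"

definition centred_residual :: "nat \<Rightarrow> ('h::real_inner \<Rightarrow>\<^sub>L 'h) \<Rightarrow> (nat \<Rightarrow> 'h) \<Rightarrow> nat \<Rightarrow> 'h" where
  "centred_residual n P x j =
     residual P x j - (1 / real n) *\<^sub>R (\<Sum>k=1..n. residual P x k)"

definition residual_pmf :: "nat \<Rightarrow> ('h::real_inner \<Rightarrow>\<^sub>L 'h) \<Rightarrow> (nat \<Rightarrow> 'h) \<Rightarrow> 'h pmf" where
  "residual_pmf n P x = map_pmf (centred_residual n P x) (pmf_of_set {1..n})"

primrec boot_path :: "('h::real_inner \<Rightarrow>\<^sub>L 'h) \<Rightarrow> 'h \<Rightarrow> (nat \<Rightarrow> 'h) \<Rightarrow> nat \<Rightarrow> 'h" where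
  "boot_path P x0 e 0 = x0"
| "boot_path P x0 e (Suc t) = P (boot_path P x0 e t) + e (Suc t)"

text \<open>
  The conditional distribution of \<open>\<Gamma>\<^sub>n\<^sup>* - \<Gamma>\<^sub>n\<close> (bootstrap minus sample covariance operator) given
  that the observed sample is \<open>x\<close>: \<open>P\<close> is the estimate of the autoregression operator and \<open>x0\<close> the
  initial value, both already evaluated at the sample.  \<open>Pi_pmf\<close> makes the innovations
  \<open>e 1, \<dots>, e n\<close> i.i.d.; its argument \<open>0\<close> is the value of \<open>e\<close> off \<open>{1..n}\<close>, which is never used.
\<close>
definition boot_cov_pmf ::
  "nat \<Rightarrow> ('h::real_inner \<Rightarrow>\<^sub>L 'h) \<Rightarrow> 'h \<Rightarrow> (nat \<Rightarrow> 'h) \<Rightarrow> ('h \<Rightarrow>\<^sub>L 'h) pmf" where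
  "boot_cov_pmf n P x0 x =
     map_pmf (\<lambda>e. gamma_hat n (boot_path P x0 e) - gamma_hat n x)
       (Pi_pmf {1..n} 0 (\<lambda>_. residual_pmf n P x))"


section \<open>Mallows metric for random operators\<close>

text \<open>
  A random operator is a map \<open>A\<close> into \<open>'h \<Rightarrow>\<^sub>L 'h\<close> such that \<open>A x\<close> is a random variable for every
  vector \<open>x\<close>.  On norm-separable sets of operators, such as the compact ones, this sigma-algebra is
  the Borel one; on all of \<open>'h \<Rightarrow>\<^sub>L 'h\<close> it is preferable, since the distance of two random operators
  is then again a random variable (see \<open>measurable_norm_op_diff\<close> below).
\<close>
definition op_algebra :: "('h::real_inner \<Rightarrow>\<^sub>L 'h) measure" where
  "op_algebra = sigma UNIV {(\<lambda>A. blinfun_apply A x) -` S | x S. S \<in> sets borel}"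

lemma space_op_algebra [simp]: "space op_algebra = UNIV"
  by (simp add: op_algebra_def space_measure_of_conv)

lemma measurable_op_apply [measurable]: "(\<lambda>A. blinfun_apply A x) \<in> op_algebra \<rightarrow>\<^sub>M borel"
proof (rule measurableI)
  fix S :: "'a set" assume "S \<in> sets borel"
  then show "(\<lambda>A. blinfun_apply A x) -` S \<inter> space op_algebra \<in> sets op_algebra"
    by (auto simp: op_algebra_def sets_measure_of_conv space_measure_of_conv)
qed simp

lemma measurable_op_algebraI:
  fixes A :: "'w \<Rightarrow> 'h::real_inner \<Rightarrow>\<^sub>L 'h"
  assumes "\<And>x. (\<lambda>\<omega>. blinfun_apply (A \<omega>) x) \<in> borel_measurable M"
  shows "A \<in> M \<rightarrow>\<^sub>M op_algebra"
  unfolding op_algebra_def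
proof (rule measurable_measure_of)
  fix T :: "('h \<Rightarrow>\<^sub>L 'h) set" assume "T \<in> {(\<lambda>A. blinfun_apply A x) -` S | x S. S \<in> sets borel}"
  then obtain x S where "S \<in> sets borel" "T = (\<lambda>A. blinfun_apply A x) -` S"
    by blast
  then show "A -` T \<inter> space M \<in> sets M"
    using measurable_sets[OF assms[of x], of S] by (simp add: vimage_def)
qed auto

lemma measurable_norm_op_diff [measurable]:
  "(\<lambda>(A, B). norm (A - B :: 'h::{real_inner, second_countable_topology} \<Rightarrow>\<^sub>L 'h))
     \<in> borel_measurable (op_algebra \<Otimes>\<^sub>M op_algebra)"
proof -
  obtain D :: "'h set" where D: "countable D" "\<And>U. open U \<Longrightarrow> U \<noteq> {} \<Longrightarrow> \<exists>d\<in>D. d \<in> U"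
    using countable_dense_exists by blast
  have norm_le_iff: "norm C \<le> a \<longleftrightarrow> 0 \<le> a \<and> (\<forall>x\<in>D. norm (C x) \<le> a * norm x)"
    for C :: "'h \<Rightarrow>\<^sub>L 'h" and a
  proof
    assume "norm C \<le> a"
    then show "0 \<le> a \<and> (\<forall>x\<in>D. norm (C x) \<le> a * norm x)"
      by (meson mult_right_mono norm_blinfun norm_ge_zero order_trans)
  next
    assume *: "0 \<le> a \<and> (\<forall>x\<in>D. norm (C x) \<le> a * norm x)"
    have "open {x. a * norm x < norm (C x)}"
      by (intro open_Collect_less continuous_intros)
    then have "{x. a * norm x < norm (C x)} = {}"
      using D(2) * by (metis (mono_tags, lifting) mem_Collect_eq not_less)
    then show "norm C \<le> a"
      using * by (intro norm_blinfun_bound) (auto simp: not_less)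
  qed
  have "Measurable.pred (op_algebra \<Otimes>\<^sub>M op_algebra)
          (\<lambda>p :: ('h \<Rightarrow>\<^sub>L 'h) \<times> ('h \<Rightarrow>\<^sub>L 'h). \<forall>x\<in>D. norm (blinfun_apply (fst p) x - blinfun_apply (snd p) x) \<le> a * norm x)" for a
    using D(1) by measurable
  then show ?thesis
    by (simp add: case_prod_beta borel_measurable_iff_le norm_le_iff blinfun.diff_left)
qed

lemma measurable_gamma_hat:
  fixes x :: "'w \<Rightarrow> nat \<Rightarrow> 'h::{real_inner, second_countable_topology}"
  assumes [measurable]: "\<And>j. j < n \<Longrightarrow> (\<lambda>\<omega>. x \<omega> j) \<in> borel_measurable M"
  shows "(\<lambda>\<omega>. gamma_hat n (x \<omega>) - G) \<in> M \<rightarrow>\<^sub>M op_algebra"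
  by (rule measurable_op_algebraI)
     (simp add: gamma_hat_def blinfun.diff_left blinfun.scaleR_left blinfun.sum_left tensor.rep_eq)

text \<open>
  The infimum over all pairs of random operators with given marginal distributions \<open>\<mu>\<close> and \<open>\<nu>\<close> is
  taken over their joint distributions.
\<close>
definition couplings ::
  "('h::real_inner \<Rightarrow>\<^sub>L 'h) measure \<Rightarrow> ('h \<Rightarrow>\<^sub>L 'h) measure \<Rightarrow> (('h \<Rightarrow>\<^sub>L 'h) \<times> ('h \<Rightarrow>\<^sub>L 'h)) measure set"
  where
  "couplings \<mu> \<nu> = {Q. prob_space Q \<and> sets Q = sets (op_algebra \<Otimes>\<^sub>M op_algebra) \<and>
     distr Q op_algebra fst = \<mu> \<and> distr Q op_algebra snd = \<nu>}"

definition mallows_sq ::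
  "('h::real_inner \<Rightarrow>\<^sub>L 'h) measure \<Rightarrow> ('h \<Rightarrow>\<^sub>L 'h) measure \<Rightarrow> ennreal" where
  "mallows_sq \<mu> \<nu> = (\<Sqinter>Q\<in>couplings \<mu> \<nu>. \<integral>\<^sup>+ (A, B). ennreal ((norm (A - B))\<^sup>2) \<partial>Q)"


section \<open>Stochastic convergence\<close>

text \<open>
  Both notions use outer probability, which agrees with probability on measurable events; thus no
  measurability of the infimum in \<open>mallows_sq\<close>, or of the choice of empirical eigenvectors, is needed.
\<close>

definition tendsto_zero_in_prob :: "'w measure \<Rightarrow> (nat \<Rightarrow> 'w \<Rightarrow> ennreal) \<Rightarrow> bool" where
  "tendsto_zero_in_prob M Z \<longleftrightarrow>
     (\<forall>\<delta>::real. \<delta> > 0 \<longrightarrow>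
        (\<lambda>n. outer_measure_of M {\<omega> \<in> space M. Z n \<omega> > ennreal \<delta>}) \<longlonglongrightarrow> 0)"

definition bounded_in_prob :: "'w measure \<Rightarrow> (nat \<Rightarrow> 'w \<Rightarrow> 'h::real_normed_vector) \<Rightarrow> bool" where
  "bounded_in_prob M Y \<longleftrightarrow>
     (\<forall>\<eta>::real. \<eta> > 0 \<longrightarrow> (\<exists>K::real. \<forall>\<^sub>F n in sequentially.
        outer_measure_of M {\<omega> \<in> space M. norm (Y n \<omega>) > K} \<le> ennreal \<eta>))"

text \<open>In particular the usual bootstrap initial values \<open>X\<^sub>0\<close> and \<open>0\<close> are bounded in probability.\<close>
lemma bounded_in_prob_const:
  fixes Y :: "'w \<Rightarrow> 'h::real_normed_vector"
  assumes "prob_space M" and [measurable]: "Y \<in> borel_measurable M"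
  shows "bounded_in_prob M (\<lambda>_. Y)"
  unfolding bounded_in_prob_def
proof (intro allI impI)
  interpret prob_space M by fact
  fix \<eta> :: real assume "\<eta> > 0"
  let ?A = "\<lambda>m::nat. {\<omega> \<in> space M. norm (Y \<omega>) > real m}"
  have "(\<Inter>m. ?A m) = {}"
    by (auto simp: not_less) (metis less_asym' reals_Archimedean2)
  moreover have "decseq ?A"
    by (force simp: decseq_def)
  ultimately have "(\<lambda>m. emeasure M (?A m)) \<longlonglongrightarrow> 0"
    using Lim_emeasure_decseq[of ?A M] by (auto simp: image_subset_iff)
  then have "\<forall>\<^sub>F m in sequentially. emeasure M (?A m) < ennreal \<eta>"
    by (rule order_tendstoD) (use \<open>\<eta> > 0\<close> in simp)
  then obtain m where "emeasure M (?A m) < ennreal \<eta>"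
    by (auto simp: eventually_sequentially)
  then show "\<exists>K. \<forall>\<^sub>F n in sequentially.
      outer_measure_of M {\<omega> \<in> space M. norm (Y \<omega>) > K} \<le> ennreal \<eta>"
    by (intro exI[of _ "real m"]) (simp add: less_imp_le)
qed

end

theory Submission
  imports Defs
begin

text \<open>
  The sample and the bootstrap sample are paths of two contractive autoregressions. Any joint
  construction of the two bounds the Mallows distance, and the one used here runs both recursions on
  one probability space, driven by independent copies of a suitable pair of innovations.

  For a path \<open>x (t + 1) = P (x t) + a (t + 1)\<close> whose innovations have covariance operator \<open>S\<close>, the centred
  sum of tensor squares \<open>G = (\<Sum>t<n. x t \<otimes>\<^sub>H x t) - n \<Gamma>\<close> satisfies
  \<open>G = P G P\<^sup>* + N - (x n \<otimes>\<^sub>H x n - x 0 \<otimes>\<^sub>H x 0) + n (P \<Gamma> P\<^sup>* + S - \<Gamma>)\<close>, where \<open>N\<close> is a sum of martingale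
  differences (\<open>sum_tensor_square_identity\<close>). The map \<open>G \<mapsto> P G P\<^sup>*\<close> is a contraction, so everything can be
  read off from the right-hand side. Subtracting the equations of two coupled paths, with
  \<open>norm (P - P') \<le> \<theta>\<close> and innovations whose difference has fourth moment at most \<open>s\<^sup>2\<close>, leaves a martingale
  whose increments have mean square of order \<open>\<theta>\<^sup>2 + s\<close>; martingale differences are orthogonal, and the
  Hilbert--Schmidt norm of tensors is explicit. Hence \<open>E (norm (G - G'))\<^sup>2 = O (n (\<theta>\<^sup>2 + s) + 1 + \<beta>\<^sup>2)\<close>, where
  \<open>\<beta>\<close> bounds the defect \<open>n (P' \<Gamma>' P'\<^sup>* + S' - \<Gamma>')\<close> of the second path
  (\<open>mean_le_coupled_difference\<close>). The covariance estimates are these sums divided by \<open>n\<close>, so \<open>n\<close> times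
  the squared Mallows distance is of order \<open>\<theta>\<^sup>2 + s + (1 + \<beta>\<^sup>2) / n\<close>, and it remains to make
  \<open>\<theta>\<close>, \<open>s\<close> and \<open>\<beta>\<^sup>2 / n\<close> small.

  \<^item> \<open>\<beta>\<close>: the true covariance operator solves the fixed point equation exactly (\<open>\<Gamma>X_fixed_point\<close>). The
    sample covariance operator solves that of the bootstrap autoregression up to the two ends of the
    sample and the tensor square of the residual mean: by the normal equations of the estimator, the residuals are orthogonal
    to the fitted values (\<open>gamma_hat_fixed_point\<close>).

  \<^item> \<open>\<theta>\<close>: the error of the estimated autoregression operator is \<open>R \<Gamma>\<^sup>\<dagger> - \<Psi> Q\<close>, where \<open>R\<close> is the empirical
    cross covariance of observations and innovations, \<open>\<Gamma>\<^sup>\<dagger>\<close> is the spectral cutoff inverse of the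
    sample covariance operator, and \<open>Q\<close> projects onto the complement of the leading empirical
    eigenvectors. The norm of \<open>R\<close> is of order \<open>n powr (-1/2)\<close>, while Weyl's inequality bounds that of \<open>\<Gamma>\<^sup>\<dagger>\<close> by
    \<open>2 * n powr (1/4)\<close> with high probability. The eigenvalues of index larger than \<open>k n\<close> tend to zero because their trace is
    bounded, so \<open>Q\<close> tends to zero on the range of \<open>\<Gamma>\<close>, which is dense; as \<open>\<Psi>\<close> is a Hilbert--Schmidt
    operator, pointwise convergence of \<open>Q\<close> makes \<open>\<Psi> Q\<close> tend to zero in norm (\<open>small_theta\<close>).

  \<^item> \<open>s\<close>: the innovations are quantized to finitely many values. Once every cell has nearly its expected
    empirical frequency, an innovation and a random index can be coupled so that the innovation and
    the observed innovation with that index lie in the same cell with probability close to one; the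
    residuals are close to the observed innovations by consistency of the estimator
    (\<open>likely_coupling\<close>).
\<close>


section \<open>Projections, Riesz representation and adjoints\<close>

text \<open>
  The parallelogram law turns a minimizing sequence for the distance from \<open>x\<close> into a Cauchy sequence.
\<close>
lemma closed_subspace_projection:
  fixes S :: "'h::{real_inner, banach} set"
  assumes "closed S" "subspace S"
  shows "\<exists>p\<in>S. \<forall>s\<in>S. inner (x - p) s = 0"
proof -
  define D where "D = (\<lambda>s. (norm (x - s))\<^sup>2) ` S"
  define d where "d = Inf D"
  have ne: "D \<noteq> {}"
    using subspace_0[OF assms(2)] by (auto simp: D_def)
  have bdd: "bdd_below D"
    unfolding D_def by (rule bdd_belowI[of _ 0]) auto
  have low: "d \<le> (norm (x - s))\<^sup>2" if "s \<in> S" for s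
    unfolding d_def by (rule cInf_lower[OF _ bdd]) (use that in \<open>auto simp: D_def\<close>)
  have "\<exists>s\<in>S. (norm (x - s))\<^sup>2 < d + 1 / Suc n" for n
  proof -
    have "Inf D < d + 1 / Suc n"
      by (simp add: d_def)
    from cInf_lessD[OF ne this] show ?thesis
      by (auto simp: D_def)
  qed
  then obtain s where s: "\<And>n. s n \<in> S" "\<And>n. (norm (x - s n))\<^sup>2 < d + 1 / Suc n"
    by metis
  have close: "(norm (s n - s m))\<^sup>2 \<le> 2 / Suc n + 2 / Suc m" for n m
  proof -
    have "(1/2) *\<^sub>R (s n + s m) \<in> S"
      using assms(2) s(1) by (intro subspace_scale subspace_add)
    then have "d \<le> (norm (x - (1/2) *\<^sub>R (s n + s m)))\<^sup>2"
      by (rule low)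
    moreover have "(norm (s n - s m))\<^sup>2 = 2 * (norm (x - s n))\<^sup>2 + 2 * (norm (x - s m))\<^sup>2
        - 4 * (norm (x - (1/2) *\<^sub>R (s n + s m)))\<^sup>2"
      by (simp add: power2_norm_eq_inner inner_diff_left inner_diff_right inner_add_left
          inner_add_right inner_commute algebra_simps)
    ultimately show ?thesis
      using s(2)[of n] s(2)[of m] by linarith
  qed
  have "Cauchy s"
  proof (rule metric_CauchyI)
    fix e :: real assume e: "e > 0"
    then obtain N :: nat where N: "4 / e\<^sup>2 < real N"
      using reals_Archimedean2 by blast
    have "dist (s m) (s n) < e" if "m \<ge> N" "n \<ge> N" for m n
    proof -
      have "(norm (s m - s n))\<^sup>2 \<le> 2 / Suc m + 2 / Suc n"
        by (rule close)
      also have "\<dots> \<le> 2 / Suc N + 2 / Suc N"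
        using that by (intro add_mono divide_left_mono) auto
      also have "\<dots> < e\<^sup>2"
      proof -
        have "4 < real N * e\<^sup>2"
          using N e by (simp add: field_simps)
        then have "4 < e\<^sup>2 * real (Suc N)"
          using e by (simp add: algebra_simps) (smt (verit) zero_less_power)
        then show ?thesis
          by (simp add: divide_less_eq flip: add_divide_distrib)
      qed
      finally show ?thesis
        using e by (simp add: dist_norm power_less_imp_less_base)
    qed
    then show "\<exists>M. \<forall>m\<ge>M. \<forall>n\<ge>M. dist (s m) (s n) < e"
      by blast
  qed
  then obtain p where p: "s \<longlonglongrightarrow> p"
    by (metis Cauchy_convergent convergent_def)
  have pS: "p \<in> S"
    using closed_sequentially[OF assms(1)] s(1) p by blast
  have "(norm (x - p))\<^sup>2 \<le> d + 0"
  proof (rule LIMSEQ_le)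
    show "(\<lambda>n. (norm (x - s n))\<^sup>2) \<longlonglongrightarrow> (norm (x - p))\<^sup>2"
      by (intro tendsto_intros p)
    show "(\<lambda>n. d + 1 / Suc n) \<longlonglongrightarrow> d + 0"
      by (intro tendsto_intros LIMSEQ_Suc lim_const_over_n)
  qed (use s(2) in \<open>auto intro!: exI[of _ 0] less_imp_le simp del: of_nat_Suc\<close>)
  then have pd: "(norm (x - p))\<^sup>2 \<le> d"
    by simp
  have "inner (x - p) u = 0" if u: "u \<in> S" for u
  proof (cases "u = 0")
    case False
    define t where "t = inner (x - p) u / inner u u"
    have "p + t *\<^sub>R u \<in> S"
      using assms(2) u pS by (intro subspace_scale subspace_add)
    then have "(norm (x - p))\<^sup>2 \<le> (norm (x - (p + t *\<^sub>R u)))\<^sup>2"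
      using low pd order_trans by blast
    also have "\<dots> = (norm (x - p))\<^sup>2 - 2 * t * inner (x - p) u + t\<^sup>2 * inner u u"
      unfolding power2_norm_eq_inner unfolding power2_eq_square
      by (simp add: inner_diff_left inner_diff_right inner_add_left
          inner_add_right inner_commute algebra_simps)
    also have "\<dots> = (norm (x - p))\<^sup>2 - (inner (x - p) u)\<^sup>2 / inner u u"
      using False by (simp add: t_def field_simps power2_eq_square)
    finally have "(inner (x - p) u)\<^sup>2 / inner u u \<le> 0"
      by simp
    moreover have "inner u u > 0"
      using False by simp
    ultimately have "(inner (x - p) u)\<^sup>2 \<le> 0"
      by (simp add: divide_le_0_iff)
    then show ?thesis
      by simp
  qed simp
  with pS show ?thesis
    by blast
qed

text \<open>The representing vector is a multiple of a vector orthogonal to the kernel.\<close>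
lemma riesz_representation:
  fixes f :: "'h::{real_inner, banach} \<Rightarrow> real"
  assumes f: "bounded_linear f"
  shows "\<exists>y. \<forall>x. f x = inner y x"
proof (cases "\<forall>x. f x = 0")
  case True
  then show ?thesis
    by (intro exI[of _ 0]) simp
next
  case False
  interpret bounded_linear f by fact
  obtain x0 where x0: "f x0 \<noteq> 0"
    using False by blast
  have cl: "closed {x. f x = 0}"
    by (intro closed_Collect_eq continuous_intros linear_continuous_on f)
  have sub: "subspace {x. f x = 0}"
    by (auto simp: subspace_def add scaleR zero)
  obtain p where p: "f p = 0" "\<And>s. f s = 0 \<Longrightarrow> inner (x0 - p) s = 0"
    using closed_subspace_projection[OF cl sub, of x0] by auto
  define z where "z = x0 - p"
  have fz: "f z \<noteq> 0"
    using x0 p(1) by (simp add: z_def diff)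
  then have z0: "z \<noteq> 0"
    using zero by metis
  have "f x = inner ((f z / inner z z) *\<^sub>R z) x" for x
  proof -
    have "f (x - (f x / f z) *\<^sub>R z) = 0"
      using fz by (simp add: diff scaleR)
    then have "inner z (x - (f x / f z) *\<^sub>R z) = 0"
      using p(2) by (simp add: z_def)
    then have "inner z x = (f x / f z) * inner z z"
      by (simp add: inner_diff_right)
    then show ?thesis
      using fz z0 by simp
  qed
  then show ?thesis
    by blast
qed

lemma adjoint_exists:
  fixes A :: "'h::{real_inner, banach} \<Rightarrow>\<^sub>L 'h"
  shows "\<exists>B :: 'h \<Rightarrow>\<^sub>L 'h. norm B \<le> norm A \<and> (\<forall>x y. inner (blinfun_apply A x) y = inner x (blinfun_apply B y))"
proof -
  have "\<exists>z. \<forall>x. inner (A x) y = inner x z" for y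
  proof -
    have "bounded_linear (\<lambda>x. inner (A x) y)"
      by (intro bounded_linear_intros)
    from riesz_representation[OF this] show ?thesis
      by (metis inner_commute)
  qed
  then obtain g where g: "\<And>x y. inner (A x) y = inner x (g y)"
    by metis
  have bd: "norm (g y) \<le> norm y * norm A" for y
  proof (cases "g y = 0")
    case False
    have "norm (g y) * norm (g y) = inner (A (g y)) y"
      by (simp add: g power2_norm_eq_inner flip: power2_eq_square)
    also have "\<dots> \<le> norm (A (g y)) * norm y"
      by (rule norm_cauchy_schwarz)
    also have "\<dots> \<le> (norm A * norm (g y)) * norm y"
      by (intro mult_right_mono norm_blinfun) auto
    finally have "norm (g y) * norm (g y) \<le> norm (g y) * (norm y * norm A)"
      by (simp add: ac_simps)
    then show ?thesis
      using False by simp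
  qed simp
  have "bounded_linear g"
  proof (rule bounded_linear_intro[OF _ _ bd])
    show "g (x + y) = g x + g y" for x y
      by (rule vector_eq_rdot[THEN iffD1]) (metis g inner_add_right inner_commute)
    show "g (r *\<^sub>R x) = r *\<^sub>R g x" for r x
      by (rule vector_eq_rdot[THEN iffD1]) (metis g inner_scaleR_right inner_commute)
  qed
  then have "blinfun_apply (Blinfun g) = g"
    by (rule bounded_linear_Blinfun_apply)
  moreover have "norm (Blinfun g) \<le> norm A"
    using bd calculation by (intro norm_blinfun_bound) (auto simp: mult.commute)
  ultimately show ?thesis
    using g by (intro exI[of _ "Blinfun g"]) auto
qed

definition adj :: "('h::{real_inner, banach} \<Rightarrow>\<^sub>L 'h) \<Rightarrow> 'h \<Rightarrow>\<^sub>L 'h" where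
  "adj A = (SOME B. norm B \<le> norm A \<and> (\<forall>x y. inner (blinfun_apply A x) y = inner x (blinfun_apply B y)))"

lemma norm_adj_le: "norm (adj A) \<le> norm A"
  and inner_adj: "inner (blinfun_apply A x) y = inner x (blinfun_apply (adj A) y)"
  using someI_ex[OF adjoint_exists[of A], folded adj_def] by blast+

lemma adj_diff: "adj (A - B) = adj A - adj B"
proof (rule blinfun_eqI)
  fix y
  have "inner x (adj (A - B) y) = inner x ((adj A - adj B) y)" for x
    by (simp add: blinfun.diff_left inner_diff_right inner_diff_left flip: inner_adj)
  then have "\<forall>x. inner x (adj (A - B) y) = inner x ((adj A - adj B) y)"
    by blast
  then show "adj (A - B) y = (adj A - adj B) y"
    by (simp only: vector_eq_ldot)
qed

text \<open>
  The action \<open>G \<mapsto> A G A\<^sup>*\<close> of an operator on covariance operators.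
\<close>
definition sandwich :: "('h::{real_inner, banach} \<Rightarrow>\<^sub>L 'h) \<Rightarrow> ('h \<Rightarrow>\<^sub>L 'h) \<Rightarrow> 'h \<Rightarrow>\<^sub>L 'h" where
  "sandwich A G = A o\<^sub>L G o\<^sub>L adj A"

lemma sandwich_apply: "sandwich A G x = A (G (adj A x))"
  by (simp add: sandwich_def)

lemma sandwich_tensor: "sandwich A (x \<otimes>\<^sub>H y) = A x \<otimes>\<^sub>H A y"
  by (rule blinfun_eqI) (simp add: sandwich_apply tensor.rep_eq blinfun.scaleR_right inner_adj)

lemma sandwich_add: "sandwich A (G + H) = sandwich A G + sandwich A H"
  and sandwich_diff: "sandwich A (G - H) = sandwich A G - sandwich A H"
  and sandwich_scaleR: "sandwich A (r *\<^sub>R G) = r *\<^sub>R sandwich A G"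
  by (rule blinfun_eqI; simp add: sandwich_apply blinfun.add_left blinfun.add_right
      blinfun.diff_left blinfun.diff_right blinfun.scaleR_left blinfun.scaleR_right)+

lemma sandwich_zero: "sandwich A 0 = 0"
  by (rule blinfun_eqI) (simp add: sandwich_apply)

lemma sandwich_sum: "sandwich A (\<Sum>i\<in>I. G i) = (\<Sum>i\<in>I. sandwich A (G i))"
  by (induction I rule: infinite_finite_induct) (simp_all add: sandwich_add sandwich_zero)

lemma norm_sandwich_le: "norm (sandwich A G) \<le> (norm A)\<^sup>2 * norm G"
proof -
  have "norm (sandwich A G) \<le> norm (A o\<^sub>L G) * norm (adj A)"
    unfolding sandwich_def by (rule norm_blinfun_compose)
  also have "\<dots> \<le> (norm A * norm G) * norm A"
    by (intro mult_mono norm_blinfun_compose norm_adj_le) auto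
  finally show ?thesis
    by (simp add: power2_eq_square ac_simps)
qed

lemma norm_sandwich_diff_le:
  "norm (sandwich A G - sandwich B G) \<le> (norm A + norm B) * norm (A - B) * norm G"
proof -
  have "sandwich A G - sandwich B G = ((A - B) o\<^sub>L G o\<^sub>L adj A) + (B o\<^sub>L G o\<^sub>L adj (A - B))"
    by (rule blinfun_eqI)
       (simp add: sandwich_apply adj_diff blinfun.add_left blinfun.diff_left blinfun.diff_right)
  also have "norm \<dots> \<le> norm (A - B) * norm G * norm A + norm B * norm G * norm (A - B)"
    by (intro norm_triangle_le add_mono order_trans[OF norm_blinfun_compose] mult_mono
        norm_blinfun_compose order_trans[OF norm_adj_le]) auto
  finally show ?thesis
    by (simp add: algebra_simps)
qed

lemma norm_tensor_le: "norm (x \<otimes>\<^sub>H y) \<le> norm x * norm y"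
proof (rule norm_blinfun_bound)
  fix z
  have "norm ((x \<otimes>\<^sub>H y) z) = \<bar>inner x z\<bar> * norm y"
    by (simp add: tensor.rep_eq)
  also have "\<dots> \<le> (norm x * norm z) * norm y"
    by (intro mult_right_mono Cauchy_Schwarz_ineq2) auto
  finally show "norm ((x \<otimes>\<^sub>H y) z) \<le> norm x * norm y * norm z"
    by (simp add: ac_simps)
qed simp

lemma tensor_add_left: "(x + y) \<otimes>\<^sub>H z = x \<otimes>\<^sub>H z + y \<otimes>\<^sub>H z"
  and tensor_add_right: "z \<otimes>\<^sub>H (x + y) = z \<otimes>\<^sub>H x + z \<otimes>\<^sub>H y"
  and tensor_diff_left: "(x - y) \<otimes>\<^sub>H z = x \<otimes>\<^sub>H z - y \<otimes>\<^sub>H z"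
  and tensor_diff_right: "z \<otimes>\<^sub>H (x - y) = z \<otimes>\<^sub>H x - z \<otimes>\<^sub>H y"
  and tensor_scaleR_left: "(r *\<^sub>R x) \<otimes>\<^sub>H z = r *\<^sub>R (x \<otimes>\<^sub>H z)"
  and tensor_scaleR_right: "x \<otimes>\<^sub>H (r *\<^sub>R z) = r *\<^sub>R (x \<otimes>\<^sub>H z)"
  and tensor_zero_left: "0 \<otimes>\<^sub>H z = 0"
  and tensor_zero_right: "z \<otimes>\<^sub>H 0 = 0"
  by (rule blinfun_eqI; simp add: tensor.rep_eq inner_add_left inner_diff_left blinfun.add_left
      blinfun.diff_left blinfun.scaleR_left algebra_simps)+

lemma tensor_sum_left: "(\<Sum>i\<in>I. f i) \<otimes>\<^sub>H z = (\<Sum>i\<in>I. f i \<otimes>\<^sub>H z)"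
  and tensor_sum_right: "z \<otimes>\<^sub>H (\<Sum>i\<in>I. f i) = (\<Sum>i\<in>I. z \<otimes>\<^sub>H f i)"
  by (induction I rule: infinite_finite_induct)
     (simp_all add: tensor_zero_left tensor_zero_right tensor_add_left tensor_add_right)

text \<open>A vector orthogonal to the range of a symmetric operator lies in its kernel.\<close>
lemma dense_range_of_injective_selfadjoint:
  fixes G :: "'h::{real_inner, banach} \<Rightarrow>\<^sub>L 'h"
  assumes sym: "\<And>x y. inner (G x) y = inner x (G y)" and inj: "\<And>x. G x = 0 \<Longrightarrow> x = 0"
  shows "closure (range G) = UNIV"
proof -
  have sub: "subspace (closure (range G))"
    unfolding subspace_def
  proof safe
    show "0 \<in> closure (range G)"
      using closure_subset[of "range G"] blinfun.zero_right[of G] by (metis rangeI subsetD)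
  next
    fix x y assume "x \<in> closure (range G)" "y \<in> closure (range G)"
    then obtain f g where "\<And>n. f n \<in> range G" "f \<longlonglongrightarrow> x" "\<And>n. g n \<in> range G" "g \<longlonglongrightarrow> y"
      unfolding closure_sequential by blast
    moreover have "f n + g n \<in> range G" for n
      using calculation(1)[of n] calculation(3)[of n] by (auto simp flip: blinfun.add_right)
    ultimately show "x + y \<in> closure (range G)"
      unfolding closure_sequential by (intro exI[of _ "\<lambda>n. f n + g n"]) (auto intro: tendsto_add)
  next
    fix c x assume "x \<in> closure (range G)"
    then obtain f where "\<And>n. f n \<in> range G" "f \<longlonglongrightarrow> x"
      unfolding closure_sequential by blast
    moreover have "c *\<^sub>R f n \<in> range G" for n
      using calculation(1)[of n] by (auto simp flip: blinfun.scaleR_right)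
    ultimately show "c *\<^sub>R x \<in> closure (range G)"
      unfolding closure_sequential by (intro exI[of _ "\<lambda>n. c *\<^sub>R f n"]) (auto intro: tendsto_scaleR)
  qed
  have "x \<in> closure (range G)" for x
  proof -
    obtain p where p: "p \<in> closure (range G)"
        "\<And>s. s \<in> closure (range G) \<Longrightarrow> inner (x - p) s = 0"
      using closed_subspace_projection[OF closed_closure sub] by blast
    have "inner (x - p) (G (G (x - p))) = 0"
      by (intro p(2) subsetD[OF closure_subset] rangeI)
    then have "inner (G (x - p)) (G (x - p)) = 0"
      by (simp only: sym)
    then have "G (x - p) = 0"
      by simp
    then show ?thesis
      using inj[of "x - p"] p(1) by simp
  qed
  then show ?thesis
    by blast
qed


section \<open>Orthonormal sequences and Hilbert--Schmidt norms\<close>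

lemma norm_sum_orthogonal:
  fixes b :: "'i \<Rightarrow> 'h::real_inner"
  assumes "finite I" "\<And>i j. i \<in> I \<Longrightarrow> j \<in> I \<Longrightarrow> i \<noteq> j \<Longrightarrow> inner (b i) (b j) = 0"
  shows "(norm (\<Sum>i\<in>I. c i *\<^sub>R b i))\<^sup>2 = (\<Sum>i\<in>I. (c i)\<^sup>2 * (norm (b i))\<^sup>2)"
  using assms
proof (induction I rule: finite_induct)
  case (insert k I)
  have "inner (b k) (b i) = 0" if "i \<in> I" for i
    using insert.prems[of k i] insert.hyps that by auto
  then have "inner (c k *\<^sub>R b k) (\<Sum>i\<in>I. c i *\<^sub>R b i) = 0"
    by (simp add: inner_sum_right)
  moreover define w where "w = (\<Sum>i\<in>I. c i *\<^sub>R b i)"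
  ultimately have "(norm (c k *\<^sub>R b k + w))\<^sup>2 = (norm (c k *\<^sub>R b k))\<^sup>2 + (norm w)\<^sup>2"
    unfolding power2_norm_eq_inner inner_add_left inner_add_right by (simp add: inner_commute)
  then show ?case
    using insert by (simp add: power_mult_distrib w_def)
qed simp

lemma bessel_inequality:
  fixes b :: "'i \<Rightarrow> 'h::real_inner"
  assumes fin: "finite I"
    and orth: "\<And>i j. i \<in> I \<Longrightarrow> j \<in> I \<Longrightarrow> i \<noteq> j \<Longrightarrow> inner (b i) (b j) = 0"
    and le1: "\<And>i. i \<in> I \<Longrightarrow> norm (b i) \<le> 1"
  shows "(\<Sum>i\<in>I. (inner (b i) x)\<^sup>2) \<le> (norm x)\<^sup>2"
proof -
  define y where "y = (\<Sum>i\<in>I. inner (b i) x *\<^sub>R b i)"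
  define q where "q = (\<Sum>i\<in>I. (inner (b i) x)\<^sup>2)"
  have xy: "inner x y = q"
    by (simp add: y_def q_def inner_sum_right power2_eq_square inner_commute)
  have "(norm y)\<^sup>2 = (\<Sum>i\<in>I. (inner (b i) x)\<^sup>2 * (norm (b i))\<^sup>2)"
    unfolding y_def by (rule norm_sum_orthogonal[OF fin orth])
  also have "\<dots> \<le> q"
    unfolding q_def using le1 by (intro sum_mono mult_right_le_one_le) (auto simp: power_le_one)
  finally have "(norm y)\<^sup>2 \<le> q" .
  moreover have "0 \<le> (norm (x - y))\<^sup>2"
    by simp
  moreover have "(norm (x - y))\<^sup>2 = (norm x)\<^sup>2 - 2 * inner x y + (norm y)\<^sup>2"
    by (simp add: power2_norm_eq_inner inner_diff_left inner_diff_right inner_commute)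
  ultimately show ?thesis
    using xy by (simp add: q_def)
qed

text \<open>
  An orthonormal basis as a sequence indexed by all natural numbers; vanishing entries are allowed,
  so that a basis of any countable cardinality can be enumerated in this way.
\<close>
definition basis_seq :: "(nat \<Rightarrow> 'h::real_inner) \<Rightarrow> bool" where
  "basis_seq b \<longleftrightarrow> (\<forall>i j. i \<noteq> j \<longrightarrow> inner (b i) (b j) = 0) \<and> (\<forall>i. norm (b i) = 1 \<or> b i = 0) \<and>
     closure (span (range b)) = UNIV"

lemma basis_seqD:
  assumes "basis_seq b"
  shows "i \<noteq> j \<Longrightarrow> inner (b i) (b j) = 0" "norm (b i) = 1 \<or> b i = 0" "norm (b i) \<le> 1"
    "closure (span (range b)) = UNIV"
  using assms by (auto simp: basis_seq_def) (metis norm_zero order_refl zero_le_one)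

lemma basis_seq_bessel:
  assumes "basis_seq b"
  shows "(\<Sum>i<m. (inner (b i) x)\<^sup>2) \<le> (norm x)\<^sup>2"
  by (rule bessel_inequality) (use basis_seqD[OF assms] in auto)

lemma span_range_seq:
  fixes b :: "nat \<Rightarrow> 'a::real_vector"
  assumes "x \<in> span (range b)"
  shows "\<exists>m c. x = (\<Sum>i<m. c i *\<^sub>R b i)"
  using assms
proof (induction rule: span_induct_alt)
  case base
  show ?case
    by (intro exI[of _ 0]) simp
next
  case (step a y z)
  then obtain j m c where j: "y = b j" and z: "z = (\<Sum>i<m. c i *\<^sub>R b i)"
    by blast
  define M where "M = max m (Suc j)"
  have "z = (\<Sum>i<M. (if i < m then c i else 0) *\<^sub>R b i)"
    unfolding z by (rule sum.mono_neutral_cong_left) (auto simp: M_def)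
  moreover have "a *\<^sub>R y = (\<Sum>i<M. (if i = j then a else 0) *\<^sub>R b i)"
    by (simp add: j M_def if_distrib[of "\<lambda>r. r *\<^sub>R _"] less_max_iff_disj cong: if_cong)
  ultimately have "a *\<^sub>R y + z = (\<Sum>i<M. ((if i = j then a else 0) + (if i < m then c i else 0)) *\<^sub>R b i)"
    by (simp add: scaleR_add_left sum.distrib)
  then show ?case
    by (intro exI)
qed

text \<open>
  The Hilbert--Schmidt norm is used only through bounds on its partial sums over a basis, so that no infinite
  sums of random variables arise.
\<close>
lemma operator_norm_le_hs:
  fixes A :: "'h::real_inner \<Rightarrow>\<^sub>L 'h"
  assumes b: "basis_seq b" and C: "\<And>m. (\<Sum>i<m. (norm (A (b i)))\<^sup>2) \<le> C"
  shows "(norm A)\<^sup>2 \<le> C"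
proof -
  have C0: "C \<ge> 0"
    using C[of 0] by simp
  have span: "norm (A x) \<le> sqrt C * norm x" if xs: "x \<in> span (range b)" for x
  proof -
    obtain m c where x: "x = (\<Sum>i<m. c i *\<^sub>R b i)"
      using span_range_seq[OF xs] by blast
    have nx: "(norm x)\<^sup>2 = (\<Sum>i<m. (\<bar>c i\<bar> * norm (b i))\<^sup>2)"
      unfolding x by (subst norm_sum_orthogonal) (use basis_seqD[OF b] in \<open>auto simp: power_mult_distrib\<close>)
    have "norm (A x) \<le> (\<Sum>i<m. norm (c i *\<^sub>R A (b i)))"
      unfolding x blinfun.sum_right blinfun.scaleR_right by (rule norm_sum)
    also have "\<dots> = (\<Sum>i<m. (\<bar>c i\<bar> * norm (b i)) * norm (A (b i)))"
    proof (intro sum.cong refl)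
      fix i
      show "norm (c i *\<^sub>R A (b i)) = \<bar>c i\<bar> * norm (b i) * norm (A (b i))"
        using basis_seqD(2)[OF b, of i] by auto
    qed
    finally have "(norm (A x))\<^sup>2 \<le> (\<Sum>i<m. (\<bar>c i\<bar> * norm (b i)) * norm (A (b i)))\<^sup>2"
      by (intro power_mono) auto
    also have "\<dots> \<le> (norm x)\<^sup>2 * (\<Sum>i<m. (norm (A (b i)))\<^sup>2)"
      unfolding nx by (rule Cauchy_Schwarz_ineq_sum)
    also have "\<dots> \<le> (norm x)\<^sup>2 * C"
      by (intro mult_left_mono C) auto
    also have "\<dots> = (sqrt C * norm x)\<^sup>2"
      using C0 by (simp add: power_mult_distrib)
    finally show ?thesis
      by (rule power2_le_imp_le) (use C0 in simp)
  qed
  have "closed {x. norm (A x) \<le> sqrt C * norm x}"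
    by (intro closed_Collect_le continuous_intros)
  then have "closure (span (range b)) \<subseteq> {x. norm (A x) \<le> sqrt C * norm x}"
    using span by (intro closure_minimal) auto
  then have "norm (A x) \<le> sqrt C * norm x" for x
    using basis_seqD(4)[OF b] by auto
  then have "norm A \<le> sqrt C"
    using C0 by (intro norm_blinfun_bound) auto
  then have "(norm A)\<^sup>2 \<le> (sqrt C)\<^sup>2"
    by (intro power_mono) auto
  then show ?thesis
    using C0 by simp
qed

text \<open>
  The balls of radius \<open>1/2\<close> around the members are disjoint, and a separable space contains only countably
  many disjoint nonempty open sets.
\<close>
lemma orthonormal_countable:
  fixes E :: "'h::{real_inner, second_countable_topology} set"
  assumes "pairwise orthogonal E" "\<And>e. e \<in> E \<Longrightarrow> norm e = 1"
  shows "countable E"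
proof -
  have far: "disjnt (ball x (1/2)) (ball y (1/2))" if "x \<in> E" "y \<in> E" "x \<noteq> y" for x y
  proof -
    have "inner x y = 0"
      using assms(1) that by (auto simp: pairwise_def orthogonal_def)
    then have "(dist x y)\<^sup>2 = 2"
      using assms(2)[OF that(1)] assms(2)[OF that(2)]
      by (simp add: dist_norm power2_norm_eq_inner inner_diff_left inner_diff_right inner_commute
          norm_eq_1)
    then have "dist x y \<ge> 1"
      by (smt (verit, best) power_le_one zero_le_dist)
    then show ?thesis
      by (auto simp: disjnt_def ball_def) (smt (verit, ccfv_SIG) dist_commute dist_triangle field_sum_of_halves)
  qed
  have "countable ((\<lambda>e. ball e (1/2)) ` E)"
    by (rule countable_disjoint_open_subsets)
       (use far in \<open>auto simp: pairwise_def\<close>)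
  moreover have "inj_on (\<lambda>e. ball e (1/2 :: real)) E"
  proof (rule inj_onI)
    fix x y assume "x \<in> E" "y \<in> E" "ball x (1/2 :: real) = ball y (1/2)"
    then show "x = y"
      using far[of x y] by (auto simp: disjnt_def)
  qed
  ultimately show ?thesis
    by (rule countable_image_inj_on)
qed

lemma hilbert_schmidt_basis_seq:
  fixes A :: "'h::{real_inner, second_countable_topology} \<Rightarrow>\<^sub>L 'h"
  assumes "hilbert_schmidt A"
  obtains b where "basis_seq b" "summable (\<lambda>i. (norm (A (b i)))\<^sup>2)"
proof -
  obtain E where E: "orthonormal_basis E" "(\<lambda>e. (norm (A e))\<^sup>2) summable_on E"
    using assms by (auto simp: hilbert_schmidt_def)
  have orth: "\<And>x y. x \<in> E \<Longrightarrow> y \<in> E \<Longrightarrow> x \<noteq> y \<Longrightarrow> inner x y = 0" and n1: "\<And>e. e \<in> E \<Longrightarrow> norm e = 1"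
    and cl: "closure (span E) = UNIV"
    using E(1) by (auto simp: orthonormal_basis_def pairwise_def orthogonal_def)
  have count: "countable E"
    using E(1) by (intro orthonormal_countable) (auto simp: orthonormal_basis_def)
  define N where "N = to_nat_on E ` E"
  define b where "b i = (if i \<in> N then from_nat_into E i else 0)" for i
  have bE: "b i \<in> E" if "i \<in> N" for i
    using that count by (auto simp: b_def N_def)
  have binj: "i = j" if "i \<in> N" "j \<in> N" "b i = b j" for i j
    using that count by (auto simp: b_def N_def)
  have "E \<subseteq> range b"
  proof
    fix e assume "e \<in> E"
    then have "b (to_nat_on E e) = e"
      using count by (simp add: b_def N_def)
    then show "e \<in> range b"
      by (metis rangeI)
  qed
  then have "closure (span E) \<subseteq> closure (span (range b))"
    by (intro closure_mono span_mono)
  then have "basis_seq b"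
    using cl n1 bE binj orth unfolding basis_seq_def
    by (auto simp: b_def) (metis binj bE b_def orth)+
  moreover have "summable (\<lambda>i. (norm (A (b i)))\<^sup>2)"
  proof (rule summableI_nonneg_bounded)
    fix m
    have "(\<Sum>i<m. (norm (A (b i)))\<^sup>2) = (\<Sum>i\<in>{..<m} \<inter> N. (norm (A (b i)))\<^sup>2)"
      by (rule sum.mono_neutral_right) (auto simp: b_def)
    also have "\<dots> = (\<Sum>e\<in>b ` ({..<m} \<inter> N). (norm (A e))\<^sup>2)"
      using binj by (subst sum.reindex) (auto simp: inj_on_def)
    also have "\<dots> \<le> infsum (\<lambda>e. (norm (A e))\<^sup>2) E"
      using bE by (intro finite_sum_le_infsum E(2)) auto
    finally show "(\<Sum>i<m. (norm (A (b i)))\<^sup>2) \<le> infsum (\<lambda>e. (norm (A e))\<^sup>2) E" .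
  qed auto
  ultimately show ?thesis
    using that by blast
qed

text \<open>
  A Hilbert--Schmidt operator is a finite-rank operator up to an error that is small in operator
  norm, so composing it with a symmetric contraction gives something small as soon as the
  contraction is small on finitely many basis vectors.
\<close>
lemma hilbert_schmidt_compose_small:
  fixes A :: "'h::real_inner \<Rightarrow>\<^sub>L 'h"
  assumes b: "basis_seq b" and sm: "summable (\<lambda>i. (norm (A (b i)))\<^sup>2)" and "\<delta> > 0"
  obtains m where "\<And>Q :: 'h \<Rightarrow>\<^sub>L 'h. norm Q \<le> 1 \<Longrightarrow> (\<And>x y. inner (blinfun_apply Q x) y = inner x (blinfun_apply Q y)) \<Longrightarrow>
    norm (A o\<^sub>L Q) \<le> \<delta> + (\<Sum>i<m. norm (A (b i)) * norm (Q (b i)))"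
proof -
  define c where "c i = (norm (A (b i)))\<^sup>2" for i
  have sc: "summable c"
    using sm by (simp add: c_def[abs_def])
  have "(\<lambda>m. \<Sum>i<m. c i) \<longlonglongrightarrow> suminf c"
    by (rule summable_LIMSEQ[OF sc])
  then have "\<forall>\<^sub>F m in sequentially. suminf c - \<delta>\<^sup>2 < (\<Sum>i<m. c i)"
    using \<open>\<delta> > 0\<close> by (intro order_tendstoD) auto
  then obtain m where m: "suminf c - \<delta>\<^sup>2 < (\<Sum>i<m. c i)"
    by (auto simp: eventually_sequentially)
  define Am where "Am = (\<Sum>i<m. b i \<otimes>\<^sub>H A (b i))"
  have Am_apply: "Am x = (\<Sum>i<m. inner (b i) x *\<^sub>R A (b i))" for x
    by (simp add: Am_def blinfun.sum_left tensor.rep_eq)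
  have diff: "(A - Am) (b j) = (if j < m then 0 else A (b j))" for j
  proof -
    have "Am (b j) = (\<Sum>i<m. if i = j then A (b j) else 0)"
      unfolding Am_apply
    proof (intro sum.cong refl)
      fix i
      show "inner (b i) (b j) *\<^sub>R A (b i) = (if i = j then A (b j) else 0)"
        using basis_seqD(1)[OF b, of i j] basis_seqD(2)[OF b, of j] by (auto simp: norm_eq_1)
    qed
    then show ?thesis
      by (simp add: blinfun.diff_left)
  qed
  have "(norm (A - Am))\<^sup>2 \<le> \<delta>\<^sup>2"
  proof (rule operator_norm_le_hs[OF b])
    fix N
    have "(\<Sum>i<N. (norm ((A - Am) (b i)))\<^sup>2) = (\<Sum>i\<in>{m..<N}. c i)"
      unfolding diff by (rule sum.mono_neutral_cong_right) (auto simp: c_def)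
    also have "\<dots> + (\<Sum>i<m. c i) \<le> suminf c"
    proof -
      have "(\<Sum>i\<in>{m..<N}. c i) + (\<Sum>i<m. c i) = (\<Sum>i\<in>{m..<N} \<union> {..<m}. c i)"
        by (subst sum.union_disjoint) auto
      also have "\<dots> \<le> suminf c"
        by (rule sum_le_suminf[OF sc]) (auto simp: c_def)
      finally show ?thesis .
    qed
    finally show "(\<Sum>i<N. (norm ((A - Am) (b i)))\<^sup>2) \<le> \<delta>\<^sup>2"
      using m by simp
  qed
  then have Adiff: "norm (A - Am) \<le> \<delta>"
    by (rule power2_le_imp_le) (use \<open>\<delta> > 0\<close> in simp)
  show ?thesis
  proof
    fix Q :: "'h \<Rightarrow>\<^sub>L 'h"
    assume Q: "norm Q \<le> 1" "\<And>x y. inner (blinfun_apply Q x) y = inner x (blinfun_apply Q y)"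
    have "A o\<^sub>L Q = ((A - Am) o\<^sub>L Q) + (\<Sum>i<m. Q (b i) \<otimes>\<^sub>H A (b i))"
      by (rule blinfun_eqI)
         (simp add: blinfun.add_left blinfun.diff_left blinfun.sum_left tensor.rep_eq Am_apply Q(2))
    also have "norm \<dots> \<le> norm (A - Am) * norm Q + (\<Sum>i<m. norm (A (b i)) * norm (Q (b i)))"
      by (intro norm_triangle_le add_mono norm_blinfun_compose order_trans[OF norm_sum] sum_mono
          order_trans[OF norm_tensor_le]) (simp add: mult.commute)
    also have "norm (A - Am) * norm Q \<le> \<delta> * 1"
      using Adiff Q(1) \<open>\<delta> > 0\<close> by (intro mult_mono) auto
    finally show "norm (A o\<^sub>L Q) \<le> \<delta> + (\<Sum>i<m. norm (A (b i)) * norm (Q (b i)))"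
      by simp
  qed
qed


section \<open>Spectral bounds for the sample covariance operator\<close>

lemma gamma_hat_apply: "gamma_hat n x y = (1 / real n) *\<^sub>R (\<Sum>j<n. inner (x j) y *\<^sub>R x j)"
  by (simp add: gamma_hat_def blinfun.scaleR_left blinfun.sum_left tensor.rep_eq)

lemma inner_gamma_hat: "inner (gamma_hat n x y) z = (1 / real n) * (\<Sum>j<n. inner (x j) y * inner (x j) z)"
  by (simp add: gamma_hat_apply inner_sum_left)

lemma gamma_hat_sym: "inner (gamma_hat n x y) z = inner y (gamma_hat n x z)"
  by (subst (2) inner_commute) (simp add: inner_gamma_hat mult.commute)

lemma gamma_hat_nonneg: "0 \<le> inner (gamma_hat n x y) y"
  by (simp add: inner_gamma_hat sum_nonneg flip: power2_eq_square)

text \<open>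
  The quadratic form of the operator is a sum of squares, hence a semi-inner product.
\<close>
lemma gamma_hat_cauchy_schwarz:
  "(inner (gamma_hat n x y) z)\<^sup>2 \<le> inner (gamma_hat n x y) y * inner (gamma_hat n x z) z"
proof -
  have "(inner (gamma_hat n x y) z)\<^sup>2
      = (1 / real n)\<^sup>2 * (\<Sum>j<n. inner (x j) y * inner (x j) z)\<^sup>2"
    by (simp add: inner_gamma_hat power_divide)
  also have "\<dots> \<le> (1 / real n)\<^sup>2 * ((\<Sum>j<n. (inner (x j) y)\<^sup>2) * (\<Sum>j<n. (inner (x j) z)\<^sup>2))"
    by (intro mult_left_mono Cauchy_Schwarz_ineq_sum) auto
  also have "\<dots> = inner (gamma_hat n x y) y * inner (gamma_hat n x z) z"
    by (simp add: inner_gamma_hat power2_eq_square)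
  finally show ?thesis .
qed

lemma gamma_hat_norm_sq_le:
  assumes "inner (gamma_hat n x (gamma_hat n x y)) (gamma_hat n x y) \<le> c * (norm (gamma_hat n x y))\<^sup>2"
    and "c \<ge> 0"
  shows "(norm (gamma_hat n x y))\<^sup>2 \<le> c * inner (gamma_hat n x y) y"
proof (cases "gamma_hat n x y = 0")
  case False
  define w where "w = gamma_hat n x y"
  have "(norm w)\<^sup>2 * (norm w)\<^sup>2 = (inner (gamma_hat n x y) w)\<^sup>2"
    by (simp add: w_def dot_square_norm power2_eq_square)
  also have "\<dots> \<le> inner w y * inner (gamma_hat n x w) w"
    unfolding w_def by (rule gamma_hat_cauchy_schwarz)
  also have "\<dots> \<le> inner w y * (c * (norm w)\<^sup>2)"
    using assms by (intro mult_left_mono) (auto simp: w_def gamma_hat_nonneg)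
  finally have "(norm w)\<^sup>2 * (norm w)\<^sup>2 \<le> (c * inner w y) * (norm w)\<^sup>2"
    by (simp add: ac_simps)
  then have "(norm w)\<^sup>2 \<le> c * inner w y"
    by (rule mult_right_le_imp_le) (use False in \<open>simp add: w_def\<close>)
  then show ?thesis
    by (simp add: w_def)
qed (use assms(2) in simp)

lemma simultaneous_convergent_subsequence:
  fixes u :: "nat \<Rightarrow> nat \<Rightarrow> real"
  assumes "\<And>j. bounded (range (u j))"
  shows "\<exists>r. strict_mono r \<and> (\<forall>j<m::nat. convergent (\<lambda>i. u j (r i)))"
proof (induction m)
  case 0
  show ?case
    by (intro exI[of _ id]) (auto simp: strict_mono_def)
next
  case (Suc m)
  then obtain r :: "nat \<Rightarrow> nat" where r: "strict_mono r" "\<And>j. j < m \<Longrightarrow> convergent (\<lambda>i. u j (r i))"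
    by blast
  have "bounded (range (\<lambda>i. u m (r i)))"
    by (rule bounded_subset[OF assms[of m]]) auto
  then obtain l r' where r': "strict_mono (r' :: nat \<Rightarrow> nat)" "((\<lambda>i. u m (r i)) \<circ> r') \<longlonglongrightarrow> l"
    using bounded_imp_convergent_subsequence[of "\<lambda>i. u m (r i)"] by metis
  have "convergent (\<lambda>i. u j (r (r' i)))" if "j < Suc m" for j
  proof (cases "j = m")
    case True
    then show ?thesis
      using r'(2) by (auto simp: convergent_def o_def)
  next
    case False
    then have "convergent (\<lambda>i. u j (r i))"
      using that r(2) by simp
    then show ?thesis
      using r'(1) convergent_subseq_convergent[of "\<lambda>i. u j (r i)" r'] by (simp add: o_def)
  qed
  then show ?case
    using strict_mono_o[OF r(1) r'(1)] by (intro exI[of _ "r \<circ> r'"]) (auto simp: o_def)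
qed

text \<open>
  The operator has finite rank: its value at \<open>u\<close> is determined by \<open>n\<close> inner products.
\<close>
lemma gamma_hat_compact:
  fixes x :: "nat \<Rightarrow> 'h::real_inner"
  assumes "\<And>i. norm (u i) \<le> 1"
  shows "\<exists>r l. strict_mono (r :: nat \<Rightarrow> nat) \<and> (\<lambda>i. gamma_hat n x (u (r i))) \<longlonglongrightarrow> l"
proof -
  have "bounded (range (\<lambda>i. inner (x j) (u i)))" for j
  proof (rule boundedI)
    fix y assume "y \<in> range (\<lambda>i. inner (x j) (u i))"
    then obtain i where y: "y = inner (x j) (u i)"
      by blast
    have "norm y \<le> norm (x j) * norm (u i)"
      by (simp add: y Cauchy_Schwarz_ineq2)
    also have "\<dots> \<le> norm (x j) * 1"
      using assms by (intro mult_left_mono) auto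
    finally show "norm y \<le> norm (x j)"
      by simp
  qed
  then have "\<exists>r. strict_mono r \<and> (\<forall>j<n. convergent (\<lambda>i. inner (x j) (u (r i))))"
    by (intro simultaneous_convergent_subsequence)
  then obtain r where r: "strict_mono r" "\<forall>j<n. convergent (\<lambda>i. inner (x j) (u (r i)))"
    by (elim exE conjE) (rule that)
  define l where "l j = lim (\<lambda>i. inner (x j) (u (r i)))" for j
  have "(\<lambda>i. inner (x j) (u (r i))) \<longlonglongrightarrow> l j" if "j < n" for j
    using r(2) that unfolding l_def by (simp add: convergent_LIMSEQ_iff)
  then have "(\<lambda>i. gamma_hat n x (u (r i))) \<longlonglongrightarrow> (1 / real n) *\<^sub>R (\<Sum>j<n. l j *\<^sub>R x j)"
    unfolding gamma_hat_apply by (intro tendsto_intros) auto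
  with r(1) show ?thesis
    by blast
qed

lemma eigensystemD:
  assumes "eigensystem A lam v"
  shows "1 \<le> i \<Longrightarrow> i \<le> j \<Longrightarrow> lam j \<le> lam i"
    and "1 \<le> i \<Longrightarrow> 1 \<le> j \<Longrightarrow> inner (v i) (v j) = (if i = j then 1 else 0)"
    and "1 \<le> j \<Longrightarrow> A (v j) = lam j *\<^sub>R v j"
    and "\<mu> \<noteq> 0 \<Longrightarrow> eigenspace A \<mu> = span (v ` {j. 1 \<le> j \<and> lam j = \<mu>})"
  using assms unfolding eigensystem_def by blast+

lemma eigensystem_norm: "eigensystem A lam v \<Longrightarrow> 1 \<le> j \<Longrightarrow> norm (v j) = 1"
  using eigensystemD(2)[of A lam v j j] by (simp add: norm_eq_1)

lemma gamma_hat_eigenvalue_nonneg: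
  assumes "eigensystem (gamma_hat n x) lam v" "1 \<le> j"
  shows "0 \<le> lam j"
  using gamma_hat_nonneg[of n x "v j"] eigensystemD(2)[OF assms(1), of j j] assms(2)
  by (simp add: eigensystemD(3)[OF assms])

text \<open>
  The supremum of the quadratic form over the unit ball of the invariant subspace orthogonal to the
  leading eigenvectors is attained, because the operator is compact; if positive it is an eigenvalue
  with an eigenvector in that subspace, and so one of those that have not been used yet.
\<close>
lemma rayleigh_le_eigenvalue:
  fixes x :: "nat \<Rightarrow> 'h::{real_inner, banach}"
  assumes es: "eigensystem (gamma_hat n x) lam v" and m: "1 \<le> m"
    and y: "\<And>j. 1 \<le> j \<Longrightarrow> j < m \<Longrightarrow> inner (v j) y = 0"
  shows "inner (gamma_hat n x y) y \<le> lam m * (norm y)\<^sup>2"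
proof -
  define A where "A = gamma_hat n x"
  define W where "W = {y. \<forall>j. 1 \<le> j \<longrightarrow> j < m \<longrightarrow> inner (v j) y = 0}"
  define R where "R = (\<lambda>y. inner (A y) y) ` {y\<in>W. norm y \<le> 1}"
  define \<mu> where "\<mu> = Sup R"
  have yW: "y \<in> W"
    using y by (simp add: W_def)
  have scaleW: "c *\<^sub>R y \<in> W" if "y \<in> W" for c y
    using that by (simp add: W_def)
  have AW: "A y \<in> W" if "y \<in> W" for y
    unfolding W_def
  proof safe
    fix j assume j: "1 \<le> j" "j < m"
    have "inner (v j) (A y) = inner (A (v j)) y"
      by (simp add: A_def gamma_hat_sym)
    also have "\<dots> = lam j * inner (v j) y"
      using eigensystemD(3)[OF es j(1)] by (simp add: A_def)
    finally show "inner (v j) (A y) = 0"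
      using that j by (simp add: W_def)
  qed
  have bdd: "bdd_above R"
  proof (rule bdd_aboveI)
    fix r assume "r \<in> R"
    then obtain y where y: "norm y \<le> 1" "r = inner (A y) y"
      by (auto simp: R_def)
    have "r \<le> norm (A y) * norm y"
      unfolding y(2) by (rule norm_cauchy_schwarz)
    also have "\<dots> \<le> (norm A * norm y) * norm y"
      by (intro mult_right_mono norm_blinfun) auto
    also have "\<dots> \<le> (norm A * 1) * 1"
      using y by (intro mult_mono) auto
    finally show "r \<le> norm A"
      by simp
  qed
  have "0 \<in> R"
    by (auto simp: R_def W_def intro!: image_eqI[of _ _ 0])
  then have mu0: "0 \<le> \<mu>" and ne: "R \<noteq> {}"
    using cSup_upper[OF _ bdd] by (auto simp: \<mu>_def)
  have bound: "inner (A y) y \<le> \<mu> * (norm y)\<^sup>2" if "y \<in> W" for y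
  proof (cases "y = 0")
    case False
    have "inner (A ((1 / norm y) *\<^sub>R y)) ((1 / norm y) *\<^sub>R y) \<in> R"
      unfolding R_def by (rule image_eqI[OF refl]) (use False scaleW[OF that] in simp)
    then have "inner (A ((1 / norm y) *\<^sub>R y)) ((1 / norm y) *\<^sub>R y) \<le> \<mu>"
      unfolding \<mu>_def by (rule cSup_upper[OF _ bdd])
    then have "inner (A y) y / (norm y)\<^sup>2 \<le> \<mu>"
      by (simp add: blinfun.scaleR_right power2_eq_square)
    then show ?thesis
      using False by (simp add: divide_le_eq)
  qed simp
  \<comment> \<open>A maximizing sequence consists of approximate eigenvectors, because of this inequality.\<close>
  have sq: "(norm (A y))\<^sup>2 \<le> \<mu> * inner (A y) y" if "y \<in> W" for y
    unfolding A_def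
    by (rule gamma_hat_norm_sq_le) (use bound[OF AW[OF that]] mu0 in \<open>auto simp: A_def\<close>)
  have lam0: "0 \<le> lam m"
    by (rule gamma_hat_eigenvalue_nonneg[OF es m])
  have "\<mu> \<le> lam m"
  proof (rule ccontr)
    assume "\<not> \<mu> \<le> lam m"
    then have mu: "\<mu> > lam m" "\<mu> > 0"
      using lam0 by auto
    have "\<exists>y\<in>W. norm y \<le> 1 \<and> \<mu> - 1 / real (Suc i) < inner (A y) y" for i
    proof -
      have "\<mu> - 1 / real (Suc i) < Sup R"
        by (simp add: \<mu>_def)
      from less_cSupD[OF ne this] show ?thesis
        by (auto simp: R_def)
    qed
    then obtain u where u: "\<And>i. u i \<in> W" "\<And>i. norm (u i) \<le> 1"
        "\<And>i. \<mu> - 1 / real (Suc i) < inner (A (u i)) (u i)"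
      by metis
    obtain r l where r: "strict_mono (r :: nat \<Rightarrow> nat)" "(\<lambda>i. A (u (r i))) \<longlonglongrightarrow> l"
      using gamma_hat_compact[of u n x] u(2) unfolding A_def by blast
    have near: "(norm (A (u i) - \<mu> *\<^sub>R u i))\<^sup>2 \<le> \<mu> * (1 / real (Suc i))" for i
    proof -
      have "(norm (A (u i) - \<mu> *\<^sub>R u i))\<^sup>2
          = (norm (A (u i)))\<^sup>2 - 2 * \<mu> * inner (A (u i)) (u i) + \<mu>\<^sup>2 * (norm (u i))\<^sup>2"
        unfolding power2_norm_eq_inner
        by (simp add: inner_diff_left inner_diff_right inner_commute power2_eq_square)
      also have "\<dots> \<le> \<mu> * inner (A (u i)) (u i) - 2 * \<mu> * inner (A (u i)) (u i) + \<mu>\<^sup>2 * 1"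
        using sq[OF u(1)] u(2)[of i] mu0 by (intro add_mono diff_mono mult_left_mono) (auto simp: power_le_one)
      also have "\<dots> = \<mu> * (\<mu> - inner (A (u i)) (u i))"
        by (simp add: algebra_simps power2_eq_square)
      also have "\<dots> \<le> \<mu> * (1 / real (Suc i))"
        using u(3)[of i] mu by (intro mult_left_mono) auto
      finally show ?thesis .
    qed
    have "(\<lambda>i. A (u i) - \<mu> *\<^sub>R u i) \<longlonglongrightarrow> 0"
    proof -
      have "(\<lambda>i. \<mu> * (1 / real (Suc i))) \<longlonglongrightarrow> \<mu> * 0"
        by (intro tendsto_intros LIMSEQ_Suc lim_const_over_n)
      then have h: "(\<lambda>i. \<mu> * (1 / real (Suc i))) \<longlonglongrightarrow> 0"
        by simp
      have "(\<lambda>i. (norm (A (u i) - \<mu> *\<^sub>R u i))\<^sup>2) \<longlonglongrightarrow> 0"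
        by (rule tendsto_sandwich[OF _ _ tendsto_const h]) (use near in auto)
      then have "(\<lambda>i. sqrt ((norm (A (u i) - \<mu> *\<^sub>R u i))\<^sup>2)) \<longlonglongrightarrow> sqrt 0"
        by (intro tendsto_intros)
      then have "(\<lambda>i. norm (A (u i) - \<mu> *\<^sub>R u i)) \<longlonglongrightarrow> 0"
        by simp
      then show ?thesis
        by (rule tendsto_norm_zero_cancel)
    qed
    then have "(\<lambda>i. A (u (r i)) - \<mu> *\<^sub>R u (r i)) \<longlonglongrightarrow> 0"
      using LIMSEQ_subseq_LIMSEQ[OF _ r(1)] by (fastforce simp: o_def)
    then have "(\<lambda>i. (1 / \<mu>) *\<^sub>R (A (u (r i)) - (A (u (r i)) - \<mu> *\<^sub>R u (r i)))) \<longlonglongrightarrow> (1 / \<mu>) *\<^sub>R (l - 0)"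
      by (intro tendsto_intros r)
    then have lim: "(\<lambda>i. u (r i)) \<longlonglongrightarrow> (1 / \<mu>) *\<^sub>R l"
      using mu by simp
    define z where "z = (1 / \<mu>) *\<^sub>R l"
    have zW: "z \<in> W"
    proof -
      have "inner (v j) z = 0" if "1 \<le> j" "j < m" for j
      proof -
        have "(\<lambda>i. inner (v j) (u (r i))) \<longlonglongrightarrow> inner (v j) z"
          unfolding z_def by (intro tendsto_intros lim)
        moreover have "inner (v j) (u (r i)) = 0" for i
          using u(1)[of "r i"] that by (simp add: W_def)
        ultimately show ?thesis
          by (simp add: LIMSEQ_const_iff)
      qed
      then show ?thesis
        by (simp add: W_def)
    qed
    have "(\<lambda>i. A (u (r i))) \<longlonglongrightarrow> A z"
      unfolding z_def by (intro tendsto_intros lim)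
    then have "A z = l"
      using r(2) LIMSEQ_unique by blast
    then have Az: "A z = \<mu> *\<^sub>R z"
      using mu by (simp add: z_def)
    have z0: "z \<noteq> 0"
    proof
      assume "z = 0"
      have "(\<lambda>i. inner (A (u (r i))) (u (r i))) \<longlonglongrightarrow> inner (A z) z"
        unfolding z_def by (intro tendsto_intros lim)
      moreover have "(\<lambda>i. \<mu> - 1 / real (Suc (r i))) \<longlonglongrightarrow> \<mu> - 0"
      proof -
        have "(\<lambda>i. \<mu> - 1 / real (Suc i)) \<longlonglongrightarrow> \<mu> - 0"
          by (intro tendsto_intros LIMSEQ_Suc lim_const_over_n)
        from LIMSEQ_subseq_LIMSEQ[OF this r(1)] show ?thesis
          by (simp add: o_def)
      qed
      ultimately have "\<mu> - 0 \<le> inner (A z) z"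
        using u(3) by (intro LIMSEQ_le) (auto intro!: exI[of _ 0] less_imp_le simp del: of_nat_Suc)
      then show False
        using \<open>z = 0\<close> mu by simp
    qed
    \<comment> \<open>The limit \<open>z\<close> is a combination of listed eigenvectors, all orthogonal to it.\<close>
    have "z \<in> span (v ` {j. 1 \<le> j \<and> lam j = \<mu>})"
      using eigensystemD(4)[OF es, of \<mu>] mu Az by (auto simp: eigenspace_def A_def)
    moreover have "orthogonal z w" if w: "w \<in> v ` {j. 1 \<le> j \<and> lam j = \<mu>}" for w
    proof -
      obtain j where j: "w = v j" "1 \<le> j" "lam j = \<mu>"
        using w by blast
      have "j < m"
        using eigensystemD(1)[OF es m, of j] j mu by (cases "j < m") auto
      then show ?thesis
        using zW j by (simp add: W_def orthogonal_def inner_commute)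
    qed
    ultimately have "orthogonal z z"
      using orthogonal_to_span by blast
    then show False
      using z0 by (simp add: orthogonal_def)
  qed
  then have "\<mu> * (norm y)\<^sup>2 \<le> lam m * (norm y)\<^sup>2"
    by (intro mult_right_mono) auto
  with bound[OF yW] show ?thesis
    by (simp add: A_def)
qed

lemma gamma_hat_norm_le_eigenvalue:
  fixes x :: "nat \<Rightarrow> 'h::{real_inner, banach}"
  assumes es: "eigensystem (gamma_hat n x) lam v" and m: "1 \<le> m"
    and y: "\<And>j. 1 \<le> j \<Longrightarrow> j < m \<Longrightarrow> inner (v j) y = 0"
  shows "norm (gamma_hat n x y) \<le> lam m * norm y"
proof -
  have lam0: "0 \<le> lam m"
    by (rule gamma_hat_eigenvalue_nonneg[OF es m])
  have "inner (v j) (gamma_hat n x y) = 0" if "1 \<le> j" "j < m" for j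
    using y[OF that] eigensystemD(3)[OF es that(1)] by (simp flip: gamma_hat_sym)
  then have "(norm (gamma_hat n x y))\<^sup>2 \<le> lam m * inner (gamma_hat n x y) y"
    by (intro gamma_hat_norm_sq_le lam0 rayleigh_le_eigenvalue[OF es m])
  also have "\<dots> \<le> lam m * (lam m * (norm y)\<^sup>2)"
    by (intro mult_left_mono lam0 rayleigh_le_eigenvalue[OF es m y])
  also have "\<dots> = (lam m * norm y)\<^sup>2"
    by (simp add: power2_eq_square)
  finally show ?thesis
    by (rule power2_le_imp_le) (use lam0 in simp)
qed

text \<open>
  The quadratic form on the first \<open>m\<close> eigenvectors sums to at least \<open>m * lam m\<close>, and by Bessel's
  inequality to at most the trace.
\<close>
lemma gamma_hat_eigenvalue_le_trace:
  assumes es: "eigensystem (gamma_hat n x) lam v" and m: "1 \<le> m"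
  shows "real m * lam m \<le> (1 / real n) * (\<Sum>j<n. (norm (x j))\<^sup>2)"
proof -
  have "real m * lam m = (\<Sum>i=1..m. lam m)"
    by simp
  also have "\<dots> \<le> (\<Sum>i=1..m. lam i)"
    using eigensystemD(1)[OF es] by (intro sum_mono) auto
  also have "\<dots> = (\<Sum>i=1..m. inner (gamma_hat n x (v i)) (v i))"
    using eigensystemD(2,3)[OF es] by (intro sum.cong refl) auto
  also have "\<dots> = (1 / real n) * (\<Sum>j<n. \<Sum>i=1..m. (inner (v i) (x j))\<^sup>2)"
    unfolding inner_gamma_hat
    by (subst sum.swap) (simp add: sum_distrib_left power2_eq_square inner_commute)
  also have "\<dots> \<le> (1 / real n) * (\<Sum>j<n. (norm (x j))\<^sup>2)"
    by (intro mult_left_mono sum_mono bessel_inequality)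
       (use eigensystemD(2)[OF es] eigensystem_norm[OF es] in auto)
  finally show ?thesis .
qed

text \<open>
  Fewer than \<open>k\<close> homogeneous linear equations in \<open>k\<close> unknowns. The orthonormal sequence serves only to
  represent the coefficients as vectors in a space of dimension \<open>k - 1\<close>.
\<close>
lemma underdetermined_system:
  fixes f :: "nat \<Rightarrow> nat \<Rightarrow> real"
  fixes v :: "nat \<Rightarrow> 'h::real_inner"
  assumes on: "\<And>i j. 1 \<le> i \<Longrightarrow> 1 \<le> j \<Longrightarrow> inner (v i) (v j) = (if i = j then 1 else 0)" and k: "1 \<le> k"
  shows "\<exists>c. (\<exists>i\<in>{1..k}. c i \<noteq> 0) \<and> (\<forall>j\<in>{1..<k}. (\<Sum>i=1..k. c i * f j i) = 0)"
proof -
  define w where "w i = (\<Sum>j\<in>{1..<k}. f j i *\<^sub>R v j)" for i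
  have "\<exists>c. (\<exists>i\<in>{1..k}. c i \<noteq> 0) \<and> (\<Sum>i=1..k. c i *\<^sub>R w i) = 0"
  proof (cases "inj_on w {1..k}")
    case True
    have "w ` {1..k} \<subseteq> span (v ` {1..<k})"
      unfolding w_def by (intro image_subsetI span_sum span_scale span_base imageI)
    then have "independent (w ` {1..k}) \<Longrightarrow> card (w ` {1..k}) \<le> card (v ` {1..<k})"
      using independent_span_bound[of "v ` {1..<k}" "w ` {1..k}"] by auto
    moreover have "card (v ` {1..<k}) < card (w ` {1..k})"
      using card_image_le[of "{1..<k}" v] card_image[OF True] k by simp
    ultimately have "dependent (w ` {1..k})"
      by linarith
    then obtain u where u: "\<exists>z\<in>w ` {1..k}. u z \<noteq> 0" "(\<Sum>z\<in>w ` {1..k}. u z *\<^sub>R z) = 0"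
      by (auto simp: dependent_finite)
    have "(\<Sum>i=1..k. u (w i) *\<^sub>R w i) = 0"
      using u(2) by (subst (asm) sum.reindex[OF True]) simp
    then show ?thesis
      using u(1) by (intro exI[of _ "\<lambda>i. u (w i)"]) auto
  next
    case False
    then obtain a b where ab: "a \<in> {1..k}" "b \<in> {1..k}" "a \<noteq> b" "w a = w b"
      by (auto simp: inj_on_def)
    define c :: "nat \<Rightarrow> real" where "c i = (if i = a then 1 else if i = b then -1 else 0)" for i
    have "(\<Sum>i=1..k. c i *\<^sub>R w i) = (\<Sum>i\<in>{a, b}. c i *\<^sub>R w i)"
      using ab by (intro sum.mono_neutral_right) (auto simp: c_def)
    also have "\<dots> = 0"
      using ab by (simp add: c_def)
    finally show ?thesis
      using ab by (intro exI[of _ c]) (auto simp: c_def)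
  qed
  then obtain c where c: "\<exists>i\<in>{1..k}. c i \<noteq> 0" "(\<Sum>i=1..k. c i *\<^sub>R w i) = 0"
    by blast
  have "(\<Sum>i=1..k. c i * f j i) = 0" if j: "j \<in> {1..<k}" for j
  proof -
    have vw: "inner (v j) (w i) = f j i" for i
    proof -
      have "inner (v j) (w i) = (\<Sum>l\<in>{1..<k}. if l = j then f j i else 0)"
        unfolding w_def inner_sum_right
        by (rule sum.cong) (use on[of j] j in auto)
      then show ?thesis
        using j by simp
    qed
    have "0 = inner (v j) (\<Sum>i=1..k. c i *\<^sub>R w i)"
      unfolding c(2) by simp
    also have "\<dots> = (\<Sum>i=1..k. c i * f j i)"
      by (simp add: inner_sum_right vw)
    finally show ?thesis
      by simp
  qed
  then show ?thesis
    using c(1) by blast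
qed

text \<open>
  Weyl's inequality: some nonzero vector in the span of the \<open>k\<close> leading true eigenvectors is orthogonal to the
  first \<open>k - 1\<close> empirical ones, and on it the two quadratic forms can be compared.
\<close>
lemma gamma_hat_eigenvalue_lower_bound:
  fixes x :: "nat \<Rightarrow> 'h::{real_inner, banach}" and G :: "'h \<Rightarrow>\<^sub>L 'h"
  assumes es: "eigensystem (gamma_hat n x) lam v" and k: "1 \<le> k"
    and on: "\<And>i j. 1 \<le> i \<Longrightarrow> 1 \<le> j \<Longrightarrow> inner (w i) (w j) = (if i = j then 1 else 0)"
    and eig: "\<And>i. 1 \<le> i \<Longrightarrow> G (w i) = l i *\<^sub>R w i"
    and dec: "\<And>i. 1 \<le> i \<Longrightarrow> i \<le> k \<Longrightarrow> l k \<le> l i"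
  shows "l k - norm (gamma_hat n x - G) \<le> lam k"
proof -
  obtain c where c: "\<exists>i\<in>{1..k}. c i \<noteq> 0" "\<And>j. j \<in> {1..<k} \<Longrightarrow> (\<Sum>i=1..k. c i * inner (v j) (w i)) = 0"
    using underdetermined_system[OF eigensystemD(2)[OF es] k, of "\<lambda>j i. inner (v j) (w i)"] by blast
  define y where "y = (\<Sum>i=1..k. c i *\<^sub>R w i)"
  have wy: "inner (w i) y = c i" if "i \<in> {1..k}" for i
  proof -
    have "inner (w i) y = (\<Sum>j=1..k. if j = i then c i else 0)"
      unfolding y_def inner_sum_right by (rule sum.cong) (use on[of i] that in auto)
    then show ?thesis
      using that by simp
  qed
  have "inner y z = (\<Sum>i=1..k. c i * inner (w i) z)" for z
    by (simp add: y_def inner_sum_left)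
  then have ny: "(norm y)\<^sup>2 = (\<Sum>i=1..k. (c i)\<^sup>2)"
    unfolding power2_norm_eq_inner using wy by (simp add: power2_eq_square)
  have Gy: "inner (G y) y = (\<Sum>i=1..k. l i * (c i)\<^sup>2)"
  proof -
    have "G y = (\<Sum>i=1..k. (c i * l i) *\<^sub>R w i)"
      unfolding y_def blinfun.sum_right blinfun.scaleR_right by (rule sum.cong) (simp_all add: eig)
    then have "inner (G y) y = (\<Sum>i=1..k. (c i * l i) * inner (w i) y)"
      by (simp add: inner_sum_left)
    then show ?thesis
      using wy by (simp add: power2_eq_square ac_simps)
  qed
  have "(norm y)\<^sup>2 > 0"
  proof -
    obtain i where "i \<in> {1..k}" "c i \<noteq> 0"
      using c(1) by blast
    then show ?thesis
      unfolding ny by (intro sum_pos2[of _ i]) auto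
  qed
  have "l k * (norm y)\<^sup>2 \<le> inner (G y) y"
    unfolding ny Gy sum_distrib_left using dec by (intro sum_mono mult_right_mono) auto
  also have "\<dots> = inner (gamma_hat n x y) y - inner ((gamma_hat n x - G) y) y"
    by (simp add: blinfun.diff_left inner_diff_left)
  also have "\<dots> \<le> lam k * (norm y)\<^sup>2 + norm (gamma_hat n x - G) * (norm y)\<^sup>2"
  proof -
    have "inner (gamma_hat n x y) y \<le> lam k * (norm y)\<^sup>2"
      using c(2) by (intro rayleigh_le_eigenvalue[OF es k]) (simp add: y_def inner_sum_right)
    moreover have "- inner ((gamma_hat n x - G) y) y \<le> norm ((gamma_hat n x - G) y) * norm y"
      using Cauchy_Schwarz_ineq2[of "(gamma_hat n x - G) y" y] by linarith
    moreover have "\<dots> \<le> (norm (gamma_hat n x - G) * norm y) * norm y"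
      by (intro mult_right_mono norm_blinfun) auto
    ultimately show ?thesis
      by (simp add: power2_eq_square)
  qed
  finally have "l k * (norm y)\<^sup>2 \<le> (lam k + norm (gamma_hat n x - G)) * (norm y)\<^sup>2"
    by (simp add: distrib_right)
  with \<open>(norm y)\<^sup>2 > 0\<close> show ?thesis
    by (simp del: zero_less_power2)
qed


section \<open>The estimator of the autoregression operator\<close>

lemma spectral_cutoff_inverse_apply:
  "spectral_cutoff_inverse k lam v y = (\<Sum>j=1..k. (inner (v j) y / lam j) *\<^sub>R v j)"
  by (simp add: spectral_cutoff_inverse_def blinfun.sum_left blinfun.scaleR_left tensor.rep_eq)

lemma spectral_cutoff_inverse_sym:
  "inner (spectral_cutoff_inverse k lam v y) z = inner y (spectral_cutoff_inverse k lam v z)"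
  by (simp add: spectral_cutoff_inverse_apply inner_sum_left inner_sum_right inner_commute ac_simps)

context
  fixes n k :: nat and x :: "nat \<Rightarrow> 'h::{real_inner, banach}" and lam v
  assumes es: "eigensystem (gamma_hat n x) lam v" and k: "1 \<le> k" and pos: "0 < lam k"
begin

private abbreviation (input) "A \<equiv> gamma_hat n x"
private abbreviation (input) "D \<equiv> spectral_cutoff_inverse k lam v"

lemma lam_pos': "1 \<le> j \<Longrightarrow> j \<le> k \<Longrightarrow> 0 < lam j"
  using eigensystemD(1)[OF es, of j k] pos by simp

lemma gamma_hat_cutoff: "A (D y) = (\<Sum>j=1..k. inner (v j) y *\<^sub>R v j)"
  unfolding spectral_cutoff_inverse_apply blinfun.sum_right blinfun.scaleR_right
proof (rule sum.cong[OF refl])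
  fix j assume "j \<in> {1..k}"
  then show "(inner (v j) y / lam j) *\<^sub>R A (v j) = inner (v j) y *\<^sub>R v j"
    using eigensystemD(3)[OF es, of j] lam_pos'[of j] by simp
qed

lemma cutoff_gamma_hat: "D (A y) = A (D y)"
  unfolding gamma_hat_cutoff unfolding spectral_cutoff_inverse_apply
proof (rule sum.cong[OF refl])
  fix j assume j: "j \<in> {1..k}"
  have "inner (v j) (A y) = lam j * inner (v j) y"
    using eigensystemD(3)[OF es, of j] j by (simp flip: gamma_hat_sym)
  then show "(inner (v j) (A y) / lam j) *\<^sub>R v j = inner (v j) y *\<^sub>R v j"
    using lam_pos'[of j] j by simp
qed

lemma inner_eigenvector_complement:
  assumes j: "1 \<le> j" "j \<le> k"
  shows "inner (v j) (y - A (D y)) = 0"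
proof -
  have "inner (v j) (A (D y)) = (\<Sum>i=1..k. if i = j then inner (v j) y else 0)"
    unfolding gamma_hat_cutoff inner_sum_right
    by (rule sum.cong) (use eigensystemD(2)[OF es, of j] j in auto)
  then show ?thesis
    using j by (simp add: inner_diff_right)
qed

lemma cutoff_gamma_hat_cutoff: "D (A (D y)) = D y"
proof -
  have "D (y - A (D y)) = 0"
    using inner_eigenvector_complement by (simp add: spectral_cutoff_inverse_apply)
  then show ?thesis
    by (simp add: blinfun.diff_right)
qed

lemma norm_cutoff_le: "norm D \<le> 1 / lam k"
proof (rule norm_blinfun_bound)
  fix y
  have "(norm (D y))\<^sup>2 = (\<Sum>j=1..k. (inner (v j) y / lam j)\<^sup>2 * (norm (v j))\<^sup>2)"
    unfolding spectral_cutoff_inverse_apply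
    by (rule norm_sum_orthogonal) (use eigensystemD(2)[OF es] in auto)
  also have "\<dots> \<le> (\<Sum>j=1..k. (1 / lam k)\<^sup>2 * (inner (v j) y)\<^sup>2)"
  proof (rule sum_mono)
    fix j assume j: "j \<in> {1..k}"
    have "(inner (v j) y)\<^sup>2 / (lam j)\<^sup>2 \<le> (inner (v j) y)\<^sup>2 / (lam k)\<^sup>2"
      using eigensystemD(1)[OF es, of j k] pos j by (intro divide_left_mono power_mono) auto
    then show "(inner (v j) y / lam j)\<^sup>2 * (norm (v j))\<^sup>2 \<le> (1 / lam k)\<^sup>2 * (inner (v j) y)\<^sup>2"
      using eigensystem_norm[OF es, of j] j by (simp add: power_divide)
  qed
  also have "\<dots> \<le> (1 / lam k)\<^sup>2 * (norm y)\<^sup>2"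
    unfolding sum_distrib_left[symmetric]
    by (intro mult_left_mono bessel_inequality)
       (use eigensystemD(2)[OF es] eigensystem_norm[OF es] in auto)
  also have "\<dots> = (1 / lam k * norm y)\<^sup>2"
    by (simp add: power_mult_distrib power_divide)
  finally show "norm (D y) \<le> 1 / lam k * norm y"
    by (rule power2_le_imp_le) (use pos in simp)
qed (use pos in simp)

definition cutoff_complement :: "'h \<Rightarrow>\<^sub>L 'h" where
  "cutoff_complement = id_blinfun - (A o\<^sub>L D)"

lemma cutoff_complement_apply: "cutoff_complement y = y - A (D y)"
  by (simp add: cutoff_complement_def blinfun.diff_left)

lemma cutoff_complement_sym: "inner (cutoff_complement y) z = inner y (cutoff_complement z)"
  by (simp add: cutoff_complement_apply inner_diff_left inner_diff_right gamma_hat_sym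
      spectral_cutoff_inverse_sym cutoff_gamma_hat)

text \<open>
  The operator is the orthogonal projection onto the complement of the leading \<open>k\<close> eigenvectors.
\<close>
lemma norm_cutoff_complement_le: "norm cutoff_complement \<le> 1"
proof (rule norm_blinfun_bound)
  fix y
  let ?q = "A (D y)"
  have "inner ?q (y - ?q) = (\<Sum>j=1..k. inner (v j) y * inner (v j) (y - ?q))"
    by (subst gamma_hat_cutoff) (simp add: inner_sum_left)
  also have "\<dots> = 0"
    using inner_eigenvector_complement by simp
  finally have "inner (y - ?q) (y - ?q) = inner y (y - ?q)"
    by (simp add: inner_diff_left)
  then have "norm (y - ?q) * norm (y - ?q) \<le> norm y * norm (y - ?q)"
    using norm_cauchy_schwarz[of y "y - ?q"] by (simp add: power2_norm_eq_inner flip: power2_eq_square)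
  then show "norm (cutoff_complement y) \<le> 1 * norm y"
    by (cases "y - ?q = 0") (simp_all add: cutoff_complement_apply)
qed simp

text \<open>
  The projection commutes with the operator, and on the complement the largest eigenvalue is the next
  one.
\<close>
lemma norm_gamma_hat_complement_le:
  "norm (cutoff_complement (A y)) \<le> lam (k + 1) * norm y"
proof -
  have "cutoff_complement (A y) = A (cutoff_complement y)"
    by (simp add: cutoff_complement_apply blinfun.diff_right cutoff_gamma_hat)
  also have "norm \<dots> \<le> lam (k + 1) * norm (cutoff_complement y)"
    by (rule gamma_hat_norm_le_eigenvalue[OF es])
       (use inner_eigenvector_complement in \<open>auto simp: cutoff_complement_apply\<close>)
  also have "\<dots> \<le> lam (k + 1) * (1 * norm y)"
    by (intro mult_left_mono gamma_hat_eigenvalue_nonneg[OF es]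
        order_trans[OF norm_blinfun] mult_right_mono norm_cutoff_complement_le) auto
  finally show ?thesis
    by simp
qed

text \<open>
  Substituting \<open>x (j + 1) = P (x j) + (x (j + 1) - P (x j))\<close> splits the estimator into the compression of \<open>P\<close> to
  the leading eigenvectors and the cutoff inverse applied to a cross covariance. With the true operator for
  \<open>P\<close> the latter involves the innovations only.
\<close>
lemma psi_hat_error_le:
  "norm (psi_hat n k lam v x - P)
     \<le> norm (P o\<^sub>L cutoff_complement)
       + norm ((1 / real n) *\<^sub>R (\<Sum>j<n. x j \<otimes>\<^sub>H (x (j + 1) - P (x j)))) / lam k"
proof -
  define R where "R = (1 / real n) *\<^sub>R (\<Sum>j<n. x j \<otimes>\<^sub>H (x (j + 1) - P (x j)))"
  have "c_hat n x y = P (A y) + R y" for y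
  proof -
    have "(\<Sum>j<n. inner (x j) y *\<^sub>R x (j + 1))
        = (\<Sum>j<n. inner (x j) y *\<^sub>R P (x j)) + (\<Sum>j<n. inner (x j) y *\<^sub>R (x (j + 1) - P (x j)))"
      by (simp flip: sum.distrib scaleR_add_right)
    then show ?thesis
      by (simp add: c_hat_def R_def gamma_hat_apply blinfun.scaleR_left blinfun.scaleR_right
          blinfun.sum_left blinfun.sum_right tensor.rep_eq flip: scaleR_add_right)
  qed
  then have "psi_hat n k lam v x - P = (R o\<^sub>L D) - (P o\<^sub>L cutoff_complement)"
    by (intro blinfun_eqI) (simp add: psi_hat_def blinfun.diff_left blinfun.diff_right
        cutoff_complement_apply)
  also have "norm \<dots> \<le> norm (R o\<^sub>L D) + norm (P o\<^sub>L cutoff_complement)"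
    by (rule norm_triangle_ineq4)
  also have "norm (R o\<^sub>L D) \<le> norm R * (1 / lam k)"
    by (intro order_trans[OF norm_blinfun_compose] mult_left_mono norm_cutoff_le) auto
  finally show ?thesis
    by (simp add: R_def)
qed

text \<open>
  With the estimator \<open>P = C D\<close>, where \<open>C\<close> is the empirical cross covariance and \<open>D\<close> the cutoff inverse of \<open>A\<close>, the
  sum of \<open>P (x j) \<otimes>\<^sub>H P (x j)\<close> is \<open>n\<close> times \<open>C D A D C\<^sup>*\<close>, that of \<open>P (x j) \<otimes>\<^sub>H x (j + 1)\<close> is \<open>n\<close> times
  \<open>C D C\<^sup>*\<close>, and \<open>D A D = D\<close>. So the residuals are orthogonal, in the sample, to the fitted values, in
  spite of the regularization.
\<close>
lemma psi_hat_normal_equations: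
  defines "P \<equiv> psi_hat n k lam v x"
  shows "(\<Sum>j<n. P (x j) \<otimes>\<^sub>H residual P x (j + 1)) = 0" (is ?fit)
    and "(\<Sum>j<n. residual P x (j + 1) \<otimes>\<^sub>H P (x j)) = 0" (is ?fit')
proof -
  have adjP: "adj P y = D (adj (c_hat n x) y)" for y
  proof -
    have "inner z (adj P y) = inner z (D (adj (c_hat n x) y))" for z
    proof -
      have "inner z (adj P y) = inner (c_hat n x (D z)) y"
        by (simp add: P_def psi_hat_def flip: inner_adj)
      also have "\<dots> = inner (D z) (adj (c_hat n x) y)"
        by (rule inner_adj)
      finally show ?thesis
        by (simp add: spectral_cutoff_inverse_sym)
    qed
    then have "\<forall>z. inner z (adj P y) = inner z (D (adj (c_hat n x) y))"
      by blast
    then show ?thesis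
      by (simp only: vector_eq_ldot)
  qed
  have n: "(\<Sum>j<n. x j \<otimes>\<^sub>H residual P x (j + 1)) y = real n *\<^sub>R (c_hat n x y - P (A y))" for y
  proof (cases "n = 0")
    case False
    then show ?thesis
      by (simp add: c_hat_def gamma_hat_apply blinfun.sum_left blinfun.scaleR_left blinfun.scaleR_right
        blinfun.sum_right tensor.rep_eq residual_def scaleR_diff_right sum_subtractf)
  qed simp
  have "(\<Sum>j<n. P (x j) \<otimes>\<^sub>H residual P x (j + 1)) y
      = (\<Sum>j<n. x j \<otimes>\<^sub>H residual P x (j + 1)) (adj P y)" for y
    by (simp add: blinfun.sum_left tensor.rep_eq inner_adj)
  also have "\<dots> y = real n *\<^sub>R (c_hat n x (D (adj (c_hat n x) y)) - c_hat n x (D (A (D (adj (c_hat n x) y)))))" for y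
    unfolding n adjP by (simp add: P_def psi_hat_def)
  also have "\<dots> y = 0" for y
    by (simp add: cutoff_gamma_hat_cutoff)
  finally have *: "(\<Sum>j<n. P (x j) \<otimes>\<^sub>H residual P x (j + 1)) y = 0" for y .
  then show ?fit
    by (intro blinfun_eqI) simp
  have "inner ((\<Sum>j<n. residual P x (j + 1) \<otimes>\<^sub>H P (x j)) y) z
      = inner y ((\<Sum>j<n. P (x j) \<otimes>\<^sub>H residual P x (j + 1)) z)" for y z
    by (simp add: blinfun.sum_left tensor.rep_eq inner_sum_left inner_sum_right inner_commute mult.commute)
  then have "inner ((\<Sum>j<n. residual P x (j + 1) \<otimes>\<^sub>H P (x j)) y) ((\<Sum>j<n. residual P x (j + 1) \<otimes>\<^sub>H P (x j)) y) = 0" for y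
    using * by simp
  then show ?fit'
    by (intro blinfun_eqI) simp
qed

text \<open>
  Expanding \<open>x j = P (x (j - 1)) + residual P x j\<close> in \<open>x j \<otimes>\<^sub>H x j\<close>, the mixed terms sum to zero by the normal
  equations. The tensor squares with indices \<open>1..n\<close> and \<open>0..<n\<close> differ at the two ends only.
\<close>
lemma gamma_hat_fixed_point:
  defines "P \<equiv> psi_hat n k lam v x"
  assumes n: "n \<ge> 1"
  shows "sandwich P A + (1 / real n) *\<^sub>R (\<Sum>j=1..n. residual P x j \<otimes>\<^sub>H residual P x j)
    = A + (1 / real n) *\<^sub>R (x n \<otimes>\<^sub>H x n - x 0 \<otimes>\<^sub>H x 0)"
proof -
  have split: "x (j + 1) \<otimes>\<^sub>H x (j + 1) = P (x j) \<otimes>\<^sub>H P (x j) + P (x j) \<otimes>\<^sub>H residual P x (j + 1)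
      + residual P x (j + 1) \<otimes>\<^sub>H P (x j) + residual P x (j + 1) \<otimes>\<^sub>H residual P x (j + 1)" for j
  proof -
    have "x (j + 1) = P (x j) + residual P x (j + 1)"
      by (simp add: residual_def)
    then show ?thesis
      by (simp only: tensor_add_left tensor_add_right) simp
  qed
  have "(\<Sum>j<n. x (j + 1) \<otimes>\<^sub>H x (j + 1)) = (\<Sum>j<n. P (x j) \<otimes>\<^sub>H P (x j))
      + (\<Sum>j<n. residual P x (j + 1) \<otimes>\<^sub>H residual P x (j + 1))"
    unfolding split sum.distrib
    using psi_hat_normal_equations by (simp add: P_def)
  moreover have "(\<Sum>j<n. x (j + 1) \<otimes>\<^sub>H x (j + 1)) = (\<Sum>j<n. x j \<otimes>\<^sub>H x j) + (x n \<otimes>\<^sub>H x n - x 0 \<otimes>\<^sub>H x 0)"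
    using sum_lessThan_telescope[of "\<lambda>j. x j \<otimes>\<^sub>H x j" n] by (simp add: sum_subtractf algebra_simps)
  moreover have "(\<Sum>j=1..n. residual P x j \<otimes>\<^sub>H residual P x j) = (\<Sum>j<n. residual P x (j + 1) \<otimes>\<^sub>H residual P x (j + 1))"
    by (rule sum.reindex_bij_witness[of _ Suc "\<lambda>j. j - 1"]) auto
  moreover have "sandwich P A = (1 / real n) *\<^sub>R (\<Sum>j<n. P (x j) \<otimes>\<^sub>H P (x j))"
    by (simp add: gamma_hat_def sandwich_scaleR sandwich_sum sandwich_tensor)
  ultimately show ?thesis
    by (simp add: gamma_hat_def flip: scaleR_add_right)
qed

end

lemma centred_second_moment:
  fixes r :: "nat \<Rightarrow> 'h::real_inner"
  assumes "n \<ge> 1"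
  defines "m \<equiv> (1 / real n) *\<^sub>R (\<Sum>j=1..n. r j)"
  shows "(1 / real n) *\<^sub>R (\<Sum>j=1..n. (r j - m) \<otimes>\<^sub>H (r j - m))
    = (1 / real n) *\<^sub>R (\<Sum>j=1..n. r j \<otimes>\<^sub>H r j) - m \<otimes>\<^sub>H m"
proof -
  have sm: "(\<Sum>j=1..n. r j) = real n *\<^sub>R m"
    using assms(1) by (simp add: m_def)
  have "(\<Sum>j=1..n. (r j - m) \<otimes>\<^sub>H (r j - m))
      = (\<Sum>j=1..n. r j \<otimes>\<^sub>H r j) - (\<Sum>j=1..n. r j) \<otimes>\<^sub>H m - m \<otimes>\<^sub>H (\<Sum>j=1..n. r j) + real n *\<^sub>R (m \<otimes>\<^sub>H m)"
    by (simp add: tensor_diff_left tensor_diff_right tensor_sum_left tensor_sum_right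
        sum_subtractf sum.distrib algebra_simps)
       (simp add: sum_constant_scaleR)
  also have "\<dots> = (\<Sum>j=1..n. r j \<otimes>\<^sub>H r j) - real n *\<^sub>R (m \<otimes>\<^sub>H m)"
    unfolding sm tensor_scaleR_left tensor_scaleR_right by simp
  finally show ?thesis
    using assms(1) by (simp add: scaleR_diff_right)
qed


section \<open>Expectations of sums of orthogonal random operators\<close>

text \<open>
  Integrability is part of the notion, since the Bochner integral of a function that is not integrable
  is \<open>0\<close> and a bare inequality between integrals would then say nothing.
\<close>
definition mean_le :: "'w measure \<Rightarrow> ('w \<Rightarrow> real) \<Rightarrow> real \<Rightarrow> bool" where
  "mean_le M f c \<longleftrightarrow> integrable M f \<and> (\<integral>\<omega>. f \<omega> \<partial>M) \<le> c"

lemma mean_leD: "mean_le M f c \<Longrightarrow> integrable M f" "mean_le M f c \<Longrightarrow> (\<integral>\<omega>. f \<omega> \<partial>M) \<le> c"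
  by (auto simp: mean_le_def)

lemma mean_le_nonneg:
  assumes "mean_le M f c" "\<And>\<omega>. \<omega> \<in> space M \<Longrightarrow> 0 \<le> f \<omega>"
  shows "0 \<le> c"
proof -
  have "0 \<le> (\<integral>\<omega>. f \<omega> \<partial>M)"
    by (rule Bochner_Integration.integral_nonneg) (rule assms(2))
  with mean_leD(2)[OF assms(1)] show ?thesis
    by simp
qed

lemma mean_le_weaken: "mean_le M f c \<Longrightarrow> c \<le> d \<Longrightarrow> mean_le M f d"
  by (auto simp: mean_le_def)

lemma mean_le_mono:
  assumes "mean_le M f c" and [measurable]: "g \<in> borel_measurable M"
    and "\<And>\<omega>. \<omega> \<in> space M \<Longrightarrow> 0 \<le> g \<omega>" "\<And>\<omega>. \<omega> \<in> space M \<Longrightarrow> g \<omega> \<le> f \<omega>" and "c \<le> d"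
  shows "mean_le M g d"
proof -
  have f: "integrable M f" "(\<integral>\<omega>. f \<omega> \<partial>M) \<le> c"
    using assms(1) by (auto simp: mean_le_def)
  have g: "integrable M g"
    by (rule Bochner_Integration.integrable_bound[OF f(1)]) (use assms(3,4) in \<open>fastforce intro!: AE_I2\<close>)+
  moreover have "(\<integral>\<omega>. g \<omega> \<partial>M) \<le> (\<integral>\<omega>. f \<omega> \<partial>M)"
    by (rule integral_mono[OF g f(1) assms(4)])
  ultimately show ?thesis
    using f(2) \<open>c \<le> d\<close> by (simp add: mean_le_def)
qed

lemma mean_le_add: "mean_le M f c \<Longrightarrow> mean_le M g d \<Longrightarrow> mean_le M (\<lambda>\<omega>. f \<omega> + g \<omega>) (c + d)"
  by (auto simp: mean_le_def)

lemma mean_le_cmult: "mean_le M f c \<Longrightarrow> 0 \<le> r \<Longrightarrow> mean_le M (\<lambda>\<omega>. r * f \<omega>) (r * c)"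
  by (auto simp: mean_le_def mult_left_mono)

lemma mean_le_sum:
  "(\<And>i. i \<in> I \<Longrightarrow> mean_le M (f i) (c i)) \<Longrightarrow> mean_le M (\<lambda>\<omega>. \<Sum>i\<in>I. f i \<omega>) (\<Sum>i\<in>I. c i)"
  by (auto simp: mean_le_def intro!: sum_mono)

lemma (in prob_space) mean_le_const: "mean_le M (\<lambda>_. c) c"
  by (simp add: mean_le_def prob_space)

text \<open>
  Second moments thus have the same bound as fourth moments, provided that it is at least \<open>1\<close>.
\<close>
lemma square_le_fourth: "(u::real)\<^sup>2 \<le> (1 + u ^ 4) / 2"
proof -
  have "0 \<le> (u\<^sup>2 - 1)\<^sup>2"
    by simp
  then show ?thesis
    by (simp add: power2_eq_square power4_eq_xxxx algebra_simps)
qed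

lemma (in prob_space) mean_le_square_of_fourth:
  assumes "mean_le M (\<lambda>\<omega>. norm (f \<omega>) ^ 4) c" and [measurable]: "f \<in> borel_measurable M" and "c \<ge> 1"
  shows "mean_le M (\<lambda>\<omega>. (norm (f \<omega>))\<^sup>2) c"
proof (rule mean_le_mono)
  show "mean_le M (\<lambda>\<omega>. (1/2) * (1 + norm (f \<omega>) ^ 4)) ((1/2) * (1 + c))"
    by (intro mean_le_cmult mean_le_add mean_le_const assms) simp
qed (use assms(3) square_le_fourth in \<open>auto simp: mult.commute\<close>)

text \<open>
  Unlike \<open>indep_var\<close>, this does not force the two values to have the same type; the past of a process
  will be paired with a single innovation.
\<close>
definition indep_pair ::
  "'w measure \<Rightarrow> 's measure \<Rightarrow> ('w \<Rightarrow> 's) \<Rightarrow> 't measure \<Rightarrow> ('w \<Rightarrow> 't) \<Rightarrow> bool" where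
  "indep_pair M S X T Y \<longleftrightarrow> X \<in> M \<rightarrow>\<^sub>M S \<and> Y \<in> M \<rightarrow>\<^sub>M T \<and>
     (\<forall>A\<in>sets S. \<forall>B\<in>sets T. emeasure M (X -` A \<inter> Y -` B \<inter> space M)
        = emeasure M (X -` A \<inter> space M) * emeasure M (Y -` B \<inter> space M))"

lemma indep_pair_compose:
  assumes ind: "indep_pair M S X T Y"
    and f: "f \<in> S \<rightarrow>\<^sub>M S'" and g: "g \<in> T \<rightarrow>\<^sub>M T'"
  shows "indep_pair M S' (\<lambda>\<omega>. f (X \<omega>)) T' (\<lambda>\<omega>. g (Y \<omega>))"
proof -
  have X: "X \<in> M \<rightarrow>\<^sub>M S" and Y: "Y \<in> M \<rightarrow>\<^sub>M T"
    using ind by (auto simp: indep_pair_def)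
  have eq: "(\<lambda>\<omega>. f (X \<omega>)) -` A \<inter> space M = X -` (f -` A \<inter> space S) \<inter> space M"
    "(\<lambda>\<omega>. g (Y \<omega>)) -` B \<inter> space M = Y -` (g -` B \<inter> space T) \<inter> space M"
    "(\<lambda>\<omega>. f (X \<omega>)) -` A \<inter> (\<lambda>\<omega>. g (Y \<omega>)) -` B \<inter> space M
      = X -` (f -` A \<inter> space S) \<inter> Y -` (g -` B \<inter> space T) \<inter> space M" for A B
    using measurable_space[OF X] measurable_space[OF Y] by auto
  show ?thesis
    using ind measurable_compose[OF X f] measurable_compose[OF Y g]
      measurable_sets[OF f] measurable_sets[OF g]
    unfolding indep_pair_def eq by blast
qed

lemma (in prob_space) indep_pair_distr:
  assumes ind: "indep_pair M S X T Y"
  shows "distr M S X \<Otimes>\<^sub>M distr M T Y = distr M (S \<Otimes>\<^sub>M T) (\<lambda>\<omega>. (X \<omega>, Y \<omega>))"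
proof -
  have X [measurable]: "X \<in> M \<rightarrow>\<^sub>M S" and Y [measurable]: "Y \<in> M \<rightarrow>\<^sub>M T"
    using ind by (auto simp: indep_pair_def)
  interpret DX: prob_space "distr M S X"
    by (rule prob_space_distr) fact
  interpret DY: prob_space "distr M T Y"
    by (rule prob_space_distr) fact
  show ?thesis
  proof (rule pair_measure_eqI)
    show "sigma_finite_measure (distr M S X)" "sigma_finite_measure (distr M T Y)"
      by unfold_locales
    fix A B assume "A \<in> sets (distr M S X)" "B \<in> sets (distr M T Y)"
    then have AB: "A \<in> sets S" "B \<in> sets T"
      by auto
    have "(\<lambda>\<omega>. (X \<omega>, Y \<omega>)) -` (A \<times> B) \<inter> space M = X -` A \<inter> Y -` B \<inter> space M"
      by auto
    then show "emeasure (distr M S X) A * emeasure (distr M T Y) B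
        = emeasure (distr M (S \<Otimes>\<^sub>M T) (\<lambda>\<omega>. (X \<omega>, Y \<omega>))) (A \<times> B)"
      using ind AB by (simp add: emeasure_distr indep_pair_def)
  qed simp
qed

lemma (in prob_space) indep_pair_imp_indep_var:
  fixes X Y :: "'a \<Rightarrow> 's"
  assumes "indep_pair M S X T Y"
  shows "indep_var S X T Y"
  using indep_pair_distr[OF assms] assms by (simp add: indep_var_distribution_eq indep_pair_def)

lemma (in prob_space) mean_le_indep_mult:
  assumes ind: "indep_pair M S X T Y"
    and f: "f \<in> borel_measurable S" and g: "g \<in> borel_measurable T"
    and "mean_le M (\<lambda>\<omega>. f (X \<omega>)) c" "mean_le M (\<lambda>\<omega>. g (Y \<omega>)) d"
    and "\<And>x. 0 \<le> f x" "\<And>y. 0 \<le> g y"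
  shows "mean_le M (\<lambda>\<omega>. f (X \<omega>) * g (Y \<omega>)) (c * d)"
proof -
  have ind': "indep_var borel (\<lambda>\<omega>. f (X \<omega>)) borel (\<lambda>\<omega>. g (Y \<omega>))"
    by (rule indep_pair_imp_indep_var[OF indep_pair_compose[OF ind f g]])
  have int: "integrable M (\<lambda>\<omega>. f (X \<omega>))" "integrable M (\<lambda>\<omega>. g (Y \<omega>))"
    using assms by (auto simp: mean_le_def)
  have "(\<integral>\<omega>. f (X \<omega>) * g (Y \<omega>) \<partial>M) = (\<integral>\<omega>. f (X \<omega>) \<partial>M) * (\<integral>\<omega>. g (Y \<omega>) \<partial>M)"
    by (rule indep_var_lebesgue_integral[OF ind' int])
  also have "\<dots> \<le> c * d"
    using assms(4-7) by (intro mult_mono) (auto simp: mean_le_def intro: order_trans[rotated])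
  finally show ?thesis
    using indep_var_integrable[OF ind' int] by (simp add: mean_le_def)
qed

text \<open>
  Fubini's theorem: for a fixed first argument, the inner product with the second one integrates to zero.
\<close>
lemma (in prob_space) indep_mean_zero:
  fixes d :: "'s \<Rightarrow> 't \<Rightarrow> 'h::{real_inner, banach, second_countable_topology}"
    and S :: "'s measure" and T :: "'t measure"
  assumes ind: "indep_pair M S X T Y"
    and g [measurable]: "g \<in> borel_measurable S"
    and d [measurable]: "(\<lambda>(s, t). d s t) \<in> borel_measurable (S \<Otimes>\<^sub>M T)"
    and dint: "\<And>s. s \<in> space S \<Longrightarrow> integrable M (\<lambda>\<omega>. d s (Y \<omega>))"
    and d0: "\<And>s. s \<in> space S \<Longrightarrow> (\<integral>\<omega>. d s (Y \<omega>) \<partial>M) = 0"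
    and int: "integrable M (\<lambda>\<omega>. inner (g (X \<omega>)) (d (X \<omega>) (Y \<omega>)))"
  shows "(\<integral>\<omega>. inner (g (X \<omega>)) (d (X \<omega>) (Y \<omega>)) \<partial>M) = 0"
proof -
  have X [measurable]: "X \<in> M \<rightarrow>\<^sub>M S" and Y [measurable]: "Y \<in> M \<rightarrow>\<^sub>M T"
    using ind by (auto simp: indep_pair_def)
  interpret DX: prob_space "distr M S X"
    by (rule prob_space_distr) fact
  interpret DY: prob_space "distr M T Y"
    by (rule prob_space_distr) fact
  have eq: "distr M S X \<Otimes>\<^sub>M distr M T Y = distr M (S \<Otimes>\<^sub>M T) (\<lambda>\<omega>. (X \<omega>, Y \<omega>))"
    by (rule indep_pair_distr[OF ind])
  interpret pp: pair_prob_space "distr M S X" "distr M T Y" ..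
  let ?h = "\<lambda>p. inner (g (fst p)) (d (fst p) (snd p))"
  have dm [measurable]: "(\<lambda>p. d (fst p) (snd p)) \<in> borel_measurable (S \<Otimes>\<^sub>M T)"
    using d by (simp add: case_prod_beta)
  have h: "?h \<in> borel_measurable (S \<Otimes>\<^sub>M T)"
    by measurable
  have hint: "integrable (distr M S X \<Otimes>\<^sub>M distr M T Y) ?h"
    unfolding eq by (subst integrable_distr_eq) (use int h in auto)
  have "(\<integral>\<omega>. inner (g (X \<omega>)) (d (X \<omega>) (Y \<omega>)) \<partial>M) = (\<integral>p. ?h p \<partial>(distr M S X \<Otimes>\<^sub>M distr M T Y))"
    unfolding eq by (subst integral_distr) (use h in auto)
  also have "\<dots> = (\<integral>s. (\<integral>t. ?h (s, t) \<partial>distr M T Y) \<partial>distr M S X)"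
    by (rule pp.integral_fst'[OF hint, symmetric])
  also have "\<dots> = (\<integral>s. 0 \<partial>distr M S X)"
  proof (rule Bochner_Integration.integral_cong[OF refl])
    fix s assume "s \<in> space (distr M S X)"
    then have s: "s \<in> space S"
      by simp
    have ds [measurable]: "d s \<in> borel_measurable T"
      using measurable_compose[OF measurable_Pair1'[OF s] d] by simp
    have "integrable (distr M T Y) (d s)"
      by (subst integrable_distr_eq) (use dint[OF s] in auto)
    then have "(\<integral>t. ?h (s, t) \<partial>distr M T Y) = inner (g s) (\<integral>t. d s t \<partial>distr M T Y)"
      by (simp add: integral_inner_right)
    also have "(\<integral>t. d s t \<partial>distr M T Y) = 0"
      by (subst integral_distr) (use d0[OF s] in auto)
    finally show "(\<integral>t. ?h (s, t) \<partial>distr M T Y) = 0"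
      by simp
  qed
  finally show ?thesis
    by simp
qed

lemma integrable_inner_of_squares:
  fixes f g :: "'w \<Rightarrow> 'h::{real_inner, second_countable_topology}"
  assumes [measurable]: "f \<in> borel_measurable M" "g \<in> borel_measurable M"
    and "integrable M (\<lambda>\<omega>. (norm (f \<omega>))\<^sup>2)" "integrable M (\<lambda>\<omega>. (norm (g \<omega>))\<^sup>2)"
  shows "integrable M (\<lambda>\<omega>. inner (f \<omega>) (g \<omega>))"
proof (rule Bochner_Integration.integrable_bound)
  show "integrable M (\<lambda>\<omega>. (norm (f \<omega>))\<^sup>2 + (norm (g \<omega>))\<^sup>2)"
    using assms by simp
  have "\<bar>inner x y\<bar> \<le> (norm x)\<^sup>2 + (norm y)\<^sup>2" for x y :: 'h
  proof -
    have "0 \<le> (norm x - norm y)\<^sup>2"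
      by simp
    then have "2 * (norm x * norm y) \<le> (norm x)\<^sup>2 + (norm y)\<^sup>2"
      by (simp add: power2_diff)
    moreover have "0 \<le> norm x * norm y"
      by simp
    ultimately show ?thesis
      using Cauchy_Schwarz_ineq2[of x y] by linarith
  qed
  then show "AE \<omega> in M. norm (inner (f \<omega>) (g \<omega>)) \<le> norm ((norm (f \<omega>))\<^sup>2 + (norm (g \<omega>))\<^sup>2)"
    by (intro AE_I2) (simp add: abs_of_nonneg[OF add_nonneg_nonneg])
qed measurable

text \<open>Pythagoras in the space of square integrable random vectors.\<close>
lemma mean_le_orthogonal_sum:
  fixes D :: "nat \<Rightarrow> 'w \<Rightarrow> 'h::{real_inner, second_countable_topology}"
  assumes meas: "\<And>t. t < n \<Longrightarrow> D t \<in> borel_measurable M"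
    and sq: "\<And>t. t < n \<Longrightarrow> mean_le M (\<lambda>\<omega>. (norm (D t \<omega>))\<^sup>2) (c t)"
    and orth: "\<And>s t. s < t \<Longrightarrow> t < n \<Longrightarrow> (\<integral>\<omega>. inner (D s \<omega>) (D t \<omega>) \<partial>M) = 0"
  shows "mean_le M (\<lambda>\<omega>. (norm (\<Sum>t<n. D t \<omega>))\<^sup>2) (\<Sum>t<n. c t)"
  using assms
proof (induction n)
  case 0
  then show ?case
    by (simp add: mean_le_def)
next
  case (Suc n)
  note [measurable] = Suc.prems(1)
  have IH: "mean_le M (\<lambda>\<omega>. (norm (\<Sum>t<n. D t \<omega>))\<^sup>2) (\<Sum>t<n. c t)"
    using Suc.prems by (intro Suc.IH) auto
  have int: "integrable M (\<lambda>\<omega>. inner (D s \<omega>) (D n \<omega>))" if "s < n" for s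
    using that Suc.prems(2)[of s] Suc.prems(2)[of n]
    by (intro integrable_inner_of_squares) (auto simp: mean_le_def)
  have "mean_le M (\<lambda>\<omega>. 2 * (\<Sum>s<n. inner (D s \<omega>) (D n \<omega>))) 0"
    using int Suc.prems(3) unfolding mean_le_def
    by (auto simp: Bochner_Integration.integral_sum intro!: Bochner_Integration.integrable_sum)
  from mean_le_add[OF mean_le_add[OF IH this] Suc.prems(2)[of n]]
  have "mean_le M (\<lambda>\<omega>. (norm (\<Sum>t<n. D t \<omega>))\<^sup>2 + 2 * (\<Sum>s<n. inner (D s \<omega>) (D n \<omega>)) + (norm (D n \<omega>))\<^sup>2)
      (\<Sum>t<Suc n. c t)"
    by simp
  moreover have "(norm (\<Sum>t<Suc n. D t \<omega>))\<^sup>2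
      = (norm (\<Sum>t<n. D t \<omega>))\<^sup>2 + 2 * (\<Sum>s<n. inner (D s \<omega>) (D n \<omega>)) + (norm (D n \<omega>))\<^sup>2" for \<omega>
    unfolding power2_norm_eq_inner sum.lessThan_Suc
    by (simp add: inner_add_left inner_add_right inner_commute flip: inner_sum_left)
  ultimately show ?case
    by simp
qed

lemma measurable_norm_op:
  fixes A :: "'w \<Rightarrow> 'h::{real_inner, second_countable_topology} \<Rightarrow>\<^sub>L 'h"
  assumes [measurable]: "A \<in> M \<rightarrow>\<^sub>M op_algebra"
  shows "(\<lambda>\<omega>. norm (A \<omega>)) \<in> borel_measurable M"
proof -
  have "(\<lambda>\<omega>. (A \<omega>, 0 :: 'h \<Rightarrow>\<^sub>L 'h)) \<in> M \<rightarrow>\<^sub>M op_algebra \<Otimes>\<^sub>M op_algebra"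
    by measurable
  from measurable_compose[OF this measurable_norm_op_diff] show ?thesis
    by simp
qed

lemma measurable_sum_op:
  fixes A :: "'i \<Rightarrow> 'w \<Rightarrow> 'h::{real_inner, second_countable_topology} \<Rightarrow>\<^sub>L 'h"
  assumes "\<And>i. i \<in> I \<Longrightarrow> A i \<in> M \<rightarrow>\<^sub>M op_algebra"
  shows "(\<lambda>\<omega>. \<Sum>i\<in>I. A i \<omega>) \<in> M \<rightarrow>\<^sub>M op_algebra"
proof (rule measurable_op_algebraI)
  fix x
  have "(\<lambda>\<omega>. A i \<omega> x) \<in> borel_measurable M" if "i \<in> I" for i
    using measurable_compose[OF assms[OF that] measurable_op_apply] .
  then show "(\<lambda>\<omega>. (\<Sum>i\<in>I. A i \<omega>) x) \<in> borel_measurable M"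
    by (simp add: blinfun.sum_left)
qed

text \<open>
  Orthogonality is used through the Hilbert--Schmidt norm, which dominates the operator norm and is
  a sum of Hilbert space norms, one for each basis vector.
\<close>
lemma mean_le_orthogonal_operator_sum:
  fixes D :: "nat \<Rightarrow> 'w \<Rightarrow> 'h::{real_inner, second_countable_topology} \<Rightarrow>\<^sub>L 'h"
  assumes b: "basis_seq b"
    and meas: "\<And>t. t < n \<Longrightarrow> D t \<in> M \<rightarrow>\<^sub>M op_algebra"
    and sq: "\<And>t m. t < n \<Longrightarrow> mean_le M (\<lambda>\<omega>. \<Sum>i<m. (norm (D t \<omega> (b i)))\<^sup>2) (c t)"
    and orth: "\<And>s t i. s < t \<Longrightarrow> t < n \<Longrightarrow> (\<integral>\<omega>. inner (D s \<omega> (b i)) (D t \<omega> (b i)) \<partial>M) = 0"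
  shows "mean_le M (\<lambda>\<omega>. (norm (\<Sum>t<n. D t \<omega>))\<^sup>2) (\<Sum>t<n. c t)"
proof -
  define A where "A = (\<lambda>\<omega>. \<Sum>t<n. D t \<omega>)"
  have Am: "A \<in> M \<rightarrow>\<^sub>M op_algebra"
    unfolding A_def by (rule measurable_sum_op) (use meas in auto)
  have Db [measurable]: "(\<lambda>\<omega>. D t \<omega> x) \<in> borel_measurable M" if "t < n" for t x
    using measurable_compose[OF meas[OF that] measurable_op_apply] .
  have Ab [measurable]: "(\<lambda>\<omega>. A \<omega> x) \<in> borel_measurable M" for x
    using measurable_compose[OF Am measurable_op_apply] .
  have one: "mean_le M (\<lambda>\<omega>. (norm (D t \<omega> (b i)))\<^sup>2) (\<integral>\<omega>. (norm (D t \<omega> (b i)))\<^sup>2 \<partial>M)" if "t < n" for t i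
  proof -
    have "integrable M (\<lambda>\<omega>. \<Sum>j<Suc i. (norm (D t \<omega> (b j)))\<^sup>2)"
      by (rule mean_leD(1)[OF sq[OF that]])
    then have "integrable M (\<lambda>\<omega>. (norm (D t \<omega> (b i)))\<^sup>2)"
      by (rule Bochner_Integration.integrable_bound)
         (use that in \<open>auto intro!: AE_I2 order_trans[OF _ abs_ge_self] simp: sum_nonneg\<close>)
    then show ?thesis
      by (simp add: mean_le_def)
  qed
  have part: "mean_le M (\<lambda>\<omega>. \<Sum>i<m. (norm (A \<omega> (b i)))\<^sup>2) (\<Sum>t<n. c t)" for m
  proof (rule mean_le_weaken)
    show "mean_le M (\<lambda>\<omega>. \<Sum>i<m. (norm (A \<omega> (b i)))\<^sup>2)
        (\<Sum>i<m. \<Sum>t<n. \<integral>\<omega>. (norm (D t \<omega> (b i)))\<^sup>2 \<partial>M)"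
      unfolding A_def blinfun.sum_left
      by (intro mean_le_sum mean_le_orthogonal_sum one orth Db)
    have "(\<Sum>i<m. \<Sum>t<n. \<integral>\<omega>. (norm (D t \<omega> (b i)))\<^sup>2 \<partial>M)
        = (\<Sum>t<n. \<integral>\<omega>. (\<Sum>i<m. (norm (D t \<omega> (b i)))\<^sup>2) \<partial>M)"
      using mean_leD(1)[OF one] by (subst sum.swap) simp
    also have "\<dots> \<le> (\<Sum>t<n. c t)"
      using sq by (intro sum_mono) (auto simp: mean_le_def)
    finally show "(\<Sum>i<m. \<Sum>t<n. \<integral>\<omega>. (norm (D t \<omega> (b i)))\<^sup>2 \<partial>M) \<le> (\<Sum>t<n. c t)" .
  qed
  have c0: "0 \<le> (\<Sum>t<n. c t)"
    by (rule mean_le_nonneg[OF part[of 0]]) simp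
  define f where "f m \<omega> = ennreal (\<Sum>i<m. (norm (A \<omega> (b i)))\<^sup>2)" for m :: nat and \<omega>
  have pw: "ennreal ((norm (A \<omega>))\<^sup>2) \<le> (SUP m. f m \<omega>)" for \<omega>
  proof (cases "(SUP m. f m \<omega>) = top")
    case True
    then show ?thesis
      by (simp only: top_greatest)
  next
    case False
    then obtain C where C: "(SUP m. f m \<omega>) = ennreal C" "0 \<le> C"
      by (metis ennreal_cases)
    have "f m \<omega> \<le> ennreal C" for m
      using SUP_upper[of m UNIV "\<lambda>m. f m \<omega>"] C by simp
    then have "(norm (A \<omega>))\<^sup>2 \<le> C"
      using C(2) by (intro operator_norm_le_hs[OF b]) (simp add: f_def)
    then show ?thesis
      unfolding C(1) by (rule ennreal_leI)
  qed
  have "(\<integral>\<^sup>+\<omega>. ennreal ((norm (A \<omega>))\<^sup>2) \<partial>M) \<le> (\<integral>\<^sup>+\<omega>. (SUP m. f m \<omega>) \<partial>M)"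
    by (intro nn_integral_mono pw)
  also have "\<dots> = (SUP m. \<integral>\<^sup>+\<omega>. f m \<omega> \<partial>M)"
  proof (rule nn_integral_monotone_convergence_SUP)
    show "incseq f"
      unfolding f_def by (intro incseq_SucI le_funI ennreal_leI) simp
  qed (simp add: f_def)
  also have "\<dots> \<le> ennreal (\<Sum>t<n. c t)"
  proof (rule SUP_least)
    fix m
    have "(\<integral>\<^sup>+\<omega>. f m \<omega> \<partial>M) = ennreal (\<integral>\<omega>. (\<Sum>i<m. (norm (A \<omega> (b i)))\<^sup>2) \<partial>M)"
      unfolding f_def using mean_leD(1)[OF part[of m]] by (intro nn_integral_eq_integral) (auto simp: sum_nonneg)
    also have "\<dots> \<le> ennreal (\<Sum>t<n. c t)"
      using mean_leD(2)[OF part[of m]] by (rule ennreal_leI)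
    finally show "(\<integral>\<^sup>+\<omega>. f m \<omega> \<partial>M) \<le> ennreal (\<Sum>t<n. c t)" .
  qed
  finally have le: "(\<integral>\<^sup>+\<omega>. ennreal ((norm (A \<omega>))\<^sup>2) \<partial>M) \<le> ennreal (\<Sum>t<n. c t)" .
  note [measurable] = measurable_norm_op[OF Am]
  have int: "integrable M (\<lambda>\<omega>. (norm (A \<omega>))\<^sup>2)"
    by (rule integrableI_nonneg) (use le in \<open>auto intro: le_less_trans\<close>)
  have "ennreal (\<integral>\<omega>. (norm (A \<omega>))\<^sup>2 \<partial>M) \<le> ennreal (\<Sum>t<n. c t)"
    using le by (subst (asm) nn_integral_eq_integral[OF int]) auto
  then show ?thesis
    using int c0 by (simp add: mean_le_def A_def)
qed


section \<open>Independent noise and the past\<close>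

locale noise = prob_space Q for Q :: "'w measure" +
  fixes V :: "nat \<Rightarrow> 'w \<Rightarrow> 's::topological_space" and n :: nat
  assumes indep: "indep_vars (\<lambda>_. borel) V {..n}"
begin

text \<open>
  The \<open>\<sigma>\<close>-algebra generated by the noise up to time \<open>t\<close>.
\<close>
definition past :: "nat \<Rightarrow> 'w measure" where
  "past t = vimage_algebra (space Q) (\<lambda>\<omega>. restrict (\<lambda>i. V i \<omega>) {..t}) (PiM {..t} (\<lambda>_. borel))"

lemma V_measurable: "i \<le> n \<Longrightarrow> V i \<in> borel_measurable Q"
  using indep by (auto simp: indep_vars_def)

lemma space_past [simp]: "space (past t) = space Q"
  by (simp add: past_def)

lemma measurable_past_V:
  assumes "i \<le> t"
  shows "V i \<in> borel_measurable (past t)"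
proof -
  have "(\<lambda>\<omega>. restrict (\<lambda>i. V i \<omega>) {..t}) \<in> past t \<rightarrow>\<^sub>M PiM {..t} (\<lambda>_. borel)"
    unfolding past_def by (rule measurable_vimage_algebra1) (auto simp: space_PiM)
  from measurable_compose[OF this measurable_component_singleton[of i "{..t}"]] assms
  show ?thesis
    by (simp add: restrict_def)
qed

lemma measurable_past_mono:
  assumes f: "f \<in> past s \<rightarrow>\<^sub>M N" and st: "s \<le> t"
  shows "f \<in> past t \<rightarrow>\<^sub>M N"
proof -
  have "(\<lambda>\<omega>. \<omega>) \<in> past t \<rightarrow>\<^sub>M past s"
    unfolding past_def[of s]
    by (rule measurable_vimage_algebra2) (use st in \<open>auto intro!: measurable_restrict measurable_past_V\<close>)
  from measurable_compose[OF this f] show ?thesis .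
qed

lemma measurable_past:
  assumes f: "f \<in> past t \<rightarrow>\<^sub>M N" and t: "t \<le> n"
  shows "f \<in> Q \<rightarrow>\<^sub>M N"
proof -
  have "(\<lambda>\<omega>. \<omega>) \<in> Q \<rightarrow>\<^sub>M past t"
    unfolding past_def
    by (rule measurable_vimage_algebra2) (use t in \<open>auto intro!: measurable_restrict V_measurable\<close>)
  from measurable_compose[OF this f] show ?thesis .
qed

lemma indep_past:
  assumes f: "f \<in> past t \<rightarrow>\<^sub>M N" and t: "t < n"
  shows "indep_pair Q N f borel (V (Suc t))"
proof -
  define R where "R = (\<lambda>\<omega>. restrict (\<lambda>i. V i \<omega>) {..t})"
  define R' where "R' = (\<lambda>\<omega>. restrict (\<lambda>i. V i \<omega>) {Suc t})"
  have RR: "indep_var (PiM {..t} (\<lambda>_. borel)) R (PiM {Suc t} (\<lambda>_. borel)) R'"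
    unfolding R_def R'_def by (rule indep_var_restrict[OF indep]) (use t in auto)
  have "emeasure Q (f -` A \<inter> V (Suc t) -` B \<inter> space Q)
      = emeasure Q (f -` A \<inter> space Q) * emeasure Q (V (Suc t) -` B \<inter> space Q)"
    if A: "A \<in> sets N" and B: "B \<in> sets borel" for A B
  proof -
    have "f -` A \<inter> space Q \<in> sets (past t)"
      using measurable_sets[OF f A] by simp
    moreover have "R \<in> space Q \<rightarrow> space (PiM {..t} (\<lambda>_. borel))"
      by (auto simp: R_def space_PiM)
    ultimately obtain A' where A': "A' \<in> sets (PiM {..t} (\<lambda>_. borel))" "f -` A \<inter> space Q = R -` A' \<inter> space Q"
      unfolding past_def R_def[symmetric] by (auto simp: sets_vimage_algebra2)
    define B' where "B' = (\<lambda>g. g (Suc t)) -` B \<inter> space (PiM {Suc t} (\<lambda>_. borel :: 's measure))"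
    have B': "B' \<in> sets (PiM {Suc t} (\<lambda>_. borel))"
      unfolding B'_def using measurable_component_singleton[of "Suc t" "{Suc t}" "\<lambda>_. borel :: 's measure"] B
      by (intro measurable_sets) auto
    have VB: "V (Suc t) -` B \<inter> space Q = R' -` B' \<inter> space Q"
      by (auto simp: B'_def R'_def space_PiM)
    have "f -` A \<inter> V (Suc t) -` B \<inter> space Q = (f -` A \<inter> space Q) \<inter> (V (Suc t) -` B \<inter> space Q)"
      by blast
    also have "\<dots> = (\<lambda>\<omega>. (R \<omega>, R' \<omega>)) -` (A' \<times> B') \<inter> space Q"
      unfolding A'(2) VB by blast
    finally have "f -` A \<inter> V (Suc t) -` B \<inter> space Q = (\<lambda>\<omega>. (R \<omega>, R' \<omega>)) -` (A' \<times> B') \<inter> space Q" .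
    moreover have "emeasure Q ((\<lambda>\<omega>. (R \<omega>, R' \<omega>)) -` (A' \<times> B') \<inter> space Q)
        = emeasure Q (R -` A' \<inter> space Q) * emeasure Q (R' -` B' \<inter> space Q)"
      using indep_varD[OF RR A'(1) B'] by (simp add: emeasure_eq_measure ennreal_mult')
    ultimately show ?thesis
      using A'(2) VB by simp
  qed
  then show ?thesis
    using measurable_past[OF f] V_measurable t by (simp add: indep_pair_def)
qed

end


section \<open>Coupling two autoregressions\<close>

text \<open>
  The number \<open>\<rho> * u + v\<close> is the convex combination of \<open>u\<close> and \<open>v / (1 - \<rho>)\<close> with weights \<open>\<rho>\<close> and \<open>1 - \<rho>\<close>. The
  point is the coefficient \<open>\<rho>\<close> of the power of \<open>u\<close>: contractive recursions for norms turn into contractive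
  recursions for moments, without independence.
\<close>
lemma convex_power_mean:
  fixes u v \<rho> :: real
  assumes "0 \<le> \<rho>" "\<rho> < 1"
  shows "(\<rho> * u + v)\<^sup>2 \<le> \<rho> * u\<^sup>2 + v\<^sup>2 / (1 - \<rho>)"
    and "(\<rho> * u + v) ^ 4 \<le> \<rho> * u ^ 4 + v ^ 4 / (1 - \<rho>) ^ 3"
proof -
  have *: "(\<rho> * u + v) ^ m \<le> \<rho> * u ^ m + (1 - \<rho>) * (v / (1 - \<rho>)) ^ m" if "even m" for m
  proof -
    have "convex_on UNIV (\<lambda>x::real. x ^ m)"
      using that by (rule convex_power_even)
    from convex_onD[OF this, of "1 - \<rho>" u "v / (1 - \<rho>)"] assms show ?thesis
      by simp
  qed
  show "(\<rho> * u + v)\<^sup>2 \<le> \<rho> * u\<^sup>2 + v\<^sup>2 / (1 - \<rho>)"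
    using *[of 2] assms by (simp add: power_divide power2_eq_square)
  have "(1 - \<rho>) * (v / (1 - \<rho>)) ^ 4 = v ^ 4 / (1 - \<rho>) ^ 3"
    using assms by (simp add: power_divide power4_eq_xxxx power3_eq_cube)
  then show "(\<rho> * u + v) ^ 4 \<le> \<rho> * u ^ 4 + v ^ 4 / (1 - \<rho>) ^ 3"
    using *[of 4] by simp
qed

lemma measurable_blinfun_apply:
  fixes P :: "'h::real_normed_vector \<Rightarrow>\<^sub>L 'h"
  assumes "f \<in> borel_measurable M"
  shows "(\<lambda>\<omega>. P (f \<omega>)) \<in> borel_measurable M"
  using assms by (rule borel_measurable_continuous_on[rotated]) (intro continuous_intros)

lemma measurable_boot_path:
  fixes P :: "'h::{real_inner, second_countable_topology} \<Rightarrow>\<^sub>L 'h"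
  assumes "Z \<in> borel_measurable M" "\<And>i. 1 \<le> i \<Longrightarrow> i \<le> t \<Longrightarrow> e i \<in> borel_measurable M"
  shows "(\<lambda>\<omega>. boot_path P (Z \<omega>) (\<lambda>i. e i \<omega>) t) \<in> borel_measurable M"
  using assms(2)
  by (induction t) (auto intro!: borel_measurable_add measurable_blinfun_apply assms(1))

lemma boot_path_cong:
  "(\<And>i. 1 \<le> i \<Longrightarrow> i \<le> t \<Longrightarrow> e i = e' i) \<Longrightarrow> boot_path P z e t = boot_path P z e' t"
  by (induction t) auto

lemma (in prob_space) boot_path_fourth_moment:
  fixes P :: "'h::{real_inner, second_countable_topology} \<Rightarrow>\<^sub>L 'h"
  assumes \<rho>: "0 \<le> \<rho>" "\<rho> < 1" "norm P \<le> \<rho>"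
    and Z: "Z \<in> borel_measurable M" "mean_le M (\<lambda>\<omega>. norm (Z \<omega>) ^ 4) (c / (1 - \<rho>) ^ 4)"
    and e: "\<And>i. 1 \<le> i \<Longrightarrow> i \<le> t \<Longrightarrow> e i \<in> borel_measurable M"
      "\<And>i. 1 \<le> i \<Longrightarrow> i \<le> t \<Longrightarrow> mean_le M (\<lambda>\<omega>. norm (e i \<omega>) ^ 4) c"
  shows "mean_le M (\<lambda>\<omega>. norm (boot_path P (Z \<omega>) (\<lambda>i. e i \<omega>) t) ^ 4) (c / (1 - \<rho>) ^ 4)"
  using e
proof (induction t)
  case 0
  then show ?case
    using Z(2) by simp
next
  case (Suc t)
  define x where "x \<omega> = boot_path P (Z \<omega>) (\<lambda>i. e i \<omega>) t" for \<omega>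
  have IH: "mean_le M (\<lambda>\<omega>. norm (x \<omega>) ^ 4) (c / (1 - \<rho>) ^ 4)"
    unfolding x_def using Suc.prems by (intro Suc.IH) auto
  have "mean_le M (\<lambda>\<omega>. norm (e (Suc t) \<omega>) ^ 4) c"
    by (intro Suc.prems) auto
  then have bound: "mean_le M (\<lambda>\<omega>. \<rho> * norm (x \<omega>) ^ 4 + 1 / (1 - \<rho>) ^ 3 * norm (e (Suc t) \<omega>) ^ 4)
      (\<rho> * (c / (1 - \<rho>) ^ 4) + 1 / (1 - \<rho>) ^ 3 * c)"
    using \<rho> IH by (intro mean_le_add mean_le_cmult) auto
  have eq: "\<rho> * (c / (1 - \<rho>) ^ 4) + 1 / (1 - \<rho>) ^ 3 * c = c / (1 - \<rho>) ^ 4"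
  proof -
    have "1 / (1 - \<rho>) ^ 3 * c = (1 - \<rho>) * (c / (1 - \<rho>) ^ 4)"
      using \<rho> by (simp add: power3_eq_cube power4_eq_xxxx)
    then show ?thesis
      by (metis add.commute diff_add_cancel distrib_right mult_1)
  qed
  have le: "norm (boot_path P (Z \<omega>) (\<lambda>i. e i \<omega>) (Suc t)) ^ 4
      \<le> \<rho> * norm (x \<omega>) ^ 4 + 1 / (1 - \<rho>) ^ 3 * norm (e (Suc t) \<omega>) ^ 4" for \<omega>
  proof -
    have "norm (boot_path P (Z \<omega>) (\<lambda>i. e i \<omega>) (Suc t)) \<le> norm (P (x \<omega>)) + norm (e (Suc t) \<omega>)"
      by (simp add: x_def norm_triangle_ineq)
    also have "\<dots> \<le> \<rho> * norm (x \<omega>) + norm (e (Suc t) \<omega>)"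
      by (intro add_right_mono order_trans[OF norm_blinfun] mult_right_mono \<rho>) auto
    finally have "norm (boot_path P (Z \<omega>) (\<lambda>i. e i \<omega>) (Suc t)) ^ 4
        \<le> (\<rho> * norm (x \<omega>) + norm (e (Suc t) \<omega>)) ^ 4"
      by (intro power_mono) auto
    also have "\<dots> \<le> \<rho> * norm (x \<omega>) ^ 4 + norm (e (Suc t) \<omega>) ^ 4 / (1 - \<rho>) ^ 3"
      by (rule convex_power_mean[OF \<rho>(1,2)])
    finally show ?thesis
      by simp
  qed
  have meas: "(\<lambda>\<omega>. boot_path P (Z \<omega>) (\<lambda>i. e i \<omega>) (Suc t)) \<in> borel_measurable M"
    using Suc.prems by (intro measurable_boot_path Z) auto
  show ?case
  proof (rule mean_le_mono[OF bound])
    show "(\<lambda>\<omega>. norm (boot_path P (Z \<omega>) (\<lambda>i. e i \<omega>) (Suc t)) ^ 4) \<in> borel_measurable M"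
      using meas by measurable
  qed (use le eq in \<open>auto simp del: boot_path.simps\<close>)
qed

lemma sum_norm_sq_add:
  fixes f g :: "nat \<Rightarrow> 'h::real_inner"
  shows "(\<Sum>i<m. (norm (f i + g i))\<^sup>2) \<le> 2 * (\<Sum>i<m. (norm (f i))\<^sup>2) + 2 * (\<Sum>i<m. (norm (g i))\<^sup>2)"
proof -
  have "(norm (x + y))\<^sup>2 \<le> 2 * (norm x)\<^sup>2 + 2 * (norm y)\<^sup>2" for x y :: 'h
  proof -
    have "(norm (x + y))\<^sup>2 + (norm (x - y))\<^sup>2 = 2 * (norm x)\<^sup>2 + 2 * (norm y)\<^sup>2"
      unfolding power2_norm_eq_inner
      by (simp add: inner_add_left inner_add_right inner_diff_left inner_diff_right inner_commute)
    then show ?thesis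
      using zero_le_power2[of "norm (x - y)"] by linarith
  qed
  then show ?thesis
    unfolding sum_distrib_left sum.distrib[symmetric] by (rule sum_mono)
qed

lemma norm_sq_add_le: "(norm (x + y))\<^sup>2 \<le> 2 * (norm x)\<^sup>2 + 2 * (norm (y :: 'h::real_inner))\<^sup>2"
  using sum_norm_sq_add[of "\<lambda>_. x" "\<lambda>_. y" 1] by simp

lemma hs_tensor_le:
  assumes b: "basis_seq b"
  shows "(\<Sum>i<m. (norm ((z \<otimes>\<^sub>H w) (b i)))\<^sup>2) \<le> (norm z)\<^sup>2 * (norm w)\<^sup>2"
proof -
  have "(\<Sum>i<m. (norm ((z \<otimes>\<^sub>H w) (b i)))\<^sup>2) = (\<Sum>i<m. (inner (b i) z)\<^sup>2) * (norm w)\<^sup>2"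
    by (simp add: tensor.rep_eq power_mult_distrib sum_distrib_right inner_commute)
  also have "\<dots> \<le> (norm z)\<^sup>2 * (norm w)\<^sup>2"
    by (intro mult_right_mono basis_seq_bessel b) auto
  finally show ?thesis .
qed

text \<open>
  The Hilbert--Schmidt norm of a tensor is the product of the norms; the difference is
  \<open>(z - z') \<otimes>\<^sub>H w + z' \<otimes>\<^sub>H (w - w')\<close>.
\<close>
lemma hs_tensor_diff_le:
  assumes b: "basis_seq b"
  shows "(\<Sum>i<m. (norm ((z \<otimes>\<^sub>H w - z' \<otimes>\<^sub>H w') (b i)))\<^sup>2)
    \<le> 2 * ((norm (z - z'))\<^sup>2 * (norm w)\<^sup>2) + 2 * ((norm z')\<^sup>2 * (norm (w - w'))\<^sup>2)"
proof -
  have "z \<otimes>\<^sub>H w - z' \<otimes>\<^sub>H w' = (z - z') \<otimes>\<^sub>H w + z' \<otimes>\<^sub>H (w - w')"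
    by (simp add: tensor_diff_left tensor_diff_right)
  then have "(\<Sum>i<m. (norm ((z \<otimes>\<^sub>H w - z' \<otimes>\<^sub>H w') (b i)))\<^sup>2)
      \<le> 2 * (\<Sum>i<m. (norm (((z - z') \<otimes>\<^sub>H w) (b i)))\<^sup>2) + 2 * (\<Sum>i<m. (norm ((z' \<otimes>\<^sub>H (w - w')) (b i)))\<^sup>2)"
    by (simp add: blinfun.add_left sum_norm_sq_add)
  also have "\<dots> \<le> 2 * ((norm (z - z'))\<^sup>2 * (norm w)\<^sup>2) + 2 * ((norm z')\<^sup>2 * (norm (w - w'))\<^sup>2)"
    by (intro add_mono mult_left_mono hs_tensor_le b) auto
  finally show ?thesis .
qed

text \<open>The mirror image with the tensor factors exchanged, and the same bound.\<close>
lemma hs_tensor_diff_le':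
  assumes b: "basis_seq b"
  shows "(\<Sum>i<m. (norm ((w \<otimes>\<^sub>H z - w' \<otimes>\<^sub>H z') (b i)))\<^sup>2)
    \<le> 2 * ((norm (z - z'))\<^sup>2 * (norm w)\<^sup>2) + 2 * ((norm z')\<^sup>2 * (norm (w - w'))\<^sup>2)"
proof -
  have "w \<otimes>\<^sub>H z - w' \<otimes>\<^sub>H z' = w \<otimes>\<^sub>H (z - z') + (w - w') \<otimes>\<^sub>H z'"
    by (simp add: tensor_diff_left tensor_diff_right)
  then have "(\<Sum>i<m. (norm ((w \<otimes>\<^sub>H z - w' \<otimes>\<^sub>H z') (b i)))\<^sup>2)
      \<le> 2 * (\<Sum>i<m. (norm ((w \<otimes>\<^sub>H (z - z')) (b i)))\<^sup>2) + 2 * (\<Sum>i<m. (norm (((w - w') \<otimes>\<^sub>H z') (b i)))\<^sup>2)"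
    by (simp add: blinfun.add_left sum_norm_sq_add)
  also have "\<dots> \<le> 2 * ((norm w)\<^sup>2 * (norm (z - z'))\<^sup>2) + 2 * ((norm (w - w'))\<^sup>2 * (norm z')\<^sup>2)"
    by (intro add_mono mult_left_mono hs_tensor_le b) auto
  finally show ?thesis
    by (simp add: mult.commute)
qed

lemma (in prob_space) mean_le_centred_square:
  fixes Z :: "'a \<Rightarrow> 'h::{real_inner, banach, second_countable_topology}"
  assumes "integrable M Z" "integrable M (\<lambda>\<omega>. (norm (Z \<omega>))\<^sup>2)" "(\<integral>\<omega>. Z \<omega> \<partial>M) = z"
  shows "mean_le M (\<lambda>\<omega>. (norm (Z \<omega> - z))\<^sup>2) (\<integral>\<omega>. (norm (Z \<omega>))\<^sup>2 \<partial>M)"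
proof -
  have eq: "(norm (Z \<omega> - z))\<^sup>2 = (norm (Z \<omega>))\<^sup>2 - 2 * inner (Z \<omega>) z + (norm z)\<^sup>2" for \<omega>
    unfolding power2_norm_eq_inner by (simp add: inner_diff_left inner_diff_right inner_commute)
  have "(\<integral>\<omega>. inner (Z \<omega>) z \<partial>M) = (norm z)\<^sup>2"
    using assms by (simp add: integral_inner_left power2_norm_eq_inner)
  then show ?thesis
    unfolding eq mean_le_def using assms by (simp add: prob_space)
qed

text \<open>
  Two autoregressions with coupled innovations: \<open>V 0\<close> is the pair of initial values and \<open>V i\<close>, for
  \<open>i \<ge> 1\<close>, the pair of innovations at time \<open>i\<close>.  The numbers \<open>\<theta>\<close> and \<open>s\<close> measure how far the two
  recursions are apart, while \<open>K\<close> and \<open>K'\<close> bound fourth moments; only the initial value of the second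
  recursion may exceed \<open>K\<close>.
\<close>
locale coupled_autoregressions = noise Q V n
  for Q :: "'w measure" and V :: "nat \<Rightarrow> 'w \<Rightarrow> 'h::{real_inner, banach, second_countable_topology} \<times> 'h"
    and n :: nat +
  fixes P S P' S' :: "'h \<Rightarrow>\<^sub>L 'h" and b :: "nat \<Rightarrow> 'h" and \<rho> \<theta> s K K' :: real
  assumes basis: "basis_seq b"
    and \<rho>: "0 \<le> \<rho>" "\<rho> < 1" "norm P \<le> \<rho>" "norm P' \<le> \<rho>"
    and \<theta>: "norm (P - P') \<le> \<theta>"
    and K: "1 \<le> K" "K \<le> K'" and s: "0 < s" "s \<le> K"
    and init: "mean_le Q (\<lambda>\<omega>. norm (fst (V 0 \<omega>)) ^ 4) K" "mean_le Q (\<lambda>\<omega>. norm (snd (V 0 \<omega>)) ^ 4) K'"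
    and fourth: "\<And>i. 1 \<le> i \<Longrightarrow> i \<le> n \<Longrightarrow> mean_le Q (\<lambda>\<omega>. norm (fst (V i \<omega>)) ^ 4) K"
      "\<And>i. 1 \<le> i \<Longrightarrow> i \<le> n \<Longrightarrow> mean_le Q (\<lambda>\<omega>. norm (snd (V i \<omega>)) ^ 4) K"
    and close: "\<And>i. 1 \<le> i \<Longrightarrow> i \<le> n \<Longrightarrow> mean_le Q (\<lambda>\<omega>. norm (fst (V i \<omega>) - snd (V i \<omega>)) ^ 4) (s\<^sup>2)"
    and centred: "\<And>i. 1 \<le> i \<Longrightarrow> i \<le> n \<Longrightarrow> (\<integral>\<omega>. fst (V i \<omega>) \<partial>Q) = 0"
      "\<And>i. 1 \<le> i \<Longrightarrow> i \<le> n \<Longrightarrow> (\<integral>\<omega>. snd (V i \<omega>) \<partial>Q) = 0"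
    and cov: "\<And>i u. 1 \<le> i \<Longrightarrow> i \<le> n \<Longrightarrow> (\<integral>\<omega>. inner (fst (V i \<omega>)) u *\<^sub>R fst (V i \<omega>) \<partial>Q) = S u"
      "\<And>i u. 1 \<le> i \<Longrightarrow> i \<le> n \<Longrightarrow> (\<integral>\<omega>. inner (snd (V i \<omega>)) u *\<^sub>R snd (V i \<omega>) \<partial>Q) = S' u"
begin

definition x :: "nat \<Rightarrow> 'w \<Rightarrow> 'h" where
  "x t \<omega> = boot_path P (fst (V 0 \<omega>)) (\<lambda>i. fst (V i \<omega>)) t"

definition y :: "nat \<Rightarrow> 'w \<Rightarrow> 'h" where
  "y t \<omega> = boot_path P' (snd (V 0 \<omega>)) (\<lambda>i. snd (V i \<omega>)) t"

lemma x_Suc: "x (Suc t) \<omega> = P (x t \<omega>) + fst (V (Suc t) \<omega>)"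
  and y_Suc: "y (Suc t) \<omega> = P' (y t \<omega>) + snd (V (Suc t) \<omega>)"
  by (simp_all add: x_def y_def)

lemma measurable_fst_snd:
  assumes "f \<in> borel_measurable N"
  shows "(\<lambda>\<omega>. fst (f \<omega> :: 'h \<times> 'h)) \<in> borel_measurable N" "(\<lambda>\<omega>. snd (f \<omega>)) \<in> borel_measurable N"
  using borel_measurable_continuous_on[OF continuous_on_fst[OF continuous_on_id] assms]
    borel_measurable_continuous_on[OF continuous_on_snd[OF continuous_on_id] assms] by auto

lemma past_x: "x t \<in> borel_measurable (past t)"
  and past_y: "y t \<in> borel_measurable (past t)"
  unfolding x_def y_def by (intro measurable_boot_path measurable_fst_snd measurable_past_V; simp)+

lemma measurable_x: "t \<le> n \<Longrightarrow> x t \<in> borel_measurable Q"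
  and measurable_y: "t \<le> n \<Longrightarrow> y t \<in> borel_measurable Q"
  using measurable_past past_x past_y by blast+

lemma measurable_ab:
  assumes "i \<le> n"
  shows "(\<lambda>\<omega>. fst (V i \<omega>)) \<in> borel_measurable Q" "(\<lambda>\<omega>. snd (V i \<omega>)) \<in> borel_measurable Q"
  by (intro measurable_fst_snd V_measurable assms)+

text \<open>
  All constants are expressed through this sum of the geometric series with ratio \<open>\<rho>\<close>.
\<close>
definition r :: real where "r = 1 / (1 - \<rho>)"

lemma r1: "1 \<le> r" and r_inverse: "r * (1 - \<rho>) = 1"
  using \<rho> by (simp_all add: r_def)

definition Kx :: real where "Kx = K * r ^ 4"

lemma Kx: "K \<le> Kx" "1 \<le> Kx"
proof -
  have "1 \<le> r ^ 4"
    using r1 by simp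
  then have "K * 1 \<le> K * r ^ 4"
    using K by (intro mult_left_mono) auto
  then show "K \<le> Kx"
    by (simp add: Kx_def)
  with K show "1 \<le> Kx"
    by linarith
qed

lemma fourth_x:
  assumes "t \<le> n"
  shows "mean_le Q (\<lambda>\<omega>. norm (x t \<omega>) ^ 4) Kx"
proof -
  have "K / (1 - \<rho>) ^ 4 = Kx"
    by (simp add: Kx_def r_def power_divide)
  moreover have "mean_le Q (\<lambda>\<omega>. norm (x t \<omega>) ^ 4) (K / (1 - \<rho>) ^ 4)"
    unfolding x_def
    by (rule boot_path_fourth_moment[OF \<rho>(1,2,3)])
       (use assms init(1) fourth(1) Kx measurable_ab calculation in \<open>auto intro: mean_le_weaken\<close>)
  ultimately show ?thesis
    by simp
qed

lemma fourth_y: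
  assumes "t \<le> n"
  shows "mean_le Q (\<lambda>\<omega>. norm (y t \<omega>) ^ 4) (K' * r ^ 4)"
proof -
  have "K' * 1 \<le> K' * r ^ 4"
    using K r1 by (intro mult_left_mono) auto
  moreover have "K' / (1 - \<rho>) ^ 4 = K' * r ^ 4"
    by (simp add: r_def power_divide)
  moreover have "mean_le Q (\<lambda>\<omega>. norm (y t \<omega>) ^ 4) (K' / (1 - \<rho>) ^ 4)"
    unfolding y_def
    by (rule boot_path_fourth_moment[OF \<rho>(1,2,4)])
       (use assms init(2) K measurable_ab calculation in
          \<open>auto intro: mean_le_weaken[OF fourth(2) K(2)] mean_le_weaken[OF init(2)]\<close>)
  ultimately show ?thesis
    by simp
qed

lemma square_x: "t \<le> n \<Longrightarrow> mean_le Q (\<lambda>\<omega>. (norm (x t \<omega>))\<^sup>2) Kx"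
  by (intro mean_le_square_of_fourth fourth_x measurable_x Kx)

lemma square_a: "1 \<le> i \<Longrightarrow> i \<le> n \<Longrightarrow> mean_le Q (\<lambda>\<omega>. (norm (fst (V i \<omega>)))\<^sup>2) K"
  by (intro mean_le_square_of_fourth fourth measurable_ab K)

lemma square_b: "1 \<le> i \<Longrightarrow> i \<le> n \<Longrightarrow> mean_le Q (\<lambda>\<omega>. (norm (snd (V i \<omega>)))\<^sup>2) K"
  by (intro mean_le_square_of_fourth fourth measurable_ab K)

lemma square_diff_ab:
  assumes i: "1 \<le> i" "i \<le> n"
  shows "mean_le Q (\<lambda>\<omega>. (norm (fst (V i \<omega>) - snd (V i \<omega>)))\<^sup>2) (2 * s)"
proof (rule mean_le_mono)
  note [measurable] = measurable_ab[OF i(2)]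
  show "(\<lambda>\<omega>. (norm (fst (V i \<omega>) - snd (V i \<omega>)))\<^sup>2) \<in> borel_measurable Q"
    by measurable
  show "mean_le Q (\<lambda>\<omega>. (1 / s) * norm (fst (V i \<omega>) - snd (V i \<omega>)) ^ 4 + s) ((1 / s) * s\<^sup>2 + s)"
    using s by (intro mean_le_add mean_le_cmult close[OF i] mean_le_const) auto
  have "u\<^sup>2 \<le> (1 / s) * u ^ 4 + s" for u
  proof -
    have "0 \<le> (u\<^sup>2 - s)\<^sup>2"
      by simp
    then have "2 * s * u\<^sup>2 \<le> u ^ 4 + s\<^sup>2"
      by (simp add: power2_diff power_mult[symmetric] ac_simps)
    moreover have "0 \<le> s * u\<^sup>2"
      using s by simp
    ultimately have "s * u\<^sup>2 \<le> u ^ 4 + s\<^sup>2"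
      by linarith
    then show ?thesis
      using s by (simp add: field_simps power2_eq_square)
  qed
  then show "(norm (fst (V i \<omega>) - snd (V i \<omega>)))\<^sup>2
      \<le> (1 / s) * norm (fst (V i \<omega>) - snd (V i \<omega>)) ^ 4 + s" for \<omega> .
qed (use s in \<open>auto simp: power2_eq_square\<close>)

text \<open>
  The squared distance of the two recursions per time step, up to a constant: \<open>\<theta>\<^sup>2\<close> comes from the
  operators and \<open>s\<close> from the innovations.
\<close>
definition g :: real where "g = \<theta>\<^sup>2 + s"

lemma g0: "0 < g"
  using s by (simp add: g_def add_nonneg_pos)

text \<open>
  A bound for the mean squared distance of the two paths. The initial distance, which need not be
  small, is forgotten at a geometric rate, so summing over \<open>n\<close> time steps gives a bounded term and
  one that is proportional to \<open>n * g\<close>.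
\<close>
fun \<delta> :: "nat \<Rightarrow> real" where
  "\<delta> 0 = 4 * K'"
| "\<delta> (Suc t) = \<rho> * \<delta> t + 4 * r * Kx * g"

lemma \<delta>_nonneg: "0 \<le> \<delta> t"
  by (induction t) (use K \<rho> r1 Kx g0 in \<open>auto intro!: add_nonneg_nonneg mult_nonneg_nonneg\<close>)

lemma square_diff_xy:
  assumes "t \<le> n"
  shows "mean_le Q (\<lambda>\<omega>. (norm (x t \<omega> - y t \<omega>))\<^sup>2) (\<delta> t)"
  using assms
proof (induction t)
  case 0
  note [measurable] = measurable_ab[of 0, simplified]
  have "1 \<le> K'"
    using K by simp
  then have "mean_le Q (\<lambda>\<omega>. 2 * (norm (fst (V 0 \<omega>)))\<^sup>2 + 2 * (norm (snd (V 0 \<omega>)))\<^sup>2) (2 * K + 2 * K')"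
    using K by (intro mean_le_add mean_le_cmult mean_le_square_of_fourth init) auto
  then show ?case
    by (rule mean_le_mono)
       (use K in \<open>auto simp: x_def y_def intro!: order_trans[OF norm_sq_add_le[of _ "- _", simplified]]\<close>)
next
  case (Suc t)
  then have t: "t \<le> n" "Suc t \<le> n" "1 \<le> Suc t"
    by auto
  note [measurable] = measurable_ab[OF t(2)] measurable_x[OF t(1)] measurable_y[OF t(1)]
    measurable_x[OF t(2)] measurable_y[OF t(2)]
  let ?a = "\<lambda>\<omega>. fst (V (Suc t) \<omega>)" and ?b = "\<lambda>\<omega>. snd (V (Suc t) \<omega>)"
  have "mean_le Q (\<lambda>\<omega>. \<rho> * (norm (x t \<omega> - y t \<omega>))\<^sup>2
        + r * (2 * \<theta>\<^sup>2 * (norm (x t \<omega>))\<^sup>2 + 2 * (norm (?a \<omega> - ?b \<omega>))\<^sup>2))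
      (\<rho> * \<delta> t + r * (2 * \<theta>\<^sup>2 * Kx + 2 * (2 * s)))"
    using \<rho> r1 t
    by (intro mean_le_add mean_le_cmult Suc.IH square_x square_diff_ab) auto
  moreover have "(norm (x (Suc t) \<omega> - y (Suc t) \<omega>))\<^sup>2 \<le> \<rho> * (norm (x t \<omega> - y t \<omega>))\<^sup>2
        + r * (2 * \<theta>\<^sup>2 * (norm (x t \<omega>))\<^sup>2 + 2 * (norm (?a \<omega> - ?b \<omega>))\<^sup>2)" for \<omega>
  proof -
    have \<theta>0: "0 \<le> \<theta>"
      using \<theta> norm_ge_zero order_trans by blast
    define v where "v = \<theta> * norm (x t \<omega>) + norm (?a \<omega> - ?b \<omega>)"
    \<comment> \<open>The error from replacing \<open>P\<close> by \<open>P'\<close> is charged to \<open>x\<close>, whose moments are bounded by \<open>K\<close> and not by \<open>K'\<close>.\<close>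
    have "x (Suc t) \<omega> - y (Suc t) \<omega> = P' (x t \<omega> - y t \<omega>) + ((P - P') (x t \<omega>) + (?a \<omega> - ?b \<omega>))"
      by (simp add: x_Suc y_Suc blinfun.diff_left blinfun.diff_right)
    also have "norm \<dots> \<le> \<rho> * norm (x t \<omega> - y t \<omega>) + v"
      unfolding v_def
      by (intro norm_triangle_le add_mono order_trans[OF norm_blinfun] mult_right_mono \<rho> \<theta>) auto
    finally have "(norm (x (Suc t) \<omega> - y (Suc t) \<omega>))\<^sup>2 \<le> (\<rho> * norm (x t \<omega> - y t \<omega>) + v)\<^sup>2"
      by (intro power_mono) auto
    also have "\<dots> \<le> \<rho> * (norm (x t \<omega> - y t \<omega>))\<^sup>2 + v\<^sup>2 / (1 - \<rho>)"
      by (rule convex_power_mean[OF \<rho>(1,2)])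
    also have "v\<^sup>2 / (1 - \<rho>) = r * v\<^sup>2"
      by (simp add: r_def)
    also have "r * v\<^sup>2 \<le> r * (2 * \<theta>\<^sup>2 * (norm (x t \<omega>))\<^sup>2 + 2 * (norm (?a \<omega> - ?b \<omega>))\<^sup>2)"
      using norm_sq_add_le[of "\<theta> * norm (x t \<omega>)" "norm (?a \<omega> - ?b \<omega>)"] r1 \<theta>0
      by (intro mult_left_mono) (auto simp: v_def power_mult_distrib)
    finally show ?thesis
      by simp
  qed
  moreover have "\<rho> * \<delta> t + r * (2 * \<theta>\<^sup>2 * Kx + 2 * (2 * s)) \<le> \<delta> (Suc t)"
  proof -
    have "s * 1 \<le> s * Kx"
      using s Kx by (intro mult_left_mono) auto
    moreover have "0 \<le> \<theta>\<^sup>2 * Kx"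
      using Kx by simp
    ultimately have "2 * \<theta>\<^sup>2 * Kx + 2 * (2 * s) \<le> 4 * (Kx * g)"
      by (simp add: g_def algebra_simps)
    then have "r * (2 * \<theta>\<^sup>2 * Kx + 2 * (2 * s)) \<le> r * (4 * (Kx * g))"
      using r1 by (intro mult_left_mono) auto
    then show ?thesis
      by (simp add: ac_simps)
  qed
  ultimately show ?case
    by (intro mean_le_mono[where g = "\<lambda>\<omega>. (norm (x (Suc t) \<omega> - y (Suc t) \<omega>))\<^sup>2"]) auto
qed

lemma sum_\<delta>: "(\<Sum>t<m. \<delta> t) + r * \<delta> m = r * (4 * K' + real m * (4 * r * Kx * g))"
proof (induction m)
  case (Suc m)
  have "\<delta> m + r * (\<rho> * \<delta> m) = (r * (1 - \<rho>)) * \<delta> m + r * \<rho> * \<delta> m"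
    by (simp add: r_inverse)
  then have "\<delta> m + r * (\<rho> * \<delta> m) = r * \<delta> m"
    by (simp add: algebra_simps)
  with Suc show ?case
    by (simp add: algebra_simps)
qed simp

text \<open>
  Differences of martingale increments: given the past, \<open>x (Suc t) \<otimes>\<^sub>H x (Suc t)\<close> has mean
  \<open>P (x t) \<otimes>\<^sub>H P (x t) + S\<close>, and likewise for \<open>y\<close>.
\<close>
definition D :: "nat \<Rightarrow> 'w \<Rightarrow> 'h \<Rightarrow>\<^sub>L 'h" where
  "D t \<omega> = (x (Suc t) \<omega> \<otimes>\<^sub>H x (Suc t) \<omega> - P (x t \<omega>) \<otimes>\<^sub>H P (x t \<omega>) - S)
     - (y (Suc t) \<omega> \<otimes>\<^sub>H y (Suc t) \<omega> - P' (y t \<omega>) \<otimes>\<^sub>H P' (y t \<omega>) - S')"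

text \<open>
  The same increment applied to \<open>e\<close>, as a function of the two values \<open>u\<close> at time \<open>t\<close> and the two innovations
  \<open>v\<close>; separating the variables lets the innovations be integrated out first.
\<close>
definition d :: "'h \<Rightarrow> 'h \<times> 'h \<Rightarrow> 'h \<times> 'h \<Rightarrow> 'h" where
  "d e u v = (inner (P (fst u)) e *\<^sub>R fst v + inner (fst v) e *\<^sub>R P (fst u) + (inner (fst v) e *\<^sub>R fst v - S e))
     - (inner (P' (snd u)) e *\<^sub>R snd v + inner (snd v) e *\<^sub>R P' (snd u) + (inner (snd v) e *\<^sub>R snd v - S' e))"

lemma D_apply: "D t \<omega> e = d e (x t \<omega>, y t \<omega>) (V (Suc t) \<omega>)"
  unfolding D_def d_def x_Suc y_Suc blinfun.diff_left tensor.rep_eq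
  by (simp add: inner_add_left algebra_simps)

lemma past_D:
  assumes "Suc t \<le> m"
  shows "(\<lambda>\<omega>. D t \<omega> e) \<in> borel_measurable (past m)"
proof -
  have [measurable]: "x t \<in> borel_measurable (past m)" "x (Suc t) \<in> borel_measurable (past m)"
    "y t \<in> borel_measurable (past m)" "y (Suc t) \<in> borel_measurable (past m)"
    using assms by (auto intro: measurable_past_mono[OF past_x] measurable_past_mono[OF past_y])
  note [measurable] = measurable_blinfun_apply
  show ?thesis
    unfolding D_def blinfun.diff_left tensor.rep_eq by measurable
qed

lemma measurable_D: "t < n \<Longrightarrow> D t \<in> Q \<rightarrow>\<^sub>M op_algebra"
  by (rule measurable_op_algebraI) (rule measurable_past[OF past_D], auto)

lemma integrable_ab:
  assumes "1 \<le> i" "i \<le> n"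
  shows "integrable Q (\<lambda>\<omega>. fst (V i \<omega>))" "integrable Q (\<lambda>\<omega>. snd (V i \<omega>))"
    "integrable Q (\<lambda>\<omega>. inner (fst (V i \<omega>)) u *\<^sub>R fst (V i \<omega>))"
    "integrable Q (\<lambda>\<omega>. inner (snd (V i \<omega>)) u *\<^sub>R snd (V i \<omega>))"
proof -
  note [measurable] = measurable_ab[OF assms(2)]
  have sq: "integrable Q (\<lambda>\<omega>. (norm (fst (V i \<omega>)))\<^sup>2)" "integrable Q (\<lambda>\<omega>. (norm (snd (V i \<omega>)))\<^sup>2)"
    using square_a[OF assms] square_b[OF assms] by (auto simp: mean_le_def)
  have 1: "norm w \<le> 1 + (norm w)\<^sup>2" for w :: 'h
    by (smt (verit, best) norm_ge_zero power2_eq_square mult_left_le self_le_power one_less_numeral_iff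
        semiring_norm(76) zero_less_numeral zero_le_power2)
  have 2: "norm (inner w u *\<^sub>R w) \<le> (norm w)\<^sup>2 * norm u" for w u :: 'h
    using mult_right_mono[OF Cauchy_Schwarz_ineq2[of w u] norm_ge_zero[of w]]
    by (simp add: power2_eq_square ac_simps)
  show "integrable Q (\<lambda>\<omega>. fst (V i \<omega>))"
    by (rule Bochner_Integration.integrable_bound[where f = "\<lambda>\<omega>. 1 + (norm (fst (V i \<omega>)))\<^sup>2"])
       (use sq 1 in auto)
  show "integrable Q (\<lambda>\<omega>. snd (V i \<omega>))"
    by (rule Bochner_Integration.integrable_bound[where f = "\<lambda>\<omega>. 1 + (norm (snd (V i \<omega>)))\<^sup>2"])
       (use sq 1 in auto)
  show "integrable Q (\<lambda>\<omega>. inner (fst (V i \<omega>)) u *\<^sub>R fst (V i \<omega>))"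
    by (rule Bochner_Integration.integrable_bound[where f = "\<lambda>\<omega>. (norm (fst (V i \<omega>)))\<^sup>2 * norm u"])
       (use sq 2 in \<open>auto simp: abs_mult\<close>)
  show "integrable Q (\<lambda>\<omega>. inner (snd (V i \<omega>)) u *\<^sub>R snd (V i \<omega>))"
    by (rule Bochner_Integration.integrable_bound[where f = "\<lambda>\<omega>. (norm (snd (V i \<omega>)))\<^sup>2 * norm u"])
       (use sq 2 in \<open>auto simp: abs_mult\<close>)
qed

lemma d_integral:
  assumes "1 \<le> i" "i \<le> n"
  shows "integrable Q (\<lambda>\<omega>. d e u (V i \<omega>))" "(\<integral>\<omega>. d e u (V i \<omega>) \<partial>Q) = 0"
  using integrable_ab[OF assms] centred[OF assms] cov[OF assms]
  by (simp_all add: d_def prob_space)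

text \<open>
  The increment is \<open>X \<otimes>\<^sub>H a + a \<otimes>\<^sub>H X + (a \<otimes>\<^sub>H a - S)\<close>, with \<open>X = P (x t)\<close> and \<open>a\<close> the innovation, minus the same
  expression for the second recursion. The first two terms are estimated with independence of the past and the
  innovation, so that second moments are enough; the last one needs fourth moments of the innovations.
\<close>
lemma sum_square_D:
  assumes t: "t < n"
  shows "mean_le Q (\<lambda>\<omega>. \<Sum>i<m. (norm (D t \<omega> (b i)))\<^sup>2) (72 * K * \<delta> t + 63 * K * Kx * g)"
proof -
  have t': "t \<le> n" "1 \<le> Suc t" "Suc t \<le> n"
    using t by auto
  define X where "X \<omega> = P (x t \<omega>)" for \<omega>
  define Y where "Y \<omega> = P' (y t \<omega>)" for \<omega>
  define a where "a \<omega> = fst (V (Suc t) \<omega>)" for \<omega>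
  define c where "c \<omega> = snd (V (Suc t) \<omega>)" for \<omega>
  have [measurable]: "a \<in> borel_measurable Q" "c \<in> borel_measurable Q"
    using measurable_ab[OF t'(3)] by (auto simp: a_def[abs_def] c_def[abs_def])
  have [measurable]: "x t \<in> borel_measurable Q" "y t \<in> borel_measurable Q"
    using measurable_x[OF t'(1)] measurable_y[OF t'(1)] .
  have [measurable]: "X \<in> borel_measurable Q" "Y \<in> borel_measurable Q"
    unfolding X_def[abs_def] Y_def[abs_def] by (auto intro!: measurable_blinfun_apply)
  have ind: "indep_pair Q borel (\<lambda>\<omega>. (X \<omega>, Y \<omega>)) borel (V (Suc t))"
  proof (rule indep_past[OF _ t])
    show "(\<lambda>\<omega>. (X \<omega>, Y \<omega>)) \<in> borel_measurable (past t)"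
      unfolding X_def Y_def
      by (intro borel_measurable_Pair measurable_blinfun_apply past_x past_y)
  qed
  have XY: "mean_le Q (\<lambda>\<omega>. (norm (X \<omega> - Y \<omega>))\<^sup>2) (2 * \<delta> t + 2 * (\<theta>\<^sup>2 * Kx))"
  proof (rule mean_le_mono)
    show "mean_le Q (\<lambda>\<omega>. 2 * (norm (x t \<omega> - y t \<omega>))\<^sup>2 + 2 * (\<theta>\<^sup>2 * (norm (x t \<omega>))\<^sup>2))
        (2 * \<delta> t + 2 * (\<theta>\<^sup>2 * Kx))"
      by (intro mean_le_add mean_le_cmult square_diff_xy square_x t') auto
    show "(norm (X \<omega> - Y \<omega>))\<^sup>2 \<le> 2 * (norm (x t \<omega> - y t \<omega>))\<^sup>2 + 2 * (\<theta>\<^sup>2 * (norm (x t \<omega>))\<^sup>2)" for \<omega>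
    proof -
      have "X \<omega> - Y \<omega> = P' (x t \<omega> - y t \<omega>) + (P - P') (x t \<omega>)"
        by (simp add: X_def Y_def blinfun.diff_left blinfun.diff_right)
      then have "(norm (X \<omega> - Y \<omega>))\<^sup>2
          \<le> 2 * (norm (P' (x t \<omega> - y t \<omega>)))\<^sup>2 + 2 * (norm ((P - P') (x t \<omega>)))\<^sup>2"
        using norm_sq_add_le by metis
      also have "\<dots> \<le> 2 * (1 * norm (x t \<omega> - y t \<omega>))\<^sup>2 + 2 * (\<theta> * norm (x t \<omega>))\<^sup>2"
        using \<rho> by (intro add_mono mult_left_mono power_mono order_trans[OF norm_blinfun] mult_right_mono \<theta>) auto
      finally show ?thesis
        by (simp add: power_mult_distrib)
    qed
  qed auto
  have YY: "mean_le Q (\<lambda>\<omega>. (norm (Y \<omega>))\<^sup>2) (2 * \<delta> t + 2 * Kx)"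
  proof (rule mean_le_mono)
    show "mean_le Q (\<lambda>\<omega>. 2 * (norm (x t \<omega> - y t \<omega>))\<^sup>2 + 2 * (norm (x t \<omega>))\<^sup>2) (2 * \<delta> t + 2 * Kx)"
      by (intro mean_le_add mean_le_cmult square_diff_xy square_x t') auto
    show "(norm (Y \<omega>))\<^sup>2 \<le> 2 * (norm (x t \<omega> - y t \<omega>))\<^sup>2 + 2 * (norm (x t \<omega>))\<^sup>2" for \<omega>
    proof -
      have "norm (Y \<omega>) \<le> 1 * norm (y t \<omega>)"
        unfolding Y_def using \<rho> by (intro order_trans[OF norm_blinfun] mult_right_mono) auto
      then have "(norm (Y \<omega>))\<^sup>2 \<le> (norm (y t \<omega>))\<^sup>2"
        by (intro power_mono) auto
      also have "\<dots> \<le> 2 * (norm (x t \<omega> - y t \<omega>))\<^sup>2 + 2 * (norm (x t \<omega>))\<^sup>2"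
        using norm_sq_add_le[of "- (x t \<omega> - y t \<omega>)" "x t \<omega>"] by (simp add: norm_minus_commute)
      finally show ?thesis .
    qed
  qed auto
  define q where "q \<omega> = 2 * ((norm (X \<omega> - Y \<omega>))\<^sup>2 * (norm (a \<omega>))\<^sup>2)
      + 2 * ((norm (Y \<omega>))\<^sup>2 * (norm (a \<omega> - c \<omega>))\<^sup>2)" for \<omega>
  have q: "mean_le Q q (2 * ((2 * \<delta> t + 2 * (\<theta>\<^sup>2 * Kx)) * K) + 2 * ((2 * \<delta> t + 2 * Kx) * (2 * s)))"
    unfolding q_def[abs_def]
  proof (intro mean_le_add mean_le_cmult)
    show "mean_le Q (\<lambda>\<omega>. (norm (X \<omega> - Y \<omega>))\<^sup>2 * (norm (a \<omega>))\<^sup>2) ((2 * \<delta> t + 2 * (\<theta>\<^sup>2 * Kx)) * K)"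
      unfolding a_def
      by (rule mean_le_indep_mult[OF ind, of "\<lambda>p. (norm (fst p - snd p))\<^sup>2" "\<lambda>p. (norm (fst p))\<^sup>2", simplified])
         (use XY square_a[OF t'(2,3)] in \<open>auto intro!: borel_measurable_continuous_onI continuous_intros\<close>)
    show "mean_le Q (\<lambda>\<omega>. (norm (Y \<omega>))\<^sup>2 * (norm (a \<omega> - c \<omega>))\<^sup>2) ((2 * \<delta> t + 2 * Kx) * (2 * s))"
      unfolding a_def c_def
      by (rule mean_le_indep_mult[OF ind, of "\<lambda>p. (norm (snd p))\<^sup>2" "\<lambda>p. (norm (fst p - snd p))\<^sup>2", simplified])
         (use YY square_diff_ab[OF t'(2,3)] in \<open>auto intro!: borel_measurable_continuous_onI continuous_intros\<close>)
  qed auto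
  define Z where "Z e \<omega> = inner (a \<omega>) e *\<^sub>R a \<omega> - inner (c \<omega>) e *\<^sub>R c \<omega>" for e \<omega>
  \<comment> \<open>The inequality \<open>2 * u * w \<le> u\<^sup>2 / s + s * w\<^sup>2\<close> replaces Cauchy--Schwarz for a product of square roots of fourth moments.\<close>
  define v where "v \<omega> = (1 / s) * norm (a \<omega> - c \<omega>) ^ 4 + s * (2 * norm (a \<omega>) ^ 4 + 2 * norm (c \<omega>) ^ 4)" for \<omega>
  have v: "mean_le Q v ((1 / s) * s\<^sup>2 + s * (2 * K + 2 * K))"
    unfolding v_def[abs_def] a_def c_def using s
    by (intro mean_le_add mean_le_cmult close fourth t') auto
  have Zm [measurable]: "Z e \<in> borel_measurable Q" for e
    unfolding Z_def[abs_def] by measurable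
  have Zv: "(\<Sum>i<m. (norm (Z (b i) \<omega>))\<^sup>2) \<le> v \<omega>" for m \<omega>
  proof -
    have "(\<Sum>i<m. (norm (Z (b i) \<omega>))\<^sup>2) = (\<Sum>i<m. (norm ((a \<omega> \<otimes>\<^sub>H a \<omega> - c \<omega> \<otimes>\<^sub>H c \<omega>) (b i)))\<^sup>2)"
      by (simp add: Z_def blinfun.diff_left tensor.rep_eq)
    also have "\<dots> \<le> 2 * ((norm (a \<omega> - c \<omega>))\<^sup>2 * (norm (a \<omega>))\<^sup>2) + 2 * ((norm (c \<omega>))\<^sup>2 * (norm (a \<omega> - c \<omega>))\<^sup>2)"
      by (rule hs_tensor_diff_le[OF basis])
    also have "\<dots> = 2 * (norm (a \<omega> - c \<omega>))\<^sup>2 * ((norm (a \<omega>))\<^sup>2 + (norm (c \<omega>))\<^sup>2)"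
      by (simp add: algebra_simps)
    also have "\<dots> \<le> (1 / s) * ((norm (a \<omega> - c \<omega>))\<^sup>2)\<^sup>2 + s * ((norm (a \<omega>))\<^sup>2 + (norm (c \<omega>))\<^sup>2)\<^sup>2"
    proof -
      have "2 * u * w \<le> (1 / s) * u\<^sup>2 + s * w\<^sup>2" for u w :: real
      proof -
        have "0 \<le> (u - s * w)\<^sup>2 / s"
          using s by simp
        then show ?thesis
          using s by (simp add: power2_eq_square field_simps)
      qed
      then show ?thesis .
    qed
    also have "\<dots> \<le> v \<omega>"
      unfolding v_def using s norm_sq_add_le[of "(norm (a \<omega>))\<^sup>2" "(norm (c \<omega>))\<^sup>2"]
      by (intro add_mono mult_left_mono) (simp_all flip: power_mult)
    finally show ?thesis .
  qed
  have Z1: "mean_le Q (\<lambda>\<omega>. (norm (Z (b i) \<omega>))\<^sup>2) (\<integral>\<omega>. (norm (Z (b i) \<omega>))\<^sup>2 \<partial>Q)" for i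
  proof -
    have "(norm (Z (b i) \<omega>))\<^sup>2 \<le> v \<omega>" for \<omega>
      using Zv[of \<omega> "Suc i"] order_trans[OF member_le_sum[of i "{..<Suc i}" "\<lambda>i. (norm (Z (b i) \<omega>))\<^sup>2"]]
      by simp
    then have "mean_le Q (\<lambda>\<omega>. (norm (Z (b i) \<omega>))\<^sup>2) ((1 / s) * s\<^sup>2 + s * (2 * K + 2 * K))"
      by (intro mean_le_mono[OF v]) auto
    then show ?thesis
      by (simp add: mean_le_def)
  qed
  have Zint: "integrable Q (Z e)" "(\<integral>\<omega>. Z e \<omega> \<partial>Q) = S e - S' e" for e
    using integrable_ab[OF t'(2,3)] cov[OF t'(2,3)] by (simp_all add: Z_def[abs_def] a_def c_def)
  \<comment> \<open>Subtracting the mean does not increase the mean square.\<close>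
  have U3: "mean_le Q (\<lambda>\<omega>. \<Sum>i<m. (norm (Z (b i) \<omega> - (S (b i) - S' (b i))))\<^sup>2)
      ((1 / s) * s\<^sup>2 + s * (2 * K + 2 * K))"
  proof (rule mean_le_weaken)
    show "mean_le Q (\<lambda>\<omega>. \<Sum>i<m. (norm (Z (b i) \<omega> - (S (b i) - S' (b i))))\<^sup>2)
        (\<Sum>i<m. \<integral>\<omega>. (norm (Z (b i) \<omega>))\<^sup>2 \<partial>Q)"
      using mean_leD(1)[OF Z1] by (intro mean_le_sum mean_le_centred_square Zint)
    have "(\<Sum>i<m. \<integral>\<omega>. (norm (Z (b i) \<omega>))\<^sup>2 \<partial>Q) = (\<integral>\<omega>. (\<Sum>i<m. (norm (Z (b i) \<omega>))\<^sup>2) \<partial>Q)"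
      using mean_leD(1)[OF Z1] by simp
    also have "\<dots> \<le> (1 / s) * s\<^sup>2 + s * (2 * K + 2 * K)"
      by (rule mean_leD(2), rule mean_le_mono[OF v]) (use Zv in \<open>auto simp: sum_nonneg\<close>)
    finally show "(\<Sum>i<m. \<integral>\<omega>. (norm (Z (b i) \<omega>))\<^sup>2 \<partial>Q) \<le> (1 / s) * s\<^sup>2 + s * (2 * K + 2 * K)" .
  qed
  have split: "(\<Sum>i<m. (norm (D t \<omega> (b i)))\<^sup>2)
      \<le> 3 * (q \<omega> + q \<omega> + (\<Sum>i<m. (norm (Z (b i) \<omega> - (S (b i) - S' (b i))))\<^sup>2))" for \<omega>
  proof -
    define U1 where "U1 = X \<omega> \<otimes>\<^sub>H a \<omega> - Y \<omega> \<otimes>\<^sub>H c \<omega>"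
    define U2 where "U2 = a \<omega> \<otimes>\<^sub>H X \<omega> - c \<omega> \<otimes>\<^sub>H Y \<omega>"
    have three: "(norm (u + v + w))\<^sup>2 \<le> 3 * ((norm u)\<^sup>2 + (norm v)\<^sup>2 + (norm w)\<^sup>2)" for u v w :: 'h
    proof -
      have "norm (u + v + w) \<le> norm u + norm v + norm w"
        by (intro norm_triangle_le add_right_mono norm_triangle_ineq)
      then have "(norm (u + v + w))\<^sup>2 \<le> (norm u + norm v + norm w)\<^sup>2"
        by (intro power_mono) auto
      moreover have "0 \<le> (norm u - norm v)\<^sup>2 + (norm v - norm w)\<^sup>2 + (norm u - norm w)\<^sup>2"
        by simp
      ultimately show ?thesis
        by (simp add: power2_eq_square algebra_simps)
    qed
    have "D t \<omega> e = U1 e + U2 e + (Z e \<omega> - (S e - S' e))" for e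
      by (simp add: D_apply d_def U1_def U2_def Z_def X_def Y_def a_def c_def blinfun.diff_left tensor.rep_eq)
    then have "(\<Sum>i<m. (norm (D t \<omega> (b i)))\<^sup>2) \<le> (\<Sum>i<m. 3 * ((norm (U1 (b i)))\<^sup>2 + (norm (U2 (b i)))\<^sup>2
        + (norm (Z (b i) \<omega> - (S (b i) - S' (b i))))\<^sup>2))"
      by (intro sum_mono) (simp only: three)
    also have "\<dots> = 3 * ((\<Sum>i<m. (norm (U1 (b i)))\<^sup>2) + (\<Sum>i<m. (norm (U2 (b i)))\<^sup>2)
        + (\<Sum>i<m. (norm (Z (b i) \<omega> - (S (b i) - S' (b i))))\<^sup>2))"
      by (simp add: sum_distrib_left sum.distrib)
    also have "\<dots> \<le> 3 * (q \<omega> + q \<omega> + (\<Sum>i<m. (norm (Z (b i) \<omega> - (S (b i) - S' (b i))))\<^sup>2))"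
      unfolding U1_def U2_def q_def
      by (intro mult_left_mono add_mono hs_tensor_diff_le hs_tensor_diff_le' basis order_refl) auto
    finally show ?thesis .
  qed
  show ?thesis
  proof (rule mean_le_mono)
    show "mean_le Q (\<lambda>\<omega>. 3 * (q \<omega> + q \<omega> + (\<Sum>i<m. (norm (Z (b i) \<omega> - (S (b i) - S' (b i))))\<^sup>2)))
        (3 * ((2 * ((2 * \<delta> t + 2 * (\<theta>\<^sup>2 * Kx)) * K) + 2 * ((2 * \<delta> t + 2 * Kx) * (2 * s)))
          + (2 * ((2 * \<delta> t + 2 * (\<theta>\<^sup>2 * Kx)) * K) + 2 * ((2 * \<delta> t + 2 * Kx) * (2 * s)))
          + ((1 / s) * s\<^sup>2 + s * (2 * K + 2 * K))))"
      by (intro mean_le_cmult mean_le_add q U3) auto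
    have Db: "(\<lambda>\<omega>. D t \<omega> e) \<in> borel_measurable Q" for e
      using t by (intro measurable_past[OF past_D]) auto
    show "(\<lambda>\<omega>. \<Sum>i<m. (norm (D t \<omega> (b i)))\<^sup>2) \<in> borel_measurable Q"
      using Db by measurable
    have "\<delta> t * s \<le> \<delta> t * K"
      using s by (intro mult_left_mono \<delta>_nonneg)
    then have "\<delta> t * s \<le> K * \<delta> t"
      by (simp only: mult.commute)
    moreover have "1 * (Kx * s) \<le> K * (Kx * s)"
      using s Kx K by (intro mult_right_mono) auto
    then have "Kx * s \<le> K * Kx * s"
      by (simp only: mult_1 mult.assoc)
    moreover have "(K * 1) * s \<le> (K * Kx) * s"
      using s Kx K by (intro mult_right_mono mult_left_mono) auto
    then have "K * s \<le> K * Kx * s"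
      by (simp only: mult_1_right)
    moreover have "1 * s \<le> K * s"
      using s K by (intro mult_right_mono) auto
    then have "s \<le> K * s"
      by (simp only: mult_1)
    moreover have "0 \<le> K * Kx * \<theta>\<^sup>2"
      using Kx K by simp
    moreover have "3 * ((2 * ((2 * \<delta> t + 2 * (\<theta>\<^sup>2 * Kx)) * K) + 2 * ((2 * \<delta> t + 2 * Kx) * (2 * s)))
          + (2 * ((2 * \<delta> t + 2 * (\<theta>\<^sup>2 * Kx)) * K) + 2 * ((2 * \<delta> t + 2 * Kx) * (2 * s)))
          + ((1 / s) * s\<^sup>2 + s * (2 * K + 2 * K)))
        = 24 * (K * \<delta> t) + 24 * (K * Kx * \<theta>\<^sup>2) + 48 * (\<delta> t * s) + 48 * (Kx * s) + 3 * s + 12 * (K * s)"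
      using s by (simp add: power2_eq_square algebra_simps)
    moreover have "72 * K * \<delta> t + 63 * K * Kx * g = 72 * (K * \<delta> t) + 63 * (K * Kx * \<theta>\<^sup>2) + 63 * (K * Kx * s)"
      by (simp add: g_def algebra_simps)
    ultimately show "3 * ((2 * ((2 * \<delta> t + 2 * (\<theta>\<^sup>2 * Kx)) * K) + 2 * ((2 * \<delta> t + 2 * Kx) * (2 * s)))
          + (2 * ((2 * \<delta> t + 2 * (\<theta>\<^sup>2 * Kx)) * K) + 2 * ((2 * \<delta> t + 2 * Kx) * (2 * s)))
          + ((1 / s) * s\<^sup>2 + s * (2 * K + 2 * K)))
        \<le> 72 * K * \<delta> t + 63 * K * Kx * g"
      by (simp only:)
  qed (use split in \<open>auto simp: sum_nonneg\<close>)
qed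

text \<open>
  The earlier increment and the two values at time \<open>t\<close> are functions of the past, and given the past
  the later increment has mean zero.
\<close>
lemma orthogonal_D:
  assumes st: "t' < t" "t < n"
  shows "(\<integral>\<omega>. inner (D t' \<omega> (b i)) (D t \<omega> (b i)) \<partial>Q) = 0"
proof -
  let ?X = "\<lambda>\<omega>. (D t' \<omega> (b i), (x t \<omega>, y t \<omega>))"
  have X: "?X \<in> borel_measurable (past t)"
    using st by (intro borel_measurable_Pair past_D past_x past_y) auto
  have int: "integrable Q (\<lambda>\<omega>. (norm (D u \<omega> (b i)))\<^sup>2)" if u: "u < n" for u
  proof -
    have [measurable]: "(\<lambda>\<omega>. D u \<omega> e) \<in> borel_measurable Q" for e
      using u by (intro measurable_past[OF past_D]) auto
    have "integrable Q (\<lambda>\<omega>. \<Sum>j<Suc i. (norm (D u \<omega> (b j)))\<^sup>2)"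
      by (rule mean_leD(1)[OF sum_square_D[OF u]])
    then show ?thesis
      by (rule Bochner_Integration.integrable_bound)
         (auto intro!: AE_I2 order_trans[OF _ abs_ge_self] simp: sum_nonneg)
  qed
  have meas: "(\<lambda>\<omega>. D u \<omega> e) \<in> borel_measurable Q" if "u < n" for u e
    using that by (intro measurable_past[OF past_D]) auto
  have "(\<integral>\<omega>. inner (fst (?X \<omega>)) (d (b i) (snd (?X \<omega>)) (V (Suc t) \<omega>)) \<partial>Q) = 0"
  proof (rule indep_mean_zero[OF indep_past[OF X st(2)], of fst "\<lambda>p. d (b i) (snd p)"])
    show "fst \<in> borel_measurable (borel :: ('h \<times> 'h \<times> 'h) measure)"
      by (intro borel_measurable_continuous_onI continuous_intros)
    show "(\<lambda>(p, v). d (b i) (snd p) v) \<in> borel_measurable ((borel :: ('h \<times> 'h \<times> 'h) measure) \<Otimes>\<^sub>M borel)"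
      unfolding borel_prod d_def case_prod_beta
      by (intro borel_measurable_continuous_onI continuous_intros)
    show "integrable Q (\<lambda>\<omega>. inner (fst (?X \<omega>)) (d (b i) (snd (?X \<omega>)) (V (Suc t) \<omega>)))"
      unfolding fst_conv snd_conv D_apply[symmetric]
      using st by (intro integrable_inner_of_squares meas int) auto
  qed (use st d_integral in auto)
  then show ?thesis
    by (simp add: D_apply)
qed

lemma mean_le_sum_D:
  "mean_le Q (\<lambda>\<omega>. (norm (\<Sum>t<n. D t \<omega>))\<^sup>2) (351 * K\<^sup>2 * r ^ 6 * (K' + real n * g))"
proof (rule mean_le_weaken)
  show "mean_le Q (\<lambda>\<omega>. (norm (\<Sum>t<n. D t \<omega>))\<^sup>2) (\<Sum>t<n. 72 * K * \<delta> t + 63 * K * Kx * g)"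
    by (rule mean_le_orthogonal_operator_sum[OF basis measurable_D sum_square_D orthogonal_D])
  have "(\<Sum>t<n. 72 * K * \<delta> t + 63 * K * Kx * g) = 72 * K * (\<Sum>t<n. \<delta> t) + real n * (63 * K * Kx * g)"
    by (simp add: sum.distrib sum_distrib_left)
  also have "(\<Sum>t<n. \<delta> t) \<le> r * (4 * K' + real n * (4 * r * Kx * g))"
  proof -
    have "0 \<le> r * \<delta> n"
      using r1 by (intro mult_nonneg_nonneg \<delta>_nonneg) auto
    then show ?thesis
      using sum_\<delta>[of n] by linarith
  qed
  also have "72 * K * (r * (4 * K' + real n * (4 * r * Kx * g))) + real n * (63 * K * Kx * g)
      \<le> 351 * K\<^sup>2 * r ^ 6 * (K' + real n * g)"
  proof -
    have ng: "0 \<le> real n * g"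
      using g0 by simp
    have "1 \<le> r ^ 5" "1 \<le> r\<^sup>2"
      using r1 by (auto simp: one_le_power)
    then have "(K * r * K') * 1 \<le> (K * r * K') * (K * r ^ 5)"
      using K r1 mult_mono[of 1 K 1 "r ^ 5"] by (intro mult_left_mono) auto
    moreover have "(K\<^sup>2 * r ^ 4 * (real n * g)) * 1 \<le> (K\<^sup>2 * r ^ 4 * (real n * g)) * r\<^sup>2"
      using K r1 ng \<open>1 \<le> r\<^sup>2\<close> by (intro mult_left_mono) auto
    moreover have "0 \<le> K * r * K' * (K * r ^ 5)"
      using K r1 by simp
    ultimately show ?thesis
      by (simp add: Kx_def algebra_simps power2_eq_square power4_eq_xxxx eval_nat_numeral)
  qed
  finally show "(\<Sum>t<n. 72 * K * \<delta> t + 63 * K * Kx * g) \<le> 351 * K\<^sup>2 * r ^ 6 * (K' + real n * g)"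
    using K by simp
qed

end

text \<open>
  The map \<open>G \<mapsto> P G P\<^sup>*\<close> has norm at most \<open>\<rho>\<^sup>2 \<le> \<rho>\<close>, so \<open>G\<close> can be absorbed into the left-hand side.
\<close>
lemma norm_le_of_sandwich_fixed_point:
  assumes eq: "G = sandwich P G + E" and P: "norm P \<le> \<rho>" "0 \<le> \<rho>" "\<rho> < 1"
  shows "norm G \<le> 1 / (1 - \<rho>) * norm E"
proof -
  have "norm G \<le> norm (sandwich P G) + norm E"
    using norm_triangle_ineq[of "sandwich P G" E] eq by simp
  also have "norm (sandwich P G) \<le> (norm P)\<^sup>2 * norm G"
    by (rule norm_sandwich_le)
  also have "(norm P)\<^sup>2 * norm G \<le> \<rho> * norm G"
  proof (rule mult_right_mono)
    have "(norm P)\<^sup>2 \<le> \<rho>\<^sup>2"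
      using P by (intro power_mono) auto
    also have "\<dots> \<le> \<rho> * 1"
      using P unfolding power2_eq_square by (intro mult_left_mono) auto
    finally show "(norm P)\<^sup>2 \<le> \<rho>"
      by simp
  qed simp
  finally have "(1 - \<rho>) * norm G \<le> norm E"
    by (simp add: algebra_simps)
  then show ?thesis
    using P by (simp add: field_simps)
qed

text \<open>
  An algebraic identity, valid for every sequence: the sums of \<open>X (Suc t) \<otimes>\<^sub>H X (Suc t)\<close> and of \<open>X t \<otimes>\<^sub>H X t\<close>
  differ by the ends only.
\<close>
lemma sum_tensor_square_identity:
  fixes X :: "nat \<Rightarrow> 'h::{real_inner, banach}"
  shows "(\<Sum>t<n. X t \<otimes>\<^sub>H X t) - real n *\<^sub>R \<Gamma>
    = sandwich P ((\<Sum>t<n. X t \<otimes>\<^sub>H X t) - real n *\<^sub>R \<Gamma>)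
      + ((\<Sum>t<n. X (Suc t) \<otimes>\<^sub>H X (Suc t) - P (X t) \<otimes>\<^sub>H P (X t) - S)
         - (X n \<otimes>\<^sub>H X n - X 0 \<otimes>\<^sub>H X 0) + real n *\<^sub>R (sandwich P \<Gamma> + S - \<Gamma>))"
proof -
  have "sandwich P (\<Sum>t<n. X t \<otimes>\<^sub>H X t) = (\<Sum>t<n. P (X t) \<otimes>\<^sub>H P (X t))"
    by (simp add: sandwich_sum sandwich_tensor)
  moreover have "(\<Sum>t<n. X (Suc t) \<otimes>\<^sub>H X (Suc t)) = (\<Sum>t<n. X t \<otimes>\<^sub>H X t) + (X n \<otimes>\<^sub>H X n - X 0 \<otimes>\<^sub>H X 0)"
    using sum_lessThan_telescope[of "\<lambda>j. X j \<otimes>\<^sub>H X j" n] by (simp add: sum_subtractf algebra_simps)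
  moreover have "(\<Sum>t<n. S) = real n *\<^sub>R S"
    by (simp add: sum_constant_scaleR)
  ultimately show ?thesis
    by (simp add: sandwich_diff sandwich_scaleR sum_subtractf scaleR_add_right scaleR_diff_right)
qed

lemma square_sum4_le: "((a::real) + b + c + d)\<^sup>2 \<le> 4 * (a\<^sup>2 + b\<^sup>2 + c\<^sup>2 + d\<^sup>2)"
proof -
  have "0 \<le> (a - b)\<^sup>2 + (a - c)\<^sup>2 + (a - d)\<^sup>2 + (b - c)\<^sup>2 + (b - d)\<^sup>2 + (c - d)\<^sup>2"
    by simp
  then show ?thesis
    by (simp add: power2_eq_square algebra_simps)
qed

context coupled_autoregressions
begin

text \<open>
  Comparison with the zero process turns every bound for a pair of recursions into one for the first
  recursion alone.
\<close>
lemma coupled_with_zero: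
  "coupled_autoregressions Q (\<lambda>i \<omega>. (fst (V i \<omega>), 0)) n P S 0 0 b \<rho> 1 K K K"
proof unfold_locales
  show "indep_vars (\<lambda>_. borel) (\<lambda>i \<omega>. (fst (V i \<omega>), 0 :: 'h)) {..n}"
    by (rule indep_vars_compose2[OF indep])
       (intro borel_measurable_continuous_onI continuous_intros)
  show "K \<le> K" "0 < K" "1 \<le> K"
    using K by auto
  show "norm (P - 0) \<le> 1"
    using \<rho> by simp
  have KK: "K \<le> K\<^sup>2"
    using K by (simp add: power2_eq_square)
  show "mean_le Q (\<lambda>\<omega>. norm (fst (fst (V i \<omega>), 0 :: 'h) - snd (fst (V i \<omega>), 0 :: 'h)) ^ 4) (K\<^sup>2)"
    if "1 \<le> i" "i \<le> n" for i
    using mean_le_weaken[OF fourth(1)[OF that] KK] by simp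
  have "mean_le Q (\<lambda>\<omega>. norm (0 :: 'h) ^ 4) K"
    using K by (simp add: mean_le_def)
  then show "mean_le Q (\<lambda>\<omega>. norm (snd (fst (V i \<omega>), 0 :: 'h)) ^ 4) K" if "1 \<le> i" "i \<le> n" for i
    by simp
  show "mean_le Q (\<lambda>\<omega>. norm (snd (fst (V 0 \<omega>), 0 :: 'h)) ^ 4) K"
    using K by (simp add: mean_le_def)
qed (use \<rho> basis fourth init centred cov in auto)

lemma boot_path_zero: "boot_path 0 0 (\<lambda>i. 0) t = 0"
  by (induction t) auto

lemma mean_le_sum_D_single:
  "mean_le Q (\<lambda>\<omega>. (norm (\<Sum>t<n. x (Suc t) \<omega> \<otimes>\<^sub>H x (Suc t) \<omega> - P (x t \<omega>) \<otimes>\<^sub>H P (x t \<omega>) - S))\<^sup>2)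
     (351 * K\<^sup>2 * r ^ 6 * (K + real n * (1 + K)))"
proof -
  interpret zero: coupled_autoregressions Q "\<lambda>i \<omega>. (fst (V i \<omega>), 0)" n P S 0 0 b \<rho> 1 K K K
    by (rule coupled_with_zero)
  have "zero.x = x"
    by (intro ext) (simp add: zero.x_def x_def)
  moreover have "zero.y t \<omega> = 0" for t \<omega>
    by (simp add: zero.y_def boot_path_zero)
  ultimately show ?thesis
    using zero.mean_le_sum_D by (simp add: zero.D_def zero.g_def zero.r_def r_def tensor_zero_left)
qed

lemma mean_le_sum_tensor_noise:
  "mean_le Q (\<lambda>\<omega>. (norm (\<Sum>t<n. x t \<omega> \<otimes>\<^sub>H fst (V (Suc t) \<omega>)))\<^sup>2) (real n * (Kx * K))"
proof -
  have past_T: "(\<lambda>\<omega>. (x t \<omega> \<otimes>\<^sub>H fst (V (Suc t) \<omega>)) e) \<in> borel_measurable (past m)" if "Suc t \<le> m" for t m e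
  proof -
    have [measurable]: "x t \<in> borel_measurable (past m)" "(\<lambda>\<omega>. fst (V (Suc t) \<omega>)) \<in> borel_measurable (past m)"
      using that by (auto intro!: measurable_past_mono[OF past_x] measurable_fst_snd measurable_past_V)
    show ?thesis
      unfolding tensor.rep_eq by measurable
  qed
  have meas: "(\<lambda>\<omega>. (x t \<omega> \<otimes>\<^sub>H fst (V (Suc t) \<omega>)) e) \<in> borel_measurable Q" if "t < n" for t e
    using that by (intro measurable_past[OF past_T]) auto
  have sq: "mean_le Q (\<lambda>\<omega>. \<Sum>i<m. (norm ((x t \<omega> \<otimes>\<^sub>H fst (V (Suc t) \<omega>)) (b i)))\<^sup>2) (Kx * K)" if t: "t < n" for t m
  proof (rule mean_le_mono)
    show "mean_le Q (\<lambda>\<omega>. (norm (x t \<omega>))\<^sup>2 * (norm (fst (V (Suc t) \<omega>)))\<^sup>2) (Kx * K)"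
      by (rule mean_le_indep_mult[OF indep_past[OF past_x t], of "\<lambda>z. (norm z)\<^sup>2" "\<lambda>v. (norm (fst v))\<^sup>2"])
         (use t square_x square_a in \<open>auto intro!: borel_measurable_continuous_onI continuous_intros\<close>)
    show "(\<lambda>\<omega>. \<Sum>i<m. (norm ((x t \<omega> \<otimes>\<^sub>H fst (V (Suc t) \<omega>)) (b i)))\<^sup>2) \<in> borel_measurable Q"
      using meas[OF t] by measurable
  qed (auto simp: sum_nonneg hs_tensor_le[OF basis])
  have "mean_le Q (\<lambda>\<omega>. (norm (\<Sum>t<n. x t \<omega> \<otimes>\<^sub>H fst (V (Suc t) \<omega>)))\<^sup>2) (\<Sum>t<n. Kx * K)"
  proof (rule mean_le_orthogonal_operator_sum[OF basis measurable_op_algebraI[OF meas] sq])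
    fix t' t i assume st: "t' < t" "t < n"
    let ?X = "\<lambda>\<omega>. ((x t' \<omega> \<otimes>\<^sub>H fst (V (Suc t') \<omega>)) (b i), x t \<omega>)"
    have X: "?X \<in> borel_measurable (past t)"
      using st by (intro borel_measurable_Pair past_T past_x) auto
    have int: "integrable Q (\<lambda>\<omega>. (norm ((x u \<omega> \<otimes>\<^sub>H fst (V (Suc u) \<omega>)) (b i)))\<^sup>2)" if u: "u < n" for u
    proof -
      have [measurable]: "(\<lambda>\<omega>. (x u \<omega> \<otimes>\<^sub>H fst (V (Suc u) \<omega>)) e) \<in> borel_measurable Q" for e
        using meas[OF u] .
      have "integrable Q (\<lambda>\<omega>. \<Sum>j<Suc i. (norm ((x u \<omega> \<otimes>\<^sub>H fst (V (Suc u) \<omega>)) (b j)))\<^sup>2)"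
        by (rule mean_leD(1)[OF sq[OF u]])
      then show ?thesis
        by (rule Bochner_Integration.integrable_bound)
           (auto intro!: AE_I2 order_trans[OF _ abs_ge_self] simp: sum_nonneg)
    qed
    have "(\<integral>\<omega>. inner (fst (?X \<omega>)) (inner (snd (?X \<omega>)) (b i) *\<^sub>R fst (V (Suc t) \<omega>)) \<partial>Q) = 0"
    proof (rule indep_mean_zero[OF indep_past[OF X st(2)], of fst "\<lambda>p v. inner (snd p) (b i) *\<^sub>R fst v"])
      show "fst \<in> borel_measurable (borel :: ('h \<times> 'h) measure)"
        by (intro borel_measurable_continuous_onI continuous_intros)
      show "(\<lambda>(p, v). inner (snd p) (b i) *\<^sub>R fst v)
          \<in> borel_measurable ((borel :: ('h \<times> 'h) measure) \<Otimes>\<^sub>M (borel :: ('h \<times> 'h) measure))"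
        unfolding borel_prod case_prod_beta
        by (intro borel_measurable_continuous_onI continuous_intros)
      have "integrable Q (\<lambda>\<omega>. inner ((x t' \<omega> \<otimes>\<^sub>H fst (V (Suc t') \<omega>)) (b i)) ((x t \<omega> \<otimes>\<^sub>H fst (V (Suc t) \<omega>)) (b i)))"
        using st by (intro integrable_inner_of_squares meas int) auto
      then show "integrable Q (\<lambda>\<omega>. inner (fst (?X \<omega>)) (inner (snd (?X \<omega>)) (b i) *\<^sub>R fst (V (Suc t) \<omega>)))"
        by (simp add: tensor.rep_eq)
    qed (use st integrable_ab centred in auto)
    then show "(\<integral>\<omega>. inner ((x t' \<omega> \<otimes>\<^sub>H fst (V (Suc t') \<omega>)) (b i)) ((x t \<omega> \<otimes>\<^sub>H fst (V (Suc t) \<omega>)) (b i)) \<partial>Q) = 0"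
      by (simp add: tensor.rep_eq)
  qed auto
  then show ?thesis
    by simp
qed

lemma mean_le_sum_noise: "mean_le Q (\<lambda>\<omega>. (norm (\<Sum>t<n. fst (V (Suc t) \<omega>)))\<^sup>2) (real n * K)"
proof -
  have "mean_le Q (\<lambda>\<omega>. (norm (\<Sum>t<n. fst (V (Suc t) \<omega>)))\<^sup>2) (\<Sum>t<n. K)"
  proof (rule mean_le_orthogonal_sum)
    show "(\<lambda>\<omega>. fst (V (Suc t) \<omega>)) \<in> borel_measurable Q" if "t < n" for t
      using that by (intro measurable_ab) auto
    show "mean_le Q (\<lambda>\<omega>. (norm (fst (V (Suc t) \<omega>)))\<^sup>2) K" if "t < n" for t
      using that by (intro square_a) auto
    fix t' t assume st: "t' < t" "t < n"
    have X: "(\<lambda>\<omega>. fst (V (Suc t') \<omega>)) \<in> borel_measurable (past t)"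
      using st by (intro measurable_fst_snd measurable_past_V) auto
    show "(\<integral>\<omega>. inner (fst (V (Suc t') \<omega>)) (fst (V (Suc t) \<omega>)) \<partial>Q) = 0"
    proof (rule indep_mean_zero[OF indep_past[OF X st(2)], of "\<lambda>z. z" "\<lambda>_ v. fst v"])
      show "(\<lambda>(_, v). fst v) \<in> borel_measurable ((borel :: 'h measure) \<Otimes>\<^sub>M (borel :: ('h \<times> 'h) measure))"
        unfolding borel_prod case_prod_beta
        by (intro borel_measurable_continuous_onI continuous_intros)
      show "integrable Q (\<lambda>\<omega>. inner (fst (V (Suc t') \<omega>)) (fst (V (Suc t) \<omega>)))"
        using st by (intro integrable_inner_of_squares measurable_ab mean_leD(1)[OF square_a]) auto
    qed (use st integrable_ab centred in auto)
  qed
  then show ?thesis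
    by simp
qed

definition Gx :: "'h \<Rightarrow>\<^sub>L 'h \<Rightarrow> 'w \<Rightarrow> 'h \<Rightarrow>\<^sub>L 'h" where
  "Gx \<Gamma> \<omega> = (\<Sum>t<n. x t \<omega> \<otimes>\<^sub>H x t \<omega>) - real n *\<^sub>R \<Gamma>"

definition Gy :: "'h \<Rightarrow>\<^sub>L 'h \<Rightarrow> 'w \<Rightarrow> 'h \<Rightarrow>\<^sub>L 'h" where
  "Gy \<Gamma> \<omega> = (\<Sum>t<n. y t \<omega> \<otimes>\<^sub>H y t \<omega>) - real n *\<^sub>R \<Gamma>"

lemma measurable_Gx: "Gx \<Gamma> \<in> Q \<rightarrow>\<^sub>M op_algebra"
  and measurable_Gy: "Gy \<Gamma> \<in> Q \<rightarrow>\<^sub>M op_algebra"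
proof -
  have [measurable]: "x t \<in> borel_measurable Q" "y t \<in> borel_measurable Q" if "t < n" for t
    using that measurable_x[of t] measurable_y[of t] by auto
  show "Gx \<Gamma> \<in> Q \<rightarrow>\<^sub>M op_algebra" "Gy \<Gamma> \<in> Q \<rightarrow>\<^sub>M op_algebra"
    unfolding Gx_def[abs_def] Gy_def[abs_def]
    by (rule measurable_op_algebraI; simp add: blinfun.diff_left blinfun.sum_left tensor.rep_eq)+
qed

text \<open>
  The special case of a single path started from moments of the size of those of its innovations. The
  numerical constant matters only through being independent of the autoregression.
\<close>
lemma mean_le_Gx:
  assumes fp: "sandwich P \<Gamma> + S = \<Gamma>" and n: "1 \<le> n"
  shows "mean_le Q (\<lambda>\<omega>. (norm (Gx \<Gamma> \<omega>))\<^sup>2) (4220 * K ^ 3 * r ^ 8 * real n)"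
proof (rule mean_le_mono)
  let ?N = "\<lambda>\<omega>. \<Sum>t<n. x (Suc t) \<omega> \<otimes>\<^sub>H x (Suc t) \<omega> - P (x t \<omega>) \<otimes>\<^sub>H P (x t \<omega>) - S"
  show "mean_le Q (\<lambda>\<omega>. r\<^sup>2 * (4 * ((norm (?N \<omega>))\<^sup>2 + norm (x 0 \<omega>) ^ 4 + norm (x n \<omega>) ^ 4)))
      (r\<^sup>2 * (4 * (351 * K\<^sup>2 * r ^ 6 * (K + real n * (1 + K)) + Kx + Kx)))"
    by (intro mean_le_cmult mean_le_add mean_le_sum_D_single fourth_x) auto
  show "(norm (Gx \<Gamma> \<omega>))\<^sup>2 \<le> r\<^sup>2 * (4 * ((norm (?N \<omega>))\<^sup>2 + norm (x 0 \<omega>) ^ 4 + norm (x n \<omega>) ^ 4))" for \<omega>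
  proof -
    let ?E = "?N \<omega> - (x n \<omega> \<otimes>\<^sub>H x n \<omega> - x 0 \<omega> \<otimes>\<^sub>H x 0 \<omega>)"
    have "Gx \<Gamma> \<omega> = sandwich P (Gx \<Gamma> \<omega>) + ?E"
      using sum_tensor_square_identity[where X = "\<lambda>t. x t \<omega>" and n = n and \<Gamma> = \<Gamma> and P = P and S = S] fp
      by (simp add: Gx_def)
    then have "norm (Gx \<Gamma> \<omega>) \<le> r * norm ?E"
      unfolding r_def by (rule norm_le_of_sandwich_fixed_point) (use \<rho> in auto)
    also have "norm ?E \<le> norm (?N \<omega>) + (norm (x n \<omega>))\<^sup>2 + (norm (x 0 \<omega>))\<^sup>2 + 0"
    proof -
      have "norm ?E \<le> norm (?N \<omega>) + norm (x n \<omega> \<otimes>\<^sub>H x n \<omega> - x 0 \<omega> \<otimes>\<^sub>H x 0 \<omega>)"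
        by (rule norm_triangle_ineq4)
      also have "norm (x n \<omega> \<otimes>\<^sub>H x n \<omega> - x 0 \<omega> \<otimes>\<^sub>H x 0 \<omega>) \<le> (norm (x n \<omega>))\<^sup>2 + (norm (x 0 \<omega>))\<^sup>2"
        unfolding power2_eq_square
        by (intro order_trans[OF norm_triangle_ineq4] add_mono norm_tensor_le)
      finally show ?thesis
        by simp
    qed
    finally have "norm (Gx \<Gamma> \<omega>) \<le> r * (norm (?N \<omega>) + (norm (x n \<omega>))\<^sup>2 + (norm (x 0 \<omega>))\<^sup>2 + 0)"
      using r1 by simp
    then have "(norm (Gx \<Gamma> \<omega>))\<^sup>2 \<le> (r * (norm (?N \<omega>) + (norm (x n \<omega>))\<^sup>2 + (norm (x 0 \<omega>))\<^sup>2 + 0))\<^sup>2"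
      by (intro power_mono) auto
    also have "\<dots> \<le> r\<^sup>2 * (4 * ((norm (?N \<omega>))\<^sup>2 + ((norm (x n \<omega>))\<^sup>2)\<^sup>2 + ((norm (x 0 \<omega>))\<^sup>2)\<^sup>2 + 0\<^sup>2))"
      unfolding power_mult_distrib by (intro mult_left_mono square_sum4_le) auto
    finally show ?thesis
      by (simp add: algebra_simps flip: power_mult)
  qed
  show "(\<lambda>\<omega>. (norm (Gx \<Gamma> \<omega>))\<^sup>2) \<in> borel_measurable Q"
    using measurable_norm_op[OF measurable_Gx] by measurable
  show "r\<^sup>2 * (4 * (351 * K\<^sup>2 * r ^ 6 * (K + real n * (1 + K)) + Kx + Kx)) \<le> 4220 * K ^ 3 * r ^ 8 * real n"
  proof -
    have nK: "1 \<le> K" "1 \<le> real n" "1 \<le> r"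
      using K n r1 by auto
    have "K \<le> K * real n" "real n \<le> K * real n"
      using mult_left_mono[of 1 "real n" K] mult_right_mono[of 1 K "real n"] nK by auto
    moreover have "K + real n * (1 + K) = K + real n + K * real n"
      by (simp add: algebra_simps)
    ultimately have "K + real n * (1 + K) \<le> 3 * (K * real n)"
      by linarith
    then have "351 * K\<^sup>2 * r ^ 6 * (K + real n * (1 + K)) \<le> 351 * K\<^sup>2 * r ^ 6 * (3 * (K * real n))"
      using nK by (intro mult_left_mono) auto
    moreover have "Kx \<le> K ^ 3 * r ^ 6 * real n"
    proof -
      have "K * r ^ 4 * 1 \<le> K ^ 3 * r ^ 6 * real n"
        using nK self_le_power[of K 3] power_increasing[of 4 6 r] by (intro mult_mono) auto
      then show ?thesis
        by (simp add: Kx_def)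
    qed
    ultimately have "351 * K\<^sup>2 * r ^ 6 * (K + real n * (1 + K)) + Kx + Kx \<le> 1055 * (K ^ 3 * r ^ 6 * real n)"
      by (simp add: power3_eq_cube power2_eq_square algebra_simps)
    then have "r\<^sup>2 * (4 * (351 * K\<^sup>2 * r ^ 6 * (K + real n * (1 + K)) + Kx + Kx))
        \<le> r\<^sup>2 * (4 * (1055 * (K ^ 3 * r ^ 6 * real n)))"
      by (intro mult_left_mono) auto
    also have "\<dots> = 4220 * K ^ 3 * r ^ 8 * real n"
      by (simp add: eval_nat_numeral)
    finally show ?thesis .
  qed
qed auto

text \<open>
  The difference of the two centred sums of squares solves a contractive linear equation whose right
  hand side consists of a martingale with small increments and of terms that stay bounded.
\<close>
lemma mean_le_coupled_difference:
  assumes fp: "sandwich P \<Gamma> + S = \<Gamma>" and n: "1 \<le> n"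
    and fp': "norm (real n *\<^sub>R (sandwich P' \<Gamma>' + S' - \<Gamma>')) \<le> \<beta>"
  shows "mean_le Q (\<lambda>\<omega>. (norm (Gx \<Gamma> \<omega> - Gy \<Gamma>' \<omega>))\<^sup>2)
    (138000 * K ^ 3 * r ^ 10 * (K' + real n * g + \<beta>\<^sup>2))"
proof (rule mean_le_mono)
  have \<theta>0: "0 \<le> \<theta>" and \<beta>0: "0 \<le> \<beta>"
    using \<theta> fp' norm_ge_zero order_trans by blast+
  let ?N = "\<lambda>\<omega>. \<Sum>t<n. D t \<omega>"
  let ?R = "\<lambda>\<omega>. 4 * (4 * \<theta>\<^sup>2 * (norm (Gx \<Gamma> \<omega>))\<^sup>2 + (norm (?N \<omega>))\<^sup>2 + \<beta>\<^sup>2)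
        + 4 * (norm (x n \<omega>) ^ 4 + norm (x 0 \<omega>) ^ 4 + norm (y n \<omega>) ^ 4 + norm (y 0 \<omega>) ^ 4)"
  show "mean_le Q (\<lambda>\<omega>. r\<^sup>2 * (2 * ?R \<omega>))
     (r\<^sup>2 * (2 * (4 * (4 * \<theta>\<^sup>2 * (4220 * K ^ 3 * r ^ 8 * real n) + 351 * K\<^sup>2 * r ^ 6 * (K' + real n * g) + \<beta>\<^sup>2)
        + 4 * (Kx + Kx + K' * r ^ 4 + K' * r ^ 4))))"
    by (intro mean_le_cmult mean_le_add mean_le_sum_D mean_le_Gx fp n fourth_x fourth_y mean_le_const) auto
  show "(norm (Gx \<Gamma> \<omega> - Gy \<Gamma>' \<omega>))\<^sup>2 \<le> r\<^sup>2 * (2 * ?R \<omega>)" for \<omega>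
  proof -
    define \<Delta> where "\<Delta> = Gx \<Gamma> \<omega> - Gy \<Gamma>' \<omega>"
    \<comment> \<open>\<open>T\<close> is the error from exchanging the operators on \<open>Gx\<close>, \<open>B\<close> the defect of the second fixed point equation, and \<open>W\<close> the four ends.\<close>
    define T where "T = sandwich P (Gx \<Gamma> \<omega>) - sandwich P' (Gx \<Gamma> \<omega>)"
    define B where "B = real n *\<^sub>R (sandwich P' \<Gamma>' + S' - \<Gamma>')"
    define W where "W = (y n \<omega> \<otimes>\<^sub>H y n \<omega> - y 0 \<omega> \<otimes>\<^sub>H y 0 \<omega>) - (x n \<omega> \<otimes>\<^sub>H x n \<omega> - x 0 \<omega> \<otimes>\<^sub>H x 0 \<omega>)"
    have 1: "Gx \<Gamma> \<omega> = sandwich P (Gx \<Gamma> \<omega>) + ((\<Sum>t<n. x (Suc t) \<omega> \<otimes>\<^sub>H x (Suc t) \<omega> - P (x t \<omega>) \<otimes>\<^sub>H P (x t \<omega>) - S)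
        - (x n \<omega> \<otimes>\<^sub>H x n \<omega> - x 0 \<omega> \<otimes>\<^sub>H x 0 \<omega>))"
      using sum_tensor_square_identity[where X = "\<lambda>t. x t \<omega>" and n = n and \<Gamma> = \<Gamma> and P = P and S = S] fp
      by (simp add: Gx_def)
    have 2: "Gy \<Gamma>' \<omega> = sandwich P' (Gy \<Gamma>' \<omega>) + ((\<Sum>t<n. y (Suc t) \<omega> \<otimes>\<^sub>H y (Suc t) \<omega> - P' (y t \<omega>) \<otimes>\<^sub>H P' (y t \<omega>) - S')
        - (y n \<omega> \<otimes>\<^sub>H y n \<omega> - y 0 \<omega> \<otimes>\<^sub>H y 0 \<omega>) + B)"
      unfolding B_def Gy_def
      by (rule sum_tensor_square_identity[where X = "\<lambda>t. y t \<omega>"])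
    have N: "?N \<omega> = (\<Sum>t<n. x (Suc t) \<omega> \<otimes>\<^sub>H x (Suc t) \<omega> - P (x t \<omega>) \<otimes>\<^sub>H P (x t \<omega>) - S)
        - (\<Sum>t<n. y (Suc t) \<omega> \<otimes>\<^sub>H y (Suc t) \<omega> - P' (y t \<omega>) \<otimes>\<^sub>H P' (y t \<omega>) - S')"
      unfolding D_def by (rule sum_subtractf)
    have "\<Delta> = sandwich P' \<Delta> + (T + ?N \<omega> - B + W)"
    proof -
      have sd: "sandwich P' \<Delta> = sandwich P' (Gx \<Gamma> \<omega>) - sandwich P' (Gy \<Gamma>' \<omega>)"
        by (simp add: \<Delta>_def sandwich_diff)
      show ?thesis
        unfolding T_def N W_def sd
        by (rule trans[OF arg_cong2[where f = "(-)", OF 1 2, folded \<Delta>_def]]) (simp add: algebra_simps)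
    qed
    then have "norm \<Delta> \<le> r * norm (T + ?N \<omega> - B + W)"
      unfolding r_def by (rule norm_le_of_sandwich_fixed_point) (use \<rho> in auto)
    also have "norm (T + ?N \<omega> - B + W) \<le> (2 * \<theta> * norm (Gx \<Gamma> \<omega>) + norm (?N \<omega>) + \<beta> + 0)
        + ((norm (x n \<omega>))\<^sup>2 + (norm (x 0 \<omega>))\<^sup>2 + (norm (y n \<omega>))\<^sup>2 + (norm (y 0 \<omega>))\<^sup>2)"
    proof -
      have "norm T \<le> (norm P + norm P') * norm (P - P') * norm (Gx \<Gamma> \<omega>)"
        unfolding T_def by (rule norm_sandwich_diff_le)
      also have "\<dots> \<le> 2 * \<theta> * norm (Gx \<Gamma> \<omega>)"
        using \<rho> \<theta> \<theta>0 by (intro mult_right_mono mult_mono) auto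
      finally have T: "norm T \<le> 2 * \<theta> * norm (Gx \<Gamma> \<omega>)" .
      have "norm W \<le> (norm (y n \<omega> \<otimes>\<^sub>H y n \<omega>) + norm (y 0 \<omega> \<otimes>\<^sub>H y 0 \<omega>))
          + (norm (x n \<omega> \<otimes>\<^sub>H x n \<omega>) + norm (x 0 \<omega> \<otimes>\<^sub>H x 0 \<omega>))"
        unfolding W_def by (intro order_trans[OF norm_triangle_ineq4] add_mono norm_triangle_ineq4)
      also have "\<dots> \<le> ((norm (y n \<omega>))\<^sup>2 + (norm (y 0 \<omega>))\<^sup>2) + ((norm (x n \<omega>))\<^sup>2 + (norm (x 0 \<omega>))\<^sup>2)"
        unfolding power2_eq_square by (intro add_mono norm_tensor_le)
      finally have W: "norm W \<le> ((norm (y n \<omega>))\<^sup>2 + (norm (y 0 \<omega>))\<^sup>2) + ((norm (x n \<omega>))\<^sup>2 + (norm (x 0 \<omega>))\<^sup>2)" .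
      have "norm (T + ?N \<omega> - B + W) \<le> norm T + norm (?N \<omega>) + norm B + norm W"
        by (intro norm_triangle_le add_right_mono order_trans[OF norm_triangle_ineq4] norm_triangle_ineq)
      with T W fp' show ?thesis
        by (simp add: B_def)
    qed
    finally have "norm \<Delta> \<le> r * ((2 * \<theta> * norm (Gx \<Gamma> \<omega>) + norm (?N \<omega>) + \<beta> + 0)
        + ((norm (x n \<omega>))\<^sup>2 + (norm (x 0 \<omega>))\<^sup>2 + (norm (y n \<omega>))\<^sup>2 + (norm (y 0 \<omega>))\<^sup>2))" (is "_ \<le> r * (?u + ?v)")
      using r1 by simp
    then have "(norm \<Delta>)\<^sup>2 \<le> (r * (?u + ?v))\<^sup>2"
      by (intro power_mono) auto
    also have "\<dots> = r\<^sup>2 * (?u + ?v)\<^sup>2"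
      by (rule power_mult_distrib)
    also have "\<dots> \<le> r\<^sup>2 * (2 * ?u\<^sup>2 + 2 * ?v\<^sup>2)"
      using norm_sq_add_le[of ?u ?v] by (intro mult_left_mono) (simp_all only: real_norm_def power2_abs zero_le_power2)
    also have "\<dots> \<le> r\<^sup>2 * (2 * (4 * ((2 * \<theta> * norm (Gx \<Gamma> \<omega>))\<^sup>2 + (norm (?N \<omega>))\<^sup>2 + \<beta>\<^sup>2 + 0\<^sup>2))
        + 2 * (4 * (((norm (x n \<omega>))\<^sup>2)\<^sup>2 + ((norm (x 0 \<omega>))\<^sup>2)\<^sup>2 + ((norm (y n \<omega>))\<^sup>2)\<^sup>2 + ((norm (y 0 \<omega>))\<^sup>2)\<^sup>2)))"
      by (intro mult_left_mono add_mono square_sum4_le) auto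
    also have "\<dots> = r\<^sup>2 * (2 * ?R \<omega>)"
      by (simp add: power_mult_distrib algebra_simps flip: power_mult)
    finally show ?thesis
      by (simp only: \<Delta>_def)
  qed
  show "(\<lambda>\<omega>. (norm (Gx \<Gamma> \<omega> - Gy \<Gamma>' \<omega>))\<^sup>2) \<in> borel_measurable Q"
  proof -
    have "(\<lambda>\<omega>. (Gx \<Gamma> \<omega>, Gy \<Gamma>' \<omega>)) \<in> Q \<rightarrow>\<^sub>M op_algebra \<Otimes>\<^sub>M op_algebra"
      using measurable_Gx measurable_Gy by (rule measurable_Pair)
    from measurable_compose[OF this measurable_norm_op_diff]
    have "(\<lambda>\<omega>. norm (Gx \<Gamma> \<omega> - Gy \<Gamma>' \<omega>)) \<in> borel_measurable Q"
      by simp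
    then show ?thesis
      by (rule borel_measurable_power)
  qed
  show "r\<^sup>2 * (2 * (4 * (4 * \<theta>\<^sup>2 * (4220 * K ^ 3 * r ^ 8 * real n) + 351 * K\<^sup>2 * r ^ 6 * (K' + real n * g) + \<beta>\<^sup>2)
        + 4 * (Kx + Kx + K' * r ^ 4 + K' * r ^ 4)))
      \<le> 138000 * K ^ 3 * r ^ 10 * (K' + real n * g + \<beta>\<^sup>2)"
  proof -
    define c where "c = K ^ 3 * r ^ 8"
    define z where "z = K' + real n * g + \<beta>\<^sup>2"
    have nK: "1 \<le> K" "1 \<le> r" "K \<le> K'" "1 \<le> K'" "0 \<le> real n * g"
      using K n r1 g0 by auto
    have c1: "1 \<le> c" "K\<^sup>2 * r ^ 6 \<le> c" "r ^ 4 \<le> c" "0 \<le> c"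
    proof -
      have "1 * 1 \<le> K ^ 3 * r ^ 8"
        using nK by (intro mult_mono) auto
      then show "1 \<le> c" "0 \<le> c"
        by (auto simp: c_def)
      show "K\<^sup>2 * r ^ 6 \<le> c"
        unfolding c_def using nK by (intro mult_mono power_increasing) auto
      have "1 * r ^ 4 \<le> K ^ 3 * r ^ 8"
        using nK by (intro mult_mono power_increasing) auto
      then show "r ^ 4 \<le> c"
        by (simp add: c_def)
    qed
    have z: "0 \<le> z" "K \<le> z" "K' \<le> z" "real n * g \<le> z" "\<beta>\<^sup>2 \<le> z" "K' + real n * g \<le> z"
      using nK zero_le_power2[of \<beta>] unfolding z_def by linarith+
    have "\<theta>\<^sup>2 * real n \<le> g * real n"
      using s by (intro mult_right_mono) (auto simp: g_def)
    then have "\<theta>\<^sup>2 * real n \<le> z"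
      using z by (simp add: mult.commute)
    then have a1: "4 * \<theta>\<^sup>2 * (4220 * K ^ 3 * r ^ 8 * real n) \<le> 16880 * (c * z)"
      using mult_left_mono[of "\<theta>\<^sup>2 * real n" z c] c1 by (simp add: c_def ac_simps)
    have "K\<^sup>2 * r ^ 6 * (K' + real n * g) \<le> c * z"
      using nK c1 z by (intro mult_mono) auto
    then have "351 * K\<^sup>2 * r ^ 6 * (K' + real n * g) \<le> 351 * (c * z)"
      by (simp only: mult.assoc)
    moreover have "1 * \<beta>\<^sup>2 \<le> c * z"
      using nK c1 z by (intro mult_mono) auto
    then have "\<beta>\<^sup>2 \<le> c * z"
      by simp
    moreover have "K' * r ^ 4 \<le> c * z"
      using mult_mono[of "r ^ 4" c K' z] nK c1 z by (simp add: mult.commute)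
    moreover have "Kx \<le> c * z"
      using mult_mono[of "r ^ 4" c K z] nK c1 z by (simp add: Kx_def mult.commute)
    moreover have "4 * (4 * \<theta>\<^sup>2 * (4220 * K ^ 3 * r ^ 8 * real n) + 351 * K\<^sup>2 * r ^ 6 * (K' + real n * g) + \<beta>\<^sup>2)
        + 4 * (Kx + Kx + K' * r ^ 4 + K' * r ^ 4) \<le> 69000 * (c * z)"
    proof -
      have gen: "4 * (A + B + C) + 4 * (E + E + F + F) \<le> 69000 * w"
        if "B \<le> 351 * w" "C \<le> w" "F \<le> w" "E \<le> w" "A \<le> 16880 * w" "0 \<le> w" for A B C E F w :: real
        using that by simp
      show ?thesis
        using calculation a1 mult_nonneg_nonneg[OF c1(4) z(1)] by (rule gen)
    qed
    ultimately have "r\<^sup>2 * (2 * (4 * (4 * \<theta>\<^sup>2 * (4220 * K ^ 3 * r ^ 8 * real n) + 351 * K\<^sup>2 * r ^ 6 * (K' + real n * g) + \<beta>\<^sup>2)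
        + 4 * (Kx + Kx + K' * r ^ 4 + K' * r ^ 4))) \<le> r\<^sup>2 * (2 * (69000 * (c * z)))"
      by (intro mult_left_mono) auto
    also have "\<dots> = 138000 * K ^ 3 * r ^ 10 * z"
      by (simp add: c_def eval_nat_numeral)
    finally show ?thesis
      by (simp only: z_def)
  qed
qed auto

end


section \<open>Calculus of convergence in outer probability\<close>

text \<open>
  Events are not assumed to be measurable, hence the outer measure. Statements about random
  quantities are made as statements about events that become likely, and one works pointwise on them.
\<close>
definition likely :: "'w measure \<Rightarrow> (nat \<Rightarrow> 'w \<Rightarrow> bool) \<Rightarrow> bool" where
  "likely M S \<longleftrightarrow> (\<lambda>n. outer_measure_of M {\<omega> \<in> space M. \<not> S n \<omega>}) \<longlonglongrightarrow> 0"

text \<open>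
  Convergence to zero in probability of a quantity that is nonnegative; only upper bounds matter, so no
  absolute value is taken and monotonicity is immediate.
\<close>
definition small :: "'w measure \<Rightarrow> (nat \<Rightarrow> 'w \<Rightarrow> real) \<Rightarrow> bool" where
  "small M A \<longleftrightarrow> (\<forall>c>0. likely M (\<lambda>n \<omega>. A n \<omega> \<le> c))"

definition stoch_bounded :: "'w measure \<Rightarrow> (nat \<Rightarrow> 'w \<Rightarrow> real) \<Rightarrow> bool" where
  "stoch_bounded M B \<longleftrightarrow> (\<forall>\<eta>>0. \<exists>L>0. \<forall>\<^sub>F n in sequentially.
     outer_measure_of M {\<omega> \<in> space M. \<not> B n \<omega> \<le> L} \<le> ennreal \<eta>)"

lemma outer_measure_of_Un_le:
  assumes "A \<subseteq> space M" "B \<subseteq> space M"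
  shows "outer_measure_of M (A \<union> B) \<le> outer_measure_of M A + outer_measure_of M B"
proof -
  obtain E where E: "E \<in> sets M" "A \<subseteq> E" "outer_measure_of M A = emeasure M E"
    using outer_measure_of_attain[OF assms(1)] by blast
  obtain F where F: "F \<in> sets M" "B \<subseteq> F" "outer_measure_of M B = emeasure M F"
    using outer_measure_of_attain[OF assms(2)] by blast
  have "outer_measure_of M (A \<union> B) \<le> outer_measure_of M (E \<union> F)"
    using E F by (intro outer_measure_of_mono) auto
  also have "\<dots> = emeasure M (E \<union> F)"
    using E F by simp
  also have "\<dots> \<le> emeasure M E + emeasure M F"
    using E F by (intro emeasure_subadditive)
  finally show ?thesis
    using E F by simp
qed

lemma likelyI:
  assumes "\<And>\<eta>. 0 < \<eta> \<Longrightarrow> \<forall>\<^sub>F n in sequentially. outer_measure_of M {\<omega> \<in> space M. \<not> S n \<omega>} \<le> ennreal \<eta>"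
  shows "likely M S"
  unfolding likely_def
proof (rule order_tendstoI)
  fix a :: ennreal assume "0 < a"
  then obtain e where e: "0 < e" "e < a"
    using dense by blast
  obtain \<eta> where "e = ennreal \<eta>" "0 \<le> \<eta>"
    using e by (cases e) auto
  with e have \<eta>: "0 < \<eta>" "ennreal \<eta> < a"
    by auto
  show "\<forall>\<^sub>F n in sequentially. outer_measure_of M {\<omega> \<in> space M. \<not> S n \<omega>} < a"
    using assms[OF \<eta>(1)] \<eta>(2) by (auto elim!: eventually_mono intro: le_less_trans)
qed auto

lemma likelyD:
  assumes "likely M S" "0 < \<eta>"
  shows "\<forall>\<^sub>F n in sequentially. outer_measure_of M {\<omega> \<in> space M. \<not> S n \<omega>} \<le> ennreal \<eta>"
proof -
  have "\<forall>\<^sub>F n in sequentially. outer_measure_of M {\<omega> \<in> space M. \<not> S n \<omega>} < ennreal \<eta>"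
    using assms unfolding likely_def by (intro order_tendstoD) auto
  then show ?thesis
    by (auto elim: eventually_mono)
qed

lemma likely_mono:
  assumes "likely M S" "\<forall>\<^sub>F n in sequentially. \<forall>\<omega>\<in>space M. S n \<omega> \<longrightarrow> T n \<omega>"
  shows "likely M T"
proof (rule likelyI)
  fix \<eta> :: real assume "0 < \<eta>"
  from likelyD[OF assms(1) this] assms(2)
  show "\<forall>\<^sub>F n in sequentially. outer_measure_of M {\<omega> \<in> space M. \<not> T n \<omega>} \<le> ennreal \<eta>"
  proof eventually_elim
    case (elim n)
    have "outer_measure_of M {\<omega> \<in> space M. \<not> T n \<omega>} \<le> outer_measure_of M {\<omega> \<in> space M. \<not> S n \<omega>}"
      using elim(2) by (intro outer_measure_of_mono) auto
    with elim(1) show ?case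
      by (rule order_trans[rotated])
  qed
qed

lemma outer_measure_of_conj_le:
  "outer_measure_of M {\<omega> \<in> space M. \<not> (S \<omega> \<and> T \<omega>)}
     \<le> outer_measure_of M {\<omega> \<in> space M. \<not> S \<omega>} + outer_measure_of M {\<omega> \<in> space M. \<not> T \<omega>}"
proof -
  have "{\<omega> \<in> space M. \<not> (S \<omega> \<and> T \<omega>)} = {\<omega> \<in> space M. \<not> S \<omega>} \<union> {\<omega> \<in> space M. \<not> T \<omega>}"
    by auto
  then show ?thesis
    using outer_measure_of_Un_le[of "{\<omega> \<in> space M. \<not> S \<omega>}" M "{\<omega> \<in> space M. \<not> T \<omega>}"] by simp
qed

lemma likely_conj:
  assumes "likely M S" "likely M T"
  shows "likely M (\<lambda>n \<omega>. S n \<omega> \<and> T n \<omega>)"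
  unfolding likely_def
proof (rule tendsto_sandwich[OF _ _ tendsto_const])
  show "(\<lambda>n. outer_measure_of M {\<omega> \<in> space M. \<not> S n \<omega>} + outer_measure_of M {\<omega> \<in> space M. \<not> T n \<omega>}) \<longlonglongrightarrow> 0"
    using tendsto_add[OF assms[unfolded likely_def]] by simp
  show "\<forall>\<^sub>F n in sequentially. outer_measure_of M {\<omega> \<in> space M. \<not> (S n \<omega> \<and> T n \<omega>)}
      \<le> outer_measure_of M {\<omega> \<in> space M. \<not> S n \<omega>} + outer_measure_of M {\<omega> \<in> space M. \<not> T n \<omega>}"
    by (intro always_eventually allI outer_measure_of_conj_le)
qed simp

lemma likely_eventually:
  assumes "\<forall>\<^sub>F n in sequentially. \<forall>\<omega>\<in>space M. S n \<omega>"
  shows "likely M S"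
proof (rule likely_mono)
  have "{\<omega> \<in> space M. \<not> True} = {}"
    by auto
  then show "likely M (\<lambda>_ _. True)"
    by (simp add: likely_def)
qed (use assms in auto)

lemma likely_AE:
  assumes "\<And>n. AE \<omega> in M. S n \<omega>"
  shows "likely M S"
proof -
  have "outer_measure_of M {\<omega> \<in> space M. \<not> S n \<omega>} = 0" for n
  proof -
    obtain N where "N \<in> sets M" "emeasure M N = 0" "{\<omega> \<in> space M. \<not> S n \<omega>} \<subseteq> N"
      using assms[of n] by (auto elim!: AE_E)
    then show ?thesis
      using outer_measure_of_mono[of "{\<omega> \<in> space M. \<not> S n \<omega>}" N M] by simp
  qed
  then show ?thesis
    by (simp add: likely_def)
qed

lemma smallD: "small M A \<Longrightarrow> 0 < c \<Longrightarrow> likely M (\<lambda>n \<omega>. A n \<omega> \<le> c)"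
  by (simp add: small_def)

lemma small_mono:
  assumes "small M A" "likely M S"
    and "\<forall>\<^sub>F n in sequentially. \<forall>\<omega>\<in>space M. S n \<omega> \<longrightarrow> B n \<omega> \<le> A n \<omega>"
  shows "small M B"
  unfolding small_def
proof (intro allI impI)
  fix c :: real assume c: "0 < c"
  show "likely M (\<lambda>n \<omega>. B n \<omega> \<le> c)"
    by (rule likely_mono[OF likely_conj[OF smallD[OF assms(1) c] assms(2)]])
       (use assms(3) in \<open>force elim!: eventually_mono\<close>)
qed

lemma small_add:
  assumes "small M A" "small M B"
  shows "small M (\<lambda>n \<omega>. A n \<omega> + B n \<omega>)"
  unfolding small_def
proof (intro allI impI)
  fix c :: real assume "0 < c"
  then have "likely M (\<lambda>n \<omega>. A n \<omega> \<le> c / 2 \<and> B n \<omega> \<le> c / 2)"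
    by (intro likely_conj smallD assms) auto
  then show "likely M (\<lambda>n \<omega>. A n \<omega> + B n \<omega> \<le> c)"
    by (rule likely_mono) (auto intro!: always_eventually)
qed

lemma small_sum:
  fixes m :: nat
  assumes "\<And>i. i < m \<Longrightarrow> small M (A i)"
  shows "small M (\<lambda>n \<omega>. \<Sum>i<m. A i n \<omega>)"
  using assms
proof (induction m)
  case 0
  show ?case
    by (auto simp: small_def intro!: likely_eventually always_eventually)
next
  case (Suc m)
  then show ?case
    by (auto intro!: small_add)
qed

lemma small_mult_stoch_bounded:
  assumes "small M A" "stoch_bounded M B" "\<And>n \<omega>. \<omega> \<in> space M \<Longrightarrow> 0 \<le> B n \<omega>"
  shows "small M (\<lambda>n \<omega>. A n \<omega> * B n \<omega>)"
  unfolding small_def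
proof (intro allI impI likelyI)
  fix c \<eta> :: real assume c: "0 < c" and \<eta>: "0 < \<eta>"
  obtain L where L: "0 < L"
      "\<forall>\<^sub>F n in sequentially. outer_measure_of M {\<omega> \<in> space M. \<not> B n \<omega> \<le> L} \<le> ennreal (\<eta> / 2)"
    using assms(2)[unfolded stoch_bounded_def, rule_format, of "\<eta> / 2"] \<eta> by auto
  have "likely M (\<lambda>n \<omega>. A n \<omega> \<le> c / L)"
    using c L by (intro smallD assms) auto
  from likelyD[OF this, of "\<eta> / 2"] \<eta>
  have "\<forall>\<^sub>F n in sequentially. outer_measure_of M {\<omega> \<in> space M. \<not> A n \<omega> \<le> c / L} \<le> ennreal (\<eta> / 2)"
    by simp
  with L(2) show "\<forall>\<^sub>F n in sequentially. outer_measure_of M {\<omega> \<in> space M. \<not> A n \<omega> * B n \<omega> \<le> c} \<le> ennreal \<eta>"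
  proof eventually_elim
    case (elim n)
    have "A n \<omega> * B n \<omega> \<le> c" if "\<omega> \<in> space M" "B n \<omega> \<le> L" "A n \<omega> \<le> c / L" for \<omega>
    proof -
      have "A n \<omega> * B n \<omega> \<le> (c / L) * B n \<omega>"
        using that assms(3) by (intro mult_right_mono) auto
      also have "\<dots> \<le> (c / L) * L"
        using that c L(1) by (intro mult_left_mono) auto
      finally show ?thesis
        using L(1) by simp
    qed
    then have "outer_measure_of M {\<omega> \<in> space M. \<not> A n \<omega> * B n \<omega> \<le> c}
        \<le> outer_measure_of M {\<omega> \<in> space M. \<not> (B n \<omega> \<le> L \<and> A n \<omega> \<le> c / L)}"
      by (intro outer_measure_of_mono) auto
    also have "\<dots> \<le> outer_measure_of M {\<omega> \<in> space M. \<not> B n \<omega> \<le> L} + outer_measure_of M {\<omega> \<in> space M. \<not> A n \<omega> \<le> c / L}"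
      by (rule outer_measure_of_conj_le)
    also have "\<dots> \<le> ennreal (\<eta> / 2) + ennreal (\<eta> / 2)"
      by (intro add_mono elim)
    also have "\<dots> = ennreal \<eta>"
      using \<eta> by (simp flip: ennreal_plus)
    finally show ?case .
  qed
qed

lemma stoch_bounded_const: "stoch_bounded M (\<lambda>_ _. c)"
proof -
  have "{\<omega> \<in> space M. \<not> c \<le> max c 1} = {}"
    by auto
  then show ?thesis
    unfolding stoch_bounded_def by (intro allI impI exI[of _ "max c 1"]) auto
qed

lemma small_cmult: "small M A \<Longrightarrow> 0 \<le> c \<Longrightarrow> small M (\<lambda>n \<omega>. c * A n \<omega>)"
  using small_mult_stoch_bounded[OF _ stoch_bounded_const, of M A c] by (simp add: mult.commute)

lemma small_power:
  assumes "small M A" "\<And>n \<omega>. \<omega> \<in> space M \<Longrightarrow> 0 \<le> A n \<omega>" "1 \<le> m"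
  shows "small M (\<lambda>n \<omega>. A n \<omega> ^ m)"
proof (rule small_mono[OF assms(1)])
  show "likely M (\<lambda>n \<omega>. A n \<omega> \<le> 1)"
    by (rule smallD[OF assms(1)]) simp
  have "u ^ m \<le> u" if "0 \<le> u" "u \<le> 1" for u :: real
    using power_decreasing[OF \<open>1 \<le> m\<close> that] by simp
  then show "\<forall>\<^sub>F n in sequentially. \<forall>\<omega>\<in>space M. A n \<omega> \<le> 1 \<longrightarrow> A n \<omega> ^ m \<le> A n \<omega>"
    using assms(2) by (intro always_eventually) auto
qed

lemma outer_markov:
  assumes "mean_le M A c" and "\<And>\<omega>. \<omega> \<in> space M \<Longrightarrow> 0 \<le> A \<omega>" and t: "0 < t"
  shows "outer_measure_of M {\<omega> \<in> space M. \<not> A \<omega> \<le> t} \<le> ennreal (c / t)"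
proof -
  note int = mean_leD[OF assms(1)]
  have [measurable]: "A \<in> borel_measurable M"
    using int(1) by auto
  have "outer_measure_of M {\<omega> \<in> space M. \<not> A \<omega> \<le> t} \<le> outer_measure_of M {\<omega> \<in> space M. t \<le> A \<omega>}"
    by (intro outer_measure_of_mono) auto
  also have "\<dots> = emeasure M {\<omega> \<in> space M. t \<le> A \<omega>}"
    by (rule outer_measure_of_eq) measurable
  also have "\<dots> \<le> ennreal ((1 / t) * (\<integral>\<omega>. A \<omega> \<partial>M))"
    using assms(2) by (intro integral_Markov_inequality int t AE_I2) auto
  also have "\<dots> \<le> ennreal (c / t)"
    using int(2) t by (intro ennreal_leI) (simp add: divide_right_mono)
  finally show ?thesis .
qed

lemma small_of_mean:
  assumes "\<forall>\<^sub>F n in sequentially. mean_le M (A n) (c n)" "\<And>n \<omega>. \<omega> \<in> space M \<Longrightarrow> 0 \<le> A n \<omega>" "c \<longlonglongrightarrow> 0"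
  shows "small M A"
  unfolding small_def
proof (intro allI impI likelyI)
  fix t \<eta> :: real assume t: "0 < t" and \<eta>: "0 < \<eta>"
  have "\<forall>\<^sub>F n in sequentially. c n < \<eta> * t"
    using assms(3) t \<eta> by (intro order_tendstoD) auto
  with assms(1) show "\<forall>\<^sub>F n in sequentially. outer_measure_of M {\<omega> \<in> space M. \<not> A n \<omega> \<le> t} \<le> ennreal \<eta>"
  proof eventually_elim
    case (elim n)
    have "outer_measure_of M {\<omega> \<in> space M. \<not> A n \<omega> \<le> t} \<le> ennreal (c n / t)"
      by (rule outer_markov[OF elim(1) assms(2) t])
    also have "\<dots> \<le> ennreal \<eta>"
      using elim(2) t by (intro ennreal_leI) (simp add: divide_le_eq)
    finally show ?case .
  qed
qed

lemma stoch_bounded_of_mean: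
  assumes "\<forall>\<^sub>F n in sequentially. mean_le M (A n) c" "\<And>n \<omega>. \<omega> \<in> space M \<Longrightarrow> 0 \<le> A n \<omega>"
  shows "stoch_bounded M A"
  unfolding stoch_bounded_def
proof (intro allI impI)
  fix \<eta> :: real assume \<eta>: "0 < \<eta>"
  define L where "L = (\<bar>c\<bar> + 1) / \<eta>"
  have L: "0 < L"
    using \<eta> by (simp add: L_def)
  have "\<eta> * L = \<bar>c\<bar> + 1"
    using \<eta> by (simp add: L_def)
  then have "c / L \<le> \<eta>"
    using L by (simp add: pos_divide_le_eq)
  then have "outer_measure_of M {\<omega> \<in> space M. \<not> A n \<omega> \<le> L} \<le> ennreal \<eta>" if "mean_le M (A n) c" for n
    using outer_markov[OF that assms(2) L] by (meson ennreal_leI order_trans)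
  then show "\<exists>L>0. \<forall>\<^sub>F n in sequentially. outer_measure_of M {\<omega> \<in> space M. \<not> A n \<omega> \<le> L} \<le> ennreal \<eta>"
    using L assms(1) by (auto intro!: exI[of _ L] elim!: eventually_mono)
qed

lemma stoch_bounded_of_bounded_in_prob:
  assumes "bounded_in_prob M Y"
  shows "stoch_bounded M (\<lambda>n \<omega>. norm (Y n \<omega>))"
  unfolding stoch_bounded_def
proof (intro allI impI)
  fix \<eta> :: real assume "0 < \<eta>"
  then obtain K where K: "\<forall>\<^sub>F n in sequentially. outer_measure_of M {\<omega> \<in> space M. norm (Y n \<omega>) > K} \<le> ennreal \<eta>"
    using assms unfolding bounded_in_prob_def by blast
  show "\<exists>L>0. \<forall>\<^sub>F n in sequentially. outer_measure_of M {\<omega> \<in> space M. \<not> norm (Y n \<omega>) \<le> L} \<le> ennreal \<eta>"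
  proof (intro exI conjI)
    show "0 < max K 1"
      by simp
    show "\<forall>\<^sub>F n in sequentially. outer_measure_of M {\<omega> \<in> space M. \<not> norm (Y n \<omega>) \<le> max K 1} \<le> ennreal \<eta>"
      using K
    proof eventually_elim
      case (elim n)
      have "outer_measure_of M {\<omega> \<in> space M. \<not> norm (Y n \<omega>) \<le> max K 1}
          \<le> outer_measure_of M {\<omega> \<in> space M. norm (Y n \<omega>) > K}"
        by (intro outer_measure_of_mono) auto
      with elim show ?case
        by (rule order_trans[rotated])
    qed
  qed
qed

lemma stoch_bounded_power:
  assumes "stoch_bounded M B" "\<And>n \<omega>. \<omega> \<in> space M \<Longrightarrow> 0 \<le> B n \<omega>"
  shows "stoch_bounded M (\<lambda>n \<omega>. B n \<omega> ^ m)"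
  unfolding stoch_bounded_def
proof (intro allI impI)
  fix \<eta> :: real assume "0 < \<eta>"
  then obtain L where L: "0 < L" "\<forall>\<^sub>F n in sequentially. outer_measure_of M {\<omega> \<in> space M. \<not> B n \<omega> \<le> L} \<le> ennreal \<eta>"
    using assms unfolding stoch_bounded_def by blast
  show "\<exists>L>0. \<forall>\<^sub>F n in sequentially. outer_measure_of M {\<omega> \<in> space M. \<not> B n \<omega> ^ m \<le> L} \<le> ennreal \<eta>"
  proof (intro exI conjI)
    show "0 < L ^ m"
      using L by simp
    show "\<forall>\<^sub>F n in sequentially. outer_measure_of M {\<omega> \<in> space M. \<not> B n \<omega> ^ m \<le> L ^ m} \<le> ennreal \<eta>"
      using L(2)
    proof eventually_elim
      case (elim n)
      have "outer_measure_of M {\<omega> \<in> space M. \<not> B n \<omega> ^ m \<le> L ^ m} \<le> outer_measure_of M {\<omega> \<in> space M. \<not> B n \<omega> \<le> L}"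
        using assms(2) by (intro outer_measure_of_mono) (auto intro: power_mono)
      with elim show ?case
        by (rule order_trans[rotated])
    qed
  qed
qed

lemma small_of_tendsto:
  assumes "c \<longlonglongrightarrow> 0"
  shows "small M (\<lambda>n _. c n)"
  unfolding small_def
proof (intro allI impI)
  fix t :: real assume "0 < t"
  then have "\<forall>\<^sub>F n in sequentially. c n < t"
    using assms by (intro order_tendstoD) auto
  then show "likely M (\<lambda>n \<omega>. c n \<le> t)"
    by (intro likely_eventually) (auto elim!: eventually_mono)
qed


section \<open>The stationary autoregression\<close>

lemma (in prob_space) distr_eq_mean_le:
  assumes "distr M N f = distr M N g" and "f \<in> M \<rightarrow>\<^sub>M N" "g \<in> M \<rightarrow>\<^sub>M N" and "h \<in> borel_measurable N"
    and "mean_le M (\<lambda>\<omega>. h (f \<omega>)) c"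
  shows "mean_le M (\<lambda>\<omega>. h (g \<omega>)) c"
  using assms integrable_distr_eq[of f M N h] integrable_distr_eq[of g M N h]
    integral_distr[of f M N h] integral_distr[of g M N h]
  unfolding mean_le_def by simp

text \<open>
  A solution of the recursion on the whole time axis that is stationary and integrable is a function of
  past innovations, whatever its construction: iterating backwards, the starting value is contracted
  away. Its independence of future innovations and its fourth moments are thus consequences.
\<close>
locale stationary_autoregression = prob_space M
  for M :: "'w measure" +
  fixes X \<epsilon> :: "int \<Rightarrow> 'w \<Rightarrow> 'h::{real_inner, banach, second_countable_topology}"
    and \<Psi> :: "'h \<Rightarrow>\<^sub>L 'h"
  assumes stationary: "stationary_process M X"
    and far1: "\<And>t. AE \<omega> in M. X (t + 1) \<omega> = \<Psi> (X t \<omega>) + \<epsilon> (t + 1) \<omega>"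
    and mean_X: "\<And>t. integrable M (X t)"
    and iid_indep: "indep_vars (\<lambda>_. borel) \<epsilon> UNIV"
    and iid_ident: "\<And>s t. distr M borel (\<epsilon> s) = distr M borel (\<epsilon> t)"
    and mean_eps: "\<And>t. (\<integral>\<omega>. \<epsilon> t \<omega> \<partial>M) = 0"
    and moment_eps: "\<And>t. integrable M (\<lambda>\<omega>. norm (\<epsilon> t \<omega>) ^ 4)"
    and Psi_norm: "norm \<Psi> < 1"
begin

abbreviation "\<rho> \<equiv> norm \<Psi>"

lemma X_measurable [measurable]: "X t \<in> borel_measurable M"
  using stationary by (simp add: stationary_process_def)

lemma eps_measurable [measurable]: "\<epsilon> t \<in> borel_measurable M"
  using iid_indep by (simp add: indep_vars_def)

lemma distr_X: "distr M borel (X t) = distr M borel (X 0)"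
proof -
  have 1: "(\<lambda>f. f (0::int)) \<in> PiM UNIV (\<lambda>_. borel) \<rightarrow>\<^sub>M (borel :: 'h measure)"
    by (rule measurable_component_singleton) simp
  have 2: "(\<lambda>\<omega> s. X (s + h) \<omega>) \<in> M \<rightarrow>\<^sub>M PiM UNIV (\<lambda>_. borel)" for h
    by (rule measurable_PiM_single') auto
  have eq: "distr M (PiM UNIV (\<lambda>_. borel)) (\<lambda>\<omega> s. X (s + t) \<omega>) = distr M (PiM UNIV (\<lambda>_. borel)) (\<lambda>\<omega> s. X s \<omega>)"
    using stationary by (simp add: stationary_process_def)
  have "distr M borel (X t) = distr (distr M (PiM UNIV (\<lambda>_. borel)) (\<lambda>\<omega> s. X (s + t) \<omega>)) borel (\<lambda>f. f 0)"
    using distr_distr[OF 1 2[of t]] by (simp add: o_def)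
  also have "\<dots> = distr M borel (X 0)"
    unfolding eq using distr_distr[OF 1 2[of 0]] by (simp add: o_def)
  finally show ?thesis .
qed

definition c\<^sub>4 :: real where "c\<^sub>4 = (\<integral>\<omega>. norm (\<epsilon> 0 \<omega>) ^ 4 \<partial>M)"

lemma eps_fourth: "mean_le M (\<lambda>\<omega>. norm (\<epsilon> t \<omega>) ^ 4) c\<^sub>4"
proof (rule distr_eq_mean_le[OF iid_ident[of 0 t], where h = "\<lambda>z. norm z ^ 4"])
  show "mean_le M (\<lambda>\<omega>. norm (\<epsilon> 0 \<omega>) ^ 4) c\<^sub>4"
    using moment_eps[of 0] by (simp add: mean_le_def c\<^sub>4_def)
qed measurable

lemma c\<^sub>4_nonneg: "0 \<le> c\<^sub>4"
  by (rule mean_le_nonneg[OF eps_fourth[of 0]]) simp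

text \<open>
  The recursion started from zero at time \<open>-m\<close>, evaluated at time \<open>0\<close>.
\<close>
definition backward :: "nat \<Rightarrow> (int \<Rightarrow> 'h) \<Rightarrow> 'h" where
  "backward m f = boot_path \<Psi> 0 (\<lambda>i. f (int i - int m)) m"

lemma backward_cong: "(\<And>i. i \<le> 0 \<Longrightarrow> f i = g i) \<Longrightarrow> backward m f = backward m g"
  unfolding backward_def by (rule boot_path_cong) auto

lemma backward_measurable: "backward m \<in> PiM {..0} (\<lambda>_. borel) \<rightarrow>\<^sub>M borel"
  unfolding backward_def[abs_def]
proof (rule measurable_boot_path)
  fix i assume "1 \<le> i" "i \<le> m"
  then show "(\<lambda>f. f (int i - int m)) \<in> PiM {..0} (\<lambda>_. borel) \<rightarrow>\<^sub>M borel"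
    by (intro measurable_component_singleton) auto
qed simp

lemma recursion_AE: "AE \<omega> in M. \<forall>t. X (t + 1) \<omega> = \<Psi> (X t \<omega>) + \<epsilon> (t + 1) \<omega>"
  unfolding AE_all_countable using far1 by blast

lemma backward_error:
  assumes "\<forall>t. X (t + 1) \<omega> = \<Psi> (X t \<omega>) + \<epsilon> (t + 1) \<omega>"
  shows "norm (X 0 \<omega> - backward m (\<lambda>i. \<epsilon> i \<omega>)) \<le> \<rho> ^ m * norm (X (- int m) \<omega>)"
proof -
  have "norm (X (int s - int m) \<omega> - boot_path \<Psi> 0 (\<lambda>i. \<epsilon> (int i - int m) \<omega>) s) \<le> \<rho> ^ s * norm (X (- int m) \<omega>)" for s
  proof (induction s)
    case (Suc s)
    have "X (int (Suc s) - int m) \<omega> = \<Psi> (X (int s - int m) \<omega>) + \<epsilon> (int (Suc s) - int m) \<omega>"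
      using assms[rule_format, of "int s - int m"] by (simp add: algebra_simps)
    then have "norm (X (int (Suc s) - int m) \<omega> - boot_path \<Psi> 0 (\<lambda>i. \<epsilon> (int i - int m) \<omega>) (Suc s))
        = norm (\<Psi> (X (int s - int m) \<omega> - boot_path \<Psi> 0 (\<lambda>i. \<epsilon> (int i - int m) \<omega>) s))"
      by (simp add: blinfun.diff_right)
    also have "\<dots> \<le> \<rho> * (\<rho> ^ s * norm (X (- int m) \<omega>))"
      by (intro order_trans[OF norm_blinfun] mult_left_mono Suc) auto
    finally show ?case
      by simp
  qed simp
  from this[of m] show ?thesis
    by (simp add: backward_def)
qed

text \<open>By stationarity the means of the terms form a geometric series.\<close>
lemma summable_AE: "AE \<omega> in M. summable (\<lambda>m. \<rho> ^ m * norm (X (- int m) \<omega>))"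
proof -
  define e where "e = (\<integral>\<omega>. norm (X 0 \<omega>) \<partial>M)"
  have "mean_le M (\<lambda>\<omega>. norm (X 0 \<omega>)) e"
    using mean_X[of 0] by (simp add: mean_le_def e_def)
  then have mean: "mean_le M (\<lambda>\<omega>. norm (X t \<omega>)) e" for t
    by (intro distr_eq_mean_le[OF distr_X[of t, symmetric], where h = norm]) auto
  have e0: "0 \<le> e"
    by (rule mean_le_nonneg[OF mean[of 0]]) simp
  have "(\<integral>\<^sup>+\<omega>. (\<Sum>m. ennreal (\<rho> ^ m * norm (X (- int m) \<omega>))) \<partial>M)
      = (\<Sum>m. \<integral>\<^sup>+\<omega>. ennreal (\<rho> ^ m * norm (X (- int m) \<omega>)) \<partial>M)"
    by (rule nn_integral_suminf) measurable
  also have "\<dots> \<le> (\<Sum>m. ennreal (\<rho> ^ m * e))"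
  proof (intro suminf_le)
    fix m
    have "(\<integral>\<^sup>+\<omega>. ennreal (\<rho> ^ m * norm (X (- int m) \<omega>)) \<partial>M)
        = ennreal (\<integral>\<omega>. \<rho> ^ m * norm (X (- int m) \<omega>) \<partial>M)"
      using mean_X by (intro nn_integral_eq_integral) auto
    also have "\<dots> \<le> ennreal (\<rho> ^ m * e)"
      using mean_leD(2)[OF mean[of "- int m"]] by (intro ennreal_leI) (simp add: mult_left_mono)
    finally show "(\<integral>\<^sup>+\<omega>. ennreal (\<rho> ^ m * norm (X (- int m) \<omega>)) \<partial>M) \<le> ennreal (\<rho> ^ m * e)" .
  qed auto
  also have "\<dots> < top"
  proof -
    have "summable (\<lambda>m. \<rho> ^ m * e)"
      using Psi_norm by (intro summable_mult2 summable_geometric) simp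
    then have "(\<Sum>m. ennreal (\<rho> ^ m * e)) = ennreal (\<Sum>m. \<rho> ^ m * e)"
      using e0 by (intro suminf_ennreal2) auto
    then show ?thesis
      by simp
  qed
  finally have "AE \<omega> in M. (\<Sum>m. ennreal (\<rho> ^ m * norm (X (- int m) \<omega>))) \<noteq> \<infinity>"
    by (intro nn_integral_PInf_AE) (auto simp: top.not_eq_extremum)
  then show ?thesis
    by eventually_elim (auto intro!: summable_suminf_not_top)
qed

text \<open>
  A version of \<open>X 0\<close> that is, at every point of the sample space, a function of the innovations up to
  time \<open>0\<close>.
\<close>
definition G :: "'w \<Rightarrow> 'h" where
  "G \<omega> = lim (\<lambda>m. backward m (\<lambda>i. \<epsilon> i \<omega>))"

lemma backward_converges: "AE \<omega> in M. (\<lambda>m. backward m (\<lambda>i. \<epsilon> i \<omega>)) \<longlonglongrightarrow> X 0 \<omega>"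
  using recursion_AE summable_AE
proof eventually_elim
  case (elim \<omega>)
  have "(\<lambda>m. norm (X 0 \<omega> - backward m (\<lambda>i. \<epsilon> i \<omega>))) \<longlonglongrightarrow> 0"
    by (rule tendsto_sandwich[OF _ _ tendsto_const summable_LIMSEQ_zero[OF elim(2)]])
       (use backward_error[OF elim(1)] in auto)
  then have "(\<lambda>m. X 0 \<omega> - backward m (\<lambda>i. \<epsilon> i \<omega>)) \<longlonglongrightarrow> 0"
    by (rule tendsto_norm_zero_cancel)
  from tendsto_diff[OF tendsto_const[of "X 0 \<omega>"] this] show ?case
    by simp
qed

lemma X0_eq_G: "AE \<omega> in M. X 0 \<omega> = G \<omega>"
  using backward_converges by eventually_elim (simp add: G_def limI)

text \<open>
  The present is a function of the innovations up to the present, hence independent of the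
  innovations to come.
\<close>
lemma indep_G: "indep_vars (\<lambda>_. borel) (\<lambda>i. if i = 0 then G else \<epsilon> (int i)) {..n}"
proof -
  define K :: "nat \<Rightarrow> int set" where "K j = (if j = 0 then {..0} else {int j})" for j
  define Y :: "nat \<Rightarrow> (int \<Rightarrow> 'h) \<Rightarrow> 'h" where
    "Y j = (if j = 0 then (\<lambda>f. lim (\<lambda>m. backward m f)) else (\<lambda>f. f (int j)))" for j
  have "indep_vars (\<lambda>j. PiM (K j) (\<lambda>_. borel)) (\<lambda>j \<omega>. restrict (\<lambda>i. \<epsilon> i \<omega>) (K j)) {..n}"
    by (rule indep_vars_restrict[OF iid_indep]) (auto simp: K_def disjoint_family_on_def)
  then have "indep_vars (\<lambda>_. borel) (\<lambda>j \<omega>. Y j (restrict (\<lambda>i. \<epsilon> i \<omega>) (K j))) {..n}"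
  proof (rule indep_vars_compose2)
    fix j
    show "Y j \<in> PiM (K j) (\<lambda>_. borel) \<rightarrow>\<^sub>M borel"
    proof (cases "j = 0")
      case True
      have "(\<lambda>f. lim (\<lambda>m. backward m f)) \<in> PiM {..0} (\<lambda>_. borel) \<rightarrow>\<^sub>M borel"
        by (intro borel_measurable_lim_metric backward_measurable)
      then show ?thesis
        by (simp add: True Y_def K_def)
    next
      case False
      then show ?thesis
        by (auto simp: Y_def K_def intro!: measurable_component_singleton)
    qed
  qed
  moreover have "Y j (restrict (\<lambda>i. \<epsilon> i \<omega>) (K j)) = (if j = 0 then G else \<epsilon> (int j)) \<omega>" for j \<omega>
  proof (cases "j = 0")
    case True
    have "backward m (restrict (\<lambda>i. \<epsilon> i \<omega>) {..0}) = backward m (\<lambda>i. \<epsilon> i \<omega>)" for m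
      by (rule backward_cong) auto
    then show ?thesis
      by (simp add: True Y_def K_def G_def)
  qed (simp add: Y_def K_def)
  ultimately show ?thesis
    by simp
qed

lemma G_measurable [measurable]: "G \<in> borel_measurable M"
  using indep_G[of 0] by (simp add: indep_vars_def)

text \<open>Fatou's lemma transfers the uniform bound for the approximating recursions.\<close>
lemma G_fourth: "mean_le M (\<lambda>\<omega>. norm (G \<omega>) ^ 4) (c\<^sub>4 / (1 - \<rho>) ^ 4)"
proof -
  define C where "C = c\<^sub>4 / (1 - \<rho>) ^ 4"
  have C0: "0 \<le> C"
    using c\<^sub>4_nonneg Psi_norm by (simp add: C_def)
  have bm [measurable]: "(\<lambda>\<omega>. backward m (\<lambda>i. \<epsilon> i \<omega>)) \<in> borel_measurable M" for m
    unfolding backward_def by (rule measurable_boot_path) auto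
  have bmean: "mean_le M (\<lambda>\<omega>. norm (backward m (\<lambda>i. \<epsilon> i \<omega>)) ^ 4) C" for m
    unfolding backward_def C_def
    by (rule boot_path_fourth_moment[where \<rho> = \<rho>])
       (use Psi_norm c\<^sub>4_nonneg eps_fourth in \<open>auto simp: mean_le_def\<close>)
  have "(\<integral>\<^sup>+\<omega>. ennreal (norm (G \<omega>) ^ 4) \<partial>M)
      = (\<integral>\<^sup>+\<omega>. liminf (\<lambda>m. ennreal (norm (backward m (\<lambda>i. \<epsilon> i \<omega>)) ^ 4)) \<partial>M)"
  proof (rule nn_integral_cong_AE)
    show "AE \<omega> in M. ennreal (norm (G \<omega>) ^ 4) = liminf (\<lambda>m. ennreal (norm (backward m (\<lambda>i. \<epsilon> i \<omega>)) ^ 4))"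
      using backward_converges X0_eq_G
    proof eventually_elim
      case (elim \<omega>)
      have "(\<lambda>m. ennreal (norm (backward m (\<lambda>i. \<epsilon> i \<omega>)) ^ 4)) \<longlonglongrightarrow> ennreal (norm (G \<omega>) ^ 4)"
        using elim by (intro tendsto_ennrealI tendsto_intros) simp
      then show ?case
        by (rule lim_imp_Liminf[OF sequentially_bot, symmetric])
    qed
  qed
  also have "\<dots> \<le> liminf (\<lambda>m. \<integral>\<^sup>+\<omega>. ennreal (norm (backward m (\<lambda>i. \<epsilon> i \<omega>)) ^ 4) \<partial>M)"
    by (rule nn_integral_liminf) measurable
  also have "\<dots> \<le> liminf (\<lambda>m::nat. ennreal C)"
  proof (intro Liminf_mono always_eventually allI)
    fix m
    have "(\<integral>\<^sup>+\<omega>. ennreal (norm (backward m (\<lambda>i. \<epsilon> i \<omega>)) ^ 4) \<partial>M)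
        = ennreal (\<integral>\<omega>. norm (backward m (\<lambda>i. \<epsilon> i \<omega>)) ^ 4 \<partial>M)"
      using mean_leD(1)[OF bmean[of m]] by (intro nn_integral_eq_integral) auto
    then show "(\<integral>\<^sup>+\<omega>. ennreal (norm (backward m (\<lambda>i. \<epsilon> i \<omega>)) ^ 4) \<partial>M) \<le> ennreal C"
      using mean_leD(2)[OF bmean[of m]] by (simp add: ennreal_leI)
  qed
  also have "\<dots> = ennreal C"
    by (simp add: Liminf_const)
  finally have le: "(\<integral>\<^sup>+\<omega>. ennreal (norm (G \<omega>) ^ 4) \<partial>M) \<le> ennreal C" .
  have int: "integrable M (\<lambda>\<omega>. norm (G \<omega>) ^ 4)"
    by (rule integrableI_nonneg) (use le in \<open>auto intro: le_less_trans\<close>)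
  then have "ennreal (\<integral>\<omega>. norm (G \<omega>) ^ 4 \<partial>M) \<le> ennreal C"
    using le by (subst (asm) nn_integral_eq_integral) auto
  then show ?thesis
    using int C0 by (simp add: mean_le_def C_def)
qed

lemma X_eq_path: "AE \<omega> in M. \<forall>j. X (int j) \<omega> = boot_path \<Psi> (G \<omega>) (\<lambda>i. \<epsilon> (int i) \<omega>) j"
  using recursion_AE X0_eq_G
proof eventually_elim
  case (elim \<omega>)
  have "X (int j) \<omega> = boot_path \<Psi> (G \<omega>) (\<lambda>i. \<epsilon> (int i) \<omega>) j" for j
  proof (induction j)
    case (Suc j)
    have "X (int j + 1) \<omega> = \<Psi> (X (int j) \<omega>) + \<epsilon> (int j + 1) \<omega>"
      using elim(1) by blast
    then show ?case
      by (simp add: Suc add.commute)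
  qed (use elim(2) in simp)
  then show ?case
    by blast
qed

definition \<Sigma> :: "'h \<Rightarrow>\<^sub>L 'h" where "\<Sigma> = cov_operator M (\<epsilon> 0)"

text \<open>
  A common bound, at least \<open>1\<close>, for the fourth moments of the innovations and of the process.
\<close>
definition K :: real where "K = max 1 (c\<^sub>4 / (1 - \<rho>) ^ 4)"

lemma K1: "1 \<le> K" and c\<^sub>4_le_K: "c\<^sub>4 \<le> K"
proof -
  have "c\<^sub>4 * (1 - \<rho>) ^ 4 \<le> c\<^sub>4 * 1"
    using Psi_norm c\<^sub>4_nonneg by (intro mult_left_mono power_le_one) auto
  then have "c\<^sub>4 \<le> c\<^sub>4 / (1 - \<rho>) ^ 4"
    using Psi_norm by (simp add: le_divide_eq)
  then show "1 \<le> K" "c\<^sub>4 \<le> K"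
    by (auto simp: K_def)
qed

lemma eps_square: "mean_le M (\<lambda>\<omega>. (norm (\<epsilon> t \<omega>))\<^sup>2) K"
  by (intro mean_le_square_of_fourth K1 mean_le_weaken[OF eps_fourth c\<^sub>4_le_K]) measurable

lemma eps_cov: "(\<integral>\<omega>. inner (\<epsilon> t \<omega>) u *\<^sub>R \<epsilon> t \<omega> \<partial>M) = \<Sigma> u"
proof -
  have "(\<integral>\<omega>. inner (\<epsilon> s \<omega>) u *\<^sub>R \<epsilon> s \<omega> \<partial>M) = (\<integral>z. inner z u *\<^sub>R z \<partial>distr M borel (\<epsilon> s))" for s
    by (subst integral_distr) auto
  then have "(\<integral>\<omega>. inner (\<epsilon> t \<omega>) u *\<^sub>R \<epsilon> t \<omega> \<partial>M) = (\<integral>\<omega>. inner (\<epsilon> 0 \<omega>) u *\<^sub>R \<epsilon> 0 \<omega> \<partial>M)"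
    using iid_ident[of t 0] by simp
  also have "\<dots> = \<Sigma> u"
    unfolding \<Sigma>_def using mean_leD(1)[OF eps_square[of 0]] by (simp add: cov_operator_apply)
  finally show ?thesis .
qed

abbreviation V :: "nat \<Rightarrow> 'w \<Rightarrow> 'h \<times> 'h" where
  "V \<equiv> (\<lambda>i \<omega>. ((if i = 0 then G else \<epsilon> (int i)) \<omega>, 0))"

text \<open>
  The process itself as the first member of a pair whose second member is zero; \<open>\<theta> = 1\<close> and \<open>s = K\<close> are then
  trivially large enough.
\<close>
lemma autoregression_with_zero:
  assumes "basis_seq b"
  shows "coupled_autoregressions M V n \<Psi> \<Sigma> 0 0 b \<rho> 1 K K K"
proof unfold_locales
  show "indep_vars (\<lambda>_. borel) V {..n}"
    by (rule indep_vars_compose2[OF indep_G])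
       (intro borel_measurable_continuous_onI continuous_intros)
  show "mean_le M (\<lambda>\<omega>. norm (fst (V 0 \<omega>)) ^ 4) K"
    using mean_le_weaken[OF G_fourth, of K] by (simp add: K_def)
  have e: "mean_le M (\<lambda>\<omega>. norm (\<epsilon> (int i) \<omega>) ^ 4) K" for i
    by (rule mean_le_weaken[OF eps_fourth c\<^sub>4_le_K])
  then show "mean_le M (\<lambda>\<omega>. norm (fst (V i \<omega>)) ^ 4) K" if "1 \<le> i" "i \<le> n" for i
    using that by simp
  have "K \<le> K\<^sup>2"
    using K1 by (simp add: power2_eq_square)
  then show "mean_le M (\<lambda>\<omega>. norm (fst (V i \<omega>) - snd (V i \<omega>)) ^ 4) (K\<^sup>2)" if "1 \<le> i" "i \<le> n" for i
    using that mean_le_weaken[OF e[of i]] by simp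
  show "mean_le M (\<lambda>\<omega>. norm (snd (V 0 \<omega>)) ^ 4) K"
    using K1 by (simp add: mean_le_def)
  show "mean_le M (\<lambda>\<omega>. norm (snd (V i \<omega>)) ^ 4) K" if "1 \<le> i" "i \<le> n" for i
    using K1 by (simp add: mean_le_def)
  show "(\<integral>\<omega>. inner (fst (V i \<omega>)) u *\<^sub>R fst (V i \<omega>) \<partial>M) = \<Sigma> u" if "1 \<le> i" "i \<le> n" for i u
    using that eps_cov by simp
  show "0 < K"
    using K1 by simp
qed (use assms Psi_norm K1 mean_eps in auto)

end


section \<open>Coupling a distribution with an empirical distribution\<close>

lemma sum_over_fibres:
  fixes h :: "'v \<Rightarrow> real"
  assumes "finite I"
  shows "(\<Sum>j\<in>I. h (f j) / real (card {i\<in>I. f i = f j})) = (\<Sum>v\<in>f ` I. h v)"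
proof -
  have "(\<Sum>j\<in>I. h (f j) / real (card {i\<in>I. f i = f j}))
      = (\<Sum>v\<in>f ` I. \<Sum>j\<in>{j\<in>I. f j = v}. h (f j) / real (card {i\<in>I. f i = f j}))"
    by (rule sum.image_gen[OF assms])
  also have "\<dots> = (\<Sum>v\<in>f ` I. h v)"
  proof (rule sum.cong[OF refl])
    fix v assume "v \<in> f ` I"
    then have "card {i\<in>I. f i = v} \<noteq> 0"
      using assms by auto
    then show "(\<Sum>j\<in>{j\<in>I. f j = v}. h (f j) / real (card {i\<in>I. f i = f j})) = h v"
      by simp
  qed
  finally show ?thesis .
qed

lemma fourth_power_sum4_le: "((a::real) + b + c + d) ^ 4 \<le> 64 * (a ^ 4 + b ^ 4 + c ^ 4 + d ^ 4)"
proof -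
  have "(a + b + c + d) ^ 4 = ((a + b + c + d)\<^sup>2)\<^sup>2"
    by (simp flip: power_mult)
  also have "\<dots> \<le> (4 * (a\<^sup>2 + b\<^sup>2 + c\<^sup>2 + d\<^sup>2))\<^sup>2"
    by (intro power_mono square_sum4_le) auto
  also have "\<dots> = 16 * (a\<^sup>2 + b\<^sup>2 + c\<^sup>2 + d\<^sup>2)\<^sup>2"
    unfolding power_mult_distrib by simp
  also have "\<dots> \<le> 16 * (4 * ((a\<^sup>2)\<^sup>2 + (b\<^sup>2)\<^sup>2 + (c\<^sup>2)\<^sup>2 + (d\<^sup>2)\<^sup>2))"
    by (intro mult_left_mono square_sum4_le) auto
  finally show ?thesis
    by (simp flip: power_mult)
qed

lemma mean_leI_nn_integral:
  assumes [measurable]: "f \<in> borel_measurable M" and "\<And>\<omega>. \<omega> \<in> space M \<Longrightarrow> 0 \<le> f \<omega>"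
    and le: "(\<integral>\<^sup>+\<omega>. ennreal (f \<omega>) \<partial>M) \<le> ennreal c" and "0 \<le> c"
  shows "mean_le M f c"
proof -
  have int: "integrable M f"
    by (rule integrableI_nonneg) (use assms in \<open>auto intro: le_less_trans\<close>)
  then have "ennreal (\<integral>\<omega>. f \<omega> \<partial>M) \<le> ennreal c"
    using assms by (subst (asm) nn_integral_eq_integral) auto
  then show ?thesis
    using int \<open>0 \<le> c\<close> by (simp add: mean_le_def)
qed

lemma mean_le_distr_iff:
  assumes "g \<in> M \<rightarrow>\<^sub>M N" "h \<in> borel_measurable N"
  shows "mean_le (distr M N g) h c \<longleftrightarrow> mean_le M (\<lambda>\<omega>. h (g \<omega>)) c"
  using assms by (simp add: mean_le_def integrable_distr_eq integral_distr)

text \<open>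
  Reweighting the product of the uniform distribution on the sample indices and the distribution
  \<open>\<mu>\<close> so that, up to a mass \<open>\<eta>\<close>, the index and the point fall in the same cell of a finite partition.
  The weight is nonnegative when no cell has much less empirical than true mass.
\<close>
locale empirical_coupling = prob_space \<mu> for \<mu> :: "'h::{real_normed_vector, second_countable_topology} measure" +
  fixes q :: "'h \<Rightarrow> 'h" and y :: "nat \<Rightarrow> 'h" and n :: nat and \<eta> :: real
  assumes sets_mu: "sets \<mu> = sets borel" and n1: "1 \<le> n" and eta: "0 < \<eta>" "\<eta> < 1"
    and q: "q \<in> borel_measurable borel" "finite (range q)"
    and freq: "\<And>v. v \<in> range q \<Longrightarrow> (1 - \<eta>) * measure \<mu> (q -` {v}) \<le> real (card {j\<in>{1..n}. q (y j) = v}) / real n"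
begin

text \<open>The simplifier would turn index ranges \<open>{1..n}\<close> into \<open>{Suc 0..n}\<close>.\<close>
declare One_nat_def [simp del]

definition p :: "'h \<Rightarrow> real" where "p v = measure \<mu> (q -` {v})"

definition ph :: "'h \<Rightarrow> real" where "ph v = real (card {j\<in>{1..n}. q (y j) = v}) / real n"

text \<open>
  The density of the point given the index. The excess \<open>(1 - \<eta>) * (1\<^sub>C - \<mu> C) / ph C\<close>, for the cell \<open>C\<close> of the
  index, has mean zero over the points, and its average over the indices is \<open>1 - \<eta>\<close> times the sum of \<open>1\<^sub>C - \<mu> C\<close>
  over all cells, which vanishes; so both marginal distributions are preserved. Outside \<open>C\<close> the weight is
  \<open>1 - (1 - \<eta>) * \<mu> C / ph C\<close>, with average \<open>\<eta>\<close> over the indices.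
\<close>
definition wt :: "nat \<Rightarrow> 'h \<Rightarrow> real" where
  "wt j x = 1 + (1 - \<eta>) * (indicator (q -` {q (y j)}) x - p (q (y j))) / ph (q (y j))"

abbreviation U :: "nat pmf" where "U \<equiv> pmf_of_set {1..n}"

lemma space_mu [simp]: "space \<mu> = UNIV"
  using sets_eq_imp_space_eq[OF sets_mu] by simp

lemma borel_mu: "borel_measurable \<mu> = borel_measurable borel"
  by (rule measurable_cong_sets[OF sets_mu refl])

lemma cell [measurable]: "q -` {v} \<in> sets \<mu>"
  using measurable_sets[OF q(1), of "{v}"] by (simp add: sets_mu)

lemma sum_p: "(\<Sum>v\<in>range q. p v) = 1"
proof -
  have "(\<Sum>v\<in>range q. p v) = measure \<mu> (\<Union>v\<in>range q. q -` {v})"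
    unfolding p_def using q(2)
    by (intro finite_measure_finite_Union[symmetric]) (auto simp: disjoint_family_on_def)
  also have "(\<Union>v\<in>range q. q -` {v}) = space \<mu>"
    by auto
  finally show ?thesis
    by (simp add: prob_space del: space_mu)
qed

lemma ph_nonneg: "0 \<le> ph v"
  by (simp add: ph_def)

lemma wt_nonneg: "0 \<le> wt j x"
proof (cases "ph (q (y j)) = 0")
  case False
  then have pos: "0 < ph (q (y j))"
    using ph_nonneg[of "q (y j)"] by linarith
  have "(1 - \<eta>) * p (q (y j)) \<le> ph (q (y j))"
    using freq[of "q (y j)"] by (simp add: p_def ph_def)
  then have "(1 - \<eta>) * p (q (y j)) / ph (q (y j)) \<le> 1"
    using pos by simp
  moreover have "0 \<le> (1 - \<eta>) * indicator (q -` {q (y j)}) x / ph (q (y j))"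
    using pos eta by simp
  moreover have "wt j x = 1 + (1 - \<eta>) * indicator (q -` {q (y j)}) x / ph (q (y j))
      - (1 - \<eta>) * p (q (y j)) / ph (q (y j))"
    by (simp add: wt_def right_diff_distrib diff_divide_distrib)
  ultimately show ?thesis
    by linarith
qed (simp add: wt_def)

lemma wt_measurable [measurable]: "wt j \<in> borel_measurable \<mu>"
  unfolding wt_def[abs_def] by measurable

lemma wt_integral: "(\<integral>\<^sup>+x. ennreal (wt j x) \<partial>\<mu>) = 1"
proof -
  have i: "integrable \<mu> (indicator (q -` {v}) :: 'h \<Rightarrow> real)" for v
    by (rule integrable_real_indicator[OF cell]) (simp add: emeasure_eq_measure)
  have "integrable \<mu> (wt j)"
    unfolding wt_def[abs_def] using i by simp
  then have "(\<integral>\<^sup>+x. ennreal (wt j x) \<partial>\<mu>) = ennreal (\<integral>x. wt j x \<partial>\<mu>)"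
    by (intro nn_integral_eq_integral) (auto simp: wt_nonneg)
  also have "(\<integral>x. wt j x \<partial>\<mu>) = 1"
    unfolding wt_def using i by (simp add: prob_space[simplified] p_def cell)
  finally show ?thesis
    by simp
qed

text \<open>
  A cell \<open>v\<close> is hit by \<open>n * ph v\<close> indices, each contributing \<open>h v / ph v\<close>.
\<close>
lemma sum_over_indices:
  "(\<Sum>j=1..n. h (q (y j)) / ph (q (y j))) = real n * (\<Sum>v\<in>(\<lambda>j. q (y j)) ` {1..n}. h v)"
  unfolding sum_over_fibres[symmetric, OF finite_atLeastAtMost] sum_distrib_left
  by (rule sum.cong) (simp_all add: ph_def)

lemma positive_cell_is_hit:
  assumes "v \<in> range q" "0 < p v"
  shows "v \<in> (\<lambda>j. q (y j)) ` {1..n}"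
proof -
  have "0 < (1 - \<eta>) * p v"
    using assms eta by simp
  then have "0 < ph v"
    using freq[OF assms(1)] by (simp add: p_def ph_def)
  moreover have "ph v = 0" if "{j\<in>{1..n}. q (y j) = v} = {}"
    unfolding ph_def that by simp
  ultimately show ?thesis
    by fastforce
qed

lemma sum_p_image: "(\<Sum>v\<in>(\<lambda>j. q (y j)) ` {1..n}. p v) = 1"
proof -
  have "(\<Sum>v\<in>(\<lambda>j. q (y j)) ` {1..n}. p v) = (\<Sum>v\<in>range q. p v)"
  proof (rule sum.mono_neutral_left)
    show "\<forall>v\<in>range q - (\<lambda>j. q (y j)) ` {1..n}. p v = 0"
    proof
      fix v assume v: "v \<in> range q - (\<lambda>j. q (y j)) ` {1..n}"
      have "0 \<le> p v"
        by (simp add: p_def)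
      with v positive_cell_is_hit[of v] show "p v = 0"
        by (cases "p v = 0") auto
    qed
  qed (use q(2) in auto)
  then show ?thesis
    by (simp add: sum_p)
qed

lemma wt_sum:
  assumes "0 < p (q x)"
  shows "(\<Sum>j=1..n. wt j x) = real n"
proof -
  let ?f = "\<lambda>j. q (y j)"
  have "(\<Sum>v\<in>?f ` {1..n}. indicator (q -` {v}) x) = (\<Sum>v\<in>?f ` {1..n}. if v = q x then 1 else (0::real))"
    by (rule sum.cong) (auto simp: indicator_def)
  also have "\<dots> = 1"
    using positive_cell_is_hit[of "q x"] assms by simp
  finally have si: "(\<Sum>v\<in>?f ` {1..n}. indicator (q -` {v}) x) = (1::real)" .
  have "(\<Sum>j=1..n. wt j x)
      = (\<Sum>j=1..n. 1) + (1 - \<eta>) * (\<Sum>j=1..n. (indicator (q -` {?f j}) x - p (?f j)) / ph (?f j))"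
    by (simp add: wt_def sum.distrib sum_distrib_left)
  also have "(\<Sum>j=1..n. (indicator (q -` {?f j}) x - p (?f j)) / ph (?f j)) = 0"
    using sum_over_indices[of "\<lambda>v. indicator (q -` {v}) x - p v"] by (simp add: sum_subtractf sum_p_image si)
  finally show ?thesis
    by simp
qed

lemma AE_positive_cell: "AE x in \<mu>. 0 < p (q x)"
proof -
  have "AE x in \<mu>. q x \<noteq> v" if "p v = 0" for v
  proof (rule AE_I)
    show "{x \<in> space \<mu>. \<not> q x \<noteq> v} \<subseteq> q -` {v}"
      by auto
    show "emeasure \<mu> (q -` {v}) = 0"
      using that by (simp add: p_def emeasure_eq_measure)
  qed (rule cell)
  then have "AE x in \<mu>. \<forall>v\<in>{v\<in>range q. p v = 0}. q x \<noteq> v"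
    using q(2) by (intro AE_finite_allI) auto
  then show ?thesis
  proof eventually_elim
    case (elim x)
    then have "p (q x) \<noteq> 0"
      by blast
    moreover have "0 \<le> p (q x)"
      by (simp add: p_def)
    ultimately show ?case
      by simp
  qed
qed

definition \<kappa> :: "(nat \<times> 'h) measure" where
  "\<kappa> = density (measure_pmf U \<Otimes>\<^sub>M \<mu>) (\<lambda>z. ennreal (wt (fst z) (snd z)))"

sublocale pp: pair_prob_space "measure_pmf U" \<mu> ..

lemma measurable_index_point:
  assumes "\<And>j. f j \<in> borel_measurable borel"
  shows "(\<lambda>z. f (fst z) (snd z)) \<in> measure_pmf U \<Otimes>\<^sub>M \<mu> \<rightarrow>\<^sub>M borel"
proof -
  have "(\<lambda>z. f (fst z) (snd z)) \<in> count_space UNIV \<Otimes>\<^sub>M \<mu> \<rightarrow>\<^sub>M borel"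
    by (rule measurable_pair_measure_countable1) (use assms borel_mu in auto)
  moreover have "sets (measure_pmf U \<Otimes>\<^sub>M \<mu>) = sets (count_space UNIV \<Otimes>\<^sub>M \<mu>)"
    by (intro sets_pair_measure_cong) auto
  ultimately show ?thesis
    by (simp cong: measurable_cong_sets)
qed

lemma wt2_measurable: "(\<lambda>z. ennreal (wt (fst z) (snd z))) \<in> borel_measurable (measure_pmf U \<Otimes>\<^sub>M \<mu>)"
proof -
  have "wt j \<in> borel_measurable borel" for j
    using wt_measurable[of j] unfolding borel_mu .
  from measurable_compose[OF measurable_index_point[OF this] measurable_ennreal] show ?thesis .
qed

lemma sets_\<kappa>: "sets \<kappa> = sets (measure_pmf U \<Otimes>\<^sub>M \<mu>)"
  unfolding \<kappa>_def by (rule sets_density)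

lemma nn_integral_\<kappa>_index:
  fixes f :: "nat \<Rightarrow> 'h \<Rightarrow> ennreal"
  assumes f: "\<And>j. f j \<in> borel_measurable borel"
  shows "(\<integral>\<^sup>+z. f (fst z) (snd z) \<partial>\<kappa>) = (\<integral>\<^sup>+j. (\<integral>\<^sup>+x. ennreal (wt j x) * f j x \<partial>\<mu>) \<partial>measure_pmf U)"
    and nn_integral_\<kappa>_point: "(\<integral>\<^sup>+z. f (fst z) (snd z) \<partial>\<kappa>)
      = (\<integral>\<^sup>+x. (\<integral>\<^sup>+j. ennreal (wt j x) * f j x \<partial>measure_pmf U) \<partial>\<mu>)"
proof -
  note fm = measurable_index_point[OF f]
  have m: "(\<lambda>z. ennreal (wt (fst z) (snd z)) * f (fst z) (snd z)) \<in> borel_measurable (measure_pmf U \<Otimes>\<^sub>M \<mu>)"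
    by (intro borel_measurable_times_ennreal wt2_measurable fm)
  have eq: "(\<integral>\<^sup>+z. f (fst z) (snd z) \<partial>\<kappa>)
      = (\<integral>\<^sup>+z. ennreal (wt (fst z) (snd z)) * f (fst z) (snd z) \<partial>(measure_pmf U \<Otimes>\<^sub>M \<mu>))"
    unfolding \<kappa>_def by (rule nn_integral_density[OF wt2_measurable fm])
  show "(\<integral>\<^sup>+z. f (fst z) (snd z) \<partial>\<kappa>) = (\<integral>\<^sup>+j. (\<integral>\<^sup>+x. ennreal (wt j x) * f j x \<partial>\<mu>) \<partial>measure_pmf U)"
    unfolding eq using nn_integral_fst[OF m] by simp
  show "(\<integral>\<^sup>+z. f (fst z) (snd z) \<partial>\<kappa>) = (\<integral>\<^sup>+x. (\<integral>\<^sup>+j. ennreal (wt j x) * f j x \<partial>measure_pmf U) \<partial>\<mu>)"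
    unfolding eq using pp.nn_integral_snd[OF m] by simp
qed

lemma nn_integral_U: "(\<integral>\<^sup>+j. h j \<partial>measure_pmf U) = (\<Sum>j=1..n. h j) / ennreal (real n)"
proof -
  have "(\<integral>\<^sup>+j. h j \<partial>measure_pmf U) = (\<Sum>j=1..n. h j) / of_nat (card {1..n})"
    by (rule nn_integral_pmf_of_set) (use n1 in auto)
  then show ?thesis
    by (simp add: ennreal_of_nat_eq_real_of_nat)
qed

lemma nn_integral_\<kappa>_snd:
  assumes f: "f \<in> borel_measurable borel"
  shows "(\<integral>\<^sup>+z. f (snd z) \<partial>\<kappa>) = (\<integral>\<^sup>+x. f x \<partial>\<mu>)"
proof -
  have "(\<integral>\<^sup>+z. f (snd z) \<partial>\<kappa>) = (\<integral>\<^sup>+x. (\<integral>\<^sup>+j. ennreal (wt j x) * f x \<partial>measure_pmf U) \<partial>\<mu>)"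
    using nn_integral_\<kappa>_point[of "\<lambda>_. f"] f by simp
  also have "\<dots> = (\<integral>\<^sup>+x. f x \<partial>\<mu>)"
  proof (rule nn_integral_cong_AE)
    show "AE x in \<mu>. (\<integral>\<^sup>+j. ennreal (wt j x) * f x \<partial>measure_pmf U) = f x"
      using AE_positive_cell
    proof eventually_elim
      case (elim x)
      have "(\<integral>\<^sup>+j. ennreal (wt j x) \<partial>measure_pmf U) = ennreal (\<Sum>j=1..n. wt j x) / ennreal (real n)"
        unfolding nn_integral_U by (subst sum_ennreal) (auto simp: wt_nonneg)
      also have "\<dots> = 1"
        using n1 by (simp add: wt_sum[OF elim] divide_ennreal)
      finally show ?case
        by (simp add: nn_integral_multc)
    qed
  qed
  finally show ?thesis .
qed

lemma nn_integral_\<kappa>_fst: "(\<integral>\<^sup>+z. h (fst z) \<partial>\<kappa>) = (\<Sum>j=1..n. h j) / ennreal (real n)"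
proof -
  have "(\<integral>\<^sup>+z. h (fst z) \<partial>\<kappa>) = (\<integral>\<^sup>+j. (\<integral>\<^sup>+x. ennreal (wt j x) * h j \<partial>\<mu>) \<partial>measure_pmf U)"
    using nn_integral_\<kappa>_index[of "\<lambda>j _. h j"] by simp
  also have "\<dots> = (\<integral>\<^sup>+j. h j \<partial>measure_pmf U)"
    by (simp add: nn_integral_multc wt_integral)
  finally show ?thesis
    by (simp add: nn_integral_U)
qed

text \<open>
  Given the index \<open>j\<close>, the mass outside its cell is at most the value of the weight there.
\<close>
lemma different_cells: "(\<integral>\<^sup>+z. indicator {z. q (snd z) \<noteq> q (y (fst z))} z \<partial>\<kappa>) \<le> ennreal \<eta>"
proof -
  let ?f = "\<lambda>j. q (y j)"
  have "(\<integral>\<^sup>+z. indicator {z. q (snd z) \<noteq> q (y (fst z))} z \<partial>\<kappa>)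
      = (\<integral>\<^sup>+z. indicator (- (q -` {q (y (fst z))})) (snd z) \<partial>\<kappa>)"
    by (rule nn_integral_cong) (auto simp: indicator_def)
  also have "\<dots> = (\<integral>\<^sup>+j. (\<integral>\<^sup>+x. ennreal (wt j x) * indicator (- (q -` {?f j})) x \<partial>\<mu>) \<partial>measure_pmf U)"
  proof (rule nn_integral_\<kappa>_index)
    fix j
    have "q -` {?f j} \<in> sets borel"
      using cell sets_mu by simp
    then show "indicator (- (q -` {?f j})) \<in> borel_measurable borel"
      by (intro borel_measurable_indicator) auto
  qed
  also have "\<dots> \<le> (\<integral>\<^sup>+j. ennreal (1 - (1 - \<eta>) * p (?f j) / ph (?f j)) \<partial>measure_pmf U)"
  proof (rule nn_integral_mono)
    fix j
    have "(\<integral>\<^sup>+x. ennreal (wt j x) * indicator (- (q -` {?f j})) x \<partial>\<mu>)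
        \<le> (\<integral>\<^sup>+x. ennreal (1 - (1 - \<eta>) * p (?f j) / ph (?f j)) \<partial>\<mu>)"
      by (rule nn_integral_mono) (auto simp: wt_def indicator_def)
    then show "(\<integral>\<^sup>+x. ennreal (wt j x) * indicator (- (q -` {?f j})) x \<partial>\<mu>)
        \<le> ennreal (1 - (1 - \<eta>) * p (?f j) / ph (?f j))"
      by (simp add: emeasure_space_1[simplified])
  qed
  also have "\<dots> = ennreal (\<Sum>j=1..n. 1 - (1 - \<eta>) * p (?f j) / ph (?f j)) / ennreal (real n)"
  proof -
    have "0 \<le> 1 - (1 - \<eta>) * p (?f j) / ph (?f j)" for j
    proof (cases "ph (?f j) = 0")
      case False
      then have "0 < ph (?f j)"
        using ph_nonneg[of "?f j"] by linarith
      moreover have "(1 - \<eta>) * p (?f j) \<le> ph (?f j)"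
        using freq[of "?f j"] by (simp add: p_def ph_def)
      ultimately show ?thesis
        by simp
    qed simp
    then show ?thesis
      unfolding nn_integral_U by (subst sum_ennreal) auto
  qed
  also have "(\<Sum>j=1..n. 1 - (1 - \<eta>) * p (?f j) / ph (?f j)) = real n * \<eta>"
  proof -
    have "(\<Sum>j=1..n. (1 - \<eta>) * p (?f j) / ph (?f j)) = real n * (1 - \<eta>)"
      using sum_over_indices[of "\<lambda>v. (1 - \<eta>) * p v"]
      by (simp add: sum_p_image flip: sum_distrib_left)
    then show ?thesis
      by (simp add: sum_subtractf algebra_simps)
  qed
  also have "ennreal (real n * \<eta>) / ennreal (real n) = ennreal \<eta>"
    using n1 eta by (simp add: divide_ennreal)
  finally show ?thesis .
qed

text \<open>
  The values \<open>f j\<close> need not be the points \<open>y j\<close> that determine the cells: the cells are those of the true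
  innovations, while \<open>f\<close> will list the centred residuals.
\<close>
definition joint :: "(nat \<Rightarrow> 'h) \<Rightarrow> ('h \<times> 'h) measure" where
  "joint f = distr \<kappa> borel (\<lambda>z. (snd z, f (fst z)))"

lemma measurable_\<kappa>:
  assumes "\<And>j. f j \<in> borel_measurable borel"
  shows "(\<lambda>z. f (fst z) (snd z)) \<in> \<kappa> \<rightarrow>\<^sub>M borel"
  using measurable_index_point[OF assms] by (simp cong: measurable_cong_sets add: sets_\<kappa>)

lemma joint_measurable: "(\<lambda>z. (snd z, f (fst z) :: 'h)) \<in> \<kappa> \<rightarrow>\<^sub>M borel"
proof (rule borel_measurable_Pair)
  show "(\<lambda>z. snd z) \<in> \<kappa> \<rightarrow>\<^sub>M borel" "(\<lambda>z. f (fst z)) \<in> \<kappa> \<rightarrow>\<^sub>M borel"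
    using measurable_\<kappa>[of "\<lambda>_ x. x"] measurable_\<kappa>[of "\<lambda>j _. f j"] by auto
qed

lemma prob_space_\<kappa>: "prob_space \<kappa>"
proof
  have "emeasure \<kappa> (space \<kappa>) = (\<integral>\<^sup>+z. 1 \<partial>\<kappa>)"
    by simp
  also have "\<dots> = (\<integral>\<^sup>+x. 1 \<partial>\<mu>)"
    by (rule nn_integral_\<kappa>_snd) simp
  also have "\<dots> = 1"
    by (simp add: emeasure_space_1[simplified])
  finally show "emeasure \<kappa> (space \<kappa>) = 1" .
qed

lemma prob_space_joint: "prob_space (joint f)"
  unfolding joint_def by (rule prob_space.prob_space_distr[OF prob_space_\<kappa> joint_measurable])

lemma joint_fst: "distr (joint f) borel fst = \<mu>"
proof (rule measure_eqI)
  fix A :: "'h set" assume "A \<in> sets (distr (joint f) borel fst)"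
  then have A: "A \<in> sets borel"
    by simp
  have fst: "fst \<in> (borel :: ('h \<times> 'h) measure) \<rightarrow>\<^sub>M borel"
    by (intro borel_measurable_continuous_onI continuous_intros)
  have m: "snd \<in> \<kappa> \<rightarrow>\<^sub>M borel"
    using measurable_\<kappa>[of "\<lambda>_ x. x"] by simp
  have "emeasure (distr (joint f) borel fst) A = emeasure (distr \<kappa> borel snd) A"
    unfolding joint_def distr_distr[OF fst joint_measurable] by (simp add: o_def)
  also have "\<dots> = (\<integral>\<^sup>+x. indicator A x \<partial>distr \<kappa> borel snd)"
    using A by simp
  also have "\<dots> = (\<integral>\<^sup>+z. indicator A (snd z) \<partial>\<kappa>)"
    using A by (intro nn_integral_distr m) auto
  also have "\<dots> = (\<integral>\<^sup>+x. indicator A x \<partial>\<mu>)"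
    using A by (intro nn_integral_\<kappa>_snd) auto
  also have "\<dots> = emeasure \<mu> A"
    using A sets_mu by simp
  finally show "emeasure (distr (joint f) borel fst) A = emeasure \<mu> A" .
qed (simp add: sets_mu)

lemma joint_snd: "distr (joint f) borel snd = distr (measure_pmf (map_pmf f U)) borel (\<lambda>x. x)"
proof (rule measure_eqI)
  fix A :: "'h set" assume "A \<in> sets (distr (joint f) borel snd)"
  then have A: "A \<in> sets borel"
    by simp
  have snd: "snd \<in> (borel :: ('h \<times> 'h) measure) \<rightarrow>\<^sub>M borel"
    by (intro borel_measurable_continuous_onI continuous_intros)
  have m: "(\<lambda>z. f (fst z)) \<in> \<kappa> \<rightarrow>\<^sub>M borel"
    using measurable_\<kappa>[of "\<lambda>j _. f j"] by simp
  have "emeasure (distr (joint f) borel snd) A = emeasure (distr \<kappa> borel (\<lambda>z. f (fst z))) A"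
    unfolding joint_def distr_distr[OF snd joint_measurable] by (simp add: o_def)
  also have "\<dots> = (\<integral>\<^sup>+x. indicator A x \<partial>distr \<kappa> borel (\<lambda>z. f (fst z)))"
    using A by simp
  also have "\<dots> = (\<integral>\<^sup>+z. indicator A (f (fst z)) \<partial>\<kappa>)"
    using A by (intro nn_integral_distr m) auto
  also have "\<dots> = (\<integral>\<^sup>+j. indicator A (f j) \<partial>measure_pmf U)"
    unfolding nn_integral_U by (rule nn_integral_\<kappa>_fst)
  also have "\<dots> = (\<integral>\<^sup>+x. indicator A x \<partial>measure_pmf (map_pmf f U))"
    by (rule nn_integral_map_pmf[symmetric])
  also have "\<dots> = emeasure (measure_pmf (map_pmf f U)) A"
    by (rule nn_integral_indicator) simp
  also have "\<dots> = emeasure (distr (measure_pmf (map_pmf f U)) borel (\<lambda>x. x)) A"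
    using A by (subst emeasure_distr) simp_all
  finally show "emeasure (distr (joint f) borel snd) A
      = emeasure (distr (measure_pmf (map_pmf f U)) borel (\<lambda>x. x)) A" .
qed simp

lemma mean_le_\<kappa>_fst:
  assumes "\<And>j. 0 \<le> h j"
  shows "mean_le \<kappa> (\<lambda>z. h (fst z)) ((1 / real n) * (\<Sum>j=1..n. h j))"
proof (rule mean_leI_nn_integral)
  have "(\<integral>\<^sup>+z. ennreal (h (fst z)) \<partial>\<kappa>) = (\<Sum>j=1..n. ennreal (h j)) / ennreal (real n)"
    by (rule nn_integral_\<kappa>_fst)
  also have "\<dots> = ennreal ((1 / real n) * (\<Sum>j=1..n. h j))"
    using n1 assms by (subst sum_ennreal) (auto simp: divide_ennreal sum_nonneg)
  finally show "(\<integral>\<^sup>+z. ennreal (h (fst z)) \<partial>\<kappa>) \<le> ennreal ((1 / real n) * (\<Sum>j=1..n. h j))"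
    by simp
  show "(\<lambda>z. h (fst z)) \<in> borel_measurable \<kappa>"
    using measurable_index_point[of "\<lambda>j _. h j"] by (simp cong: measurable_cong_sets add: sets_\<kappa>)
qed (use assms in \<open>auto simp: sum_nonneg\<close>)

text \<open>
  The way from the point to its cell centre, to the cell centre of the index, to the point \<open>y j\<close>, and to
  \<open>f j\<close>; the second leg is nonzero only with probability \<open>\<eta>\<close>, and bounded by the diameter of the range of
  \<open>q\<close>.
\<close>
lemma mean_le_joint_cost:
  assumes c: "mean_le \<mu> (\<lambda>x. norm (x - q x) ^ 4) c"
    and R: "\<And>u v. u \<in> range q \<Longrightarrow> v \<in> range q \<Longrightarrow> norm (u - v) ^ 4 \<le> R" and R0: "0 \<le> R"
  shows "mean_le (joint f) (\<lambda>z. norm (fst z - snd z) ^ 4)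
    (64 * (c + R * \<eta> + (1 / real n) * (\<Sum>j=1..n. norm (q (y j) - y j) ^ 4)
      + (1 / real n) * (\<Sum>j=1..n. norm (y j - f j) ^ 4)))"
proof -
  have h: "(\<lambda>z. norm (fst z - snd z) ^ 4) \<in> borel_measurable (borel :: ('h \<times> 'h) measure)"
    by (intro borel_measurable_continuous_onI continuous_intros)
  have hm: "(\<lambda>z. norm (snd z - f (fst z)) ^ 4) \<in> borel_measurable \<kappa>"
    using measurable_compose[OF joint_measurable h] by simp
  have c1: "mean_le \<kappa> (\<lambda>z. norm (snd z - q (snd z)) ^ 4) c"
  proof (rule mean_leI_nn_integral)
    have q4: "(\<lambda>x. norm (x - q x) ^ 4) \<in> borel_measurable borel"
      using q(1) by measurable
    have "(\<integral>\<^sup>+z. ennreal (norm (snd z - q (snd z)) ^ 4) \<partial>\<kappa>) = (\<integral>\<^sup>+x. ennreal (norm (x - q x) ^ 4) \<partial>\<mu>)"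
      by (rule nn_integral_\<kappa>_snd[OF measurable_compose[OF q4 measurable_ennreal]])
    also have "\<dots> = ennreal (\<integral>x. norm (x - q x) ^ 4 \<partial>\<mu>)"
      using mean_leD(1)[OF c] by (intro nn_integral_eq_integral) auto
    also have "\<dots> \<le> ennreal c"
      using mean_leD(2)[OF c] by (rule ennreal_leI)
    finally show "(\<integral>\<^sup>+z. ennreal (norm (snd z - q (snd z)) ^ 4) \<partial>\<kappa>) \<le> ennreal c" .
    show "(\<lambda>z. norm (snd z - q (snd z)) ^ 4) \<in> borel_measurable \<kappa>"
      using measurable_compose[OF measurable_\<kappa>[of "\<lambda>_ x. x"] q4] by simp
    show "0 \<le> c"
      by (rule mean_le_nonneg[OF c]) simp
  qed simp
  let ?B = "{z. q (snd z) \<noteq> q (y (fst z))}"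
  have Bm: "(\<lambda>z. indicator ?B z :: real) \<in> borel_measurable \<kappa>"
  proof -
    have "(\<lambda>z. indicator (- (q -` {q (y (fst z))})) (snd z) :: real) \<in> borel_measurable (measure_pmf U \<Otimes>\<^sub>M \<mu>)"
    proof (rule measurable_index_point)
      fix j
      have "q -` {q (y j)} \<in> sets borel"
        using cell sets_mu by simp
      then show "(indicator (- (q -` {q (y j)})) :: 'h \<Rightarrow> real) \<in> borel_measurable borel"
        by (intro borel_measurable_indicator) auto
    qed
    moreover have "(\<lambda>z. indicator (- (q -` {q (y (fst z))})) (snd z) :: real) = (\<lambda>z. indicator ?B z)"
      by (auto simp: indicator_def)
    ultimately show ?thesis
      by (simp cong: measurable_cong_sets add: sets_\<kappa>)
  qed
  have c2: "mean_le \<kappa> (\<lambda>z. indicator ?B z) \<eta>"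
  proof (rule mean_leI_nn_integral[OF Bm])
    show "(\<integral>\<^sup>+z. ennreal (indicator ?B z) \<partial>\<kappa>) \<le> ennreal \<eta>"
      using different_cells by (simp add: ennreal_indicator)
  qed (use eta in auto)
  have "mean_le \<kappa> (\<lambda>z. norm (snd z - f (fst z)) ^ 4) (64 * (c + R * \<eta> + (1 / real n) * (\<Sum>j=1..n. norm (q (y j) - y j) ^ 4)
      + (1 / real n) * (\<Sum>j=1..n. norm (y j - f j) ^ 4)))"
  proof (rule mean_le_mono[OF _ hm])
    show "mean_le \<kappa> (\<lambda>z. 64 * (norm (snd z - q (snd z)) ^ 4 + R * indicator ?B z
          + norm (q (y (fst z)) - y (fst z)) ^ 4 + norm (y (fst z) - f (fst z)) ^ 4))
        (64 * (c + R * \<eta> + (1 / real n) * (\<Sum>j=1..n. norm (q (y j) - y j) ^ 4)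
          + (1 / real n) * (\<Sum>j=1..n. norm (y j - f j) ^ 4)))"
      using R0 by (intro mean_le_cmult mean_le_add c1 c2 mean_le_\<kappa>_fst) auto
    fix z :: "nat \<times> 'h"
    let ?x = "snd z" and ?j = "fst z"
    have "norm (?x - f ?j) \<le> norm (?x - q ?x) + norm (q ?x - q (y ?j)) + norm (q (y ?j) - y ?j) + norm (y ?j - f ?j)"
    proof -
      have "?x - f ?j = (?x - q ?x) + (q ?x - q (y ?j)) + (q (y ?j) - y ?j) + (y ?j - f ?j)"
        by simp
      then show ?thesis
        by (metis norm_triangle_mono norm_triangle_ineq order_refl)
    qed
    then have "norm (?x - f ?j) ^ 4 \<le> (norm (?x - q ?x) + norm (q ?x - q (y ?j)) + norm (q (y ?j) - y ?j) + norm (y ?j - f ?j)) ^ 4"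
      by (intro power_mono) auto
    also have "\<dots> \<le> 64 * (norm (?x - q ?x) ^ 4 + norm (q ?x - q (y ?j)) ^ 4 + norm (q (y ?j) - y ?j) ^ 4 + norm (y ?j - f ?j) ^ 4)"
      by (rule fourth_power_sum4_le)
    also have "norm (q ?x - q (y ?j)) ^ 4 \<le> R * indicator ?B z"
      using R[of "q ?x" "q (y ?j)"] by (auto simp: indicator_def)
    finally show "norm (?x - f ?j) ^ 4 \<le> 64 * (norm (?x - q ?x) ^ 4 + R * indicator ?B z
          + norm (q (y ?j) - y ?j) ^ 4 + norm (y ?j - f ?j) ^ 4)"
      by simp
  qed auto
  then show ?thesis
    unfolding joint_def using mean_le_distr_iff[OF joint_measurable h] by simp
qed

end

text \<open>
  Simple functions approximate the identity pointwise with \<open>norm (F i x) \<le> 2 * norm x\<close>, so dominated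
  convergence applies; their finitely many level sets are the cells.
\<close>
lemma quantizer_exists:
  fixes e :: real and M :: "'h::{real_normed_vector, second_countable_topology} measure"
  assumes sets: "sets M = sets borel"
    and fourth: "integrable M (\<lambda>x. norm x ^ 4)" and "0 < e"
  shows "\<exists>q :: 'h \<Rightarrow> 'h. q \<in> borel_measurable borel \<and> finite (range q) \<and> mean_le M (\<lambda>x. norm (x - q x) ^ 4) e"
proof -
  have sp: "space M = UNIV"
    using sets_eq_imp_space_eq[OF sets] by simp
  have bm: "borel_measurable M = (borel_measurable borel :: ('h \<Rightarrow> 'h) set)"
    by (rule measurable_cong_sets[OF sets refl])
  have "(\<lambda>x. x) \<in> borel_measurable M"
    using measurable_ident_sets[OF sets] .
  from borel_measurable_implies_sequence_metric[OF this, of 0] obtain F where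
    F: "\<And>i. simple_function M (F i)" "\<And>x. (\<lambda>i. F i x) \<longlonglongrightarrow> x" "\<And>i x. norm (F i x) \<le> 2 * norm x"
    by (auto simp: sp)
  have Fm [measurable]: "F i \<in> borel_measurable M" for i
    using F(1) by (rule borel_measurable_simple_function)
  have idm [measurable]: "(\<lambda>x. x) \<in> borel_measurable M"
    by fact
  have bound: "norm (x - F i x) ^ 4 \<le> 81 * norm x ^ 4" for i x
  proof -
    have "norm (x - F i x) \<le> 3 * norm x"
      using norm_triangle_ineq4[of x "F i x"] F(3)[of i x] by linarith
    then have "norm (x - F i x) ^ 4 \<le> (3 * norm x) ^ 4"
      by (intro power_mono) auto
    then show ?thesis
      by (simp add: power_mult_distrib)
  qed
  have lim: "(\<lambda>i. \<integral>x. norm (x - F i x) ^ 4 \<partial>M) \<longlonglongrightarrow> (\<integral>x. 0 \<partial>M)"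
  proof (rule integral_dominated_convergence[where w = "\<lambda>x. 81 * norm x ^ 4"])
    show "AE x in M. (\<lambda>i. norm (x - F i x) ^ 4) \<longlonglongrightarrow> 0"
    proof (rule AE_I2)
      fix x
      have "(\<lambda>i. norm (x - F i x) ^ 4) \<longlonglongrightarrow> norm (x - x) ^ 4"
        by (intro tendsto_intros F)
      then show "(\<lambda>i. norm (x - F i x) ^ 4) \<longlonglongrightarrow> 0"
        by simp
    qed
  qed (use fourth bound in auto)
  then have "\<forall>\<^sub>F i in sequentially. (\<integral>x. norm (x - F i x) ^ 4 \<partial>M) < e"
    using \<open>0 < e\<close> by (intro order_tendstoD) auto
  then obtain i where i: "(\<integral>x. norm (x - F i x) ^ 4 \<partial>M) < e"
    by (auto simp: eventually_sequentially)
  have "integrable M (\<lambda>x. norm (x - F i x) ^ 4)"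
    by (rule Bochner_Integration.integrable_bound[where f = "\<lambda>x. 81 * norm x ^ 4"]) (use fourth bound in auto)
  moreover have "finite (range (F i))"
    using simple_functionD(1)[OF F(1), of i] by (simp add: sp)
  moreover have "F i \<in> borel_measurable borel"
    using Fm[of i] by (simp only: bm)
  ultimately show ?thesis
    using i by (intro exI[of _ "F i"]) (auto simp: mean_le_def)
qed


section \<open>Sample quantities of the stationary autoregression\<close>

context stationary_autoregression
begin

text \<open>
  The process after time \<open>0\<close>, as an explicit function of \<open>G\<close> and of the later innovations.
\<close>
definition trajectory :: "nat \<Rightarrow> 'w \<Rightarrow> 'h" where
  "trajectory j \<omega> = boot_path \<Psi> (G \<omega>) (\<lambda>i. \<epsilon> (int i) \<omega>) j"

lemma trajectory_Suc: "trajectory (Suc j) \<omega> = \<Psi> (trajectory j \<omega>) + \<epsilon> (int (Suc j)) \<omega>"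
  by (simp add: trajectory_def)

lemma trajectory_measurable [measurable]: "trajectory j \<in> borel_measurable M"
  unfolding trajectory_def[abs_def] by (rule measurable_boot_path) auto

lemma sample_AE: "AE \<omega> in M. \<forall>n. \<forall>j\<le>n. sample X n \<omega> j = trajectory j \<omega>"
  using X_eq_path
proof eventually_elim
  case (elim \<omega>)
  then have "X (int j) \<omega> = trajectory j \<omega>" for j
    unfolding trajectory_def by (rule spec)
  then show ?case
    by (simp add: sample_def)
qed

lemma distr_trajectory: "distr M borel (trajectory j) = distr M borel (X (int j))"
proof (rule distr_cong_AE)
  show "AE \<omega> in M. trajectory j \<omega> = X (int j) \<omega>"
    using X_eq_path
  proof eventually_elim
    case (elim \<omega>)
    then have "X (int j) \<omega> = trajectory j \<omega>"
      unfolding trajectory_def by (rule spec)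
    then show ?case
      by (rule sym)
  qed
qed simp_all

lemma distr_trajectory_X0: "distr M borel (trajectory j) = distr M borel (X 0)"
  by (rule trans[OF distr_trajectory distr_X])

lemma trajectory_fourth: "mean_le M (\<lambda>\<omega>. norm (trajectory j \<omega>) ^ 4) K"
proof (rule distr_eq_mean_le[where h = "\<lambda>z. norm z ^ 4"])
  show "distr M borel (trajectory 0) = distr M borel (trajectory j)"
    by (simp only: distr_trajectory_X0)
  show "mean_le M (\<lambda>\<omega>. norm (trajectory 0 \<omega>) ^ 4) K"
    using mean_le_weaken[OF G_fourth, of K] by (simp add: K_def trajectory_def)
qed measurable

lemma trajectory_square: "mean_le M (\<lambda>\<omega>. (norm (trajectory j \<omega>))\<^sup>2) K"
  by (intro mean_le_square_of_fourth trajectory_fourth K1) measurable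

lemma integrable_tensor_apply:
  assumes [measurable]: "f \<in> borel_measurable M" "g \<in> borel_measurable M"
    and "integrable M (\<lambda>\<omega>. (norm (f \<omega> :: 'h))\<^sup>2)" "integrable M (\<lambda>\<omega>. (norm (g \<omega> :: 'h))\<^sup>2)"
  shows "integrable M (\<lambda>\<omega>. inner (f \<omega>) u *\<^sub>R g \<omega>)"
proof (rule Bochner_Integration.integrable_bound)
  show "integrable M (\<lambda>\<omega>. norm u * ((norm (f \<omega>))\<^sup>2 + (norm (g \<omega>))\<^sup>2))"
    using assms by simp
  have "norm (inner a u *\<^sub>R b) \<le> norm u * ((norm a)\<^sup>2 + (norm b)\<^sup>2)" for a b :: 'h
  proof -
    have "norm (inner a u *\<^sub>R b) \<le> (norm a * norm u) * norm b"
      using Cauchy_Schwarz_ineq2[of a u] by (simp add: mult_right_mono)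
    also have "\<dots> = norm u * (norm a * norm b)"
      by simp
    also have "\<dots> \<le> norm u * ((norm a)\<^sup>2 + (norm b)\<^sup>2)"
    proof (rule mult_left_mono)
      have "0 \<le> (norm a - norm b)\<^sup>2"
        by simp
      then have "2 * (norm a * norm b) \<le> (norm a)\<^sup>2 + (norm b)\<^sup>2"
        by (simp add: power2_diff)
      moreover have "0 \<le> norm a * norm b"
        by simp
      ultimately show "norm a * norm b \<le> (norm a)\<^sup>2 + (norm b)\<^sup>2"
        by linarith
    qed simp
    finally show ?thesis .
  qed
  then show "AE \<omega> in M. norm (inner (f \<omega>) u *\<^sub>R g \<omega>) \<le> norm (norm u * ((norm (f \<omega>))\<^sup>2 + (norm (g \<omega>))\<^sup>2))"
    by (intro AE_I2) (auto intro: order_trans[OF _ abs_ge_self])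
qed measurable

definition \<Gamma>X :: "'h \<Rightarrow>\<^sub>L 'h" where "\<Gamma>X = cov_operator M (X 0)"

lemma trajectory_cov: "(\<integral>\<omega>. inner (trajectory j \<omega>) u *\<^sub>R trajectory j \<omega> \<partial>M) = \<Gamma>X u"
proof -
  have "(\<integral>\<omega>. inner (f \<omega>) u *\<^sub>R f \<omega> \<partial>M) = (\<integral>z. inner z u *\<^sub>R z \<partial>distr M borel f)"
    if "f \<in> borel_measurable M" for f
    using that by (subst integral_distr) auto
  moreover note distr_trajectory_X0[of j]
  ultimately have "(\<integral>\<omega>. inner (trajectory j \<omega>) u *\<^sub>R trajectory j \<omega> \<partial>M) = (\<integral>\<omega>. inner (X 0 \<omega>) u *\<^sub>R X 0 \<omega> \<partial>M)"
    by simp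
  also have "\<dots> = \<Gamma>X u"
  proof -
    have "mean_le M (\<lambda>\<omega>. (norm (X 0 \<omega>))\<^sup>2) K"
      by (rule distr_eq_mean_le[where N = borel and f = "trajectory 0" and g = "X 0" and h = "\<lambda>z. (norm z)\<^sup>2"])
         (use trajectory_square[of 0] distr_trajectory_X0[of 0] in auto)
    then show ?thesis
      unfolding \<Gamma>X_def by (simp add: cov_operator_apply mean_le_def)
  qed
  finally show ?thesis .
qed

lemma \<Gamma>X_sym: "inner (\<Gamma>X u) v = inner u (\<Gamma>X v)"
proof -
  have int: "integrable M (\<lambda>\<omega>. inner (trajectory 0 \<omega>) w *\<^sub>R trajectory 0 \<omega>)" for w
    using mean_leD(1)[OF trajectory_square[of 0]] by (intro integrable_tensor_apply) auto
  have "inner (\<Gamma>X u) v = (\<integral>\<omega>. inner (trajectory 0 \<omega>) u * inner (trajectory 0 \<omega>) v \<partial>M)" for u v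
    unfolding trajectory_cov[of 0, symmetric] using int by (subst integral_inner_left[symmetric]) auto
  then show ?thesis
    by (simp add: mult.commute inner_commute[of u])
qed

text \<open>
  Stationarity at the times \<open>0\<close> and \<open>1\<close>, together with independence of \<open>X 0\<close> and the next innovation.
\<close>
lemma \<Gamma>X_fixed_point:
  fixes b :: "nat \<Rightarrow> 'h"
  assumes b: "basis_seq b"
  shows "sandwich \<Psi> \<Gamma>X + \<Sigma> = \<Gamma>X"
proof (rule blinfun_eqI)
  fix u
  interpret far: coupled_autoregressions M V 1 \<Psi> \<Sigma> 0 0 b \<rho> 1 K K K
    by (rule autoregression_with_zero[OF b])
  have Gpast: "G \<in> borel_measurable (far.past 0)"
    using far.past_x[of 0] by (simp add: far.x_def[abs_def])
  have ind: "indep_pair M borel G borel (\<lambda>\<omega>. (\<epsilon> 1 \<omega>, 0 :: 'h))"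
    using far.indep_past[OF Gpast] by simp
  have fst: "fst \<in> borel \<rightarrow>\<^sub>M (borel :: 'h measure)"
    by (intro borel_measurable_continuous_onI continuous_intros)
  have ind': "indep_pair M borel G borel (\<epsilon> 1)"
    using indep_pair_compose[OF ind measurable_ident fst] by simp
  define Y where "Y \<omega> = \<Psi> (G \<omega>)" for \<omega>
  define e where "e = \<epsilon> 1"
  have [measurable]: "Y \<in> borel_measurable M" "e \<in> borel_measurable M"
    unfolding Y_def[abs_def] e_def by (auto intro: measurable_blinfun_apply)
  have sqG: "integrable M (\<lambda>\<omega>. (norm (G \<omega>))\<^sup>2)"
    using mean_leD(1)[OF trajectory_square[of 0]] by (simp add: trajectory_def)
  have sqe: "integrable M (\<lambda>\<omega>. (norm (e \<omega>))\<^sup>2)"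
    using mean_leD(1)[OF eps_square[of 1]] by (simp add: e_def)
  have sqY: "integrable M (\<lambda>\<omega>. (norm (Y \<omega>))\<^sup>2)"
  proof (rule Bochner_Integration.integrable_bound[OF sqG])
    have "(norm (Y \<omega>))\<^sup>2 \<le> (norm (G \<omega>))\<^sup>2" for \<omega>
    proof (rule power_mono)
      have "norm (Y \<omega>) \<le> \<rho> * norm (G \<omega>)"
        unfolding Y_def by (rule norm_blinfun)
      also have "\<dots> \<le> 1 * norm (G \<omega>)"
        using Psi_norm by (intro mult_right_mono) auto
      finally show "norm (Y \<omega>) \<le> norm (G \<omega>)"
        by simp
    qed simp
    then show "AE \<omega> in M. norm ((norm (Y \<omega>))\<^sup>2) \<le> norm ((norm (G \<omega>))\<^sup>2)"
      by simp
  qed measurable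
  have inte: "integrable M e"
    using far.integrable_ab(1)[of 1] by (simp add: e_def)
  have ie: "integrable M (\<lambda>\<omega>. inner (e \<omega>) u)"
    using inte by simp
  have int: "integrable M (\<lambda>\<omega>. inner (Y \<omega>) u *\<^sub>R Y \<omega>)" "integrable M (\<lambda>\<omega>. inner (Y \<omega>) u *\<^sub>R e \<omega>)"
    "integrable M (\<lambda>\<omega>. inner (e \<omega>) u *\<^sub>R Y \<omega>)" "integrable M (\<lambda>\<omega>. inner (e \<omega>) u *\<^sub>R e \<omega>)"
    using sqY sqe by (auto intro!: integrable_tensor_apply)
  have c1: "(\<integral>\<omega>. inner (Y \<omega>) u *\<^sub>R e \<omega> \<partial>M) = 0"
  proof -
    define w where "w = (\<integral>\<omega>. inner (Y \<omega>) u *\<^sub>R e \<omega> \<partial>M)"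
    have "inner w w = (\<integral>\<omega>. inner w (inner (Y \<omega>) u *\<^sub>R e \<omega>) \<partial>M)"
      using int(2) by (subst integral_inner_right) (auto simp: w_def)
    also have "\<dots> = 0"
      unfolding Y_def e_def
    proof (rule indep_mean_zero[OF ind', of "\<lambda>_. w" "\<lambda>g z. inner (\<Psi> g) u *\<^sub>R z"])
      show "(\<lambda>(g, z). inner (\<Psi> g) u *\<^sub>R z) \<in> borel_measurable (borel \<Otimes>\<^sub>M (borel :: 'h measure))"
        unfolding borel_prod case_prod_beta by (intro borel_measurable_continuous_onI continuous_intros)
      show "integrable M (\<lambda>\<omega>. inner w (inner (\<Psi> (G \<omega>)) u *\<^sub>R \<epsilon> 1 \<omega>))"
        using int(2) unfolding Y_def e_def by (intro integrable_inner_right) auto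
    qed (use inte mean_eps in \<open>auto simp: e_def\<close>)
    finally show ?thesis
      by (simp add: w_def)
  qed
  have c2: "(\<integral>\<omega>. inner (e \<omega>) u *\<^sub>R Y \<omega> \<partial>M) = 0"
  proof -
    define w where "w = (\<integral>\<omega>. inner (e \<omega>) u *\<^sub>R Y \<omega> \<partial>M)"
    have "inner w w = (\<integral>\<omega>. inner w (inner (e \<omega>) u *\<^sub>R Y \<omega>) \<partial>M)"
      using int(3) by (subst integral_inner_right) (auto simp: w_def)
    also have "\<dots> = 0"
      unfolding Y_def e_def
    proof (rule indep_mean_zero[OF ind', of "\<lambda>_. w" "\<lambda>g z. inner z u *\<^sub>R \<Psi> g"])
      show "(\<lambda>(g, z). inner z u *\<^sub>R \<Psi> g) \<in> borel_measurable (borel \<Otimes>\<^sub>M (borel :: 'h measure))"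
        unfolding borel_prod case_prod_beta by (intro borel_measurable_continuous_onI continuous_intros)
      show "integrable M (\<lambda>\<omega>. inner w (inner (\<epsilon> 1 \<omega>) u *\<^sub>R \<Psi> (G \<omega>)))"
        using int(3) unfolding Y_def e_def by (intro integrable_inner_right) auto
      have "(\<integral>\<omega>. inner (\<epsilon> 1 \<omega>) u *\<^sub>R \<Psi> g \<partial>M) = (\<integral>\<omega>. inner (\<epsilon> 1 \<omega>) u \<partial>M) *\<^sub>R \<Psi> g" for g
        using ie by (subst integral_scaleR_left) (auto simp: e_def)
      moreover have "(\<integral>\<omega>. inner (\<epsilon> 1 \<omega>) u \<partial>M) = 0"
        using inte mean_eps[of 1] by (subst integral_inner_left) (auto simp: e_def)
      ultimately show "(\<integral>\<omega>. inner (\<epsilon> 1 \<omega>) u *\<^sub>R \<Psi> g \<partial>M) = 0" for g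
        by simp
    qed (use ie in \<open>auto simp: e_def\<close>)
    finally show ?thesis
      by (simp add: w_def)
  qed
  have YY: "(\<integral>\<omega>. inner (Y \<omega>) u *\<^sub>R Y \<omega> \<partial>M) = sandwich \<Psi> \<Gamma>X u"
  proof -
    have "(\<integral>\<omega>. inner (Y \<omega>) u *\<^sub>R Y \<omega> \<partial>M) = (\<integral>\<omega>. \<Psi> (inner (G \<omega>) (adj \<Psi> u) *\<^sub>R G \<omega>) \<partial>M)"
      by (simp add: Y_def blinfun.scaleR_right inner_adj)
    also have "\<dots> = \<Psi> (\<integral>\<omega>. inner (G \<omega>) (adj \<Psi> u) *\<^sub>R G \<omega> \<partial>M)"
      using integrable_tensor_apply[OF _ _ sqG sqG]
      by (intro integral_bounded_linear blinfun.bounded_linear_right) auto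
    also have "\<dots> = \<Psi> (\<Gamma>X (adj \<Psi> u))"
      using trajectory_cov[of 0 "adj \<Psi> u"] by (simp add: trajectory_def)
    finally show ?thesis
      by (simp add: sandwich_apply)
  qed
  have "trajectory 1 \<omega> = Y \<omega> + e \<omega>" for \<omega>
    by (simp add: trajectory_def Y_def e_def)
  then have "\<Gamma>X u = (\<integral>\<omega>. inner (Y \<omega> + e \<omega>) u *\<^sub>R (Y \<omega> + e \<omega>) \<partial>M)"
    using trajectory_cov[of 1 u] by simp
  also have "\<dots> = (\<integral>\<omega>. (inner (Y \<omega>) u *\<^sub>R Y \<omega> + inner (Y \<omega>) u *\<^sub>R e \<omega>)
      + (inner (e \<omega>) u *\<^sub>R Y \<omega> + inner (e \<omega>) u *\<^sub>R e \<omega>) \<partial>M)"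
    by (intro Bochner_Integration.integral_cong refl) (simp add: inner_add_left scaleR_add_left scaleR_add_right)
  also have "\<dots> = sandwich \<Psi> \<Gamma>X u + \<Sigma> u"
    using int c1 c2 YY eps_cov[of 1 u] by (simp add: e_def)
  finally show "(sandwich \<Psi> \<Gamma>X + \<Sigma>) u = \<Gamma>X u"
    by (simp add: blinfun.add_left)
qed

end

context coupled_autoregressions
begin

lemma mean_le_sum_function:
  assumes h: "h \<in> borel_measurable borel" "\<And>z. \<bar>h z\<bar> \<le> (1::real)"
    and h0: "\<And>i. 1 \<le> i \<Longrightarrow> i \<le> n \<Longrightarrow> (\<integral>\<omega>. h (fst (V i \<omega>)) \<partial>Q) = 0"
  shows "mean_le Q (\<lambda>\<omega>. (norm (\<Sum>t<n. h (fst (V (Suc t) \<omega>))))\<^sup>2) (real n)"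
proof -
  have meas: "(\<lambda>\<omega>. h (fst (V i \<omega>))) \<in> borel_measurable Q" if "i \<le> n" for i
    by (rule measurable_compose[OF measurable_ab(1)[OF that] h(1)])
  have int: "integrable Q (\<lambda>\<omega>. h (fst (V i \<omega>)))" if "i \<le> n" for i
    by (rule integrable_const_bound[of _ 1]) (use h meas[OF that] in auto)
  have sq: "mean_le Q (\<lambda>\<omega>. (norm (h (fst (V (Suc t) \<omega>))))\<^sup>2) 1" if t: "t < n" for t
  proof (rule mean_le_mono[OF mean_le_const[of 1]])
    have "(h z)\<^sup>2 \<le> 1" for z
      using h(2)[of z] by (simp add: abs_square_le_1)
    then show "(norm (h (fst (V (Suc t) \<omega>))))\<^sup>2 \<le> 1" for \<omega>
      by simp
    show "(\<lambda>\<omega>. (norm (h (fst (V (Suc t) \<omega>))))\<^sup>2) \<in> borel_measurable Q"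
    proof -
      have [measurable]: "(\<lambda>\<omega>. h (fst (V (Suc t) \<omega>))) \<in> borel_measurable Q"
        using meas[of "Suc t"] t by simp
      show ?thesis
        by measurable
    qed
  qed auto
  have "mean_le Q (\<lambda>\<omega>. (norm (\<Sum>t<n. h (fst (V (Suc t) \<omega>))))\<^sup>2) (\<Sum>t<n. 1)"
  proof (rule mean_le_orthogonal_sum[OF meas sq])
    fix t' t assume st: "t' < t" "t < n"
    have X: "(\<lambda>\<omega>. h (fst (V (Suc t') \<omega>))) \<in> borel_measurable (past t)"
      using st by (intro measurable_compose[OF _ h(1)] measurable_fst_snd measurable_past_V) auto
    show "(\<integral>\<omega>. inner (h (fst (V (Suc t') \<omega>))) (h (fst (V (Suc t) \<omega>))) \<partial>Q) = 0"
    proof (rule indep_mean_zero[OF indep_past[OF X st(2)], of "\<lambda>z. z" "\<lambda>_ v. h (fst v)"])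
      have "fst \<in> (borel :: ('h \<times> 'h) measure) \<rightarrow>\<^sub>M borel"
        by (intro borel_measurable_continuous_onI continuous_intros)
      note [measurable] = measurable_compose[OF this h(1)]
      show "(\<lambda>(_, v). h (fst v)) \<in> borel_measurable ((borel :: real measure) \<Otimes>\<^sub>M (borel :: ('h \<times> 'h) measure))"
        by measurable
      show "integrable Q (\<lambda>\<omega>. inner (h (fst (V (Suc t') \<omega>))) (h (fst (V (Suc t) \<omega>))))"
        using st by (intro integrable_inner_of_squares meas mean_leD(1)[OF sq]) auto
    qed (use st int h0 in auto)
  qed auto
  then show ?thesis
    by simp
qed

end

context stationary_autoregression
begin

lemma trajectory_eq_x:
  fixes b :: "nat \<Rightarrow> 'h"
  assumes b: "basis_seq b"
  shows "coupled_autoregressions.x V \<Psi> t \<omega> = trajectory t \<omega>"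
proof -
  interpret far: coupled_autoregressions M V t \<Psi> \<Sigma> 0 0 b \<rho> 1 K K K
    by (rule autoregression_with_zero[OF b])
  show ?thesis
    unfolding far.x_def trajectory_def fst_conv by (simp, rule boot_path_cong) auto
qed

text \<open>
  A sum whose mean square grows linearly has an average of order \<open>n powr (-1/2)\<close>, which leaves room for a
  factor \<open>n powr (1/4)\<close>. This is the growth admitted for the inverse of the smallest eigenvalue in use.
\<close>
lemma small_rate:
  assumes "\<And>n. 1 \<le> n \<Longrightarrow> mean_le M (\<lambda>\<omega>. (A n \<omega>)\<^sup>2) (C * real n)" "\<And>n \<omega>. 0 \<le> A n \<omega>"
  shows "small M (\<lambda>n \<omega>. real n powr (1/4) * (A n \<omega> / real n))"
proof -
  have sq: "small M (\<lambda>n \<omega>. (real n powr (1/4) * (A n \<omega> / real n))\<^sup>2)"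
  proof (rule small_of_mean)
    show "\<forall>\<^sub>F n in sequentially. mean_le M (\<lambda>\<omega>. (real n powr (1/4) * (A n \<omega> / real n))\<^sup>2) (C * real n powr (-1/2))"
    proof (rule eventually_mono[OF eventually_ge_at_top[of 1]])
      fix n :: nat assume n: "1 \<le> n"
      have 1: "(real n powr (1/4))\<^sup>2 = real n powr (1/2)"
        using n by (simp add: power2_eq_square powr_add[symmetric])
      have "real n powr (-1/2) = real n powr (1/2 - 1)"
        by simp
      also have "\<dots> = real n powr (1/2) / real n"
        using n by (simp only: powr_diff) simp
      finally have 2: "(real n powr (1/2) / (real n)\<^sup>2) * (C * real n) = C * real n powr (-1/2)"
        using n by (simp add: power2_eq_square)
      have "mean_le M (\<lambda>\<omega>. (real n powr (1/2) / (real n)\<^sup>2) * (A n \<omega>)\<^sup>2) ((real n powr (1/2) / (real n)\<^sup>2) * (C * real n))"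
        by (intro mean_le_cmult assms n) auto
      then show "mean_le M (\<lambda>\<omega>. (real n powr (1/4) * (A n \<omega> / real n))\<^sup>2) (C * real n powr (-1/2))"
        unfolding 2 by (simp add: power_mult_distrib power_divide 1)
    qed
    have "(\<lambda>n. C * real n powr (-1/2)) \<longlonglongrightarrow> C * 0"
      by (intro tendsto_mult tendsto_const tendsto_neg_powr filterlim_real_sequentially) auto
    then show "(\<lambda>n. C * real n powr (-1/2)) \<longlonglongrightarrow> 0"
      by simp
  qed auto
  show ?thesis
    unfolding small_def
  proof (intro allI impI)
    fix c :: real assume c: "0 < c"
    have "likely M (\<lambda>n \<omega>. (real n powr (1/4) * (A n \<omega> / real n))\<^sup>2 \<le> c\<^sup>2)"
      using c by (intro smallD[OF sq]) auto
    then show "likely M (\<lambda>n \<omega>. real n powr (1/4) * (A n \<omega> / real n) \<le> c)"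
      by (rule likely_mono) (use c in \<open>auto intro!: always_eventually elim: power2_le_imp_le\<close>)
  qed
qed

definition cov_error :: "nat \<Rightarrow> 'w \<Rightarrow> real" where
  "cov_error n \<omega> = norm (gamma_hat n (\<lambda>j. trajectory j \<omega>) - \<Gamma>X)"

definition cross_error :: "nat \<Rightarrow> 'w \<Rightarrow> real" where
  "cross_error n \<omega> = norm ((1 / real n) *\<^sub>R (\<Sum>j<n. trajectory j \<omega> \<otimes>\<^sub>H \<epsilon> (int (j + 1)) \<omega>))"

definition noise_mean :: "nat \<Rightarrow> 'w \<Rightarrow> real" where
  "noise_mean n \<omega> = norm ((1 / real n) *\<^sub>R (\<Sum>j<n. \<epsilon> (int (j + 1)) \<omega>))"

definition path_mean :: "nat \<Rightarrow> 'w \<Rightarrow> real" where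
  "path_mean n \<omega> = norm ((1 / real n) *\<^sub>R (\<Sum>j<n. trajectory j \<omega>))"

lemma small_cov_error:
  fixes b :: "nat \<Rightarrow> 'h"
  assumes b: "basis_seq b"
  shows "small M (\<lambda>n \<omega>. real n powr (1/4) * cov_error n \<omega>)"
proof -
  let ?A = "\<lambda>n \<omega>. norm ((\<Sum>t<n. trajectory t \<omega> \<otimes>\<^sub>H trajectory t \<omega>) - real n *\<^sub>R \<Gamma>X)"
  have "small M (\<lambda>n \<omega>. real n powr (1/4) * (?A n \<omega> / real n))"
  proof (rule small_rate)
    fix n :: nat assume n: "1 \<le> n"
    interpret far: coupled_autoregressions M V n \<Psi> \<Sigma> 0 0 b \<rho> 1 K K K
      by (rule autoregression_with_zero[OF b])
    show "mean_le M (\<lambda>\<omega>. (?A n \<omega>)\<^sup>2) (4220 * K ^ 3 * (1 / (1 - \<rho>)) ^ 8 * real n)"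
      using far.mean_le_Gx[OF \<Gamma>X_fixed_point[OF b] n] by (simp add: far.Gx_def trajectory_eq_x[OF b] far.r_def)
  qed simp
  then show ?thesis
  proof (rule small_mono[OF _ likely_eventually[of M "\<lambda>n _. 1 \<le> n"]])
    show "\<forall>\<^sub>F n in sequentially. \<forall>\<omega>\<in>space M. 1 \<le> n \<longrightarrow>
        real n powr (1/4) * cov_error n \<omega> \<le> real n powr (1/4) * (?A n \<omega> / real n)"
    proof (intro always_eventually allI ballI impI)
      fix n :: nat and \<omega> assume n: "1 \<le> n"
      have "gamma_hat n (\<lambda>j. trajectory j \<omega>) - \<Gamma>X
          = (1 / real n) *\<^sub>R ((\<Sum>t<n. trajectory t \<omega> \<otimes>\<^sub>H trajectory t \<omega>) - real n *\<^sub>R \<Gamma>X)"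
        using n by (simp add: gamma_hat_def scaleR_diff_right)
      then show "real n powr (1/4) * cov_error n \<omega> \<le> real n powr (1/4) * (?A n \<omega> / real n)"
        by (simp add: cov_error_def)
    qed
  qed (auto simp: eventually_ge_at_top)
qed

lemma small_cross_error:
  fixes b :: "nat \<Rightarrow> 'h"
  assumes b: "basis_seq b"
  shows "small M (\<lambda>n \<omega>. real n powr (1/4) * cross_error n \<omega>)"
proof -
  have "small M (\<lambda>n \<omega>. real n powr (1/4) * (norm (\<Sum>j<n. trajectory j \<omega> \<otimes>\<^sub>H \<epsilon> (int (j + 1)) \<omega>) / real n))"
  proof (rule small_rate)
    fix n :: nat assume n: "1 \<le> n"
    interpret far: coupled_autoregressions M V n \<Psi> \<Sigma> 0 0 b \<rho> 1 K K K
      by (rule autoregression_with_zero[OF b])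
    show "mean_le M (\<lambda>\<omega>. (norm (\<Sum>j<n. trajectory j \<omega> \<otimes>\<^sub>H \<epsilon> (int (j + 1)) \<omega>))\<^sup>2) ((K * (1 / (1 - \<rho>)) ^ 4 * K) * real n)"
      using far.mean_le_sum_tensor_noise by (simp add: trajectory_eq_x[OF b] far.Kx_def far.r_def ac_simps)
  qed simp
  then show ?thesis
    by (simp add: cross_error_def)
qed

lemma mean_le_noise:
  fixes b :: "nat \<Rightarrow> 'h"
  assumes b: "basis_seq b"
  shows "mean_le M (\<lambda>\<omega>. (norm (\<Sum>j<n. \<epsilon> (int (j + 1)) \<omega>))\<^sup>2) (K * real n)"
proof -
  interpret far: coupled_autoregressions M V n \<Psi> \<Sigma> 0 0 b \<rho> 1 K K K
    by (rule autoregression_with_zero[OF b])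
  show ?thesis
    using far.mean_le_sum_noise by (simp add: ac_simps)
qed

lemma small_noise_mean:
  fixes b :: "nat \<Rightarrow> 'h"
  assumes b: "basis_seq b"
  shows "small M (\<lambda>n \<omega>. real n powr (1/4) * noise_mean n \<omega>)"
  using small_rate[of "\<lambda>n \<omega>. norm (\<Sum>j<n. \<epsilon> (int (j + 1)) \<omega>)" K] mean_le_noise[OF b]
  by (simp add: noise_mean_def)

text \<open>
  Summing the recursion expresses the sum of the path through the sum of the innovations and the two ends.
\<close>
lemma small_path_mean:
  fixes b :: "nat \<Rightarrow> 'h"
  assumes b: "basis_seq b"
  shows "small M (\<lambda>n \<omega>. real n powr (1/4) * path_mean n \<omega>)"
proof -
  define r where "r = 1 / (1 - \<rho>)"
  have r0: "0 \<le> r"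
    using Psi_norm by (simp add: r_def)
  have "small M (\<lambda>n \<omega>. real n powr (1/4) * (norm (\<Sum>j<n. trajectory j \<omega>) / real n))"
  proof (rule small_rate)
    fix n :: nat assume n: "1 \<le> n"
    show "mean_le M (\<lambda>\<omega>. (norm (\<Sum>j<n. trajectory j \<omega>))\<^sup>2) ((r\<^sup>2 * (4 * (3 * K))) * real n)"
    proof (rule mean_le_mono)
      show "mean_le M (\<lambda>\<omega>. r\<^sup>2 * (4 * ((norm (\<Sum>j<n. \<epsilon> (int (j + 1)) \<omega>))\<^sup>2 + (norm (trajectory n \<omega>))\<^sup>2 + (norm (trajectory 0 \<omega>))\<^sup>2)))
          (r\<^sup>2 * (4 * (K * real n + K + K)))"
        by (intro mean_le_cmult mean_le_add mean_le_noise[OF b] trajectory_square) auto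
      have "K \<le> K * real n"
        using n K1 by simp
      then have "K * real n + K + K \<le> 3 * (K * real n)"
        by linarith
      then have "r\<^sup>2 * (4 * (K * real n + K + K)) \<le> r\<^sup>2 * (4 * (3 * (K * real n)))"
        by (intro mult_left_mono) auto
      then show "r\<^sup>2 * (4 * (K * real n + K + K)) \<le> (r\<^sup>2 * (4 * (3 * K))) * real n"
        by (simp add: ac_simps)
      fix \<omega>
      let ?S = "\<Sum>j<n. trajectory j \<omega>" and ?e = "\<Sum>j<n. \<epsilon> (int (j + 1)) \<omega>"
      have "(\<Sum>j<n. trajectory (Suc j) \<omega>) = \<Psi> ?S + ?e"
        by (simp add: trajectory_Suc sum.distrib blinfun.sum_right)
      moreover have "(\<Sum>j<n. trajectory (Suc j) \<omega>) = ?S + (trajectory n \<omega> - trajectory 0 \<omega>)"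
        using sum_lessThan_telescope[of "\<lambda>j. trajectory j \<omega>" n] by (simp add: sum_subtractf algebra_simps)
      ultimately have "?S = \<Psi> ?S + (?e - trajectory n \<omega> + trajectory 0 \<omega>)"
        by (simp add: algebra_simps)
      then have "norm ?S \<le> norm (\<Psi> ?S) + norm (?e - trajectory n \<omega> + trajectory 0 \<omega>)"
        by (metis norm_triangle_ineq)
      also have "\<dots> \<le> \<rho> * norm ?S + (norm ?e + norm (trajectory n \<omega>) + norm (trajectory 0 \<omega>) + 0)"
        using norm_triangle_ineq4[of ?e "trajectory n \<omega>"]
          norm_triangle_ineq[of "?e - trajectory n \<omega>" "trajectory 0 \<omega>"] norm_blinfun[of \<Psi> ?S]
        by linarith
      finally have "norm ?S * (1 - \<rho>) \<le> norm ?e + norm (trajectory n \<omega>) + norm (trajectory 0 \<omega>) + 0"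
        by (simp add: algebra_simps)
      then have "norm ?S \<le> r * (norm ?e + norm (trajectory n \<omega>) + norm (trajectory 0 \<omega>) + 0)"
        using Psi_norm by (simp add: r_def pos_le_divide_eq)
      then have "(norm ?S)\<^sup>2 \<le> (r * (norm ?e + norm (trajectory n \<omega>) + norm (trajectory 0 \<omega>) + 0))\<^sup>2"
        by (intro power_mono) auto
      also have "\<dots> \<le> r\<^sup>2 * (4 * ((norm ?e)\<^sup>2 + (norm (trajectory n \<omega>))\<^sup>2 + (norm (trajectory 0 \<omega>))\<^sup>2 + 0\<^sup>2))"
        unfolding power_mult_distrib by (intro mult_left_mono square_sum4_le) auto
      finally show "(norm ?S)\<^sup>2 \<le> r\<^sup>2 * (4 * ((norm ?e)\<^sup>2 + (norm (trajectory n \<omega>))\<^sup>2 + (norm (trajectory 0 \<omega>))\<^sup>2))"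
        by simp
    qed auto
  qed simp
  then show ?thesis
    by (simp add: path_mean_def)
qed

definition fourth_mean :: "nat \<Rightarrow> 'w \<Rightarrow> real" where
  "fourth_mean n \<omega> = (1 / real n) * (\<Sum>j<n. norm (trajectory j \<omega>) ^ 4)"

lemma mean_average:
  assumes "\<And>j. mean_le M (f j) c" "1 \<le> n"
  shows "mean_le M (\<lambda>\<omega>. (1 / real n) * (\<Sum>j<n. f j \<omega>)) c"
proof -
  have "mean_le M (\<lambda>\<omega>. (1 / real n) * (\<Sum>j<n. f j \<omega>)) ((1 / real n) * (\<Sum>j<n. c))"
    by (intro mean_le_cmult mean_le_sum assms) auto
  then show ?thesis
    using assms(2) by simp
qed

lemma stoch_bounded_fourth_mean: "stoch_bounded M fourth_mean"
proof (rule stoch_bounded_of_mean)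
  show "\<forall>\<^sub>F n in sequentially. mean_le M (fourth_mean n) K"
    unfolding fourth_mean_def[abs_def]
    by (rule eventually_mono[OF eventually_ge_at_top[of 1]]) (intro mean_average trajectory_fourth)
qed (simp add: fourth_mean_def sum_nonneg)

lemma small_ends: "small M (\<lambda>n \<omega>. (norm (trajectory n \<omega>) ^ 4 + norm (trajectory 0 \<omega>) ^ 4) / real n)"
proof (rule small_of_mean)
  show "\<forall>\<^sub>F n in sequentially. mean_le M (\<lambda>\<omega>. (norm (trajectory n \<omega>) ^ 4 + norm (trajectory 0 \<omega>) ^ 4) / real n) ((1 / real n) * (K + K))"
  proof (intro always_eventually allI)
    fix n
    have "mean_le M (\<lambda>\<omega>. (1 / real n) * (norm (trajectory n \<omega>) ^ 4 + norm (trajectory 0 \<omega>) ^ 4)) ((1 / real n) * (K + K))"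
      by (intro mean_le_cmult mean_le_add trajectory_fourth) auto
    then show "mean_le M (\<lambda>\<omega>. (norm (trajectory n \<omega>) ^ 4 + norm (trajectory 0 \<omega>) ^ 4) / real n) ((1 / real n) * (K + K))"
      by simp
  qed
  have "(\<lambda>n. (1 / real n) * (K + K)) \<longlonglongrightarrow> 0 * (K + K)"
    by (intro tendsto_intros lim_1_over_n)
  then show "(\<lambda>n. (1 / real n) * (K + K)) \<longlonglongrightarrow> 0"
    by simp
qed auto

lemma stoch_bounded_trace: "stoch_bounded M (\<lambda>n \<omega>. (1 / real n) * (\<Sum>j<n. (norm (trajectory j \<omega>))\<^sup>2))"
proof (rule stoch_bounded_of_mean)
  show "\<forall>\<^sub>F n in sequentially. mean_le M (\<lambda>\<omega>. (1 / real n) * (\<Sum>j<n. (norm (trajectory j \<omega>))\<^sup>2)) K"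
    by (rule eventually_mono[OF eventually_ge_at_top[of 1]]) (intro mean_average trajectory_square)
qed (simp add: sum_nonneg)

end


section \<open>Consistency of the estimated autoregression operator\<close>

lemma likely_ball_finite:
  assumes "finite I" "\<And>i. i \<in> I \<Longrightarrow> likely M (\<lambda>n \<omega>. S i n \<omega>)"
  shows "likely M (\<lambda>n \<omega>. \<forall>i\<in>I. S i n \<omega>)"
  using assms
proof (induction I rule: finite_induct)
  case empty
  show ?case
    by (rule likely_eventually) auto
next
  case (insert i I)
  then have "likely M (\<lambda>n \<omega>. S i n \<omega> \<and> (\<forall>i\<in>I. S i n \<omega>))"
    by (intro likely_conj) auto
  then show ?case
    by simp
qed

text \<open>
  The basis \<open>b\<close> witnesses that the operator is Hilbert--Schmidt. The eigenvalues \<open>lam\<close> are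
  positive and exhaust the spectrum, which makes the covariance operator injective.
\<close>
locale bootstrap_setting = stationary_autoregression M X \<epsilon> \<Psi>
  for M :: "'w measure" and X \<epsilon> :: "int \<Rightarrow> 'w \<Rightarrow> 'h::{real_inner, banach, second_countable_topology}"
    and \<Psi> :: "'h \<Rightarrow>\<^sub>L 'h" +
  fixes b :: "nat \<Rightarrow> 'h" and lam :: "nat \<Rightarrow> real" and k :: "nat \<Rightarrow> nat"
    and lam_hat :: "nat \<Rightarrow> (nat \<Rightarrow> 'h) \<Rightarrow> nat \<Rightarrow> real"
    and v_hat :: "nat \<Rightarrow> (nat \<Rightarrow> 'h) \<Rightarrow> nat \<Rightarrow> 'h"
  assumes basis: "basis_seq b" and hs: "summable (\<lambda>i. (norm (\<Psi> (b i)))\<^sup>2)"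
    and lam_eigen: "eigenvalues \<Gamma>X = lam ` {1..}"
    and lam_decreasing: "\<And>j. j \<ge> 1 \<Longrightarrow> lam (j + 1) < lam j"
    and lam_pos: "\<And>j. j \<ge> 1 \<Longrightarrow> lam j > 0"
    and eigen_hat: "\<And>n x. n \<ge> 1 \<Longrightarrow> eigensystem (gamma_hat n x) (lam_hat n x) (v_hat n x)"
    and k_pos: "\<And>n. k n \<ge> 1"
    and k_lim: "filterlim k at_top sequentially"
    and rate: "\<exists>\<beta>>1/2. (\<lambda>n. 1 / lam (k n)) \<in> O(\<lambda>n. real n powr (1/4) / ln (real n) powr \<beta>)"
begin

lemma lam_mono:
  assumes "1 \<le> i" "i < j"
  shows "lam j < lam i"
  using \<open>i < j\<close>
proof (induction j rule: less_induct)
  case (less j)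
  then obtain j' where j': "j = j' + 1" "i \<le> j'"
    by (cases j) auto
  then have "lam j < lam j'"
    using lam_decreasing[of j'] \<open>1 \<le> i\<close> by simp
  then show ?case
    using less.IH[of j'] j' by (cases "i = j'") auto
qed

lemma \<Gamma>X_injective: "\<Gamma>X u = 0 \<Longrightarrow> u = 0"
proof (rule ccontr)
  assume "\<Gamma>X u = 0" "u \<noteq> 0"
  then have "0 \<in> eigenvalues \<Gamma>X"
    by (auto simp: eigenvalues_def eigenspace_def)
  then obtain j where "1 \<le> j" "lam j = 0"
    unfolding lam_eigen by auto
  then show False
    using lam_pos[of j] by simp
qed

lemma \<Gamma>X_eigenvectors:
  obtains w where "\<And>i j. 1 \<le> i \<Longrightarrow> 1 \<le> j \<Longrightarrow> inner (w i) (w j) = (if i = j then 1 else 0)"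
    "\<And>i. 1 \<le> i \<Longrightarrow> \<Gamma>X (w i) = lam i *\<^sub>R w i"
proof -
  have "\<exists>x. norm x = 1 \<and> \<Gamma>X x = lam i *\<^sub>R x" if i: "1 \<le> i" for i
  proof -
    have "lam i \<in> eigenvalues \<Gamma>X"
      unfolding lam_eigen using i by auto
    then obtain x where "x \<noteq> 0" "\<Gamma>X x = lam i *\<^sub>R x"
      by (auto simp: eigenvalues_def eigenspace_def)
    then show ?thesis
      by (intro exI[of _ "(1 / norm x) *\<^sub>R x"]) (simp add: blinfun.scaleR_right)
  qed
  then obtain w where w: "\<And>i. 1 \<le> i \<Longrightarrow> norm (w i) = 1" "\<And>i. 1 \<le> i \<Longrightarrow> \<Gamma>X (w i) = lam i *\<^sub>R w i"
    by metis
  have "inner (w i) (w j) = (if i = j then 1 else 0)" if ij: "1 \<le> i" "1 \<le> j" for i j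
  proof (cases "i = j")
    case True
    then show ?thesis
      using w(1)[of i] ij by (simp add: norm_eq_1)
  next
    case False
    have "lam i * inner (w i) (w j) = lam j * inner (w i) (w j)"
      using \<Gamma>X_sym[of "w i" "w j"] w(2) ij by simp
    moreover have "lam i \<noteq> lam j"
      using lam_mono[of i j] lam_mono[of j i] False ij by (cases "i < j") auto
    ultimately show ?thesis
      using False by simp
  qed
  then show ?thesis
    using that w(2) by blast
qed

text \<open>The logarithm absorbs the unspecified constant of the Landau symbol.\<close>
lemma eventually_lam_lower: "\<forall>\<^sub>F n in sequentially. real n powr (-1/4) \<le> lam (k n)"
proof -
  obtain \<beta> where \<beta>: "1/2 < \<beta>" "(\<lambda>n. 1 / lam (k n)) \<in> O(\<lambda>n. real n powr (1/4) / ln (real n) powr \<beta>)"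
    using rate by blast
  obtain c where c: "0 < c"
      "\<forall>\<^sub>F n in sequentially. norm (1 / lam (k n)) \<le> c * norm (real n powr (1/4) / ln (real n) powr \<beta>)"
    using landau_o.bigE[OF \<beta>(2)] by blast
  \<comment> \<open>From here on \<open>c \<le> sqrt (ln n) \<le> ln n powr \<beta>\<close>, as \<open>\<beta> > 1/2\<close>.\<close>
  have "\<forall>\<^sub>F n in sequentially. exp (max 1 (c\<^sup>2)) \<le> real n"
    using filterlim_real_sequentially by (simp add: filterlim_at_top)
  with c(2) show ?thesis
  proof eventually_elim
    case (elim n)
    have n: "0 < real n"
      using elim(2) exp_gt_zero by (rule order.strict_trans2[rotated])
    then have ln: "max 1 (c\<^sup>2) \<le> ln (real n)"
      using elim(2) n by (subst ln_ge_iff)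
    have "c \<le> sqrt (ln (real n))"
      using ln c(1) by (intro real_le_rsqrt) simp
    also have "\<dots> = ln (real n) powr (1/2)"
      using ln by (simp add: powr_half_sqrt)
    also have "\<dots> \<le> ln (real n) powr \<beta>"
      using ln \<beta>(1) by (intro powr_mono) auto
    finally have lnc: "c / ln (real n) powr \<beta> \<le> 1"
      using ln by (simp add: divide_le_eq_1)
    have pos: "0 < lam (k n)"
      using lam_pos k_pos by simp
    have "1 / lam (k n) \<le> (c / ln (real n) powr \<beta>) * real n powr (1/4)"
      using elim(1) pos n by simp
    also have "\<dots> \<le> 1 * real n powr (1/4)"
      using lnc by (intro mult_right_mono) auto
    finally have "1 \<le> real n powr (1/4) * lam (k n)"
      using pos by (simp add: divide_le_eq)
    then show "real n powr (-1/4) \<le> lam (k n)"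
      using n by (simp add: powr_minus_divide divide_le_eq mult.commute)
  qed
qed

abbreviation sam :: "nat \<Rightarrow> 'w \<Rightarrow> nat \<Rightarrow> 'h" where "sam n \<omega> \<equiv> sample X n \<omega>"

abbreviation lamh :: "nat \<Rightarrow> 'w \<Rightarrow> nat \<Rightarrow> real" where "lamh n \<omega> \<equiv> lam_hat n (sam n \<omega>)"

abbreviation vh :: "nat \<Rightarrow> 'w \<Rightarrow> nat \<Rightarrow> 'h" where "vh n \<omega> \<equiv> v_hat n (sam n \<omega>)"

definition Ph :: "nat \<Rightarrow> 'w \<Rightarrow> 'h \<Rightarrow>\<^sub>L 'h" where
  "Ph n \<omega> = psi_hat n (k n) (lamh n \<omega>) (vh n \<omega>) (sam n \<omega>)"

text \<open>
  What is used of the sample path by path: it coincides with the trajectory, which holds almost surely,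
  and the cutoff stays where eigenvalues are not too small.
\<close>
definition good :: "nat \<Rightarrow> 'w \<Rightarrow> bool" where
  "good n \<omega> \<longleftrightarrow> 1 \<le> n \<and> (\<forall>j\<le>n. sam n \<omega> j = trajectory j \<omega>) \<and> real n powr (-1/4) / 2 \<le> lamh n \<omega> (k n)"

lemma good_gamma_hat: "good n \<omega> \<Longrightarrow> gamma_hat n (sam n \<omega>) = gamma_hat n (\<lambda>j. trajectory j \<omega>)"
  unfolding gamma_hat_def good_def by (intro arg_cong[where f = "\<lambda>z. (1 / real n) *\<^sub>R z"] sum.cong) auto

lemma good_pos:
  assumes "good n \<omega>"
  shows "0 < lamh n \<omega> (k n)"
proof -
  have "0 < real n powr (-1/4) / 2" "real n powr (-1/4) / 2 \<le> lamh n \<omega> (k n)"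
    using assms by (auto simp: good_def)
  then show ?thesis
    by linarith
qed

lemma good_eigen: "good n \<omega> \<Longrightarrow> eigensystem (gamma_hat n (sam n \<omega>)) (lamh n \<omega>) (vh n \<omega>)"
  by (intro eigen_hat) (simp add: good_def)

text \<open>
  Weyl's inequality: the empirical eigenvalue differs from the true one, which is at least
  \<open>n powr (-1/4)\<close>, by at most the error of the covariance operator, which is of smaller order.
\<close>
lemma likely_good: "likely M good"
proof -
  have "likely M (\<lambda>n \<omega>. \<forall>j\<le>n. sam n \<omega> j = trajectory j \<omega>)"
    using sample_AE by (intro likely_AE) (auto elim: eventually_mono)
  moreover have "likely M (\<lambda>n \<omega>. real n powr (1/4) * cov_error n \<omega> \<le> 1/2)"
    by (intro smallD[OF small_cov_error[OF basis]]) simp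
  ultimately have "likely M (\<lambda>n \<omega>. (\<forall>j\<le>n. sam n \<omega> j = trajectory j \<omega>)
      \<and> real n powr (1/4) * cov_error n \<omega> \<le> 1/2)"
    by (rule likely_conj)
  then show ?thesis
  proof (rule likely_mono)
    show "\<forall>\<^sub>F n in sequentially. \<forall>\<omega>\<in>space M. (\<forall>j\<le>n. sam n \<omega> j = trajectory j \<omega>)
        \<and> real n powr (1/4) * cov_error n \<omega> \<le> 1/2 \<longrightarrow> good n \<omega>"
      using eventually_lam_lower eventually_ge_at_top[of 1]
    proof eventually_elim
      case (elim n)
      show ?case
      proof safe
        fix \<omega> assume a: "\<forall>j\<le>n. sam n \<omega> j = trajectory j \<omega>" "real n powr (1/4) * cov_error n \<omega> \<le> 1/2"
        have "cov_error n \<omega> \<le> real n powr (-1/4) / 2"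
          using a(2) elim(2) by (simp add: powr_minus_divide le_divide_eq mult.commute)
        moreover have g: "gamma_hat n (sam n \<omega>) = gamma_hat n (\<lambda>j. trajectory j \<omega>)"
          unfolding gamma_hat_def using a(1) by (intro arg_cong[where f = "\<lambda>z. (1 / real n) *\<^sub>R z"] sum.cong) auto
        obtain w where w: "\<And>i j. 1 \<le> i \<Longrightarrow> 1 \<le> j \<Longrightarrow> inner (w i) (w j) = (if i = j then 1 else 0)"
            "\<And>i. 1 \<le> i \<Longrightarrow> \<Gamma>X (w i) = lam i *\<^sub>R w i"
          using \<Gamma>X_eigenvectors by blast
        have "lam (k n) - norm (gamma_hat n (sam n \<omega>) - \<Gamma>X) \<le> lamh n \<omega> (k n)"
        proof (rule gamma_hat_eigenvalue_lower_bound[OF eigen_hat[OF elim(2)] k_pos w])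
          fix i assume "1 \<le> i" "i \<le> k n"
          then show "lam (k n) \<le> lam i"
            using lam_mono[of i "k n"] by (cases "i = k n") auto
        qed auto
        ultimately have "real n powr (-1/4) / 2 \<le> lamh n \<omega> (k n)"
          using elim(1) by (simp add: g cov_error_def)
        then show "good n \<omega>"
          using a(1) elim(2) by (simp add: good_def)
      qed
    qed
  qed
qed

definition Qh :: "nat \<Rightarrow> 'w \<Rightarrow> 'h \<Rightarrow>\<^sub>L 'h" where
  "Qh n \<omega> = cutoff_complement n (k n) (sam n \<omega>) (lamh n \<omega>) (vh n \<omega>)"

text \<open>It is at most the trace divided by \<open>k n + 1\<close>.\<close>
lemma small_next_eigenvalue: "small M (\<lambda>n \<omega>. if good n \<omega> then lamh n \<omega> (k n + 1) else 0)"
proof (rule small_mono)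
  have "(\<lambda>n. 1 / real (k n + 1)) \<longlonglongrightarrow> 0"
  proof (rule tendsto_divide_0[OF tendsto_const])
    have "filterlim (\<lambda>n. real (k n)) at_top sequentially"
      by (rule filterlim_compose[OF filterlim_real_sequentially k_lim])
    then have "filterlim (\<lambda>n. real (k n + 1)) at_top sequentially"
      by (rule filterlim_at_top_mono) auto
    then show "filterlim (\<lambda>n. real (k n + 1)) at_infinity sequentially"
      by (rule filterlim_at_top_imp_at_infinity)
  qed
  then show "small M (\<lambda>n \<omega>. (1 / real (k n + 1)) * ((1 / real n) * (\<Sum>j<n. (norm (trajectory j \<omega>))\<^sup>2)))"
    by (intro small_mult_stoch_bounded small_of_tendsto stoch_bounded_trace) (auto simp: sum_nonneg)
  show "\<forall>\<^sub>F n in sequentially. \<forall>\<omega>\<in>space M. good n \<omega> \<longrightarrow> (if good n \<omega> then lamh n \<omega> (k n + 1) else 0)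
      \<le> (1 / real (k n + 1)) * ((1 / real n) * (\<Sum>j<n. (norm (trajectory j \<omega>))\<^sup>2))"
  proof (intro always_eventually allI ballI impI)
    fix n \<omega> assume g: "good n \<omega>"
    have "real (k n + 1) * lamh n \<omega> (k n + 1) \<le> (1 / real n) * (\<Sum>j<n. (norm (sam n \<omega> j))\<^sup>2)"
      by (rule gamma_hat_eigenvalue_le_trace[OF good_eigen[OF g]]) simp
    also have "(\<Sum>j<n. (norm (sam n \<omega> j))\<^sup>2) = (\<Sum>j<n. (norm (trajectory j \<omega>))\<^sup>2)"
      using g by (intro sum.cong) (auto simp: good_def)
    finally have "lamh n \<omega> (k n + 1) * real (k n + 1) \<le> (1 / real n) * (\<Sum>j<n. (norm (trajectory j \<omega>))\<^sup>2)"
      by (simp only: mult.commute)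
    then have "lamh n \<omega> (k n + 1) \<le> ((1 / real n) * (\<Sum>j<n. (norm (trajectory j \<omega>))\<^sup>2)) / real (k n + 1)"
      by (subst pos_le_divide_eq) auto
    then show "(if good n \<omega> then lamh n \<omega> (k n + 1) else 0)
        \<le> (1 / real (k n + 1)) * ((1 / real n) * (\<Sum>j<n. (norm (trajectory j \<omega>))\<^sup>2))"
      by (simp only: g if_True times_divide_eq_left mult_1)
  qed
qed (rule likely_good)

lemma small_cov_error': "small M cov_error"
proof (rule small_mono[OF small_cov_error[OF basis] likely_good])
  show "\<forall>\<^sub>F n in sequentially. \<forall>\<omega>\<in>space M. good n \<omega> \<longrightarrow> cov_error n \<omega> \<le> real n powr (1/4) * cov_error n \<omega>"
  proof (intro always_eventually allI ballI impI)
    fix n \<omega> assume "good n \<omega>"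
    then have "1 \<le> real n powr (1/4)"
      by (intro ge_one_powr_ge_zero) (auto simp: good_def)
    then have "1 * cov_error n \<omega> \<le> real n powr (1/4) * cov_error n \<omega>"
      by (intro mult_right_mono) (auto simp: cov_error_def)
    then show "cov_error n \<omega> \<le> real n powr (1/4) * cov_error n \<omega>"
      by simp
  qed
qed

text \<open>
  Every vector is close to the range of the covariance operator, hence to that of the empirical one, on
  which the projection leaves only the small empirical eigenvalues.
\<close>
lemma small_complement: "small M (\<lambda>n \<omega>. norm (Qh n \<omega> e))"
  unfolding small_def
proof (intro allI impI)
  fix c :: real assume c: "0 < c"
  have "e \<in> closure (range \<Gamma>X)"
    using dense_range_of_injective_selfadjoint[OF \<Gamma>X_sym \<Gamma>X_injective] by auto
  then obtain y where y: "dist (\<Gamma>X y) e < c / 2"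
    using c unfolding closure_approachable by (metis half_gt_zero rangeE)
  have "small M (\<lambda>n \<omega>. norm y * cov_error n \<omega> + norm y * (if good n \<omega> then lamh n \<omega> (k n + 1) else 0))"
    by (intro small_add small_cmult small_cov_error' small_next_eigenvalue) auto
  then have "likely M (\<lambda>n \<omega>. norm y * cov_error n \<omega> + norm y * (if good n \<omega> then lamh n \<omega> (k n + 1) else 0) \<le> c / 2)"
    using c by (intro smallD) auto
  from likely_conj[OF this likely_good] show "likely M (\<lambda>n \<omega>. norm (Qh n \<omega> e) \<le> c)"
  proof (rule likely_mono, intro always_eventually allI ballI impI, elim conjE)
    fix n \<omega> assume g: "good n \<omega>" and le: "norm y * cov_error n \<omega> + norm y * (if good n \<omega> then lamh n \<omega> (k n + 1) else 0) \<le> c / 2"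
    note cc = good_eigen[OF g] k_pos[of n] good_pos[OF g]
    have contr: "norm (Qh n \<omega> z) \<le> norm z" for z
    proof -
      have "norm (Qh n \<omega> z) \<le> norm (Qh n \<omega>) * norm z"
        by (rule norm_blinfun)
      also have "\<dots> \<le> 1 * norm z"
        unfolding Qh_def by (intro mult_right_mono norm_cutoff_complement_le[OF cc]) auto
      finally show ?thesis
        by simp
    qed
    let ?G = "gamma_hat n (sam n \<omega>)"
    have "e = (e - \<Gamma>X y) + ((\<Gamma>X y - ?G y) + ?G y)"
      by simp
    then have "Qh n \<omega> e = Qh n \<omega> (e - \<Gamma>X y) + (Qh n \<omega> (\<Gamma>X y - ?G y) + Qh n \<omega> (?G y))"
      by (metis blinfun.add_right)
    then have "norm (Qh n \<omega> e) \<le> norm (Qh n \<omega> (e - \<Gamma>X y)) + (norm (Qh n \<omega> (\<Gamma>X y - ?G y)) + norm (Qh n \<omega> (?G y)))"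
      by (metis norm_triangle_mono norm_triangle_ineq order_refl)
    also have "\<dots> \<le> norm (e - \<Gamma>X y) + (norm (\<Gamma>X y - ?G y) + norm (Qh n \<omega> (?G y)))"
      by (intro add_mono contr order_refl)
    also have "norm (e - \<Gamma>X y) \<le> c / 2"
      using y by (simp add: dist_norm norm_minus_commute)
    also have "norm (\<Gamma>X y - ?G y) \<le> norm y * cov_error n \<omega>"
      using norm_blinfun[of "?G - \<Gamma>X" y]
      by (simp add: cov_error_def good_gamma_hat[OF g] blinfun.diff_left norm_minus_commute mult.commute)
    also have "norm (Qh n \<omega> (?G y)) \<le> lamh n \<omega> (k n + 1) * norm y"
      unfolding Qh_def by (rule norm_gamma_hat_complement_le[OF cc])
    finally show "norm (Qh n \<omega> e) \<le> c"
      using le g by (simp add: mult.commute)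
  qed
qed

definition theta :: "nat \<Rightarrow> 'w \<Rightarrow> real" where "theta n \<omega> = norm (Ph n \<omega> - \<Psi>)"

text \<open>
  The two parts of the error are treated by \<open>hilbert_schmidt_compose_small\<close> with pointwise convergence
  of the projections, and by the lower bound for the last empirical eigenvalue in use.
\<close>
lemma small_theta: "small M theta"
  unfolding small_def
proof (intro allI impI)
  fix c :: real assume c: "0 < c"
  then have c2: "0 < c / 2"
    by simp
  obtain m where m: "\<And>Q :: 'h \<Rightarrow>\<^sub>L 'h. norm Q \<le> 1 \<Longrightarrow> (\<And>x y. inner (blinfun_apply Q x) y = inner x (blinfun_apply Q y)) \<Longrightarrow>
      norm (\<Psi> o\<^sub>L Q) \<le> c / 2 + (\<Sum>i<m. norm (\<Psi> (b i)) * norm (Q (b i)))"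
    using hilbert_schmidt_compose_small[OF basis hs c2] by blast
  have "small M (\<lambda>n \<omega>. (\<Sum>i<m. norm (\<Psi> (b i)) * norm (Qh n \<omega> (b i))) + 2 * (real n powr (1/4) * cross_error n \<omega>))"
    by (intro small_add small_sum small_cmult small_complement small_cross_error[OF basis]) auto
  then have "likely M (\<lambda>n \<omega>. (\<Sum>i<m. norm (\<Psi> (b i)) * norm (Qh n \<omega> (b i))) + 2 * (real n powr (1/4) * cross_error n \<omega>) \<le> c / 2)"
    using c2 by (rule smallD)
  from likely_conj[OF this likely_good] show "likely M (\<lambda>n \<omega>. theta n \<omega> \<le> c)"
  proof (rule likely_mono, intro always_eventually allI ballI impI, elim conjE)
    fix n \<omega> assume g: "good n \<omega>"
      and le: "(\<Sum>i<m. norm (\<Psi> (b i)) * norm (Qh n \<omega> (b i))) + 2 * (real n powr (1/4) * cross_error n \<omega>) \<le> c / 2"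
    note cc = good_eigen[OF g] k_pos[of n] good_pos[OF g]
    have n: "1 \<le> n"
      using g by (simp add: good_def)
    have "(\<Sum>j<n. sam n \<omega> j \<otimes>\<^sub>H (sam n \<omega> (j + 1) - \<Psi> (sam n \<omega> j))) = (\<Sum>j<n. trajectory j \<omega> \<otimes>\<^sub>H \<epsilon> (int (j + 1)) \<omega>)"
      using g by (intro sum.cong) (auto simp: good_def trajectory_Suc)
    then have "theta n \<omega> \<le> norm (\<Psi> o\<^sub>L Qh n \<omega>) + cross_error n \<omega> / lamh n \<omega> (k n)"
      using psi_hat_error_le[OF cc, of \<Psi>] by (simp add: theta_def Ph_def Qh_def cross_error_def)
    also have "norm (\<Psi> o\<^sub>L Qh n \<omega>) \<le> c / 2 + (\<Sum>i<m. norm (\<Psi> (b i)) * norm (Qh n \<omega> (b i)))"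
      unfolding Qh_def by (intro m norm_cutoff_complement_le[OF cc] cutoff_complement_sym[OF cc])
    also have "cross_error n \<omega> / lamh n \<omega> (k n) \<le> cross_error n \<omega> / (real n powr (-1/4) / 2)"
      using g n by (intro divide_left_mono mult_pos_pos good_pos) (auto simp: good_def cross_error_def)
    also have "\<dots> = 2 * (real n powr (1/4) * cross_error n \<omega>)"
      using n by (simp add: powr_minus_divide)
    finally show "theta n \<omega> \<le> c"
      using le by simp
  qed
qed


section \<open>The residuals\<close>

definition resid_mean :: "nat \<Rightarrow> 'w \<Rightarrow> 'h" where
  "resid_mean n \<omega> = (1 / real n) *\<^sub>R (\<Sum>j=1..n. residual (Ph n \<omega>) (sam n \<omega>) j)"

abbreviation centred :: "nat \<Rightarrow> 'w \<Rightarrow> nat \<Rightarrow> 'h" where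
  "centred n \<omega> \<equiv> centred_residual n (Ph n \<omega>) (sam n \<omega>)"

lemma centred_eq: "centred n \<omega> j = residual (Ph n \<omega>) (sam n \<omega>) j - resid_mean n \<omega>"
  by (simp add: centred_residual_def resid_mean_def)

lemma good_residual:
  assumes "good n \<omega>" "1 \<le> j" "j \<le> n"
  shows "residual (Ph n \<omega>) (sam n \<omega>) j = \<epsilon> (int j) \<omega> - (Ph n \<omega> - \<Psi>) (trajectory (j - 1) \<omega>)"
proof -
  obtain i where i: "j = Suc i"
    using assms(2) by (cases j) auto
  then show ?thesis
    using assms by (simp add: residual_def good_def trajectory_Suc blinfun.diff_left)
qed

lemma norm_resid_mean_le:
  assumes g: "good n \<omega>"
  shows "norm (resid_mean n \<omega>) \<le> noise_mean n \<omega> + theta n \<omega> * path_mean n \<omega>"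
proof -
  have "(\<Sum>j=1..n. residual (Ph n \<omega>) (sam n \<omega>) j)
      = (\<Sum>j=1..n. \<epsilon> (int j) \<omega> - (Ph n \<omega> - \<Psi>) (trajectory (j - 1) \<omega>))"
    by (intro sum.cong good_residual g) auto
  also have "\<dots> = (\<Sum>j<n. \<epsilon> (int (j + 1)) \<omega> - (Ph n \<omega> - \<Psi>) (trajectory j \<omega>))"
    by (rule sum.reindex_bij_witness[of _ Suc "\<lambda>j. j - 1"]) auto
  finally have "resid_mean n \<omega> = (1 / real n) *\<^sub>R (\<Sum>j<n. \<epsilon> (int (j + 1)) \<omega>)
      - (Ph n \<omega> - \<Psi>) ((1 / real n) *\<^sub>R (\<Sum>j<n. trajectory j \<omega>))"
    by (simp add: resid_mean_def sum_subtractf blinfun.sum_right blinfun.scaleR_right scaleR_diff_right)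
  also have "norm \<dots> \<le> noise_mean n \<omega> + theta n \<omega> * path_mean n \<omega>"
    unfolding noise_mean_def path_mean_def theta_def
    by (intro order_trans[OF norm_triangle_ineq4] add_mono norm_blinfun order_refl)
  finally show ?thesis .
qed

text \<open>
  The rate is the one that the defect of the bootstrap fixed point equation requires: it contains
  \<open>n * (norm (resid_mean n \<omega>))\<^sup>2\<close>, and its square has to be small compared with \<open>n\<close>.
\<close>
lemma small_resid_mean: "small M (\<lambda>n \<omega>. real n powr (1/4) * norm (resid_mean n \<omega>))"
proof (rule small_mono)
  show "small M (\<lambda>n \<omega>. real n powr (1/4) * noise_mean n \<omega> + real n powr (1/4) * path_mean n \<omega>)"
    by (rule small_add[OF small_noise_mean[OF basis] small_path_mean[OF basis]])
  show "likely M (\<lambda>n \<omega>. good n \<omega> \<and> theta n \<omega> \<le> 1)"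
    by (intro likely_conj likely_good smallD small_theta) simp
  show "\<forall>\<^sub>F n in sequentially. \<forall>\<omega>\<in>space M. good n \<omega> \<and> theta n \<omega> \<le> 1 \<longrightarrow>
      real n powr (1/4) * norm (resid_mean n \<omega>) \<le> real n powr (1/4) * noise_mean n \<omega> + real n powr (1/4) * path_mean n \<omega>"
  proof (intro always_eventually allI ballI impI, elim conjE)
    fix n \<omega> assume g: "good n \<omega>" and t: "theta n \<omega> \<le> 1"
    have "norm (resid_mean n \<omega>) \<le> noise_mean n \<omega> + theta n \<omega> * path_mean n \<omega>"
      by (rule norm_resid_mean_le[OF g])
    also have "\<dots> \<le> noise_mean n \<omega> + 1 * path_mean n \<omega>"
      using t by (intro add_mono mult_right_mono) (auto simp: path_mean_def)
    finally have "real n powr (1/4) * norm (resid_mean n \<omega>) \<le> real n powr (1/4) * (noise_mean n \<omega> + 1 * path_mean n \<omega>)"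
      by (intro mult_left_mono) auto
    then show "real n powr (1/4) * norm (resid_mean n \<omega>) \<le> real n powr (1/4) * noise_mean n \<omega> + real n powr (1/4) * path_mean n \<omega>"
      by (simp add: algebra_simps)
  qed
qed

text \<open>The cost of moving each innovation to the centred residual with the same index.\<close>
definition resid_error :: "nat \<Rightarrow> 'w \<Rightarrow> real" where
  "resid_error n \<omega> = (1 / real n) * (\<Sum>j=1..n. norm (\<epsilon> (int j) \<omega> - centred n \<omega> j) ^ 4)"

lemma small_resid_error: "small M resid_error"
proof (rule small_mono)
  have s: "small M (\<lambda>n \<omega>. (real n powr (1/4) * norm (resid_mean n \<omega>)) ^ 4)"
    by (rule small_power[OF small_resid_mean]) auto
  have t: "small M (\<lambda>n \<omega>. theta n \<omega> ^ 4 * fourth_mean n \<omega>)"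
    by (intro small_mult_stoch_bounded small_power small_theta stoch_bounded_fourth_mean)
       (auto simp: theta_def fourth_mean_def sum_nonneg)
  show "small M (\<lambda>n \<omega>. 64 * (theta n \<omega> ^ 4 * fourth_mean n \<omega> + (real n powr (1/4) * norm (resid_mean n \<omega>)) ^ 4))"
    by (intro small_cmult small_add s t) simp
  show "likely M good"
    by (rule likely_good)
  show "\<forall>\<^sub>F n in sequentially. \<forall>\<omega>\<in>space M. good n \<omega> \<longrightarrow> resid_error n \<omega>
      \<le> 64 * (theta n \<omega> ^ 4 * fourth_mean n \<omega> + (real n powr (1/4) * norm (resid_mean n \<omega>)) ^ 4)"
  proof (intro always_eventually allI ballI impI)
    fix n \<omega> assume g: "good n \<omega>"
    have n: "1 \<le> n"
      using g by (simp add: good_def)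
    have one: "norm (\<epsilon> (int j) \<omega> - centred n \<omega> j) ^ 4
        \<le> 64 * (theta n \<omega> ^ 4 * norm (trajectory (j - 1) \<omega>) ^ 4 + norm (resid_mean n \<omega>) ^ 4)" if j: "j \<in> {1..n}" for j
    proof -
      have "\<epsilon> (int j) \<omega> - centred n \<omega> j = (Ph n \<omega> - \<Psi>) (trajectory (j - 1) \<omega>) + resid_mean n \<omega>"
        unfolding centred_eq using good_residual[OF g, of j] j by simp
      then have "norm (\<epsilon> (int j) \<omega> - centred n \<omega> j) \<le> theta n \<omega> * norm (trajectory (j - 1) \<omega>) + norm (resid_mean n \<omega>)"
        unfolding theta_def by (metis add_right_mono norm_blinfun norm_triangle_le)
      then have "norm (\<epsilon> (int j) \<omega> - centred n \<omega> j) ^ 4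
          \<le> (theta n \<omega> * norm (trajectory (j - 1) \<omega>) + norm (resid_mean n \<omega>) + 0 + 0) ^ 4"
        by (intro power_mono) auto
      also have "\<dots> \<le> 64 * ((theta n \<omega> * norm (trajectory (j - 1) \<omega>)) ^ 4 + norm (resid_mean n \<omega>) ^ 4 + 0 ^ 4 + 0 ^ 4)"
        by (rule fourth_power_sum4_le)
      finally show ?thesis
        by (simp add: power_mult_distrib)
    qed
    have "resid_error n \<omega> \<le> (1 / real n) * (\<Sum>j=1..n. 64 * (theta n \<omega> ^ 4 * norm (trajectory (j - 1) \<omega>) ^ 4 + norm (resid_mean n \<omega>) ^ 4))"
      unfolding resid_error_def by (intro mult_left_mono sum_mono one) auto
    also have "(\<Sum>j=1..n. 64 * (theta n \<omega> ^ 4 * norm (trajectory (j - 1) \<omega>) ^ 4 + norm (resid_mean n \<omega>) ^ 4))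
        = (\<Sum>j<n. 64 * (theta n \<omega> ^ 4 * norm (trajectory j \<omega>) ^ 4 + norm (resid_mean n \<omega>) ^ 4))"
      by (rule sum.reindex_bij_witness[of _ Suc "\<lambda>j. j - 1"]) auto
    also have "\<dots> = 64 * (theta n \<omega> ^ 4 * (\<Sum>j<n. norm (trajectory j \<omega>) ^ 4) + real n * norm (resid_mean n \<omega>) ^ 4)"
    proof -
      have "(\<Sum>j<n. 64 * (A * f j + B)) = 64 * (A * (\<Sum>j<n. f j) + real n * B)" for A B :: real and f
        by (simp add: sum.distrib sum_distrib_left distrib_left)
      then show ?thesis .
    qed
    also have "(1 / real n) * \<dots> = 64 * (theta n \<omega> ^ 4 * fourth_mean n \<omega> + norm (resid_mean n \<omega>) ^ 4)"
      using n by (simp add: fourth_mean_def field_simps)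
    also have "\<dots> \<le> 64 * (theta n \<omega> ^ 4 * fourth_mean n \<omega> + (real n powr (1/4) * norm (resid_mean n \<omega>)) ^ 4)"
    proof -
      have "1 \<le> real n powr (1/4)"
        using n by (intro ge_one_powr_ge_zero) auto
      then have "1 * norm (resid_mean n \<omega>) \<le> real n powr (1/4) * norm (resid_mean n \<omega>)"
        by (intro mult_right_mono) auto
      then have "norm (resid_mean n \<omega>) ^ 4 \<le> (real n powr (1/4) * norm (resid_mean n \<omega>)) ^ 4"
        by (intro power_mono) auto
      then show ?thesis
        by simp
    qed
    finally show "resid_error n \<omega> \<le> 64 * (theta n \<omega> ^ 4 * fourth_mean n \<omega> + (real n powr (1/4) * norm (resid_mean n \<omega>)) ^ 4)" .
  qed
qed

text \<open>
  A bound for \<open>n\<close> times the defect of the bootstrap fixed point equation.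
\<close>
definition boot_error :: "nat \<Rightarrow> 'w \<Rightarrow> real" where
  "boot_error n \<omega> = (norm (trajectory n \<omega>))\<^sup>2 + (norm (trajectory 0 \<omega>))\<^sup>2 + real n * (norm (resid_mean n \<omega>))\<^sup>2"

lemma small_boot_error: "small M (\<lambda>n \<omega>. (boot_error n \<omega>)\<^sup>2 / real n)"
proof (rule small_mono)
  show "small M (\<lambda>n \<omega>. 4 * ((norm (trajectory n \<omega>) ^ 4 + norm (trajectory 0 \<omega>) ^ 4) / real n
      + (real n powr (1/4) * norm (resid_mean n \<omega>)) ^ 4))"
    by (intro small_cmult small_add small_ends small_power small_resid_mean) auto
  show "likely M good"
    by (rule likely_good)
  show "\<forall>\<^sub>F n in sequentially. \<forall>\<omega>\<in>space M. good n \<omega> \<longrightarrow> (boot_error n \<omega>)\<^sup>2 / real n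
      \<le> 4 * ((norm (trajectory n \<omega>) ^ 4 + norm (trajectory 0 \<omega>) ^ 4) / real n
        + (real n powr (1/4) * norm (resid_mean n \<omega>)) ^ 4)"
  proof (intro always_eventually allI ballI impI)
    fix n \<omega> assume g: "good n \<omega>"
    have n: "1 \<le> n"
      using g by (simp add: good_def)
    have pw: "(real n powr (1/4)) ^ 4 = real n"
      using n by (simp add: powr_realpow[symmetric] powr_powr)
    have "(boot_error n \<omega>)\<^sup>2 = ((norm (trajectory n \<omega>))\<^sup>2 + (norm (trajectory 0 \<omega>))\<^sup>2 + real n * (norm (resid_mean n \<omega>))\<^sup>2 + 0)\<^sup>2"
      by (simp add: boot_error_def)
    also have "\<dots> \<le> 4 * (((norm (trajectory n \<omega>))\<^sup>2)\<^sup>2 + ((norm (trajectory 0 \<omega>))\<^sup>2)\<^sup>2 + (real n * (norm (resid_mean n \<omega>))\<^sup>2)\<^sup>2 + 0\<^sup>2)"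
      by (rule square_sum4_le)
    also have "\<dots> = 4 * (norm (trajectory n \<omega>) ^ 4 + norm (trajectory 0 \<omega>) ^ 4 + (real n)\<^sup>2 * norm (resid_mean n \<omega>) ^ 4)"
      by (simp add: power_mult_distrib flip: power_mult)
    finally have "(boot_error n \<omega>)\<^sup>2 / real n
        \<le> 4 * (norm (trajectory n \<omega>) ^ 4 + norm (trajectory 0 \<omega>) ^ 4 + (real n)\<^sup>2 * norm (resid_mean n \<omega>) ^ 4) / real n"
      by (rule divide_right_mono) simp
    also have "\<dots> = 4 * ((norm (trajectory n \<omega>) ^ 4 + norm (trajectory 0 \<omega>) ^ 4) / real n
        + (real n powr (1/4) * norm (resid_mean n \<omega>)) ^ 4)"
      using n unfolding power_mult_distrib pw by (simp add: field_simps power2_eq_square)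
    finally show "(boot_error n \<omega>)\<^sup>2 / real n \<le> 4 * ((norm (trajectory n \<omega>) ^ 4 + norm (trajectory 0 \<omega>) ^ 4) / real n
        + (real n powr (1/4) * norm (resid_mean n \<omega>)) ^ 4)" .
  qed
qed

definition resid_cov :: "nat \<Rightarrow> 'w \<Rightarrow> 'h \<Rightarrow>\<^sub>L 'h" where
  "resid_cov n \<omega> = (1 / real n) *\<^sub>R (\<Sum>j=1..n. centred n \<omega> j \<otimes>\<^sub>H centred n \<omega> j)"

lemma boot_fixed_point_error:
  assumes g: "good n \<omega>"
  shows "norm (real n *\<^sub>R (sandwich (Ph n \<omega>) (gamma_hat n (sam n \<omega>)) + resid_cov n \<omega> - gamma_hat n (sam n \<omega>)))
    \<le> boot_error n \<omega>"
proof -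
  note cc = good_eigen[OF g] k_pos[of n] good_pos[OF g]
  have n: "1 \<le> n"
    using g by (simp add: good_def)
  let ?x = "sam n \<omega>" and ?m = "resid_mean n \<omega>"
  have rc: "resid_cov n \<omega> = (1 / real n) *\<^sub>R (\<Sum>j=1..n. residual (Ph n \<omega>) ?x j \<otimes>\<^sub>H residual (Ph n \<omega>) ?x j) - ?m \<otimes>\<^sub>H ?m"
    unfolding resid_cov_def centred_eq
    unfolding resid_mean_def by (rule centred_second_moment[OF n])
  have "sandwich (Ph n \<omega>) (gamma_hat n ?x) + resid_cov n \<omega> - gamma_hat n ?x
      = (1 / real n) *\<^sub>R (?x n \<otimes>\<^sub>H ?x n - ?x 0 \<otimes>\<^sub>H ?x 0) - ?m \<otimes>\<^sub>H ?m"
    unfolding rc using gamma_hat_fixed_point[OF cc n] by (simp add: Ph_def algebra_simps)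
  then have eq: "real n *\<^sub>R (sandwich (Ph n \<omega>) (gamma_hat n ?x) + resid_cov n \<omega> - gamma_hat n ?x)
      = (trajectory n \<omega> \<otimes>\<^sub>H trajectory n \<omega> - trajectory 0 \<omega> \<otimes>\<^sub>H trajectory 0 \<omega>) - real n *\<^sub>R (?m \<otimes>\<^sub>H ?m)"
    using g n by (simp add: good_def scaleR_diff_right)
  have "norm (trajectory n \<omega> \<otimes>\<^sub>H trajectory n \<omega> - trajectory 0 \<omega> \<otimes>\<^sub>H trajectory 0 \<omega> - real n *\<^sub>R (?m \<otimes>\<^sub>H ?m))
      \<le> norm (trajectory n \<omega> \<otimes>\<^sub>H trajectory n \<omega>) + norm (trajectory 0 \<omega> \<otimes>\<^sub>H trajectory 0 \<omega>)
      + real n * norm (?m \<otimes>\<^sub>H ?m)"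
    using norm_triangle_ineq4[of "trajectory n \<omega> \<otimes>\<^sub>H trajectory n \<omega>" "trajectory 0 \<omega> \<otimes>\<^sub>H trajectory 0 \<omega>"]
      norm_triangle_ineq4[of "trajectory n \<omega> \<otimes>\<^sub>H trajectory n \<omega> - trajectory 0 \<omega> \<otimes>\<^sub>H trajectory 0 \<omega>"
        "real n *\<^sub>R (?m \<otimes>\<^sub>H ?m)"]
    by simp
  also have "\<dots> \<le> boot_error n \<omega>"
    unfolding boot_error_def power2_eq_square by (intro add_mono mult_left_mono norm_tensor_le) auto
  finally show ?thesis
    unfolding eq .
qed


section \<open>The residuals are distributed almost as the innovations\<close>

definition \<mu> :: "'h measure" where "\<mu> = distr M borel (\<epsilon> 0)"

lemma prob_space_\<mu>: "prob_space \<mu>"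
  unfolding \<mu>_def by (rule prob_space_distr) simp

lemma mean_le_\<mu>:
  assumes "h \<in> borel_measurable borel"
  shows "mean_le \<mu> h c \<longleftrightarrow> mean_le M (\<lambda>\<omega>. h (\<epsilon> i \<omega>)) c"
  unfolding \<mu>_def iid_ident[of 0 i] by (rule mean_le_distr_iff) (use assms in auto)

text \<open>
  Chebyshev's inequality for the number of innovations in a cell. Cells of probability zero satisfy
  the inequality anyway.
\<close>
lemma likely_frequency:
  assumes q: "q \<in> borel_measurable borel" and eta: "0 < \<eta>" "\<eta> < 1"
  shows "likely M (\<lambda>n \<omega>. (1 - \<eta>) * measure \<mu> (q -` {v :: 'h}) \<le> real (card {j\<in>{1..n}. q (\<epsilon> (int j) \<omega>) = v}) / real n)"
proof (cases "measure \<mu> (q -` {v}) = 0")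
  case True
  then show ?thesis
    by (auto intro!: likely_eventually)
next
  case False
  interpret mu: prob_space \<mu>
    by (rule prob_space_\<mu>)
  define p where "p = measure \<mu> (q -` {v})"
  have p: "0 < p" "p \<le> 1"
    using False by (auto simp: p_def less_le)
  have cell: "q -` {v} \<in> sets borel"
    using measurable_sets[OF q, of "{v}"] by simp
  define h where "h z = indicator (q -` {v}) z - p" for z
  have h: "h \<in> borel_measurable borel" "\<bar>h z\<bar> \<le> 1" for z
  proof -
    show "h \<in> borel_measurable borel"
      unfolding h_def[abs_def]
      by (rule borel_measurable_diff[OF borel_measurable_indicator[OF cell] borel_measurable_const])
    show "\<bar>h z\<bar> \<le> 1"
      using p by (auto simp: h_def indicator_def)
  qed
  have h0: "(\<integral>\<omega>. h (\<epsilon> i \<omega>) \<partial>M) = 0" for i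
  proof -
    have "(\<integral>\<omega>. h (\<epsilon> i \<omega>) \<partial>M) = (\<integral>z. h z \<partial>\<mu>)"
      unfolding \<mu>_def iid_ident[of 0 i] using h by (subst integral_distr) auto
    also have "\<dots> = 0"
    proof -
      have "q -` {v} \<in> sets \<mu>"
        using cell by (simp add: \<mu>_def)
      then have "integrable \<mu> (indicator (q -` {v}) :: 'h \<Rightarrow> real)"
        by (rule integrable_real_indicator) (simp add: mu.emeasure_eq_measure)
      moreover have "space \<mu> = UNIV"
        by (simp add: \<mu>_def)
      then have "(\<integral>z. indicator (q -` {v}) z \<partial>\<mu>) = p"
        by (simp add: p_def)
      ultimately show ?thesis
        unfolding h_def using mu.prob_space by simp
    qed
    finally show ?thesis .
  qed
  have "small M (\<lambda>n \<omega>. real n powr (1/4) * (\<bar>\<Sum>t<n. h (\<epsilon> (int (t + 1)) \<omega>)\<bar> / real n))"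
  proof (rule small_rate[where C = 1])
    fix n :: nat assume n: "1 \<le> n"
    interpret far: coupled_autoregressions M V n \<Psi> \<Sigma> 0 0 b \<rho> 1 K K K
      by (rule autoregression_with_zero[OF basis])
    show "mean_le M (\<lambda>\<omega>. \<bar>\<Sum>t<n. h (\<epsilon> (int (t + 1)) \<omega>)\<bar>\<^sup>2) (1 * real n)"
      using far.mean_le_sum_function[OF h] h0 by simp
  qed simp
  then have "likely M (\<lambda>n \<omega>. real n powr (1/4) * (\<bar>\<Sum>t<n. h (\<epsilon> (int (t + 1)) \<omega>)\<bar> / real n) \<le> \<eta> * p)"
    using eta p by (intro smallD) auto
  then show ?thesis
  proof (rule likely_mono)
    show "\<forall>\<^sub>F n in sequentially. \<forall>\<omega>\<in>space M. real n powr (1/4) * (\<bar>\<Sum>t<n. h (\<epsilon> (int (t + 1)) \<omega>)\<bar> / real n) \<le> \<eta> * p \<longrightarrow>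
        (1 - \<eta>) * measure \<mu> (q -` {v}) \<le> real (card {j\<in>{1..n}. q (\<epsilon> (int j) \<omega>) = v}) / real n"
    proof (rule eventually_mono[OF eventually_ge_at_top[of 1]], intro ballI impI)
      fix n :: nat and \<omega> assume n: "1 \<le> n"
        and le: "real n powr (1/4) * (\<bar>\<Sum>t<n. h (\<epsilon> (int (t + 1)) \<omega>)\<bar> / real n) \<le> \<eta> * p"
      define N where "N = real (card {j\<in>{1..n}. q (\<epsilon> (int j) \<omega>) = v})"
      have "(\<Sum>t<n. h (\<epsilon> (int (t + 1)) \<omega>)) = (\<Sum>j=1..n. h (\<epsilon> (int j) \<omega>))"
        by (rule sum.reindex_bij_witness[of _ "\<lambda>j. j - 1" Suc]) auto
      also have "\<dots> = (\<Sum>j=1..n. if q (\<epsilon> (int j) \<omega>) = v then 1 else 0) - real n * p"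
        by (simp add: h_def sum_subtractf indicator_def of_bool_def del: sum_of_bool_eq)
      also have "(\<Sum>j=1..n. if q (\<epsilon> (int j) \<omega>) = v then 1 else 0 :: real) = N"
        unfolding N_def real_of_card by (rule sum.inter_filter[symmetric]) simp
      finally have s: "(\<Sum>t<n. h (\<epsilon> (int (t + 1)) \<omega>)) = N - real n * p" .
      have "1 \<le> real n powr (1/4)"
        using n by (intro ge_one_powr_ge_zero) auto
      then have "1 * (\<bar>N - real n * p\<bar> / real n) \<le> real n powr (1/4) * (\<bar>N - real n * p\<bar> / real n)"
        by (intro mult_right_mono) auto
      then have "\<bar>N - real n * p\<bar> / real n \<le> \<eta> * p"
        using le unfolding s by linarith
      then have "\<bar>N - real n * p\<bar> \<le> \<eta> * p * real n"
        using n by (simp add: divide_le_eq)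
      then have "(1 - \<eta>) * p * real n \<le> N"
        by (simp add: algebra_simps abs_le_iff)
      then show "(1 - \<eta>) * measure \<mu> (q -` {v}) \<le> real (card {j\<in>{1..n}. q (\<epsilon> (int j) \<omega>) = v}) / real n"
        using n by (simp add: N_def p_def le_divide_eq)
    qed
  qed
qed

text \<open>
  A joint distribution of an innovation and a bootstrap innovation for the data at \<open>\<omega>\<close>.
\<close>
definition close_coupling :: "real \<Rightarrow> nat \<Rightarrow> 'w \<Rightarrow> ('h \<times> 'h) measure \<Rightarrow> bool" where
  "close_coupling c n \<omega> \<nu> \<longleftrightarrow> prob_space \<nu> \<and> sets \<nu> = sets borel \<and> distr \<nu> borel fst = \<mu> \<and>
     distr \<nu> borel snd = distr (measure_pmf (residual_pmf n (Ph n \<omega>) (sam n \<omega>))) borel (\<lambda>x. x) \<and>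
     mean_le \<nu> (\<lambda>z. norm (fst z - snd z) ^ 4) c"

text \<open>
  The quantizer is chosen first, and fixes the cost \<open>R\<close> of landing in different cells; then \<open>\<eta>\<close> can be
  taken small enough for \<open>R\<close>. The remaining two costs, from quantizing the observed innovations and from
  replacing them by residuals, are small on a likely event.
\<close>
lemma likely_coupling:
  assumes c: "0 < c"
  shows "likely M (\<lambda>n \<omega>. \<exists>\<nu>. close_coupling c n \<omega> \<nu>)"
proof (rule likelyI)
  fix \<eta>0 :: real assume \<eta>0: "0 < \<eta>0"
  interpret mu: prob_space \<mu>
    by (rule prob_space_\<mu>)
  \<comment> \<open>Four costs of size \<open>t\<close>, with the factor \<open>64\<close> from splitting a fourth power.\<close>
  define t where "t = c / 256"
  have t: "0 < t"
    using c by (simp add: t_def)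
  \<comment> \<open>The quantization error is small enough for Markov's inequality to hold at level \<open>t\<close> up to probability \<open>\<eta>0 / 2\<close>.\<close>
  define e where "e = t * min 1 (\<eta>0 / 2)"
  have e: "0 < e" "e \<le> t" "e / t \<le> \<eta>0 / 2"
    using t \<eta>0 by (auto simp: e_def intro: mult_left_le)
  have sets: "sets \<mu> = sets borel"
    by (simp add: \<mu>_def)
  have n4: "(\<lambda>z :: 'h. norm z ^ 4) \<in> borel_measurable borel"
    by measurable
  have "integrable \<mu> (\<lambda>x. norm x ^ 4)"
    by (rule mean_leD(1)) (use mean_le_\<mu>[OF n4, of c\<^sub>4 0] eps_fourth in blast)
  then obtain q where q: "q \<in> borel_measurable borel" "finite (range q)" "mean_le \<mu> (\<lambda>x. norm (x - q x) ^ 4) e"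
    using quantizer_exists[OF sets _ e(1)] by blast
  define R where "R = (\<Sum>u\<in>range q. \<Sum>v\<in>range q. norm (u - v) ^ 4)"
  have R0: "0 \<le> R"
    by (simp add: R_def sum_nonneg)
  have R: "norm (u - v) ^ 4 \<le> R" if "u \<in> range q" "v \<in> range q" for u v
  proof -
    have "norm (u - v) ^ 4 \<le> (\<Sum>v\<in>range q. norm (u - v) ^ 4)"
      using that q(2) by (intro member_le_sum) auto
    also have "\<dots> \<le> R"
      unfolding R_def using that q(2) by (intro member_le_sum[where f = "\<lambda>u. \<Sum>v\<in>range q. norm (u - v) ^ 4"]) (auto simp: sum_nonneg)
    finally show ?thesis .
  qed
  define \<eta> where "\<eta> = min (1/2) (t / (R + 1))"
  have \<eta>: "0 < \<eta>" "\<eta> < 1" "R * \<eta> \<le> t"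
  proof -
    show "0 < \<eta>" "\<eta> < 1"
      using t R0 by (auto simp: \<eta>_def)
    have "R * \<eta> \<le> R * (t / (R + 1))"
      using R0 by (intro mult_left_mono) (auto simp: \<eta>_def)
    also have "\<dots> \<le> t"
      using R0 t by (simp add: divide_le_eq algebra_simps)
    finally show "R * \<eta> \<le> t" .
  qed
  have A: "likely M (\<lambda>n \<omega>. (\<forall>v\<in>range q. (1 - \<eta>) * measure \<mu> (q -` {v}) \<le> real (card {j\<in>{1..n}. q (\<epsilon> (int j) \<omega>) = v}) / real n)
      \<and> resid_error n \<omega> \<le> t)"
    using q \<eta> t by (intro likely_conj likely_ball_finite likely_frequency smallD small_resid_error) auto
  let ?A = "\<lambda>n \<omega>. (\<forall>v\<in>range q. (1 - \<eta>) * measure \<mu> (q -` {v}) \<le> real (card {j\<in>{1..n}. q (\<epsilon> (int j) \<omega>) = v}) / real n)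
      \<and> resid_error n \<omega> \<le> t"
  let ?B = "\<lambda>n \<omega>. (1 / real n) * (\<Sum>j=1..n. norm (q (\<epsilon> (int j) \<omega>) - \<epsilon> (int j) \<omega>) ^ 4)"
  have B: "outer_measure_of M {\<omega> \<in> space M. \<not> ?B n \<omega> \<le> t} \<le> ennreal (\<eta>0 / 2)" if n: "1 \<le> n" for n
  proof -
    have q4: "(\<lambda>x. norm (x - q x) ^ 4) \<in> borel_measurable borel"
      using q(1) by measurable
    have "mean_le M (\<lambda>\<omega>. norm (\<epsilon> i \<omega> - q (\<epsilon> i \<omega>)) ^ 4) e" for i
      using mean_le_\<mu>[OF q4, of e i] q(3) by blast
    then have "mean_le M (?B n) ((1 / real n) * (\<Sum>j=1..n. e))"
      by (intro mean_le_cmult mean_le_sum) (simp_all add: norm_minus_commute)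
    then have "mean_le M (?B n) e"
      using n by simp
    then have "outer_measure_of M {\<omega> \<in> space M. \<not> ?B n \<omega> \<le> t} \<le> ennreal (e / t)"
      using t by (intro outer_markov) (auto simp: sum_nonneg)
    also have "\<dots> \<le> ennreal (\<eta>0 / 2)"
      using e by (intro ennreal_leI)
    finally show ?thesis .
  qed
  have "\<forall>\<^sub>F n in sequentially. outer_measure_of M {\<omega> \<in> space M. \<not> ?A n \<omega>} \<le> ennreal (\<eta>0 / 2)"
    using \<eta>0 by (intro likelyD[OF A]) simp
  with eventually_ge_at_top[of 1]
  show "\<forall>\<^sub>F n in sequentially. outer_measure_of M {\<omega> \<in> space M. \<not> (\<exists>\<nu>. close_coupling c n \<omega> \<nu>)} \<le> ennreal \<eta>0"
  proof eventually_elim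
    case (elim n)
    have "\<exists>\<nu>. close_coupling c n \<omega> \<nu>" if a: "?A n \<omega>" "?B n \<omega> \<le> t" for \<omega>
    proof -
      interpret ec: empirical_coupling \<mu> q "\<lambda>j. \<epsilon> (int j) \<omega>" n \<eta>
        by unfold_locales (use sets elim(1) \<eta> q a(1) in auto)
      let ?f = "centred n \<omega>"
      have m1: "mean_le (ec.joint ?f) (\<lambda>z. norm (fst z - snd z) ^ 4)
          (64 * (e + R * \<eta> + ?B n \<omega> + (1 / real n) * (\<Sum>j=1..n. norm (\<epsilon> (int j) \<omega> - ?f j) ^ 4)))"
        by (rule ec.mean_le_joint_cost[OF q(3) R R0])
      have m2: "64 * (e + R * \<eta> + ?B n \<omega> + (1 / real n) * (\<Sum>j=1..n. norm (\<epsilon> (int j) \<omega> - ?f j) ^ 4)) \<le> 64 * (t + t + t + t)"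
        using e \<eta> a unfolding resid_error_def by (intro mult_left_mono add_mono) auto
      have m3: "64 * (t + t + t + t) = c"
        by (simp add: t_def)
      have "mean_le (ec.joint ?f) (\<lambda>z. norm (fst z - snd z) ^ 4) c"
        by (rule mean_le_weaken[OF m1 m2[unfolded m3]])
      then have "close_coupling c n \<omega> (ec.joint ?f)"
        unfolding close_coupling_def
        using ec.prob_space_joint ec.joint_fst ec.joint_snd by (simp add: residual_pmf_def ec.joint_def)
      then show ?thesis
        by blast
    qed
    then have "outer_measure_of M {\<omega> \<in> space M. \<not> (\<exists>\<nu>. close_coupling c n \<omega> \<nu>)}
        \<le> outer_measure_of M {\<omega> \<in> space M. \<not> (?A n \<omega> \<and> ?B n \<omega> \<le> t)}"
      by (intro outer_measure_of_mono) blast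
    also have "\<dots> \<le> outer_measure_of M {\<omega> \<in> space M. \<not> ?A n \<omega>} + outer_measure_of M {\<omega> \<in> space M. \<not> ?B n \<omega> \<le> t}"
      by (rule outer_measure_of_conj_le)
    also have "\<dots> \<le> ennreal (\<eta>0 / 2) + ennreal (\<eta>0 / 2)"
      by (intro add_mono elim B)
    also have "\<dots> = ennreal \<eta>0"
      using \<eta>0 by (simp flip: ennreal_plus)
    finally show ?case .
  qed
qed

end


section \<open>The Mallows distance\<close>

context prob_space
begin

lemma distr_indep_vars_cong:
  assumes "indep_vars (\<lambda>_. borel) X I" "I \<noteq> {}"
    and "prob_space N" "prob_space.indep_vars N (\<lambda>_. borel) Y I"
    and "\<And>i. i \<in> I \<Longrightarrow> distr M borel (X i) = distr N borel (Y i)"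
  shows "distr M (PiM I (\<lambda>_. borel)) (\<lambda>\<omega>. \<lambda>i\<in>I. X i \<omega>) = distr N (PiM I (\<lambda>_. borel)) (\<lambda>\<omega>. \<lambda>i\<in>I. Y i \<omega>)"
proof -
  interpret N: prob_space N
    by fact
  have "distr M (PiM I (\<lambda>_. borel)) (\<lambda>\<omega>. \<lambda>i\<in>I. X i \<omega>) = PiM I (\<lambda>i. distr M borel (X i))"
    using assms(1,2) indep_vars_iff_distr_eq_PiM'[where I = I and M' = "\<lambda>_. borel" and X = X] by (auto simp: indep_vars_def)
  also have "\<dots> = PiM I (\<lambda>i. distr N borel (Y i))"
    by (intro PiM_cong assms) simp
  also have "\<dots> = distr N (PiM I (\<lambda>_. borel)) (\<lambda>\<omega>. \<lambda>i\<in>I. Y i \<omega>)"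
    using assms(2,4) N.indep_vars_iff_distr_eq_PiM'[where I = I and M' = "\<lambda>_. borel" and X = Y] by (auto simp: N.indep_vars_def)
  finally show ?thesis .
qed

end

lemma indep_vars_PiM_coordinates:
  assumes N: "\<And>i. i \<in> I \<Longrightarrow> prob_space (N i)" "\<And>i. i \<in> I \<Longrightarrow> sets (N i) = sets borel" and "I \<noteq> {}"
  shows "prob_space.indep_vars (PiM I N) (\<lambda>_. borel) (\<lambda>i \<omega>. \<omega> i) I"
    and "i \<in> I \<Longrightarrow> distr (PiM I N) borel (\<lambda>\<omega>. \<omega> i) = N i"
proof -
  interpret P: prob_space "PiM I N"
    by (rule prob_space_PiM) (rule N)
  have meas: "(\<lambda>\<omega>. \<omega> i) \<in> borel_measurable (PiM I N)" if "i \<in> I" for i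
    using measurable_component_singleton[of i I N] that N(2)[OF that] by (simp cong: measurable_cong_sets)
  have comp: "distr (PiM I N) borel (\<lambda>\<omega>. \<omega> i) = N i" if "i \<in> I" for i
  proof -
    have "distr (PiM I N) borel (\<lambda>\<omega>. \<omega> i) = distr (PiM I N) (N i) (\<lambda>\<omega>. \<omega> i)"
      by (rule distr_cong) (use N(2)[OF that] in auto)
    also have "\<dots> = N i"
      by (rule distr_PiM_component) (use N that in auto)
    finally show ?thesis .
  qed
  then show "i \<in> I \<Longrightarrow> distr (PiM I N) borel (\<lambda>\<omega>. \<omega> i) = N i" .
  have sets: "sets (PiM I (\<lambda>_. borel)) = sets (PiM I N)"
    by (rule sets_PiM_cong) (use N(2) in auto)
  have "distr (PiM I N) (PiM I (\<lambda>_. borel)) (\<lambda>\<omega>. \<lambda>i\<in>I. \<omega> i) = distr (PiM I N) (PiM I N) (\<lambda>\<omega>. \<omega>)"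
    by (rule distr_cong) (use sets in \<open>auto simp: space_PiM\<close>)
  also have "\<dots> = PiM I N"
    by (rule distr_id2) simp
  also have "\<dots> = PiM I (\<lambda>i. distr (PiM I N) borel (\<lambda>\<omega>. \<omega> i))"
    by (intro PiM_cong) (simp_all add: comp)
  finally show "P.indep_vars (\<lambda>_. borel) (\<lambda>i \<omega>. \<omega> i) I"
    using \<open>I \<noteq> {}\<close> meas by (subst P.indep_vars_iff_distr_eq_PiM') auto
qed

lemma gamma_hat_cong: "(\<And>j. j < n \<Longrightarrow> x j = y j) \<Longrightarrow> gamma_hat n x = gamma_hat n y"
  unfolding gamma_hat_def by (intro arg_cong[where f = "\<lambda>z. (1 / real n) *\<^sub>R z"] sum.cong) auto

lemma integral_snd_residual:
  fixes f :: "nat \<Rightarrow> 'h::{real_normed_vector, second_countable_topology}" and g :: "'h \<Rightarrow> 'b::{banach, second_countable_topology}"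
    and \<nu> :: "('h \<times> 'h) measure"
  assumes \<nu>: "sets \<nu> = sets borel"
    and d: "distr \<nu> borel snd = distr (measure_pmf (map_pmf f (pmf_of_set {1..n}))) borel (\<lambda>x. x)"
    and g: "g \<in> borel_measurable borel" and n: "1 \<le> n"
  shows "(\<integral>z. g (snd z) \<partial>\<nu>) = (1 / real n) *\<^sub>R (\<Sum>j=1..n. g (f j))"
proof -
  have "snd \<in> (borel :: ('h \<times> 'h) measure) \<rightarrow>\<^sub>M borel"
    by (intro borel_measurable_continuous_onI continuous_intros)
  then have snd: "snd \<in> \<nu> \<rightarrow>\<^sub>M borel"
    using \<nu> by (simp cong: measurable_cong_sets)
  have "(\<integral>z. g (snd z) \<partial>\<nu>) = (\<integral>x. g x \<partial>distr \<nu> borel snd)"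
    by (rule integral_distr[OF snd g, symmetric])
  also have "\<dots> = (\<integral>x. g x \<partial>measure_pmf (map_pmf f (pmf_of_set {1..n})))"
    unfolding d by (rule integral_distr) (use g in auto)
  also have "\<dots> = (\<integral>j. g (f j) \<partial>measure_pmf (pmf_of_set {1..n}))"
    by (rule integral_map_pmf)
  also have "\<dots> = (\<Sum>j\<in>{1..n}. pmf (pmf_of_set {1..n}) j *\<^sub>R g (f j))"
    using n by (intro integral_measure_pmf) auto
  also have "\<dots> = (1 / real n) *\<^sub>R (\<Sum>j=1..n. g (f j))"
    using n by (simp add: scaleR_sum_right)
  finally show ?thesis .
qed

context bootstrap_setting
begin

text \<open>
  A contraction factor for both operators once the estimate is within \<open>(1 - \<rho>) / 2\<close> of the true operator.
\<close>
definition \<rho>' :: real where "\<rho>' = (1 + \<rho>) / 2"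

text \<open>
  A bound for the fourth moments of innovations and of bootstrap innovations, which are within fourth-moment
  distance \<open>1\<close> of the former.
\<close>
definition KK :: real where "KK = 64 * (K + 1)"

definition CC :: real where "CC = 138000 * KK ^ 3 * (1 / (1 - \<rho>')) ^ 10"

lemma \<rho>': "0 \<le> \<rho>'" "\<rho>' < 1" "\<rho> \<le> \<rho>'"
  using Psi_norm by (auto simp: \<rho>'_def field_simps)

lemma CC_pos: "0 < CC"
  using K1 \<rho>' by (simp add: CC_def KK_def)

definition boot_dist :: "nat \<Rightarrow> 'h \<Rightarrow> 'w \<Rightarrow> ennreal" where
  "boot_dist n x0 \<omega> = mallows_sq
     (distr M op_algebra (\<lambda>\<omega>'. gamma_hat n (sam n \<omega>') - \<Gamma>X))
     (distr (measure_pmf (boot_cov_pmf n (Ph n \<omega>) x0 (sam n \<omega>))) op_algebra (\<lambda>A. A))"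

text \<open>
  Independent copies of a coupled pair of innovations drive two autoregressions, which have the
  distributions of the sample and of the bootstrap sample; the centred sums of squares of the two paths are
  then a coupling of the two distributions whose distance is to be bounded.
\<close>
lemma boot_dist_le:
  assumes g: "good n \<omega>" and th: "theta n \<omega> \<le> (1 - \<rho>) / 2" and s: "0 < s" "s \<le> 1"
    and \<nu>: "close_coupling (s\<^sup>2) n \<omega> \<nu>"
  shows "of_nat n * boot_dist n x0 \<omega>
    \<le> ennreal (CC * ((KK + norm x0 ^ 4) / real n + (theta n \<omega>)\<^sup>2 + s + (boot_error n \<omega>)\<^sup>2 / real n))"
proof -
  have n: "1 \<le> n"
    using g by (simp add: good_def)
  \<comment> \<open>Time \<open>0\<close> carries the pair of initial values, whose second member is deterministic given the data.\<close>
  define N :: "nat \<Rightarrow> ('h \<times> 'h) measure" where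
    "N i = (if i = 0 then distr M borel (\<lambda>\<omega>. (G \<omega>, x0)) else \<nu>)" for i
  have \<nu>p: "prob_space \<nu>" "sets \<nu> = sets borel" "distr \<nu> borel fst = \<mu>"
    "distr \<nu> borel snd = distr (measure_pmf (map_pmf (centred n \<omega>) (pmf_of_set {1..n}))) borel (\<lambda>x. x)"
    "mean_le \<nu> (\<lambda>z. norm (fst z - snd z) ^ 4) (s\<^sup>2)"
    using \<nu> by (auto simp: close_coupling_def residual_pmf_def)
  have Gx0: "(\<lambda>\<omega>. (G \<omega>, x0)) \<in> M \<rightarrow>\<^sub>M borel"
    by (intro borel_measurable_Pair) auto
  have N: "prob_space (N i)" "sets (N i) = sets borel" for i
    using \<nu>p(1,2) prob_space_distr[OF Gx0] by (auto simp: N_def)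
  define Q where "Q = PiM {..n} N"
  interpret Q: prob_space Q
    unfolding Q_def by (rule prob_space_PiM) (rule N)
  have indQ: "Q.indep_vars (\<lambda>_. borel) (\<lambda>i w. w i) {..n}"
    unfolding Q_def by (rule indep_vars_PiM_coordinates) (use N in auto)
  have comp: "distr Q borel (\<lambda>w. w i) = N i" if "i \<le> n" for i
    unfolding Q_def by (rule indep_vars_PiM_coordinates) (use N that in auto)
  have meas: "(\<lambda>w. w i) \<in> Q \<rightarrow>\<^sub>M borel" if "i \<le> n" for i
    using indQ that by (auto simp: Q.indep_vars_def)
  have bfst: "fst \<in> (borel :: ('h \<times> 'h) measure) \<rightarrow>\<^sub>M borel" and bsnd: "snd \<in> (borel :: ('h \<times> 'h) measure) \<rightarrow>\<^sub>M borel"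
    by (intro borel_measurable_continuous_onI continuous_intros)+
  have \<nu>fst: "fst \<in> \<nu> \<rightarrow>\<^sub>M borel" and \<nu>snd: "snd \<in> \<nu> \<rightarrow>\<^sub>M borel"
    using bfst bsnd \<nu>p(2) by (simp_all cong: measurable_cong_sets)
  have toN: "mean_le Q (\<lambda>w. h (w i)) c \<longleftrightarrow> mean_le (N i) h c" if "i \<le> n" "h \<in> borel_measurable borel" for h c i
    using mean_le_distr_iff[OF meas[OF that(1)] that(2)] comp[OF that(1)] by simp
  have intN: "(\<integral>w. h (w i) \<partial>Q) = (\<integral>z. h z \<partial>N i)" if "i \<le> n" "h \<in> borel_measurable borel" for h :: "_ \<Rightarrow> 'h" and i
    using integral_distr[OF meas[OF that(1)] that(2)] comp[OF that(1)] by simp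
  have f4: "(\<lambda>z. norm (fst z) ^ 4) \<in> borel_measurable (borel :: ('h \<times> 'h) measure)"
    and s4: "(\<lambda>z. norm (snd z) ^ 4) \<in> borel_measurable (borel :: ('h \<times> 'h) measure)"
    and d4: "(\<lambda>z. norm (fst z - snd z) ^ 4) \<in> borel_measurable (borel :: ('h \<times> 'h) measure)"
    by (intro borel_measurable_continuous_onI continuous_intros)+
  have n4: "(\<lambda>z :: 'h. norm z ^ 4) \<in> borel_measurable borel"
    by measurable
  have \<nu>f4: "mean_le \<nu> (\<lambda>z. norm (fst z) ^ 4) K"
  proof -
    have "mean_le \<mu> (\<lambda>z. norm z ^ 4) K"
      using mean_le_\<mu>[OF n4, of K 0] mean_le_weaken[OF eps_fourth c\<^sub>4_le_K] by blast
    then show ?thesis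
      using mean_le_distr_iff[OF \<nu>fst n4] \<nu>p(3) by simp
  qed
  have KK: "1 \<le> KK" "K \<le> KK"
    using K1 by (auto simp: KK_def)
  have \<nu>s4: "mean_le \<nu> (\<lambda>z. norm (snd z) ^ 4) KK"
  proof (rule mean_le_mono)
    show "mean_le \<nu> (\<lambda>z. 64 * (norm (fst z) ^ 4 + norm (fst z - snd z) ^ 4)) (64 * (K + s\<^sup>2))"
      by (intro mean_le_cmult mean_le_add \<nu>f4 \<nu>p(5)) simp
    show "(\<lambda>z. norm (snd z) ^ 4) \<in> borel_measurable \<nu>"
      using s4 \<nu>p(2) by (simp cong: measurable_cong_sets)
    show "64 * (K + s\<^sup>2) \<le> KK"
      using s by (simp add: KK_def power_le_one)
    fix z :: "'h \<times> 'h"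
    have "norm (snd z) \<le> norm (fst z) + norm (fst z - snd z) + 0 + 0"
      using norm_triangle_ineq4[of "fst z" "fst z - snd z"] by simp
    then have "norm (snd z) ^ 4 \<le> (norm (fst z) + norm (fst z - snd z) + 0 + 0) ^ 4"
      by (intro power_mono) auto
    also have "\<dots> \<le> 64 * (norm (fst z) ^ 4 + norm (fst z - snd z) ^ 4 + 0 ^ 4 + 0 ^ 4)"
      by (rule fourth_power_sum4_le)
    finally show "norm (snd z) ^ 4 \<le> 64 * (norm (fst z) ^ 4 + norm (fst z - snd z) ^ 4)"
      by simp
  qed auto
  have \<nu>int: "(\<integral>z. h (fst z) \<partial>\<nu>) = (\<integral>\<omega>. h (\<epsilon> 0 \<omega>) \<partial>M)" if "h \<in> borel_measurable borel" for h :: "'h \<Rightarrow> 'h"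
    using integral_distr[OF \<nu>fst that] \<nu>p(3) that by (simp add: \<mu>_def integral_distr)
  have sum0: "(\<Sum>j=1..n. centred n \<omega> j) = 0"
    unfolding centred_eq using n by (simp add: resid_mean_def sum_subtractf sum_constant_scaleR)
  have "norm (Ph n \<omega>) \<le> \<rho> + theta n \<omega>"
    using norm_triangle_ineq[of \<Psi> "Ph n \<omega> - \<Psi>"] by (simp add: theta_def)
  then have Ph: "norm (Ph n \<omega>) \<le> \<rho>'"
    using th by (simp add: \<rho>'_def field_simps)
  have um: "(\<lambda>z :: 'h. inner z u *\<^sub>R z) \<in> borel_measurable borel" for u
    by (intro borel_measurable_continuous_onI continuous_intros)
  interpret cpl: coupled_autoregressions Q "\<lambda>i w. w i" n \<Psi> \<Sigma> "Ph n \<omega>" "resid_cov n \<omega>" b \<rho>' "theta n \<omega>" s KK "KK + norm x0 ^ 4"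
  proof unfold_locales
    show "Q.indep_vars (\<lambda>_. borel) (\<lambda>i w. w i) {..n}"
      by (rule indQ)
    show "norm (\<Psi> - Ph n \<omega>) \<le> theta n \<omega>"
      by (simp add: theta_def norm_minus_commute)
    show "mean_le Q (\<lambda>w. norm (fst (w 0)) ^ 4) KK"
    proof -
      have "mean_le M (\<lambda>\<omega>. norm (G \<omega>) ^ 4) KK"
        using mean_le_weaken[OF G_fourth, of KK] KK by (simp add: K_def)
      then have "mean_le (N 0) (\<lambda>z. norm (fst z) ^ 4) KK"
        unfolding N_def using mean_le_distr_iff[OF Gx0 f4] by simp
      then show ?thesis
        using toN[OF _ f4, of 0] by simp
    qed
    show "mean_le Q (\<lambda>w. norm (snd (w 0)) ^ 4) (KK + norm x0 ^ 4)"
    proof -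
      have "mean_le M (\<lambda>\<omega>. norm x0 ^ 4) (KK + norm x0 ^ 4)"
        using KK by (intro mean_le_weaken[OF mean_le_const]) simp
      then have "mean_le (N 0) (\<lambda>z. norm (snd z) ^ 4) (KK + norm x0 ^ 4)"
        unfolding N_def using mean_le_distr_iff[OF Gx0 s4] by simp
      then show ?thesis
        using toN[OF _ s4, of 0] by simp
    qed
    fix i assume i: "1 \<le> i" "i \<le> n"
    then have Ni: "N i = \<nu>"
      by (simp add: N_def)
    show "mean_le Q (\<lambda>w. norm (fst (w i)) ^ 4) KK"
      using toN[OF i(2) f4] Ni mean_le_weaken[OF \<nu>f4 KK(2)] by simp
    show "mean_le Q (\<lambda>w. norm (snd (w i)) ^ 4) KK"
      using toN[OF i(2) s4] Ni \<nu>s4 by simp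
    show "mean_le Q (\<lambda>w. norm (fst (w i) - snd (w i)) ^ 4) (s\<^sup>2)"
      using toN[OF i(2) d4] Ni \<nu>p(5) by simp
    show "(\<integral>w. fst (w i) \<partial>Q) = 0"
      using intN[OF i(2) bfst] Ni \<nu>int[of "\<lambda>z. z"] mean_eps by simp
    show "(\<integral>w. snd (w i) \<partial>Q) = 0"
      using intN[OF i(2) bsnd] Ni integral_snd_residual[OF \<nu>p(2,4) _ n, of "\<lambda>z. z"] sum0 by simp
    show "(\<integral>w. inner (fst (w i)) u *\<^sub>R fst (w i) \<partial>Q) = \<Sigma> u" for u
      using intN[OF i(2) measurable_compose[OF bfst um]] Ni \<nu>int[OF um] eps_cov by simp
    show "(\<integral>w. inner (snd (w i)) u *\<^sub>R snd (w i) \<partial>Q) = resid_cov n \<omega> u" for u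
      using intN[OF i(2) measurable_compose[OF bsnd um]] Ni integral_snd_residual[OF \<nu>p(2,4) um n]
      by (simp add: resid_cov_def blinfun.scaleR_left blinfun.sum_left tensor.rep_eq)
  qed (use basis \<rho>' Ph KK s in auto)
  define \<Gamma>h where "\<Gamma>h = gamma_hat n (sam n \<omega>)"
  define A where "A w = gamma_hat n (boot_path \<Psi> (fst (w 0)) (\<lambda>i. fst (w i))) - \<Gamma>X" for w :: "nat \<Rightarrow> 'h \<times> 'h"
  define B where "B w = gamma_hat n (boot_path (Ph n \<omega>) (snd (w 0)) (\<lambda>i. snd (w i))) - \<Gamma>h" for w :: "nat \<Rightarrow> 'h \<times> 'h"
  have AG: "A w = (1 / real n) *\<^sub>R cpl.Gx \<Gamma>X w" and BG: "B w = (1 / real n) *\<^sub>R cpl.Gy \<Gamma>h w" for w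
    using n by (simp_all add: A_def B_def cpl.Gx_def cpl.Gy_def cpl.x_def cpl.y_def gamma_hat_def scaleR_diff_right)
  have path_Q: "(\<lambda>w. boot_path P (h (w 0)) (\<lambda>i. h (w i)) j) \<in> borel_measurable Q" if "j < n" "h \<in> borel \<rightarrow>\<^sub>M borel" for P :: "'h \<Rightarrow>\<^sub>L 'h" and h :: "'h \<times> 'h \<Rightarrow> 'h" and j
    by (rule measurable_boot_path) (use that in \<open>auto intro!: measurable_compose[OF meas that(2)]\<close>)
  have Am: "A \<in> Q \<rightarrow>\<^sub>M op_algebra" and Bm: "B \<in> Q \<rightarrow>\<^sub>M op_algebra"
    unfolding A_def[abs_def] B_def[abs_def]
    by (intro measurable_gamma_hat path_Q bfst bsnd; assumption)+
  \<comment> \<open>The first path has the distribution of the sample: its innovations have the right joint distribution, because they are independent with the right marginals.\<close>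
  have distrA: "distr Q op_algebra A = distr M op_algebra (\<lambda>\<omega>'. gamma_hat n (sam n \<omega>') - \<Gamma>X)"
  proof -
    define F where "F e = gamma_hat n (boot_path \<Psi> (e 0) e) - \<Gamma>X" for e :: "nat \<Rightarrow> 'h"
    have Fm: "F \<in> PiM {..n} (\<lambda>_. borel) \<rightarrow>\<^sub>M op_algebra"
      unfolding F_def[abs_def]
    proof (intro measurable_gamma_hat measurable_boot_path)
      show "(\<lambda>e. e 0) \<in> PiM {..n} (\<lambda>_. borel) \<rightarrow>\<^sub>M (borel :: 'h measure)"
        by (rule measurable_component_singleton) simp
      fix i j assume "1 \<le> i" "i \<le> j" "j < n"
      then show "(\<lambda>e. e i) \<in> PiM {..n} (\<lambda>_. borel) \<rightarrow>\<^sub>M (borel :: 'h measure)"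
        by (intro measurable_component_singleton) auto
    qed
    have Fcong: "F e = F e'" if "\<And>i. i \<le> n \<Longrightarrow> e i = e' i" for e e'
    proof -
      have "gamma_hat n (boot_path \<Psi> (e 0) e) = gamma_hat n (boot_path \<Psi> (e' 0) e')"
        using that by (intro gamma_hat_cong) (auto intro!: boot_path_cong)
      then show ?thesis
        by (simp add: F_def)
    qed
    let ?Y = "\<lambda>i. if i = 0 then G else \<epsilon> (int i)"
    let ?W = "\<lambda>w :: nat \<Rightarrow> 'h \<times> 'h. \<lambda>i\<in>{..n}. fst (w i)" and ?W' = "\<lambda>\<omega>. \<lambda>i\<in>{..n}. ?Y i \<omega>"
    have Wm: "?W \<in> Q \<rightarrow>\<^sub>M PiM {..n} (\<lambda>_. borel)"
      by (rule measurable_restrict) (use measurable_compose[OF meas bfst] in auto)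
    have W'm: "?W' \<in> M \<rightarrow>\<^sub>M PiM {..n} (\<lambda>_. borel)"
      by (rule measurable_restrict) auto
    have same: "distr Q borel (\<lambda>w. fst (w i)) = distr M borel (?Y i)" if i: "i \<in> {..n}" for i
    proof -
      have "distr Q borel (\<lambda>w. fst (w i)) = distr (distr Q borel (\<lambda>w. w i)) borel fst"
        using distr_distr[OF bfst meas[of i]] i by (simp add: o_def)
      also have "\<dots> = distr (N i) borel fst"
        using comp[of i] i by simp
      also have "\<dots> = distr M borel (?Y i)"
      proof (cases "i = 0")
        case True
        then show ?thesis
          using distr_distr[OF bfst Gx0] by (simp add: N_def o_def)
      next
        case False
        then show ?thesis
          using \<nu>p(3) iid_ident[of 0 "int i"] by (simp add: N_def \<mu>_def)
      qed
      finally show ?thesis .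
    qed
    have indf: "Q.indep_vars (\<lambda>_. borel) (\<lambda>i w. fst (w i)) {..n}"
      by (rule Q.indep_vars_compose2[OF indQ]) (rule bfst)
    have WW: "distr Q (PiM {..n} (\<lambda>_. borel)) ?W = distr M (PiM {..n} (\<lambda>_. borel)) ?W'"
      by (rule Q.distr_indep_vars_cong[OF indf _ prob_space_axioms indep_G same]) auto
    have "distr Q op_algebra A = distr Q op_algebra (F \<circ> ?W)"
    proof (rule distr_cong)
      fix w
      have "F (\<lambda>i. fst (w i)) = F (?W w)"
        by (rule Fcong) auto
      then show "A w = (F \<circ> ?W) w"
        by (simp add: A_def F_def)
    qed auto
    also have "\<dots> = distr (distr Q (PiM {..n} (\<lambda>_. borel)) ?W) op_algebra F"
      by (rule distr_distr[OF Fm Wm, symmetric])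
    also have "\<dots> = distr M op_algebra (F \<circ> ?W')"
      unfolding WW by (rule distr_distr[OF Fm W'm])
    also have "\<dots> = distr M op_algebra (\<lambda>\<omega>'. gamma_hat n (sam n \<omega>') - \<Gamma>X)"
    proof (rule distr_cong_AE)
      show "AE \<omega>' in M. (F \<circ> ?W') \<omega>' = gamma_hat n (sam n \<omega>') - \<Gamma>X"
        using sample_AE
      proof eventually_elim
        case (elim \<omega>')
        have "F (?W' \<omega>') = F (\<lambda>i. ?Y i \<omega>')"
          by (rule Fcong) auto
        also have "gamma_hat n (boot_path \<Psi> (G \<omega>') (\<lambda>i. ?Y i \<omega>')) = gamma_hat n (sam n \<omega>')"
        proof (rule gamma_hat_cong)
          fix j assume "j < n"
          have "boot_path \<Psi> (G \<omega>') (\<lambda>i. ?Y i \<omega>') j = trajectory j \<omega>'"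
            unfolding trajectory_def by (rule boot_path_cong) auto
          then show "boot_path \<Psi> (G \<omega>') (\<lambda>i. ?Y i \<omega>') j = sam n \<omega>' j"
            using elim \<open>j < n\<close> by simp
        qed
        then have "F (\<lambda>i. ?Y i \<omega>') = gamma_hat n (sam n \<omega>') - \<Gamma>X"
          by (simp add: F_def)
        finally show ?case
          by simp
      qed
      show "F \<circ> ?W' \<in> M \<rightarrow>\<^sub>M op_algebra"
        by (rule measurable_comp[OF W'm Fm])
      show "(\<lambda>\<omega>'. gamma_hat n (sam n \<omega>') - \<Gamma>X) \<in> M \<rightarrow>\<^sub>M op_algebra"
        by (rule measurable_gamma_hat) (simp add: sample_def)
    qed auto
    finally show ?thesis .
  qed
  \<comment> \<open>The same for the bootstrap, except that its initial value is constant and so only the innovations from time \<open>1\<close> matter.\<close>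
  have distrB: "distr Q op_algebra B
      = distr (measure_pmf (boot_cov_pmf n (Ph n \<omega>) x0 (sam n \<omega>))) op_algebra (\<lambda>A. A)"
  proof -
    define F where "F e = gamma_hat n (boot_path (Ph n \<omega>) x0 e) - \<Gamma>h" for e :: "nat \<Rightarrow> 'h"
    have Fm: "F \<in> PiM {1..n} (\<lambda>_. borel) \<rightarrow>\<^sub>M op_algebra"
      unfolding F_def[abs_def]
    proof (intro measurable_gamma_hat measurable_boot_path)
      fix i j assume "1 \<le> i" "i \<le> j" "j < n"
      then show "(\<lambda>e. e i) \<in> PiM {1..n} (\<lambda>_. borel) \<rightarrow>\<^sub>M (borel :: 'h measure)"
        by (intro measurable_component_singleton) auto
    qed auto
    have Fcong: "F e = F e'" if "\<And>i. 1 \<le> i \<Longrightarrow> i \<le> n \<Longrightarrow> e i = e' i" for e e'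
    proof -
      have "gamma_hat n (boot_path (Ph n \<omega>) x0 e) = gamma_hat n (boot_path (Ph n \<omega>) x0 e')"
        using that by (intro gamma_hat_cong boot_path_cong) auto
      then show ?thesis
        by (simp add: F_def)
    qed
    define R where "R = residual_pmf n (Ph n \<omega>) (sam n \<omega>)"
    define \<pi> where "\<pi> = Pi_pmf {1..n} 0 (\<lambda>_. R)"
    let ?W = "\<lambda>w :: nat \<Rightarrow> 'h \<times> 'h. \<lambda>i\<in>{1..n}. snd (w i)" and ?W' = "\<lambda>e :: nat \<Rightarrow> 'h. \<lambda>i\<in>{1..n}. e i"
    have Wm: "?W \<in> Q \<rightarrow>\<^sub>M PiM {1..n} (\<lambda>_. borel)"
      by (rule measurable_restrict) (use measurable_compose[OF meas bsnd] in auto)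
    have W'm: "?W' \<in> measure_pmf \<pi> \<rightarrow>\<^sub>M PiM {1..n} (\<lambda>_. borel)"
      by (rule measurable_restrict) auto
    have same: "distr Q borel (\<lambda>w. snd (w i)) = distr (measure_pmf \<pi>) borel (\<lambda>e. e i)" if i: "i \<in> {1..n}" for i
    proof -
      have "distr Q borel (\<lambda>w. snd (w i)) = distr (distr Q borel (\<lambda>w. w i)) borel snd"
        using distr_distr[OF bsnd meas[of i]] i by (simp add: o_def)
      also have "\<dots> = distr \<nu> borel snd"
        using comp[of i] i by (simp add: N_def)
      also have "\<dots> = distr (measure_pmf R) borel (\<lambda>x. x)"
        using \<nu>p(4) by (simp add: R_def residual_pmf_def)
      also have "R = map_pmf (\<lambda>e. e i) \<pi>"
        unfolding \<pi>_def using Pi_pmf_component[of "{1..n}" i 0 "\<lambda>_. R"] i by simp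
      also have "distr (measure_pmf (map_pmf (\<lambda>e. e i) \<pi>)) borel (\<lambda>x. x) = distr (measure_pmf \<pi>) borel (\<lambda>e. e i)"
        unfolding map_pmf_rep_eq by (subst distr_distr) (auto simp: o_def)
      finally show ?thesis .
    qed
    have ind1: "Q.indep_vars (\<lambda>_. borel) (\<lambda>i w. snd (w i)) {1..n}"
      by (rule Q.indep_vars_compose2[OF Q.indep_vars_subset[OF indQ]]) (use bsnd in auto)
    have ind2: "prob_space.indep_vars (measure_pmf \<pi>) (\<lambda>_. borel) (\<lambda>i e. e i) {1..n}"
      by (rule prob_space.indep_vars_compose2[OF measure_pmf.prob_space_axioms indep_vars_Pi_pmf[of "{1..n}" 0 "\<lambda>_. R", folded \<pi>_def], of "\<lambda>_ x. x"]) auto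
    have WW: "distr Q (PiM {1..n} (\<lambda>_. borel)) ?W = distr (measure_pmf \<pi>) (PiM {1..n} (\<lambda>_. borel)) ?W'"
      by (rule Q.distr_indep_vars_cong[OF ind1 _ measure_pmf.prob_space_axioms ind2 same]) (use n in auto)
    have x0: "AE w in Q. snd (w 0) = x0"
    proof -
      have "closed {z :: 'h \<times> 'h. snd z = x0}"
        by (intro closed_Collect_eq continuous_intros)
      then have "{z \<in> space borel. snd z = x0} \<in> sets (borel :: ('h \<times> 'h) measure)"
        by simp
      then have "AE z in N 0. snd z = x0"
        unfolding N_def using AE_distr_iff[OF Gx0, of "\<lambda>z. snd z = x0"] by simp
      then show ?thesis
        by (intro AE_distrD[OF meas]) (simp_all only: comp le0)
    qed
    have "distr Q op_algebra B = distr Q op_algebra (F \<circ> ?W)"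
    proof (rule distr_cong_AE)
      show "AE w in Q. B w = (F \<circ> ?W) w"
        using x0
      proof eventually_elim
        case (elim w)
        have "F (\<lambda>i. snd (w i)) = F (?W w)"
          by (rule Fcong) auto
        then show ?case
          using elim by (simp add: B_def F_def)
      qed
      show "F \<circ> ?W \<in> Q \<rightarrow>\<^sub>M op_algebra"
        by (rule measurable_comp[OF Wm Fm])
    qed (use Bm in auto)
    also have "\<dots> = distr (distr Q (PiM {1..n} (\<lambda>_. borel)) ?W) op_algebra F"
      by (rule distr_distr[OF Fm Wm, symmetric])
    also have "\<dots> = distr (measure_pmf \<pi>) op_algebra (F \<circ> ?W')"
      unfolding WW by (rule distr_distr[OF Fm W'm])
    also have "\<dots> = distr (measure_pmf \<pi>) op_algebra F"
    proof (rule distr_cong)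
      fix e
      show "(F \<circ> ?W') e = F e"
        unfolding o_def by (rule Fcong) auto
    qed auto
    also have "\<dots> = distr (measure_pmf (map_pmf F \<pi>)) op_algebra (\<lambda>A. A)"
      unfolding map_pmf_rep_eq by (subst distr_distr) (auto simp: o_def)
    also have "map_pmf F \<pi> = boot_cov_pmf n (Ph n \<omega>) x0 (sam n \<omega>)"
      by (simp add: boot_cov_pmf_def F_def[abs_def] \<Gamma>h_def \<pi>_def R_def)
    finally show ?thesis .
  qed
  define Qc where "Qc = distr Q (op_algebra \<Otimes>\<^sub>M op_algebra) (\<lambda>w. (A w, B w))"
  have AB: "(\<lambda>w. (A w, B w)) \<in> Q \<rightarrow>\<^sub>M op_algebra \<Otimes>\<^sub>M op_algebra"
    using Am Bm by (rule measurable_Pair)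
  have "Qc \<in> couplings (distr M op_algebra (\<lambda>\<omega>'. gamma_hat n (sam n \<omega>') - \<Gamma>X))
      (distr (measure_pmf (boot_cov_pmf n (Ph n \<omega>) x0 (sam n \<omega>))) op_algebra (\<lambda>A. A))"
    unfolding couplings_def mem_Collect_eq
  proof (intro conjI)
    show "prob_space Qc"
      unfolding Qc_def by (rule Q.prob_space_distr[OF AB])
    show "sets Qc = sets (op_algebra \<Otimes>\<^sub>M op_algebra)"
      by (simp add: Qc_def)
    show "distr Qc op_algebra fst = distr M op_algebra (\<lambda>\<omega>'. gamma_hat n (sam n \<omega>') - \<Gamma>X)"
      unfolding Qc_def distrA[symmetric] by (subst distr_distr[OF measurable_fst AB]) (simp add: o_def)
    show "distr Qc op_algebra snd = distr (measure_pmf (boot_cov_pmf n (Ph n \<omega>) x0 (sam n \<omega>))) op_algebra (\<lambda>A. A)"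
      unfolding Qc_def distrB[symmetric] by (subst distr_distr[OF measurable_snd AB]) (simp add: o_def)
  qed
  then have "boot_dist n x0 \<omega> \<le> (\<integral>\<^sup>+ (A, B). ennreal ((norm (A - B))\<^sup>2) \<partial>Qc)"
    unfolding boot_dist_def mallows_sq_def by (rule INF_lower)
  also have "\<dots> = (\<integral>\<^sup>+ w. ennreal ((norm (A w - B w))\<^sup>2) \<partial>Q)"
  proof -
    have "(\<lambda>p. ennreal ((norm (fst p - snd p))\<^sup>2)) \<in> borel_measurable (op_algebra \<Otimes>\<^sub>M (op_algebra :: ('h \<Rightarrow>\<^sub>L 'h) measure))"
      using measurable_norm_op_diff[where 'h = 'h] by (simp add: case_prod_beta)
    then show ?thesis
      unfolding Qc_def case_prod_beta by (subst nn_integral_distr[OF AB]) auto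
  qed
  also have "\<dots> \<le> ennreal (CC * ((KK + norm x0 ^ 4) + real n * ((theta n \<omega>)\<^sup>2 + s) + (boot_error n \<omega>)\<^sup>2) / (real n)\<^sup>2)"
  proof -
    have fpe: "norm (real n *\<^sub>R (sandwich (Ph n \<omega>) \<Gamma>h + resid_cov n \<omega> - \<Gamma>h)) \<le> boot_error n \<omega>"
      unfolding \<Gamma>h_def by (rule boot_fixed_point_error[OF g])
    have m: "mean_le Q (\<lambda>w. (norm (cpl.Gx \<Gamma>X w - cpl.Gy \<Gamma>h w))\<^sup>2)
        (CC * ((KK + norm x0 ^ 4) + real n * ((theta n \<omega>)\<^sup>2 + s) + (boot_error n \<omega>)\<^sup>2))"
      using cpl.mean_le_coupled_difference[OF \<Gamma>X_fixed_point[OF basis] n fpe]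
      by (simp add: CC_def cpl.r_def cpl.g_def)
    have "A w - B w = (1 / real n) *\<^sub>R (cpl.Gx \<Gamma>X w - cpl.Gy \<Gamma>h w)" for w
      by (simp add: AG BG scaleR_diff_right)
    then have e: "(norm (A w - B w))\<^sup>2 = (1 / (real n)\<^sup>2) * (norm (cpl.Gx \<Gamma>X w - cpl.Gy \<Gamma>h w))\<^sup>2" for w
      by (simp add: power_divide)
    have m': "mean_le Q (\<lambda>w. (norm (A w - B w))\<^sup>2)
        ((1 / (real n)\<^sup>2) * (CC * ((KK + norm x0 ^ 4) + real n * ((theta n \<omega>)\<^sup>2 + s) + (boot_error n \<omega>)\<^sup>2)))"
      unfolding e by (intro mean_le_cmult m) simp
    have "(\<integral>\<^sup>+ w. ennreal ((norm (A w - B w))\<^sup>2) \<partial>Q) = ennreal (\<integral> w. (norm (A w - B w))\<^sup>2 \<partial>Q)"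
      by (rule nn_integral_eq_integral[OF mean_leD(1)[OF m']]) simp
    also have "\<dots> \<le> ennreal ((1 / (real n)\<^sup>2) * (CC * ((KK + norm x0 ^ 4) + real n * ((theta n \<omega>)\<^sup>2 + s) + (boot_error n \<omega>)\<^sup>2)))"
      by (rule ennreal_leI[OF mean_leD(2)[OF m']])
    finally show ?thesis
      by simp
  qed
  finally have "of_nat n * boot_dist n x0 \<omega> \<le> ennreal (real n)
      * ennreal (CC * ((KK + norm x0 ^ 4) + real n * ((theta n \<omega>)\<^sup>2 + s) + (boot_error n \<omega>)\<^sup>2) / (real n)\<^sup>2)"
    unfolding ennreal_of_nat_eq_real_of_nat by (rule mult_left_mono) simp
  also have "\<dots> = ennreal (real n * (CC * ((KK + norm x0 ^ 4) + real n * ((theta n \<omega>)\<^sup>2 + s) + (boot_error n \<omega>)\<^sup>2) / (real n)\<^sup>2))"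
    by (rule ennreal_mult'[symmetric]) simp
  also have "real n * (CC * ((KK + norm x0 ^ 4) + real n * ((theta n \<omega>)\<^sup>2 + s) + (boot_error n \<omega>)\<^sup>2) / (real n)\<^sup>2)
      = CC * ((KK + norm x0 ^ 4) / real n + (theta n \<omega>)\<^sup>2 + s + (boot_error n \<omega>)\<^sup>2 / real n)"
    using n by (simp add: field_simps power2_eq_square)
  finally show ?thesis .
qed

text \<open>
  The four terms of the bound are made smaller than \<open>\<delta> / (4 * CC)\<close>: the coupling distance \<open>s\<close> by choice, the
  others on a likely event.
\<close>
lemma boot_dist_tendsto_zero:
  assumes x0: "bounded_in_prob M (\<lambda>n \<omega>. x0 n (sam n \<omega>))"
  shows "tendsto_zero_in_prob M (\<lambda>n \<omega>. of_nat n * boot_dist n (x0 n (sam n \<omega>)) \<omega>)"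
  unfolding tendsto_zero_in_prob_def
proof (intro allI impI)
  fix \<delta> :: real assume \<delta>: "0 < \<delta>"
  define t where "t = \<delta> / (4 * CC)"
  have t: "0 < t"
    using \<delta> CC_pos by (simp add: t_def)
  define s where "s = min 1 t"
  have s: "0 < s" "s \<le> 1" "s \<le> t"
    using t by (auto simp: s_def)
  have inv: "(\<lambda>n. 1 / real n) \<longlonglongrightarrow> 0"
    by (rule lim_1_over_n)
  have "small M (\<lambda>n \<omega>. KK * (1 / real n) + (1 / real n) * norm (x0 n (sam n \<omega>)) ^ 4)"
    using K1 by (intro small_add small_cmult small_mult_stoch_bounded small_of_tendsto inv stoch_bounded_power stoch_bounded_of_bounded_in_prob x0)
      (auto simp: KK_def)
  then have "likely M (\<lambda>n \<omega>. KK * (1 / real n) + (1 / real n) * norm (x0 n (sam n \<omega>)) ^ 4 \<le> t)"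
    using t by (rule smallD)
  moreover have "likely M (\<lambda>n \<omega>. (theta n \<omega>)\<^sup>2 \<le> t)"
    using t by (intro smallD small_power small_theta) (auto simp: theta_def)
  moreover have "likely M (\<lambda>n \<omega>. theta n \<omega> \<le> (1 - \<rho>) / 2)"
    using Psi_norm by (intro smallD small_theta) simp
  moreover have "likely M (\<lambda>n \<omega>. (boot_error n \<omega>)\<^sup>2 / real n \<le> t)"
    using t by (intro smallD small_boot_error)
  moreover have "likely M (\<lambda>n \<omega>. \<exists>\<nu>. close_coupling (s\<^sup>2) n \<omega> \<nu>)"
    using s by (intro likely_coupling) simp
  ultimately have "likely M (\<lambda>n \<omega>. KK * (1 / real n) + (1 / real n) * norm (x0 n (sam n \<omega>)) ^ 4 \<le> t \<and>
      (theta n \<omega>)\<^sup>2 \<le> t \<and> theta n \<omega> \<le> (1 - \<rho>) / 2 \<and> (boot_error n \<omega>)\<^sup>2 / real n \<le> t \<and>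
      (\<exists>\<nu>. close_coupling (s\<^sup>2) n \<omega> \<nu>) \<and> good n \<omega>)"
    by (intro likely_conj likely_good)
  then have "likely M (\<lambda>n \<omega>. of_nat n * boot_dist n (x0 n (sam n \<omega>)) \<omega> \<le> ennreal \<delta>)"
  proof (rule likely_mono, intro always_eventually allI ballI impI, elim conjE exE)
    fix n \<omega> \<nu>
    assume a: "KK * (1 / real n) + (1 / real n) * norm (x0 n (sam n \<omega>)) ^ 4 \<le> t" "(theta n \<omega>)\<^sup>2 \<le> t"
      "theta n \<omega> \<le> (1 - \<rho>) / 2" "(boot_error n \<omega>)\<^sup>2 / real n \<le> t" "close_coupling (s\<^sup>2) n \<omega> \<nu>" "good n \<omega>"
    have "of_nat n * boot_dist n (x0 n (sam n \<omega>)) \<omega> \<le> ennreal (CC * ((KK + norm (x0 n (sam n \<omega>)) ^ 4) / real n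
        + (theta n \<omega>)\<^sup>2 + s + (boot_error n \<omega>)\<^sup>2 / real n))"
      by (rule boot_dist_le[OF a(6,3) s(1,2) a(5)])
    also have "\<dots> \<le> ennreal (CC * (t + t + t + t))"
    proof (intro ennreal_leI mult_left_mono add_mono)
      show "(KK + norm (x0 n (sam n \<omega>)) ^ 4) / real n \<le> t"
        using a(1) by (simp add: add_divide_distrib)
    qed (use a s CC_pos in auto)
    also have "CC * (t + t + t + t) = \<delta>"
      using CC_pos by (simp add: t_def)
    finally show "of_nat n * boot_dist n (x0 n (sam n \<omega>)) \<omega> \<le> ennreal \<delta>" .
  qed
  then show "(\<lambda>n. outer_measure_of M {\<omega> \<in> space M. ennreal \<delta> < of_nat n * boot_dist n (x0 n (sam n \<omega>)) \<omega>}) \<longlonglongrightarrow> 0"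
    by (simp add: likely_def not_le)
qed

end

theorem theorem4p2:
  fixes M :: "'w measure"
    and X \<epsilon> :: "int \<Rightarrow> 'w \<Rightarrow> 'h::{real_inner, banach, second_countable_topology}"
    and \<Psi> \<Gamma> :: "'h \<Rightarrow>\<^sub>L 'h"
    and lam :: "nat \<Rightarrow> real"
    and k :: "nat \<Rightarrow> nat"
    and lam_hat :: "nat \<Rightarrow> (nat \<Rightarrow> 'h) \<Rightarrow> nat \<Rightarrow> real"
    and v_hat :: "nat \<Rightarrow> (nat \<Rightarrow> 'h) \<Rightarrow> nat \<Rightarrow> 'h"
    and \<Psi>_hat :: "nat \<Rightarrow> (nat \<Rightarrow> 'h) \<Rightarrow> 'h \<Rightarrow>\<^sub>L 'h"
    and x0_star :: "nat \<Rightarrow> (nat \<Rightarrow> 'h) \<Rightarrow> 'h"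
  assumes "prob_space M"
    and stationary: "stationary_process M X"
    and far1: "\<And>t. AE \<omega> in M. X (t + 1) \<omega> = \<Psi> (X t \<omega>) + \<epsilon> (t + 1) \<omega>"
    and mean_X: "\<And>t. integrable M (X t)" "\<And>t. (\<integral>\<omega>. X t \<omega> \<partial>M) = 0"
    and iid_indep: "prob_space.indep_vars M (\<lambda>_. borel) \<epsilon> UNIV"
    and iid_ident: "\<And>s t. distr M borel (\<epsilon> s) = distr M borel (\<epsilon> t)"
    and mean_eps: "\<And>t. (\<integral>\<omega>. \<epsilon> t \<omega> \<partial>M) = 0"
    and moment_eps: "\<And>t. integrable M (\<lambda>\<omega>. norm (\<epsilon> t \<omega>) ^ 4)"
    and Psi_HS: "hilbert_schmidt \<Psi>"
    and Psi_norm: "norm \<Psi> < 1"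
    and Gamma: "\<Gamma> = cov_operator M (X 0)"
    and lam_eigen: "eigenvalues \<Gamma> = lam ` {1..}"
    and lam_decreasing: "\<And>j. j \<ge> 1 \<Longrightarrow> lam (j + 1) < lam j"
    and lam_pos: "\<And>j. j \<ge> 1 \<Longrightarrow> lam j > 0"
    and lam_mult: "\<And>j. j \<ge> 1 \<Longrightarrow> dim (eigenspace \<Gamma> (lam j)) = 1"
    and eigen_hat: "\<And>n x. n \<ge> 1 \<Longrightarrow> eigensystem (gamma_hat n x) (lam_hat n x) (v_hat n x)"
    and Psi_hat: "\<And>n x. \<Psi>_hat n x = psi_hat n (k n) (lam_hat n x) (v_hat n x) x"
    and x0_star: "bounded_in_prob M (\<lambda>n \<omega>. x0_star n (sample X n \<omega>))"
    and k_pos: "\<And>n. k n \<ge> 1"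
    and k_lim: "filterlim k at_top sequentially"
    and rate1: "(\<lambda>n. real (k n) / real n * (\<Sum>j=1..k n. 1 / (eigen_gap lam j)\<^sup>2)) \<longlonglongrightarrow> 0"
    and rate2: "\<exists>\<beta>>1/2. (\<lambda>n. 1 / lam (k n)) \<in> O(\<lambda>n. real n powr (1/4) / ln (real n) powr \<beta>)"
    and rate3: "\<exists>\<beta>>1. (\<lambda>n. 1 / lam (k n) * (\<Sum>j=1..k n. 1 / eigen_gap lam j))
                        \<in> O(\<lambda>n. real n powr (1/4) / ln (real n) powr \<beta>)"
  shows "tendsto_zero_in_prob M (\<lambda>n \<omega>.
           of_nat n * mallows_sq
             (distr M op_algebra (\<lambda>\<omega>'. gamma_hat n (sample X n \<omega>') - \<Gamma>))
             (distr (measure_pmf (boot_cov_pmf n (\<Psi>_hat n (sample X n \<omega>))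
                                    (x0_star n (sample X n \<omega>)) (sample X n \<omega>)))
                op_algebra (\<lambda>A. A)))"
proof -
  interpret prob_space M
    by fact
  obtain b where b: "basis_seq b" "summable (\<lambda>i. (norm (\<Psi> (b i)))\<^sup>2)"
    using hilbert_schmidt_basis_seq[OF Psi_HS] by blast
  interpret S: stationary_autoregression M X \<epsilon> \<Psi>
    by unfold_locales (fact stationary far1 mean_X(1) iid_indep iid_ident mean_eps moment_eps Psi_norm)+
  have G: "S.\<Gamma>X = \<Gamma>"
    by (simp add: S.\<Gamma>X_def Gamma)
  interpret B: bootstrap_setting M X \<epsilon> \<Psi> b lam k lam_hat v_hat
    by unfold_locales (use b lam_eigen lam_decreasing lam_pos eigen_hat k_pos k_lim rate2 in \<open>simp_all add: G\<close>)
  show ?thesis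
    using B.boot_dist_tendsto_zero[OF x0_star]
    by (simp add: B.boot_dist_def B.Ph_def G flip: Psi_hat)
qed

end
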